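(* Let $1<p<q<\infty$, $r>0$ (real), $\alpha\ge\beta>-1$, $\alpha\ge -1/2$, and set $$\sigma=(2\alpha+2)\left(\frac1p-\frac1q\right).$$ There is a constant $C$, independent of $f$ and $t$, such that the following holds. If $f\in L_p^{(\alpha,\beta)}$ and $$\int_0^1\left(u^{-\sigma}K^{r+\sigma}\big(f,\mathcal D^{(\alpha,\beta)}_{r+\sigma},u\big)_{p,(\alpha,\beta)}\right)^q\frac{du}{u}<\infty,$$ then $f\in L_q^{(\alpha,\beta)}$ and, for $0<t\le 1$, $$K^r\big(f,\mathcal D^{(\alpha,\beta)}_r,t\big)_{q,(\alpha,\beta)}\le C\left(\int_0^t\left(u^{-\sigma}K^{r+\sigma}\big(f,\mathcal D^{(\alpha,\beta)}_{r+\sigma},u\big)_{p,(\alpha,\beta)}\right)^q\frac{du}{u}\right)^{1/q}.$$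
   Context: For $a,b>-1$ let $w^{(a,b)}(x)=(1-x)^a(1+x)^b$ on $[-1,1]$. For $1\le p<\infty$, $L_p^{(a,b)}$ is the space of measurable functions on $[-1,1]$ with finite norm $\|f\|_{p,(a,b)}=\left(\int_{-1}^1|f(x)|^p w^{(a,b)}(x)\,dx\right)^{1/p}$. For $\alpha,\beta>-1$ let $\psi_k^{(\alpha,\beta)}$, $k=0,1,\dots$, be the Jacobi polynomials ($\deg\psi_k^{(\alpha,\beta)}=k$), orthogonal on $[-1,1]$ with weight $w^{(\alpha,\beta)}$ and normalized by $\int_{-1}^1|\psi_k^{(\alpha,\beta)}|^2w^{(\alpha,\beta)}dx=1$. Put $\lambda_k^{(\alpha,\beta)}=(k(k+\alpha+\beta+1))^{1/2}$. For $f\in L_1^{(\alpha,\beta)}$ put $\widehat f_k^{(\alpha,\beta)}=\int_{-1}^1 f\,\psi_k^{(\alpha,\beta)}w^{(\alpha,\beta)}dx$; the Fourier--Jacobi expansion of $f$ is $f\sim\sum_{k\ge0}\widehat f_k^{(\alpha,\beta)}\psi_k^{(\alpha,\beta)}$. Fractional derivative: for real $s>0$, if there is $g\in L_1^{(\alpha,\beta)}$ with Fourier--Jacobi expansion $g\sim\sum_{k\ge1}\left(\lambda_k^{(\alpha,\beta)}\right)^{s}\widehat f_k^{(\alpha,\beta)}\psi_k^{(\alpha,\beta)}$, one writes $g=\mathcal D_s^{(\alpha,\beta)}f$. $K$-functional: for real $s>0$ and $t>0$, $$K^s(f,\mathcal D_s^{(\alpha,\beta)},t)_{p,(\alpha,\beta)}=\inf\left\{\|f-g\|_{p,(\alpha,\beta)}+t^s\|\mathcal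 D_s^{(\alpha,\beta)}g\|_{p,(\alpha,\beta)}\right\},$$ where the infimum is over all $g\in L_p^{(\alpha,\beta)}$ such that $\mathcal D_s^{(\alpha,\beta)}g$ exists and belongs to $L_p^{(\alpha,\beta)}$. *)

theory Defs
  imports "HOL-Analysis.Analysis" "HOL-Computational_Algebra.Polynomial"
begin

definition jacobi_weight :: "real \<Rightarrow> real \<Rightarrow> real \<Rightarrow> real" where
  "jacobi_weight a b x = (1 - x) powr a * (1 + x) powr b"

text \<open>At the end points \<open>x = 1\<close> and \<open>x = -1\<close> the convention \<open>0 powr a = 0\<close> applies also
  to negative \<open>a\<close>; these two points form a null set.\<close>

definition jacobi_measure :: "real \<Rightarrow> real \<Rightarrow> real measure" where
  "jacobi_measure a b = density (lebesgue_on {-1..1}) (\<lambda>x. ennreal (jacobi_weight a b x))"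

text \<open>Elements of \<open>L\<^sub>p\<close> are represented by real functions, not by equivalence classes;
  their values outside \<open>[-1, 1]\<close> are irrelevant.\<close>

definition jacobi_Lp :: "real \<Rightarrow> real \<Rightarrow> real \<Rightarrow> (real \<Rightarrow> real) set" where
  "jacobi_Lp p a b = {f \<in> borel_measurable (jacobi_measure a b).
     integrable (jacobi_measure a b) (\<lambda>x. \<bar>f x\<bar> powr p)}"

definition jacobi_norm :: "real \<Rightarrow> real \<Rightarrow> real \<Rightarrow> (real \<Rightarrow> real) \<Rightarrow> real" where
  "jacobi_norm p a b f = (LINT x|jacobi_measure a b. \<bar>f x\<bar> powr p) powr (1 / p)"

text \<open>These conditions determine each \<open>\<psi> k\<close> up to sign. The sign affects neither
  \<open>is_fractional_derivative\<close> nor \<open>K_functional\<close> below, so it is left open.\<close>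

definition orthonormal_jacobi_polys :: "real \<Rightarrow> real \<Rightarrow> (nat \<Rightarrow> real poly) \<Rightarrow> bool" where
  "orthonormal_jacobi_polys \<alpha> \<beta> \<psi> \<longleftrightarrow>
     (\<forall>k. degree (\<psi> k) = k) \<and>
     (\<forall>j k. j \<noteq> k \<longrightarrow> (LINT x|jacobi_measure \<alpha> \<beta>. poly (\<psi> j) x * poly (\<psi> k) x) = 0) \<and>
     (\<forall>k. (LINT x|jacobi_measure \<alpha> \<beta>. \<bar>poly (\<psi> k) x\<bar>\<^sup>2) = 1)"

definition jacobi_lambda :: "real \<Rightarrow> real \<Rightarrow> nat \<Rightarrow> real" where
  "jacobi_lambda \<alpha> \<beta> k = sqrt (real k * (real k + \<alpha> + \<beta> + 1))"

definition jacobi_coeff ::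
  "real \<Rightarrow> real \<Rightarrow> (nat \<Rightarrow> real poly) \<Rightarrow> (real \<Rightarrow> real) \<Rightarrow> nat \<Rightarrow> real" where
  "jacobi_coeff \<alpha> \<beta> \<psi> f k = (LINT x|jacobi_measure \<alpha> \<beta>. f x * poly (\<psi> k) x)"

text \<open>The derivative is determined only almost everywhere, hence a relation: \<open>g\<close> is a
  fractional derivative of order \<open>s\<close> of \<open>f\<close>.\<close>

definition is_fractional_derivative ::
  "real \<Rightarrow> real \<Rightarrow> (nat \<Rightarrow> real poly) \<Rightarrow> real \<Rightarrow> (real \<Rightarrow> real) \<Rightarrow> (real \<Rightarrow> real) \<Rightarrow> bool" where
  "is_fractional_derivative \<alpha> \<beta> \<psi> s f g \<longleftrightarrow>
     f \<in> jacobi_Lp 1 \<alpha> \<beta> \<and> g \<in> jacobi_Lp 1 \<alpha> \<beta> \<and>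
     jacobi_coeff \<alpha> \<beta> \<psi> g 0 = 0 \<and>
     (\<forall>k\<ge>1. jacobi_coeff \<alpha> \<beta> \<psi> g k = jacobi_lambda \<alpha> \<beta> k powr s * jacobi_coeff \<alpha> \<beta> \<psi> f k)"

text \<open>For \<open>f\<close> in \<open>L\<^sub>p\<close> and \<open>t > 0\<close> the set below is bounded below by \<open>0\<close> and nonempty
  (take \<open>g = h = 0\<close>), so the infimum in the reals is the intended one.\<close>

definition K_functional ::
  "real \<Rightarrow> real \<Rightarrow> (nat \<Rightarrow> real poly) \<Rightarrow> real \<Rightarrow> real \<Rightarrow> (real \<Rightarrow> real) \<Rightarrow> real \<Rightarrow> real" where
  "K_functional \<alpha> \<beta> \<psi> p s f t =
     Inf {jacobi_norm p \<alpha> \<beta> (\<lambda>x. f x - g x) + t powr s * jacobi_norm p \<alpha> \<beta> h | g h.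
            g \<in> jacobi_Lp p \<alpha> \<beta> \<and> h \<in> jacobi_Lp p \<alpha> \<beta> \<and>
            is_fractional_derivative \<alpha> \<beta> \<psi> s g h}"

end

theory Submission
  imports Defs "HOL-Complex_Analysis.Complex_Analysis"
begin

text \<open>Let \<open>L\<close> be the Jacobi operator, with eigenvalues \<open>\<lambda>\<^sub>k\<^sup>2\<close>. It is dissipative on every \<open>L\<^sub>p\<close>, so its
  resolvents \<open>(1 + \<mu> L)\<^sup>-\<^sup>1\<close> are contractions. With \<open>v(x) = 1 - (1 - (1 + x)\<^sup>-\<^sup>m)\<^sup>l\<close> the symbols
  \<open>x\<^sup>a v(x)\<close> and \<open>x\<^sup>-\<^sup>a (1 - v(x))\<close> are built from resolvents by sums, products and integration over \<open>\<mu>\<close>;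
  evaluated at \<open>x = t\<^sup>2 \<lambda>\<^sub>k\<^sup>2\<close> they give multipliers bounded uniformly in \<open>t\<close>. Hence the operator \<open>V\<^sub>t\<close>
  with symbol \<open>v(t\<^sup>2 \<lambda>\<^sub>k\<^sup>2)\<close> realizes the \<open>K\<close>-functional.

  Bernstein's inequality gives \<open>\<psi>\<^sub>0\<^sup>2 + \<dots> + \<psi>\<^sub>n\<^sup>2 \<le> C n\<^sup>N\<close> with \<open>N = 2\<alpha> + 2\<close>, so high powers of \<open>(1 + \<mu> L)\<^sup>-\<^sup>1\<close> map
  \<open>L\<^sub>1\<close> to \<open>L\<^sub>\<infinity>\<close> with norm at most a constant times \<open>\<mu>\<close> to the power \<open>- N / 2\<close>. From this one obtains \<open>L\<^sub>\<infinity>\<close> bounds for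
  \<open>d\<^sub>j = V f - V' f\<close>, with \<open>V, V'\<close> taken at scales \<open>t / 2\<^sup>j\<^sup>+\<^sup>1\<close> and \<open>t / 2\<^sup>j\<close>, and, by summation over pairs of
  dyadic level sets, the Hardy-Littlewood-Sobolev inequality for negative powers of \<open>L\<close>.

  The latter bounds the derivative part of the realization in \<open>L\<^sub>q\<close>. For \<open>f - V\<^sub>t f = d\<^sub>0 + d\<^sub>1 + \<dots>\<close> the \<open>L\<^sub>\<infinity>\<close>
  bounds are used for small \<open>j\<close> and the \<open>L\<^sub>p\<close> bounds for large \<open>j\<close>, with a threshold depending on the point;
  discrete Hardy inequalities leave the sum of \<open>t\<^sub>j\<^sup>-\<^sup>\<sigma>\<^sup>q K(t\<^sub>j)\<^sup>q\<close>, which the integral dominates.\<close>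

section \<open>Lebesgue spaces and duality\<close>

text \<open>The number \<open>N = 2 \<alpha> + 2\<close> is the dimension of the weight at
  \<open>x = 1\<close>: an arc of angle about \<open>1/n\<close> there has mass about
  \<open>n\<close> to the power \<open>- N\<close>, and \<alpha> \<ge> -1/2 together with \<beta>
  \<le> \<alpha> makes this the worst point. Passing from \<open>L_p\<close> to
  \<open>L_infinity\<close> at scale \<open>t\<close> therefore costs
  \<open>t powr (- N / p)\<close>, and stopping at \<open>L_q\<close> costs
  \<open>t powr (- \<sigma>)\<close>. The triangle inequality in \<open>L_q\<close> over the dyadic
  blocks would give the plain sum of \<open>t_j powr (- \<sigma>) * K(t_j)\<close>, which is too
  large: the claim has \<open>q\<close>-th powers inside the sum. The threshold depending on the
  point gains exactly this, and it works because all powers of \<open>t_j\<close> cancel for this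
  \<sigma>. In the same way the derivative of order \<open>r\<close> must be controlled by the one
  of order \<open>r + \<sigma>\<close> without any loss, which is why the Hardy-Littlewood-Sobolev
  inequality is needed rather than a sum over scales. Operator bounds are proved on polynomials,
  where an operator is a finite sum over eigenvalues; they reach general functions by density or by
  testing with polynomials in the conjugate exponent. Kernels enter only through their
  diagonal.\<close>

definition Lpset :: "'a measure \<Rightarrow> real \<Rightarrow> ('a \<Rightarrow> real) set" where
  "Lpset M p = {f \<in> borel_measurable M. integrable M (\<lambda>x. \<bar>f x\<bar> powr p)}"

text \<open>The Bochner integral has default value \<open>0\<close>, so \<open>Lpn\<close> is
  \<open>0\<close> for a function whose \<open>p\<close>-th power is not integrable. Hence
  membership in \<open>Lpset\<close> has to accompany every norm estimate.\<close>

definition Lpn :: "'a measure \<Rightarrow> real \<Rightarrow> ('a \<Rightarrow> real) \<Rightarrow> real" where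
  "Lpn M p f = (LINT x|M. \<bar>f x\<bar> powr p) powr (1 / p)"

lemma LpsetD: "f \<in> Lpset M p \<Longrightarrow> f \<in> borel_measurable M"
  "f \<in> Lpset M p \<Longrightarrow> integrable M (\<lambda>x. \<bar>f x\<bar> powr p)"
  by (auto simp: Lpset_def)

lemma LpsetI: "f \<in> borel_measurable M \<Longrightarrow> integrable M (\<lambda>x. \<bar>f x\<bar> powr p) \<Longrightarrow> f \<in> Lpset M p"
  by (auto simp: Lpset_def)

lemma Lpn_nonneg: "0 \<le> Lpn M p f"
  by (simp add: Lpn_def)

lemma Lpn_powr: "p > 0 \<Longrightarrow> Lpn M p f powr p = (LINT x|M. \<bar>f x\<bar> powr p)"
  by (simp add: Lpn_def powr_powr)

lemma Lpn_leI:
  assumes "p > 0" "K \<ge> 0" "(LINT x|M. \<bar>f x\<bar> powr p) \<le> K powr p"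
  shows "Lpn M p f \<le> K"
proof -
  have "Lpn M p f \<le> (K powr p) powr (1/p)"
    unfolding Lpn_def using assms by (intro powr_mono2) auto
  then show ?thesis using assms by (simp add: powr_powr)
qed

lemma Lpn_cong: "(\<And>x. x \<in> space M \<Longrightarrow> f x = g x) \<Longrightarrow> Lpn M p f = Lpn M p g"
  unfolding Lpn_def by (intro arg_cong[where f="\<lambda>t. t powr (1/p)"] Bochner_Integration.integral_cong) auto

lemma Lpset_one: "f \<in> Lpset M 1 \<longleftrightarrow> integrable M f"
proof
  assume "f \<in> Lpset M 1"
  then show "integrable M f"
    using LpsetD[of f M 1] by (intro Bochner_Integration.integrable_bound[of M "\<lambda>x. \<bar>f x\<bar> powr 1" f]) auto
next
  assume "integrable M f" then show "f \<in> Lpset M 1"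
    by (auto intro!: LpsetI)
qed

lemma Lpn_one: "Lpn M 1 f = (LINT x|M. \<bar>f x\<bar>)"
proof -
  have "(LINT x|M. \<bar>f x\<bar>) \<ge> 0" by simp
  then show ?thesis unfolding Lpn_def by simp
qed

lemma conj_exponent:
  fixes p p' :: real
  assumes "1 < p" "1 / p + 1 / p' = 1"
  shows "p' = p / (p - 1)"
proof -
  have "p' = inverse (1 / p')" by simp
  also have "1 / p' = 1 - 1 / p" using assms(2) by linarith
  also have "\<dots> = (p - 1) / p" using assms(1) by (simp add: diff_divide_distrib)
  finally show ?thesis by simp
qed

text \<open>Young's inequality for \<open>f / a\<close> and \<open>g / b\<close>, where
  \<open>a\<close> and \<open>b\<close> are the norms enlarged by \<open>e\<close>. The enlargement
  keeps the denominators positive when a norm is zero and is sent to \<open>0\<close> at the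
  end.\<close>

lemma Hoelder:
  fixes f g :: "'a \<Rightarrow> real"
  assumes p: "1 < p" "1 / p + 1 / p' = 1" and f: "f \<in> Lpset M p" and g: "g \<in> Lpset M p'"
  shows "integrable M (\<lambda>x. f x * g x)" "(LINT x|M. \<bar>f x * g x\<bar>) \<le> Lpn M p f * Lpn M p' g"
proof -
  have p': "p' > 1"
    unfolding conj_exponent[OF p] using p by simp
  note [measurable] = LpsetD(1)[OF f] LpsetD(1)[OF g]
  have Y: "\<bar>f x * g x\<bar> \<le> a * b * ((\<bar>f x\<bar> powr p) / (p * a powr p) + (\<bar>g x\<bar> powr p') / (p' * b powr p'))"
    if ab: "a > 0" "b > 0" for a b x
  proof -
    have "(\<bar>f x\<bar>/a) * (\<bar>g x\<bar>/b) \<le> (\<bar>f x\<bar>/a) powr p / p + (\<bar>g x\<bar>/b) powr p' / p'"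
      using ab p p' by (intro Youngs_inequality) auto
    also have "\<dots> = (\<bar>f x\<bar> powr p) / (p * a powr p) + (\<bar>g x\<bar> powr p') / (p' * b powr p')"
      using ab by (simp add: powr_divide field_simps)
    finally have "a * b * ((\<bar>f x\<bar>/a) * (\<bar>g x\<bar>/b)) \<le> a * b * ((\<bar>f x\<bar> powr p) / (p * a powr p) + (\<bar>g x\<bar> powr p') / (p' * b powr p'))"
      using ab by (intro mult_left_mono) auto
    moreover have "a * b * ((\<bar>f x\<bar>/a) * (\<bar>g x\<bar>/b)) = \<bar>f x * g x\<bar>"
      using ab by (simp add: abs_mult)
    ultimately show ?thesis by simp
  qed
  show i: "integrable M (\<lambda>x. f x * g x)"
  proof (rule Bochner_Integration.integrable_bound)
    show "integrable M (\<lambda>x. 1 * 1 * (\<bar>f x\<bar> powr p / (p * 1 powr p) + \<bar>g x\<bar> powr p' / (p' * 1 powr p')))"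
      using LpsetD(2)[OF f] LpsetD(2)[OF g] by simp
    show "AE x in M. norm (f x * g x) \<le> norm (1 * 1 * (\<bar>f x\<bar> powr p / (p * 1 powr p) + \<bar>g x\<bar> powr p' / (p' * 1 powr p')))"
      unfolding real_norm_def by (intro AE_I2 order_trans[OF Y[OF zero_less_one zero_less_one] abs_ge_self])
  qed measurable
  have main: "(LINT x|M. \<bar>f x * g x\<bar>) \<le> (Lpn M p f + e) * (Lpn M p' g + e)" if e: "e > 0" for e
  proof -
    define a b where "a = Lpn M p f + e" and "b = Lpn M p' g + e"
    have ab: "a > 0" "b > 0" using e Lpn_nonneg[of M p f] Lpn_nonneg[of M p' g] unfolding a_def b_def by linarith+
    have A: "(LINT x|M. \<bar>f x\<bar> powr p) \<le> a powr p"
      using Lpn_powr[of p M f] p e Lpn_nonneg[of M p f] powr_mono2[of p "Lpn M p f" a] unfolding a_def by auto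
    have B: "(LINT x|M. \<bar>g x\<bar> powr p') \<le> b powr p'"
      using Lpn_powr[of p' M g] p' e Lpn_nonneg[of M p' g] powr_mono2[of p' "Lpn M p' g" b] unfolding b_def by auto
    have "(LINT x|M. \<bar>f x * g x\<bar>) \<le> (LINT x|M. a * b * ((\<bar>f x\<bar> powr p) / (p * a powr p) + (\<bar>g x\<bar> powr p') / (p' * b powr p')))"
      using i LpsetD(2)[OF f] LpsetD(2)[OF g] Y[OF ab] by (intro integral_mono) auto
    also have "\<dots> = a * b * ((LINT x|M. \<bar>f x\<bar> powr p) / (p * a powr p) + (LINT x|M. \<bar>g x\<bar> powr p') / (p' * b powr p'))"
      using LpsetD(2)[OF f] LpsetD(2)[OF g] by simp
    also have "\<dots> \<le> a * b * (a powr p / (p * a powr p) + b powr p' / (p' * b powr p'))"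
      using ab p p' A B by (intro mult_left_mono add_mono divide_right_mono) auto
    also have "\<dots> = a * b * (1 / p + 1 / p')" using ab by simp
    finally show ?thesis using p by (simp add: a_def b_def)
  qed
  have "((\<lambda>e. (Lpn M p f + e) * (Lpn M p' g + e)) \<longlongrightarrow> (Lpn M p f + 0) * (Lpn M p' g + 0)) (at_right 0)"
    by (intro tendsto_intros)
  then show "(LINT x|M. \<bar>f x * g x\<bar>) \<le> Lpn M p f * Lpn M p' g"
    by (intro tendsto_lowerbound[where F="at_right (0::real)"])
       (auto simp: eventually_at_right_field intro!: exI[of _ 1] main)
qed

text \<open>Convexity of the power on the open half line; at a zero argument the claim reduces to
  \<open>k powr p \<le> k\<close> for \<open>k\<close> in the unit interval.\<close>

lemma powr_convex_two:
  fixes a b :: real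
  assumes "p \<ge> 1" "0 \<le> l" "l \<le> 1" "a \<ge> 0" "b \<ge> 0"
  shows "(l * a + (1 - l) * b) powr p \<le> l * a powr p + (1 - l) * b powr p"
proof -
  have z: "(k * c) powr p \<le> k * c powr p" if "0 \<le> k" "k \<le> 1" for k c :: real
    using that assms(1) powr_le_one_le[of k p] by (cases "k = 0") (auto simp: powr_mult intro!: mult_right_mono)
  consider "a = 0" | "b = 0" | "a > 0" "b > 0" using assms by linarith
  then show ?thesis
  proof cases
    case 1 then show ?thesis using z[of "1 - l" b] assms by simp
  next
    case 2 then show ?thesis using z[of l a] assms by simp
  next
    case 3
    have "convex_on {0<..} (\<lambda>x::real. x powr p)" by (rule powr_convex[OF assms(1)])
    from convex_onD[OF this, of "1 - l" a b] assms 3 show ?thesis by simp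
  qed
qed

text \<open>\<open>\<bar>f\<bar> + \<bar>g\<bar>\<close> is \<open>a + b\<close> times a convex
  combination of \<open>\<bar>f\<bar> / a\<close> and \<open>\<bar>g\<bar> / b\<close>, so convexity
  of the power works pointwise. With \<open>a\<close> and \<open>b\<close> slightly larger than the
  norms both normalized integrals are at most \<open>1\<close>; this covers \<open>p = 1\<close> and
  zero norms alike.\<close>

lemma Minkowski:
  fixes f g :: "'a \<Rightarrow> real"
  assumes p: "1 \<le> p" and f: "f \<in> Lpset M p" and g: "g \<in> Lpset M p"
  shows "(\<lambda>x. f x + g x) \<in> Lpset M p" "Lpn M p (\<lambda>x. f x + g x) \<le> Lpn M p f + Lpn M p g"
proof -
  note [measurable] = LpsetD(1)[OF f] LpsetD(1)[OF g]
  have Y: "\<bar>f x + g x\<bar> powr p \<le> (a + b) powr p * (a / (a + b) * (\<bar>f x\<bar> powr p / a powr p) + (1 - a / (a + b)) * (\<bar>g x\<bar> powr p / b powr p))"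
    if ab: "a > 0" "b > 0" for a b x
  proof -
    have "\<bar>f x + g x\<bar> powr p \<le> (\<bar>f x\<bar> + \<bar>g x\<bar>) powr p" using p by (intro powr_mono2) auto
    also have "\<bar>f x\<bar> + \<bar>g x\<bar> = (a + b) * (a / (a + b) * (\<bar>f x\<bar> / a) + (1 - a / (a + b)) * (\<bar>g x\<bar> / b))"
    proof -
      have "1 - a / (a + b) = b / (a + b)" using ab by (simp add: field_simps)
      then show ?thesis using ab by (simp add: distrib_left)
    qed
    also have "\<dots> powr p = (a + b) powr p * (a / (a + b) * (\<bar>f x\<bar> / a) + (1 - a / (a + b)) * (\<bar>g x\<bar> / b)) powr p"
      by (rule powr_mult) 
    also have "\<dots> \<le> (a + b) powr p * (a / (a + b) * (\<bar>f x\<bar> / a) powr p + (1 - a / (a + b)) * (\<bar>g x\<bar> / b) powr p)"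
      using ab p by (intro mult_left_mono powr_convex_two) (auto simp: field_simps)
    finally show ?thesis using ab by (simp add: powr_divide)
  qed
  have i: "integrable M (\<lambda>x. \<bar>f x + g x\<bar> powr p)"
  proof (rule Bochner_Integration.integrable_bound)
    show "integrable M (\<lambda>x. (1 + 1) powr p * (1 / (1 + 1) * (\<bar>f x\<bar> powr p / 1 powr p) + (1 - 1 / (1 + 1)) * (\<bar>g x\<bar> powr p / 1 powr p)))"
      using LpsetD(2)[OF f] LpsetD(2)[OF g] by simp
    have "\<bar>\<bar>f x + g x\<bar> powr p\<bar> \<le> (1 + 1) powr p * (1 / (1 + 1) * (\<bar>f x\<bar> powr p / 1 powr p) + (1 - 1 / (1 + 1)) * (\<bar>g x\<bar> powr p / 1 powr p))" for x
      using Y[OF zero_less_one zero_less_one, of x] by (simp only: abs_of_nonneg[OF powr_ge_zero])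
    then show "AE x in M. norm (\<bar>f x + g x\<bar> powr p) \<le> norm ((1 + 1) powr p * (1 / (1 + 1) * (\<bar>f x\<bar> powr p / 1 powr p) + (1 - 1 / (1 + 1)) * (\<bar>g x\<bar> powr p / 1 powr p)))"
      unfolding real_norm_def by (intro AE_I2 order_trans[OF _ abs_ge_self])
  qed measurable
  then show "(\<lambda>x. f x + g x) \<in> Lpset M p" by (intro LpsetI) auto
  have main: "Lpn M p (\<lambda>x. f x + g x) \<le> (Lpn M p f + e) + (Lpn M p g + e)" if e: "e > 0" for e
  proof -
    define a b where "a = Lpn M p f + e" and "b = Lpn M p g + e"
    have ab: "a > 0" "b > 0" using e Lpn_nonneg[of M p f] Lpn_nonneg[of M p g] unfolding a_def b_def by linarith+
    have A: "(LINT x|M. \<bar>f x\<bar> powr p) \<le> a powr p"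
      using Lpn_powr[of p M f] p e Lpn_nonneg[of M p f] powr_mono2[of p "Lpn M p f" a] unfolding a_def by auto
    have B: "(LINT x|M. \<bar>g x\<bar> powr p) \<le> b powr p"
      using Lpn_powr[of p M g] p e Lpn_nonneg[of M p g] powr_mono2[of p "Lpn M p g" b] unfolding b_def by auto
    have "(LINT x|M. \<bar>f x + g x\<bar> powr p) \<le> (LINT x|M. (a + b) powr p * (a / (a + b) * (\<bar>f x\<bar> powr p / a powr p) + (1 - a / (a + b)) * (\<bar>g x\<bar> powr p / b powr p)))"
      using i LpsetD(2)[OF f] LpsetD(2)[OF g] Y[OF ab] by (intro integral_mono) auto
    also have "\<dots> = (a + b) powr p * (a / (a + b) * ((LINT x|M. \<bar>f x\<bar> powr p) / a powr p) + (1 - a / (a + b)) * ((LINT x|M. \<bar>g x\<bar> powr p) / b powr p))"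
      using LpsetD(2)[OF f] LpsetD(2)[OF g] by simp
    also have "\<dots> \<le> (a + b) powr p * (a / (a + b) * 1 + (1 - a / (a + b)) * 1)"
      using ab p A B by (intro mult_left_mono add_mono) (auto simp: field_simps)
    finally have "(LINT x|M. \<bar>f x + g x\<bar> powr p) \<le> (a + b) powr p" by simp
    then show ?thesis using ab p by (intro Lpn_leI) (auto simp: a_def[symmetric] b_def[symmetric])
  qed
  have "((\<lambda>e. (Lpn M p f + e) + (Lpn M p g + e)) \<longlongrightarrow> (Lpn M p f + 0) + (Lpn M p g + 0)) (at_right 0)"
    by (intro tendsto_intros)
  then show "Lpn M p (\<lambda>x. f x + g x) \<le> Lpn M p f + Lpn M p g"
    by (intro tendsto_lowerbound[where F="at_right (0::real)"])
       (auto simp: eventually_at_right_field intro!: exI[of _ 1] main[simplified])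
qed

lemma Lpset_cmult: "f \<in> Lpset M p \<Longrightarrow> (\<lambda>x. c * f x) \<in> Lpset M p"
  by (auto simp: Lpset_def abs_mult powr_mult)

lemma Lpn_cmult: "p > 0 \<Longrightarrow> Lpn M p (\<lambda>x. c * f x) = \<bar>c\<bar> * Lpn M p f"
  by (auto simp: Lpn_def abs_mult powr_mult powr_powr)

lemma Lpset_uminus: "f \<in> Lpset M p \<Longrightarrow> (\<lambda>x. - f x) \<in> Lpset M p"
  using Lpset_cmult[of f M p "-1"] by simp

lemma Lpn_uminus: "Lpn M p (\<lambda>x. - f x) = Lpn M p f"
  by (simp add: Lpn_def)

lemma Minkowski_diff:
  fixes f g :: "'a \<Rightarrow> real"
  assumes p: "1 \<le> p" and f: "f \<in> Lpset M p" and g: "g \<in> Lpset M p"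
  shows "(\<lambda>x. f x - g x) \<in> Lpset M p" "Lpn M p (\<lambda>x. f x - g x) \<le> Lpn M p f + Lpn M p g"
  using Minkowski[OF p f Lpset_uminus[OF g]] by (simp_all add: Lpn_uminus)

lemma Minkowski_triangle:
  fixes f g h :: "'a \<Rightarrow> real"
  assumes p: "1 \<le> p" and "f \<in> Lpset M p" "g \<in> Lpset M p" "h \<in> Lpset M p"
  shows "Lpn M p (\<lambda>x. f x - h x) \<le> Lpn M p (\<lambda>x. f x - g x) + Lpn M p (\<lambda>x. g x - h x)"
  using Minkowski(2)[OF p Minkowski_diff(1)[OF assms(1-3)] Minkowski_diff(1)[OF p assms(3,4)]] by simp

lemma Lpset_zero: "(\<lambda>x. 0) \<in> Lpset M p" and Lpn_zero: "Lpn M p (\<lambda>x. 0) = 0"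
  by (auto simp: Lpset_def Lpn_def)

lemma Minkowski_sum:
  assumes p: "1 \<le> p" and "finite I" "\<And>i. i \<in> I \<Longrightarrow> f i \<in> Lpset M p"
  shows "(\<lambda>x. \<Sum>i\<in>I. f i x) \<in> Lpset M p \<and> Lpn M p (\<lambda>x. \<Sum>i\<in>I. f i x) \<le> (\<Sum>i\<in>I. Lpn M p (f i))"
  using assms(2,3)
proof (induction I rule: finite_induct)
  case empty show ?case by (simp add: Lpset_zero Lpn_zero)
next
  case (insert i I)
  then have IH: "(\<lambda>x. \<Sum>i\<in>I. f i x) \<in> Lpset M p" "Lpn M p (\<lambda>x. \<Sum>i\<in>I. f i x) \<le> (\<Sum>i\<in>I. Lpn M p (f i))"
    "f i \<in> Lpset M p" by auto
  show ?case using Minkowski[OF p IH(3,1)] IH(2) insert.hyps by auto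
qed

lemma Lpset_bounded:
  assumes "finite_measure M" "f \<in> borel_measurable M" "\<And>x. x \<in> space M \<Longrightarrow> \<bar>f x\<bar> \<le> B" "p > 0"
  shows "f \<in> Lpset M p"
proof -
  interpret finite_measure M by fact
  have "integrable M (\<lambda>x. \<bar>f x\<bar> powr p)"
    using assms by (intro integrable_const_bound[where B="B powr p"]) (auto intro!: powr_mono2)
  then show ?thesis using assms by (auto simp: Lpset_def)
qed

text \<open>Hoelder against the constant \<open>1\<close>. The sharp factor is the total mass to the
  power \<open>1 - 1/p\<close>; \<open>1 + measure M (space M)\<close> dominates it, so that one
  factor serves all \<open>p\<close>.\<close>

lemma Lpset_imp_L1:
  assumes M: "finite_measure M" and p: "1 \<le> p" and f: "f \<in> Lpset M p"
  shows "integrable M f" "(LINT x|M. \<bar>f x\<bar>) \<le> (1 + measure M (space M)) * Lpn M p f"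
proof -
  interpret finite_measure M by fact
  have "integrable M f \<and> (LINT x|M. \<bar>f x\<bar>) \<le> (1 + measure M (space M)) * Lpn M p f"
  proof (cases "p = 1")
    case True
    have "0 \<le> measure M (space M) * (LINT x|M. \<bar>f x\<bar>)" by simp
    then show ?thesis using f True by (auto simp: Lpset_one Lpn_one algebra_simps)
  next
    case False
    then have p1: "p > 1" using p by simp
    define p' where "p' = p / (p - 1)"
    have p': "1/p + 1/p' = 1" "p' > 0" "1/p' = 1 - 1/p" using p1 by (auto simp: p'_def field_simps)
    have one: "(\<lambda>x. 1::real) \<in> Lpset M p'" using Lpset_bounded[OF M, of "\<lambda>x. 1" 1 p'] p' by auto
    have "Lpn M p' (\<lambda>x. 1::real) = measure M (space M) powr (1 - 1/p)"
      by (simp add: Lpn_def p' lebesgue_integral_const)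
    moreover have "measure M (space M) powr (1 - 1/p) \<le> 1 + measure M (space M)"
    proof -
      have "measure M (space M) powr (1 - 1/p) \<le> (1 + measure M (space M)) powr (1 - 1/p)"
        using p1 by (intro powr_mono2) auto
      also have "\<dots> \<le> (1 + measure M (space M)) powr 1" using p1 by (intro powr_mono) auto
      finally show ?thesis by simp
    qed
    ultimately have "Lpn M p f * Lpn M p' (\<lambda>x. 1) \<le> (1 + measure M (space M)) * Lpn M p f"
      using Lpn_nonneg[of M p f] by (simp add: mult.commute mult_left_mono)
    then show ?thesis using Hoelder[OF p1 p'(1) f one] by simp
  qed
  then show "integrable M f" "(LINT x|M. \<bar>f x\<bar>) \<le> (1 + measure M (space M)) * Lpn M p f" by auto
qed

text \<open>The extremal function for \<open>G\<close> in Hoelder's inequality. It is left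
  unnormalized, so nothing has to be divided by the norm of \<open>G\<close>, which may be
  zero.\<close>

definition conj_fun :: "real \<Rightarrow> ('a \<Rightarrow> real) \<Rightarrow> 'a \<Rightarrow> real" where
  "conj_fun p G x = sgn (G x) * \<bar>G x\<bar> powr (p - 1)"

lemma conj_fun:
  assumes p: "1 < p" "1 / p + 1 / p' = 1" and G: "G \<in> Lpset M p"
  shows "conj_fun p G \<in> Lpset M p'"
    "G x * conj_fun p G x = \<bar>G x\<bar> powr p"
    "Lpn M p' (conj_fun p G) = Lpn M p G powr (p - 1)"
    "\<bar>conj_fun p G x\<bar> = \<bar>G x\<bar> powr (p - 1)"
proof -
  note [measurable] = LpsetD(1)[OF G]
  have p': "p' = p / (p - 1)" by (rule conj_exponent[OF p])
  show a: "\<bar>conj_fun p G x\<bar> = \<bar>G x\<bar> powr (p - 1)" for x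
    by (simp add: conj_fun_def abs_mult abs_sgn_eq)
  have e: "(p - 1) * p' = p" using p(1) by (simp add: p')
  have b: "\<bar>conj_fun p G x\<bar> powr p' = \<bar>G x\<bar> powr p" for x
    unfolding a powr_powr e ..
  have "conj_fun p G \<in> borel_measurable M" unfolding conj_fun_def by measurable
  then show "conj_fun p G \<in> Lpset M p'"
    using LpsetD(2)[OF G] by (intro LpsetI) (simp_all only: b)
  have "G x * conj_fun p G x = \<bar>G x\<bar> * \<bar>G x\<bar> powr (p - 1)" for x
    by (simp add: conj_fun_def abs_sgn mult.assoc[symmetric])
  also have "\<And>x. \<bar>G x\<bar> * \<bar>G x\<bar> powr (p - 1) = \<bar>G x\<bar> powr p"
    using powr_mult_base[of "\<bar>G _\<bar>" "p - 1"] by simp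
  finally show "G x * conj_fun p G x = \<bar>G x\<bar> powr p" .
  have e2: "1 / p * (p - 1) = 1 / p'" using p(1) by (simp add: p')
  show "Lpn M p' (conj_fun p G) = Lpn M p G powr (p - 1)"
    by (simp only: Lpn_def b powr_powr e2)
qed

text \<open>The form in which duality is used throughout: pairing \<open>G\<close> with
  \<open>conj_fun p G\<close> produces the hypothesis, whose left side is the \<open>p\<close>-th
  power of the norm, and \<open>p - 1\<close> of these powers cancel unless the norm is
  zero.\<close>

lemma Lpn_le_dual:
  assumes p: "1 < p" and le: "(LINT x|M. \<bar>G x\<bar> powr p) \<le> K * Lpn M p G powr (p - 1)" and K: "K \<ge> 0"
  shows "Lpn M p G \<le> K"
proof (cases "Lpn M p G = 0")
  case False
  then have pos: "Lpn M p G > 0" using Lpn_nonneg[of M p G] by simp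
  have "Lpn M p G * Lpn M p G powr (p - 1) \<le> K * Lpn M p G powr (p - 1)"
    using le Lpn_powr[of p M G] p pos powr_mult_base[of "Lpn M p G" "p - 1"] by simp
  then show ?thesis using pos by (simp add: mult_le_cancel_right)
qed (use K in simp)

section \<open>The Jacobi weight and density of polynomials\<close>

locale jacobi_weights =
  fixes \<alpha> \<beta> :: real
  assumes beta_le: "\<beta> \<le> \<alpha>" and beta_gt: "-1 < \<beta>" and alpha_ge: "-1/2 \<le> \<alpha>"
begin

abbreviation M :: "real measure" where "M \<equiv> jacobi_measure \<alpha> \<beta>"
abbreviation w :: "real \<Rightarrow> real" where "w \<equiv> jacobi_weight \<alpha> \<beta>"

lemma alpha_gt: "-1 < \<alpha>" using beta_le beta_gt by simp

lemma space_M [simp]: "space M = {-1..1}"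
  and sets_M: "sets M = sets (lebesgue_on {-1..1})"
  by (auto simp: jacobi_measure_def space_restrict_space)

lemma borel_measurable_M: "borel_measurable M = borel_measurable (lebesgue_on {-1..1})"
  by (rule measurable_cong_sets) (simp_all add: sets_M)

lemma continuous_measurable_M: "continuous_on {-1..1} f \<Longrightarrow> f \<in> borel_measurable M"
  unfolding borel_measurable_M by (rule continuous_imp_measurable_on_sets_lebesgue) auto

lemma w_measurable [measurable]: "w \<in> borel_measurable (lebesgue_on {-1..1})"
proof -
  have "w \<in> borel_measurable borel" unfolding jacobi_weight_def by measurable
  then show ?thesis
    by (metis borel_measurable_if_D lborelD measurable_completion measurable_lborel2 borel_measurable_subalgebra measurable_restrict_space1)
qed

lemma w_nonneg: "x \<in> {-1..1} \<Longrightarrow> 0 \<le> w x"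
  by (simp add: jacobi_weight_def)

lemma integrable_powr_left:
  fixes a :: real assumes "-1 < a"
  shows "(\<lambda>x. (1 - x) powr a) absolutely_integrable_on {-1..1}"
proof -
  have "((\<lambda>x. (1 - x) powr a) has_integral (- ((1 - 1) powr (a + 1) / (a + 1)) - (- ((1 - (-1)) powr (a + 1) / (a + 1))))) {-1..1}"
  proof (rule fundamental_theorem_of_calculus_interior)
    show "continuous_on {-1..1} (\<lambda>x. - ((1 - x) powr (a + 1) / (a + 1)))"
      using assms by (intro continuous_intros continuous_on_powr') auto
    fix x :: real assume "x \<in> {-1<..<1}"
    then show "((\<lambda>x. - ((1 - x) powr (a + 1) / (a + 1))) has_vector_derivative (1 - x) powr a) (at x)"
      using assms unfolding has_real_derivative_iff_has_vector_derivative[symmetric]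
      by (auto intro!: derivative_eq_intros)
  qed simp
  then show ?thesis by (intro nonnegative_absolutely_integrable_1) (auto simp: integrable_on_def)
qed

lemma integrable_powr_right:
  fixes a :: real assumes "-1 < a"
  shows "(\<lambda>x. (1 + x) powr a) absolutely_integrable_on {-1..1}"
proof -
  have "((\<lambda>x. (1 + x) powr a) has_integral ((1 + 1) powr (a + 1) / (a + 1) - ((1 + (-1)) powr (a + 1) / (a + 1)))) {-1..1}"
  proof (rule fundamental_theorem_of_calculus_interior)
    show "continuous_on {-1..1} (\<lambda>x. (1 + x) powr (a + 1) / (a + 1))"
      using assms by (intro continuous_intros continuous_on_powr') auto
    fix x :: real assume "x \<in> {-1<..<1}"
    then show "((\<lambda>x. (1 + x) powr (a + 1) / (a + 1)) has_vector_derivative (1 + x) powr a) (at x)"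
      using assms unfolding has_real_derivative_iff_has_vector_derivative[symmetric]
      by (auto intro!: derivative_eq_intros)
  qed simp
  then show ?thesis by (intro nonnegative_absolutely_integrable_1) (auto simp: integrable_on_def)
qed

text \<open>On each half of the interval one factor has its base in \<open>[1, 2]\<close> and is
  bounded whatever the sign of its exponent; the other factor is an integrable power.\<close>

lemma integrable_w: "integrable (lebesgue_on {-1..1}) w"
proof -
  have i: "integrable (lebesgue_on {-1..1}) (\<lambda>x. 2 powr \<bar>\<beta>\<bar> * (1 - x) powr \<alpha> + 2 powr \<bar>\<alpha>\<bar> * (1 + x) powr \<beta>)"
    using integrable_powr_left[OF alpha_gt] integrable_powr_right[OF beta_gt]
    by (simp add: set_integrable_def integrable_restrict_space)
  have b: "y powr a \<le> 2 powr \<bar>a\<bar>" if "1 \<le> y" "y \<le> 2" for y a :: real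
  proof -
    have "y powr a \<le> y powr \<bar>a\<bar>" using that by (intro powr_mono) auto
    also have "\<dots> \<le> 2 powr \<bar>a\<bar>" using that by (intro powr_mono2) auto
    finally show ?thesis .
  qed
  have "\<bar>w x\<bar> \<le> 2 powr \<bar>\<beta>\<bar> * (1 - x) powr \<alpha> + 2 powr \<bar>\<alpha>\<bar> * (1 + x) powr \<beta>" if "x \<in> {-1..1}" for x
  proof (cases "x \<ge> 0")
    case True
    have "w x \<le> (1 - x) powr \<alpha> * 2 powr \<bar>\<beta>\<bar>"
      unfolding jacobi_weight_def using True that by (intro mult_left_mono b) auto
    moreover have "0 \<le> 2 powr \<bar>\<alpha>\<bar> * (1 + x) powr \<beta>" by simp
    ultimately show ?thesis using w_nonneg[OF that] mult.commute[of "(1 - x) powr \<alpha>" "2 powr \<bar>\<beta>\<bar>"] by linarith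
  next
    case False
    have "w x \<le> 2 powr \<bar>\<alpha>\<bar> * (1 + x) powr \<beta>"
      unfolding jacobi_weight_def using False that by (intro mult_right_mono b) auto
    moreover have "0 \<le> 2 powr \<bar>\<beta>\<bar> * (1 - x) powr \<alpha>" by simp
    ultimately show ?thesis using w_nonneg[OF that] by linarith
  qed
  then have *: "AE x in lebesgue_on {-1..1}. norm (w x) \<le> norm (2 powr \<bar>\<beta>\<bar> * (1 - x) powr \<alpha> + 2 powr \<bar>\<alpha>\<bar> * (1 + x) powr \<beta>)"
    by (intro AE_I2) (auto simp: space_restrict_space intro: order_trans[OF _ abs_ge_self])
  show ?thesis by (rule Bochner_Integration.integrable_bound[OF i w_measurable *])
qed

lemma M_eq: "M = density (lebesgue_on {-1..1}) (\<lambda>x. ennreal (w x))"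
  by (simp add: jacobi_measure_def)

lemma AE_w_nonneg: "AE x in lebesgue_on {-1..1}. 0 \<le> w x"
  by (intro AE_I2) (auto simp: space_restrict_space w_nonneg)

lemma integral_M: "f \<in> borel_measurable M \<Longrightarrow> (LINT x|M. f x) = (LINT x|lebesgue_on {-1..1}. w x * f x)"
  for f :: "real \<Rightarrow> real"
  unfolding borel_measurable_M unfolding M_eq
  by (subst integral_density) (auto simp: AE_w_nonneg)

lemma integrable_M: "f \<in> borel_measurable M \<Longrightarrow> integrable M f \<longleftrightarrow> integrable (lebesgue_on {-1..1}) (\<lambda>x. w x * f x)"
  for f :: "real \<Rightarrow> real"
  unfolding borel_measurable_M unfolding M_eq
  by (subst integrable_density) (auto simp: AE_w_nonneg)

lemma finite_measure_M: "finite_measure M"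
proof
  have "integrable M (\<lambda>x. 1 :: real)"
    by (subst integrable_M) (auto simp: integrable_w)
  then have "emeasure M (space M) < \<infinity>" by (auto simp: integrable_iff_bounded)
  then show "emeasure M (space M) \<noteq> \<infinity>" by simp
qed

sublocale finite_measure M by (rule finite_measure_M)

lemma bounded_integrable:
  fixes f :: "real \<Rightarrow> real"
  assumes "f \<in> borel_measurable M" "\<And>x. x \<in> {-1..1} \<Longrightarrow> \<bar>f x\<bar> \<le> B"
  shows "integrable M f"
  using assms by (intro integrable_const_bound[where B=B]) auto

lemma continuous_bounded:
  fixes f :: "real \<Rightarrow> real"
  assumes "continuous_on {-1..1} f"
  obtains B where "B \<ge> 0" "\<And>x. x \<in> {-1..1} \<Longrightarrow> \<bar>f x\<bar> \<le> B"
proof -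
  have "bounded (f ` {-1..1})" using assms by (intro compact_imp_bounded compact_continuous_image) auto
  then obtain B where "\<forall>y\<in>f ` {-1..1}. norm y \<le> B" by (auto simp: bounded_iff)
  then show thesis by (intro that[of "max B 0"]) (auto simp: le_max_iff_disj)
qed

lemma continuous_integrable: "continuous_on {-1..1} f \<Longrightarrow> integrable M f" for f :: "real \<Rightarrow> real"
  by (metis continuous_bounded bounded_integrable continuous_measurable_M)

lemma continuous_Lp: "continuous_on {-1..1} f \<Longrightarrow> p > 0 \<Longrightarrow> f \<in> Lpset M p" for f :: "real \<Rightarrow> real"
  by (metis continuous_bounded Lpset_bounded[OF finite_measure_M] continuous_measurable_M space_M)

lemma poly_measurable [measurable]: "poly P \<in> borel_measurable M" for P :: "real poly"
  by (intro continuous_measurable_M continuous_intros)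

lemma poly_Lp: "p > 0 \<Longrightarrow> poly P \<in> Lpset M p" for P :: "real poly"
  by (intro continuous_Lp continuous_intros)

lemma poly_bounded:
  fixes P :: "real poly"
  obtains B where "B \<ge> 0" "\<And>x. x \<in> {-1..1} \<Longrightarrow> \<bar>poly P x\<bar> \<le> B"
  by (rule continuous_bounded[of "poly P"]) (auto intro: continuous_intros)

lemma poly_integrable: "integrable M (poly P)" for P :: "real poly"
  by (intro continuous_integrable continuous_intros)

lemma AE_M_I: "AE x in lebesgue_on {-1..1}. P x \<Longrightarrow> AE x in M. P x"
  unfolding M_eq by (subst AE_density) (auto)

lemma Lpn_LIM:
  fixes f :: "nat \<Rightarrow> real \<Rightarrow> real"
  assumes p: "p > 0" and m: "\<And>n. f n \<in> borel_measurable M" and lim: "AE x in M. (\<lambda>n. f n x) \<longlonglongrightarrow> 0"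
    and g: "integrable M (\<lambda>x. g x powr p)" and b: "\<And>n x. x \<in> {-1..1} \<Longrightarrow> \<bar>f n x\<bar> \<le> g x"
  shows "(\<lambda>n. Lpn M p (f n)) \<longlonglongrightarrow> 0"
proof -
  have "(\<lambda>n. LINT x|M. \<bar>f n x\<bar> powr p) \<longlonglongrightarrow> (LINT x|M. 0)"
  proof (rule integral_dominated_convergence)
    show "AE x in M. (\<lambda>n. \<bar>f n x\<bar> powr p) \<longlonglongrightarrow> 0"
      using lim
    proof eventually_elim
      case (elim x)
      then have "(\<lambda>n. \<bar>f n x\<bar>) \<longlonglongrightarrow> 0" by (simp add: tendsto_rabs_zero_iff)
      then have "(\<lambda>n. \<bar>f n x\<bar> powr p) \<longlonglongrightarrow> 0 powr p" using p by (intro tendsto_powr') auto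
      then show ?case by simp
    qed
    show "AE x in M. norm (\<bar>f n x\<bar> powr p) \<le> g x powr p" for n
      using b p by (intro AE_I2) (auto intro!: powr_mono2)
  qed (use m g in auto)
  then have "(\<lambda>n. (LINT x|M. \<bar>f n x\<bar> powr p) powr (1/p)) \<longlonglongrightarrow> 0 powr (1/p)"
    using p by (intro tendsto_powr') auto
  then show ?thesis by (simp add: Lpn_def)
qed

text \<open>Weierstrass approximation. A uniform error \<open>e'\<close> costs at most
  \<open>e' * (1 + measure M (space M))\<close> in the norm for any \<open>p \<ge> 1\<close>, which
  explains the choice of \<open>e'\<close>.\<close>

lemma poly_approx_continuous:
  fixes f :: "real \<Rightarrow> real"
  assumes f: "continuous_on {-1..1} f" and p: "p \<ge> 1" and e: "e > 0"
  obtains P :: "real poly" where "Lpn M p (\<lambda>x. f x - poly P x) < e"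
proof -
  define e' where "e' = e / (2 * (1 + measure M (space M)))"
  have e': "e' > 0" using e by (simp add: e'_def add_pos_nonneg)
  obtain g where g: "real_polynomial_function g" "\<And>x. x \<in> {-1..1} \<Longrightarrow> \<bar>f x - g x\<bar> < e'"
    using Stone_Weierstrass_real_polynomial_function[OF compact_Icc f e'] by metis
  obtain a n where "g = (\<lambda>x. \<Sum>i\<le>n. a i * x ^ i)"
    using g(1) by (auto simp: real_polynomial_function_iff_sum)
  define P where "P = (\<Sum>i\<le>n. monom (a i) i)"
  have P: "poly P x = g x" for x
    by (simp add: P_def poly_sum poly_monom \<open>g = _\<close>)
  have "Lpn M p (\<lambda>x. f x - poly P x) \<le> e' * (1 + measure M (space M))"
  proof (rule Lpn_leI)
    have "(LINT x|M. \<bar>f x - poly P x\<bar> powr p) \<le> (LINT x|M. e' powr p)"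
    proof (rule integral_mono)
      show "integrable M (\<lambda>x. \<bar>f x - poly P x\<bar> powr p)"
        using p f by (intro continuous_integrable continuous_intros continuous_on_powr') auto
      show "\<bar>f x - poly P x\<bar> powr p \<le> e' powr p" if "x \<in> space M" for x
        using g(2)[of x] that p unfolding P by (intro powr_mono2) auto
    qed simp
    also have "\<dots> = e' powr p * measure M (space M)" by (simp add: mult.commute)
    also have "\<dots> \<le> e' powr p * (1 + measure M (space M)) powr p"
    proof (intro mult_left_mono)
      have "measure M (space M) \<le> (1 + measure M (space M)) powr 1" by simp
      also have "\<dots> \<le> (1 + measure M (space M)) powr p" using p by (intro powr_mono) auto
      finally show "measure M (space M) \<le> (1 + measure M (space M)) powr p" .
    qed auto
    finally show "(LINT x|M. \<bar>f x - poly P x\<bar> powr p) \<le> (e' * (1 + measure M (space M))) powr p"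
      by (simp add: powr_mult)
  qed (use p e' in auto)
  also have "\<dots> < e" using e by (simp add: e'_def add_pos_nonneg field_simps)
  finally show ?thesis by (rule that)
qed

text \<open>Three approximations with error \<open>e / 3\<close> each: truncation of the values at
  height \<open>n\<close>, continuous functions that converge almost everywhere to the truncation,
  and a polynomial.\<close>

lemma poly_dense:
  fixes f :: "real \<Rightarrow> real"
  assumes p: "p \<ge> 1" and f: "f \<in> Lpset M p" and e: "e > 0"
  obtains P :: "real poly" where "Lpn M p (\<lambda>x. f x - poly P x) < e"
proof -
  have [measurable]: "f \<in> borel_measurable M" using f by (rule LpsetD)
  define tr where "tr n x = max (- real n) (min (real n) (f x))" for n x
  have [measurable]: "tr n \<in> borel_measurable M" for n unfolding tr_def by measurable
  have trLp: "tr n \<in> Lpset M p" for n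
    using p by (intro Lpset_bounded[OF finite_measure_M, where B="real n"]) (auto simp: tr_def)
  have "(\<lambda>n. Lpn M p (\<lambda>x. f x - tr n x)) \<longlonglongrightarrow> 0"
  proof (rule Lpn_LIM[where g="\<lambda>x. \<bar>f x\<bar>"])
    show "AE x in M. (\<lambda>n. f x - tr n x) \<longlonglongrightarrow> 0"
    proof (intro AE_I2)
      fix x
      obtain N where "\<bar>f x\<bar> \<le> real N" using real_arch_simple by blast
      then have "\<forall>n\<ge>N. f x - tr n x = 0" by (auto simp: tr_def)
      then show "(\<lambda>n. f x - tr n x) \<longlonglongrightarrow> 0"
        by (intro tendsto_eventually) (auto simp: eventually_sequentially)
    qed
    show "integrable M (\<lambda>x. \<bar>f x\<bar> powr p)" using f by (rule LpsetD)
  qed (use p in \<open>auto simp: tr_def\<close>)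
  then obtain n where n: "Lpn M p (\<lambda>x. f x - tr n x) < e / 3"
    using order_tendstoD(2)[of _ 0 sequentially "e / 3"] e by (auto simp: eventually_sequentially)
  have "tr n measurable_on {-1..1}"
    using \<open>tr n \<in> borel_measurable M\<close> unfolding borel_measurable_M
    by (subst measurable_on_iff_borel_measurable) auto
  then obtain N g where N: "negligible N" and g: "\<And>k. continuous_on UNIV (g k)"
    and lim: "\<And>x. x \<notin> N \<Longrightarrow> (\<lambda>k. g k x) \<longlonglongrightarrow> (if x \<in> {-1..1} then tr n x else 0)"
    unfolding measurable_on_def by blast
  \<comment> \<open>Clipping the continuous functions at the height of the truncation provides a
    dominating constant and leaves the limit unchanged.\<close>
  define h where "h k x = max (- real n) (min (real n) (g k x))" for k x
  have hc: "continuous_on {-1..1} (h k)" for k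
    unfolding h_def using g by (intro continuous_intros) (auto intro: continuous_on_subset)
  have [measurable]: "h k \<in> borel_measurable M" for k by (rule continuous_measurable_M[OF hc])
  have hLp: "h k \<in> Lpset M p" for k using p by (intro continuous_Lp hc) auto
  have "(\<lambda>k. Lpn M p (\<lambda>x. tr n x - h k x)) \<longlonglongrightarrow> 0"
  proof (rule Lpn_LIM[where g="\<lambda>x. 2 * real n"])
    have "AE x in lebesgue. x \<notin> N" using N by (intro AE_not_in) (simp add: negligible_iff_null_sets)
    then have "AE x in lebesgue_on {-1..1}. x \<notin> N" by (subst AE_restrict_space_iff) auto
    moreover have "AE x in lebesgue_on {-1..1}. x \<in> {-1..1}" by (intro AE_I2) (simp add: space_restrict_space)
    ultimately have "AE x in lebesgue_on {-1..1}. (\<lambda>k. tr n x - h k x) \<longlonglongrightarrow> 0"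
    proof eventually_elim
      case (elim x)
      have "(\<lambda>k. h k x) \<longlonglongrightarrow> max (- real n) (min (real n) (tr n x))"
        unfolding h_def using lim[OF elim(1)] elim(2) by (intro tendsto_intros) auto
      also have "max (- real n) (min (real n) (tr n x)) = tr n x" by (simp add: tr_def)
      finally show ?case using tendsto_diff[OF tendsto_const, of "\<lambda>k. h k x" _ _ "tr n x"] by fastforce
    qed
    then show "AE x in M. (\<lambda>k. tr n x - h k x) \<longlonglongrightarrow> 0" by (rule AE_M_I)
    show "\<bar>tr n x - h k x\<bar> \<le> 2 * real n" for k x unfolding tr_def h_def by linarith
  qed (use p in auto)
  then obtain k where k: "Lpn M p (\<lambda>x. tr n x - h k x) < e / 3"
    using order_tendstoD(2)[of _ 0 sequentially "e / 3"] e by (auto simp: eventually_sequentially)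
  obtain P :: "real poly" where P: "Lpn M p (\<lambda>x. h k x - poly P x) < e / 3"
    using poly_approx_continuous[OF hc p, of "e / 3"] e by auto
  have P': "poly P \<in> Lpset M p" using p by (intro poly_Lp) auto
  have "Lpn M p (\<lambda>x. f x - poly P x) < e"
    using Minkowski_triangle[OF p f trLp P', of n] Minkowski_triangle[OF p trLp hLp P', of n k] n k P by simp
  then show ?thesis by (rule that)
qed

lemma poly_dense_seq:
  fixes f :: "real \<Rightarrow> real"
  assumes p: "p \<ge> 1" and f: "f \<in> Lpset M p"
  obtains P :: "nat \<Rightarrow> real poly" where "(\<lambda>n. Lpn M p (\<lambda>x. f x - poly (P n) x)) \<longlonglongrightarrow> 0"
proof -
  have "\<forall>n. \<exists>P :: real poly. Lpn M p (\<lambda>x. f x - poly P x) < 1 / real (Suc n)"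
    using poly_dense[OF p f] by (metis of_nat_0_less_iff zero_less_Suc zero_less_divide_1_iff)
  then obtain P :: "nat \<Rightarrow> real poly" where P: "\<And>n. Lpn M p (\<lambda>x. f x - poly (P n) x) < 1 / real (Suc n)"
    by metis
  have "(\<lambda>n. Lpn M p (\<lambda>x. f x - poly (P n) x)) \<longlonglongrightarrow> 0"
    using P by (intro tendsto_sandwich[OF _ _ tendsto_const LIMSEQ_inverse_real_of_nat])
      (auto simp: Lpn_nonneg inverse_eq_divide less_imp_le)
  then show ?thesis by (rule that)
qed



section \<open>Resolvents of the Jacobi operator\<close>

text \<open>In divergence form this is \<open>- ((1 - x^2) w g')' / w\<close>, the Jacobi
  differential operator with the sign that makes its spectrum nonnegative. It is confined to
  polynomials, where no question of domains arises.\<close>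

definition Lop :: "real poly \<Rightarrow> real poly" where
  "Lop g = - ([:1, 0, -1:] * pderiv (pderiv g) + [:\<beta> - \<alpha>, -(\<alpha> + \<beta> + 2):] * pderiv g)"

text \<open>Integration by parts: the boundary terms carry the factor
  \<open>(1 - x) powr (\<alpha> + 1) * (1 + x) powr (\<beta> + 1)\<close>.\<close>

lemma Lop_parts:
  fixes h h' :: "real \<Rightarrow> real"
  assumes h: "\<And>x. (h has_real_derivative h' x) (at x)" and h': "continuous_on UNIV h'"
  shows "(LINT x|M. poly (Lop g) x * h x) = (LINT x|M. (1 - x\<^sup>2) * poly (pderiv g) x * h' x)"
proof -
  have hc: "continuous_on S h" for S
    using h by (meson DERIV_isCont continuous_at_imp_continuous_on)
  have h'c: "continuous_on S h'" for S using h' by (rule continuous_on_subset) auto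
  let ?k = "\<lambda>x. (1 - x\<^sup>2) * poly (pderiv g) x * h' x - poly (Lop g) x * h x"
  let ?F = "\<lambda>x. (1 - x) powr (\<alpha> + 1) * (1 + x) powr (\<beta> + 1) * (poly (pderiv g) x * h x)"
  have kc: "continuous_on {-1..1} ?k" by (intro continuous_intros hc h'c)
  have "((\<lambda>x. w x * ?k x) has_integral (?F 1 - ?F (-1))) {-1..1}"
  proof (rule fundamental_theorem_of_calculus_interior)
    show "continuous_on {-1..1} ?F"
      using alpha_gt beta_gt by (intro continuous_intros continuous_on_powr' hc) auto
    fix x :: real assume x: "x \<in> {-1<..<1}"
    have "(?F has_real_derivative
       ((- ((\<alpha> + 1) * (1 - x) powr \<alpha>)) * (1 + x) powr (\<beta> + 1) + (1 - x) powr (\<alpha> + 1) * ((\<beta> + 1) * (1 + x) powr \<beta>)) * (poly (pderiv g) x * h x)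
       + (1 - x) powr (\<alpha> + 1) * (1 + x) powr (\<beta> + 1) * (poly (pderiv (pderiv g)) x * h x + poly (pderiv g) x * h' x)) (at x)"
      using x by (auto intro!: derivative_eq_intros h simp: algebra_simps)
    also have "((- ((\<alpha> + 1) * (1 - x) powr \<alpha>)) * (1 + x) powr (\<beta> + 1) + (1 - x) powr (\<alpha> + 1) * ((\<beta> + 1) * (1 + x) powr \<beta>)) * (poly (pderiv g) x * h x)
       + (1 - x) powr (\<alpha> + 1) * (1 + x) powr (\<beta> + 1) * (poly (pderiv (pderiv g)) x * h x + poly (pderiv g) x * h' x)
      = w x * ?k x"
    proof -
      have e: "(1 - x) powr (\<alpha> + 1) = (1 - x) * (1 - x) powr \<alpha>" "(1 + x) powr (\<beta> + 1) = (1 + x) * (1 + x) powr \<beta>"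
        using x by (auto simp: powr_add)
      show ?thesis unfolding e jacobi_weight_def Lop_def
        by (simp add: algebra_simps power2_eq_square)
    qed
    finally show "(?F has_vector_derivative w x * ?k x) (at x)"
      by (simp add: has_real_derivative_iff_has_vector_derivative)
  qed simp
  moreover have "?F 1 = 0" "?F (-1) = 0" by simp_all
  ultimately have hi: "((\<lambda>x. w x * ?k x) has_integral 0) {-1..1}" by simp
  have "integrable M ?k" by (rule continuous_integrable[OF kc])
  then have "integrable (lebesgue_on {-1..1}) (\<lambda>x. w x * ?k x)"
    by (subst (asm) integrable_M) (auto intro: continuous_measurable_M kc)
  then have "((\<lambda>x. w x * ?k x) has_integral (LINT x|lebesgue_on {-1..1}. w x * ?k x)) {-1..1}"
    by (intro has_integral_integral_lebesgue_on) auto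
  with hi have "(LINT x|lebesgue_on {-1..1}. w x * ?k x) = 0" by (rule has_integral_unique[symmetric])
  then have "(LINT x|M. ?k x) = 0"
    by (subst integral_M) (auto intro: continuous_measurable_M kc)
  moreover have "(LINT x|M. ?k x) = (LINT x|M. (1 - x\<^sup>2) * poly (pderiv g) x * h' x) - (LINT x|M. poly (Lop g) x * h x)"
    by (intro Bochner_Integration.integral_diff continuous_integrable continuous_intros hc h'c)
  ultimately show ?thesis by simp
qed

lemma Lop_symmetric: "(LINT x|M. poly (Lop g) x * poly h x) = (LINT x|M. poly g x * poly (Lop h) x)"
proof -
  have "(LINT x|M. poly (Lop g) x * poly h x) = (LINT x|M. (1 - x\<^sup>2) * poly (pderiv g) x * poly (pderiv h) x)"
    by (rule Lop_parts) (auto intro: poly_DERIV continuous_intros)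
  also have "\<dots> = (LINT x|M. (1 - x\<^sup>2) * poly (pderiv h) x * poly (pderiv g) x)"
    by (intro Bochner_Integration.integral_cong) auto
  also have "\<dots> = (LINT x|M. poly (Lop h) x * poly g x)"
    by (rule Lop_parts[symmetric]) (auto intro: poly_DERIV continuous_intros)
  finally show ?thesis by (simp add: mult.commute)
qed

text \<open>With the test function \<phi> composed with \<open>g\<close>, integration by parts
  leaves the integral of \<open>(1 - x^2) \<phi>'(g) (g')^2\<close>. A continuously differentiable
  \<phi> is required because the natural choice \<open>\<bar>y\<bar> powr (p - 2) * y\<close> has no
  derivative at \<open>0\<close> when \<open>p < 2\<close>; a smoothed version of it will be
  inserted.\<close>

lemma Lop_dissipative:
  fixes \<phi> \<phi>' :: "real \<Rightarrow> real"
  assumes "\<And>y. (\<phi> has_real_derivative \<phi>' y) (at y)" "continuous_on UNIV \<phi>'" "\<And>y. \<phi>' y \<ge> 0"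
  shows "(LINT x|M. poly (Lop g) x * \<phi> (poly g x)) \<ge> 0"
proof -
  have "(LINT x|M. poly (Lop g) x * \<phi> (poly g x)) = (LINT x|M. (1 - x\<^sup>2) * poly (pderiv g) x * (\<phi>' (poly g x) * poly (pderiv g) x))"
  proof (rule Lop_parts)
    show "((\<lambda>x. \<phi> (poly g x)) has_real_derivative \<phi>' (poly g x) * poly (pderiv g) x) (at x)" for x
      by (rule DERIV_chain2[OF assms(1) poly_DERIV])
    show "continuous_on UNIV (\<lambda>x. \<phi>' (poly g x) * poly (pderiv g) x)"
      by (intro continuous_intros continuous_on_compose2[OF assms(2)]) auto
  qed
  also have "\<dots> \<ge> 0"
  proof (rule integral_nonneg_AE, intro AE_I2)
    fix x assume "x \<in> space M"
    then have "x\<^sup>2 \<le> 1" by (auto simp: abs_square_le_1)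
    then have "0 \<le> (1 - x\<^sup>2) * (\<phi>' (poly g x) * (poly (pderiv g) x)\<^sup>2)" using assms(3) by simp
    then show "0 \<le> (1 - x\<^sup>2) * poly (pderiv g) x * (\<phi>' (poly g x) * poly (pderiv g) x)"
      by (simp add: power2_eq_square mult_ac)
  qed
  finally show ?thesis .
qed

text \<open>Put \<open>f = g + \<mu> L g\<close>, multiply by a nondecreasing function of
  \<open>g\<close> and integrate: dissipativity removes the term with \<open>L\<close>. For the
  power of order \<open>p - 1\<close> this bounds the integral of
  \<open>\<bar>g\<bar> powr p\<close> by that of
  \<open>\<bar>f\<bar> * \<bar>g\<bar> powr (p - 1)\<close>. Stating the result in terms of
  \<open>g\<close> avoids inverting \<open>1 + \<mu> L\<close>.\<close>

lemma resolvent_contraction: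
  fixes g :: "real poly"
  assumes p: "p \<ge> 1" and mu: "\<mu> \<ge> 0"
  shows "Lpn M p (poly g) \<le> Lpn M p (poly (g + smult \<mu> (Lop g)))"
proof -
  define f where "f = g + smult \<mu> (Lop g)"
  \<comment> \<open>A smooth replacement for \<open>\<bar>y\<bar> powr (p - 2) * y\<close>, which is
    recovered as \<open>e\<close> tends to \<open>0\<close>; the factor
    \<open>(p - 1) * y^2 + e\<close> in its derivative is nonnegative since
    \<open>p \<ge> 1\<close>.\<close>
  define \<phi> where "\<phi> e y = y * (y\<^sup>2 + e) powr ((p - 2) / 2)" for e y :: real
  define \<phi>' where "\<phi>' e y = (y\<^sup>2 + e) powr ((p - 4) / 2) * ((p - 1) * y\<^sup>2 + e)" for e y :: real
  have pos: "y\<^sup>2 + e > 0" if "e > 0" for y e :: real using that by (simp add: add_nonneg_pos)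
  have d: "(\<phi> e has_real_derivative \<phi>' e y) (at y)" if e: "e > 0" for e y
  proof -
    have "(\<phi> e has_real_derivative (y\<^sup>2 + e) powr ((p - 2) / 2) + y * ((p - 2) / 2 * (y\<^sup>2 + e) powr ((p - 2) / 2 - 1) * (2 * y))) (at y)"
      unfolding \<phi>_def using pos[OF e] by (auto intro!: derivative_eq_intros)
    also have "(p - 2) / 2 - 1 = (p - 4) / 2" by (simp add: field_simps)
    also have "(y\<^sup>2 + e) powr ((p - 2) / 2) = (y\<^sup>2 + e) powr ((p - 4) / 2) * (y\<^sup>2 + e)"
    proof -
      have "(y\<^sup>2 + e) powr ((p - 2) / 2) = (y\<^sup>2 + e) powr ((p - 4) / 2 + 1)" by (simp add: field_simps)
      then show ?thesis using pos[OF e, of y] by (simp add: powr_add abs_of_pos)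
    qed
    also have "(y\<^sup>2 + e) powr ((p - 4) / 2) * (y\<^sup>2 + e) + y * ((p - 2) / 2 * (y\<^sup>2 + e) powr ((p - 4) / 2) * (2 * y)) = \<phi>' e y"
      by (simp add: \<phi>'_def field_simps power2_eq_square)
    finally show ?thesis .
  qed
  have \<phi>'nn: "\<phi>' e y \<ge> 0" if "e > 0" for e y
    unfolding \<phi>'_def using p that by (intro mult_nonneg_nonneg add_nonneg_nonneg) auto
  have \<phi>c: "continuous_on UNIV (\<phi> e)" and \<phi>'c: "continuous_on UNIV (\<phi>' e)" if "e > 0" for e
    unfolding \<phi>_def \<phi>'_def using pos[OF that] by (auto intro!: continuous_intros simp: less_imp_neq[symmetric])
  have \<phi>pc: "continuous_on {-1..1} (\<lambda>x. \<phi> e (poly g x))" if "e > 0" for e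
    by (intro continuous_on_compose2[OF \<phi>c[OF that]] continuous_intros) auto
  have step: "(LINT x|M. poly g x * \<phi> e (poly g x)) \<le> (LINT x|M. \<bar>poly f x\<bar> * \<bar>\<phi> e (poly g x)\<bar>)" if e: "e > 0" for e
  proof -
    have "0 \<le> (LINT x|M. poly (Lop g) x * \<phi> e (poly g x))"
      by (rule Lop_dissipative[of "\<phi> e" "\<phi>' e"]) (use d \<phi>'c \<phi>'nn e in auto)
    then have "(LINT x|M. poly g x * \<phi> e (poly g x)) \<le> (LINT x|M. poly g x * \<phi> e (poly g x)) + \<mu> * (LINT x|M. poly (Lop g) x * \<phi> e (poly g x))"
      using mu by simp
    also have "\<dots> = (LINT x|M. poly g x * \<phi> e (poly g x) + \<mu> * (poly (Lop g) x * \<phi> e (poly g x)))"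
      using \<phi>pc[OF e] by (subst Bochner_Integration.integral_add) (auto intro!: continuous_integrable continuous_intros)
    also have "\<dots> = (LINT x|M. poly f x * \<phi> e (poly g x))"
      by (intro Bochner_Integration.integral_cong) (auto simp: f_def algebra_simps)
    also have "\<dots> \<le> (LINT x|M. \<bar>poly f x\<bar> * \<bar>\<phi> e (poly g x)\<bar>)"
      using \<phi>pc[OF e] by (intro integral_mono continuous_integrable continuous_intros) (auto simp: abs_mult[symmetric])
    finally show ?thesis .
  qed
  obtain B where B: "B \<ge> 0" "\<And>x. x \<in> {-1..1} \<Longrightarrow> \<bar>poly g x\<bar> \<le> B" by (rule poly_bounded[of g]) blast
  obtain A where A: "A \<ge> 0" "\<And>x. x \<in> {-1..1} \<Longrightarrow> \<bar>poly f x\<bar> \<le> A" by (rule poly_bounded[of f]) blast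
  \<comment> \<open>A bound uniform in \<open>e \<le> 1\<close>, for dominated convergence. The
    exponent \<open>(p - 2) / 2\<close> may be negative, so the factor \<open>\<bar>y\<bar>\<close>
    is first absorbed to reach the nonnegative exponent \<open>(p - 1) / 2\<close>.\<close>
  have \<phi>b: "\<bar>\<phi> e y\<bar> \<le> (B\<^sup>2 + 1) powr ((p - 1) / 2)" if "e > 0" "e \<le> 1" "\<bar>y\<bar> \<le> B" for e y
  proof -
    have "\<bar>y\<bar> = (y\<^sup>2) powr (1/2)" by (simp add: powr_half_sqrt)
    also have "\<dots> \<le> (y\<^sup>2 + e) powr (1/2)" using that by (intro powr_mono2) auto
    finally have "\<bar>\<phi> e y\<bar> \<le> (y\<^sup>2 + e) powr (1/2) * (y\<^sup>2 + e) powr ((p - 2) / 2)"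
      by (simp add: \<phi>_def abs_mult mult_right_mono)
    also have "\<dots> = (y\<^sup>2 + e) powr ((p - 1) / 2)" by (simp add: powr_add[symmetric] field_simps)
    also have "\<dots> \<le> (B\<^sup>2 + 1) powr ((p - 1) / 2)"
    proof (rule powr_mono2)
      have "y\<^sup>2 \<le> B\<^sup>2" using that(3) by (metis abs_le_square_iff abs_of_nonneg B(1))
      then show "y\<^sup>2 + e \<le> B\<^sup>2 + 1" using that by simp
    qed (use p that in \<open>auto intro: add_nonneg_nonneg\<close>)
    finally show ?thesis .
  qed
  define ee where "ee n = inverse (real (Suc n))" for n
  have ee12: "ee n > 0" "ee n \<le> 1" for n by (auto simp: ee_def inverse_le_1_iff)
  have ee3: "ee \<longlonglongrightarrow> 0" unfolding ee_def by (rule LIMSEQ_inverse_real_of_nat)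
  note ee = ee12 ee3
  have y_lim: "(\<lambda>n. y * \<phi> (ee n) y) \<longlonglongrightarrow> \<bar>y\<bar> powr p" for y
  proof (cases "y = 0")
    case False
    have "(\<lambda>n. y * (y * (y\<^sup>2 + ee n) powr ((p - 2) / 2))) \<longlonglongrightarrow> y * (y * (y\<^sup>2 + 0) powr ((p - 2) / 2))"
      using False ee by (intro tendsto_intros) auto
    also have "y * (y * (y\<^sup>2 + 0) powr ((p - 2) / 2)) = \<bar>y\<bar> powr p"
    proof -
      have "y\<^sup>2 = \<bar>y\<bar> powr 2" using False by (simp add: powr_numeral)
      then have "y * (y * (y\<^sup>2 + 0) powr ((p - 2) / 2)) = \<bar>y\<bar> powr 2 * (\<bar>y\<bar> powr 2) powr ((p - 2) / 2)"
        by (simp add: power2_eq_square[symmetric] mult.assoc[symmetric])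
      also have "\<dots> = \<bar>y\<bar> powr (2 + 2 * ((p - 2) / 2))" by (simp only: powr_powr powr_add)
      also have "2 + 2 * ((p - 2) / 2) = p" by (simp add: field_simps)
      finally show ?thesis .
    qed
    finally show ?thesis by (simp add: \<phi>_def)
  qed (simp add: \<phi>_def)
  have a_lim: "(\<lambda>n. \<bar>poly f x\<bar> * \<bar>\<phi> (ee n) (poly g x)\<bar>) \<longlonglongrightarrow> \<bar>poly f x\<bar> * (if poly g x = 0 then 0 else \<bar>poly g x\<bar> powr (p - 1))" for x
  proof (cases "poly g x = 0")
    case False
    have "(\<lambda>n. \<bar>poly g x * \<phi> (ee n) (poly g x)\<bar> / \<bar>poly g x\<bar>) \<longlonglongrightarrow> \<bar>\<bar>poly g x\<bar> powr p\<bar> / \<bar>poly g x\<bar>"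
      using False by (intro tendsto_intros y_lim) auto
    also have "(\<lambda>n. \<bar>poly g x * \<phi> (ee n) (poly g x)\<bar> / \<bar>poly g x\<bar>) = (\<lambda>n. \<bar>\<phi> (ee n) (poly g x)\<bar>)"
      using False by (simp add: abs_mult)
    also have "\<bar>\<bar>poly g x\<bar> powr p\<bar> / \<bar>poly g x\<bar> = \<bar>poly g x\<bar> powr (p - 1)"
      using False by (simp add: powr_diff)
    finally show ?thesis using False by (auto intro!: tendsto_intros)
  qed (simp add: \<phi>_def)
  have L1: "(\<lambda>n. LINT x|M. poly g x * \<phi> (ee n) (poly g x)) \<longlonglongrightarrow> (LINT x|M. \<bar>poly g x\<bar> powr p)"
  proof (rule integral_dominated_convergence[where w="\<lambda>x. B * (B\<^sup>2 + 1) powr ((p - 1) / 2)"])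
    show "(\<lambda>x. poly g x * \<phi> (ee i) (poly g x)) \<in> borel_measurable M" for i
      using \<phi>pc[OF ee(1)] by (intro continuous_measurable_M continuous_intros)
    show "AE x in M. norm (poly g x * \<phi> (ee n) (poly g x)) \<le> B * (B\<^sup>2 + 1) powr ((p - 1) / 2)" for n
      using B \<phi>b[OF ee(1,2)] by (intro AE_I2) (auto simp: abs_mult intro!: mult_mono)
  qed (auto simp: y_lim)
  define gg where "gg x = (if poly g x = 0 then 0 else \<bar>poly g x\<bar> powr (p - 1))" for x
  have ggm: "gg \<in> borel_measurable M" unfolding gg_def by measurable
  have L2: "(\<lambda>n. LINT x|M. \<bar>poly f x\<bar> * \<bar>\<phi> (ee n) (poly g x)\<bar>) \<longlonglongrightarrow> (LINT x|M. \<bar>poly f x\<bar> * gg x)"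
  proof (rule integral_dominated_convergence[where w="\<lambda>x. A * (B\<^sup>2 + 1) powr ((p - 1) / 2)"])
    show "(\<lambda>x. \<bar>poly f x\<bar> * \<bar>\<phi> (ee i) (poly g x)\<bar>) \<in> borel_measurable M" for i
      using \<phi>pc[OF ee(1)] by (intro continuous_measurable_M continuous_intros)
    show "AE x in M. norm (\<bar>poly f x\<bar> * \<bar>\<phi> (ee n) (poly g x)\<bar>) \<le> A * (B\<^sup>2 + 1) powr ((p - 1) / 2)" for n
      using A B \<phi>b[OF ee(1,2)] by (intro AE_I2) (auto simp: abs_mult intro!: mult_mono)
  qed (use ggm a_lim in \<open>auto simp: gg_def\<close>)
  have main: "(LINT x|M. \<bar>poly g x\<bar> powr p) \<le> (LINT x|M. \<bar>poly f x\<bar> * gg x)"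
    by (rule LIMSEQ_le[OF L1 L2]) (use step ee in auto)
  \<comment> \<open>For \<open>p = 1\<close> the conjugate exponent is infinite; there
    \<open>gg\<close> takes only the values \<open>0\<close> and \<open>1\<close>. For
    \<open>p > 1\<close> the function \<open>gg\<close> is the absolute value of
    \<open>conj_fun p (poly g)\<close> and duality applies.\<close>
  show ?thesis
  proof (cases "p = 1")
    case True
    have "(LINT x|M. \<bar>poly f x\<bar> * gg x) \<le> (LINT x|M. \<bar>poly f x\<bar>)"
    proof (rule integral_mono)
      show "integrable M (\<lambda>x. \<bar>poly f x\<bar> * gg x)"
        using A ggm True by (intro bounded_integrable[where B=A]) (auto simp: abs_mult gg_def)
    qed (use True in \<open>auto simp: gg_def intro: poly_integrable\<close>)
    then show ?thesis using main True by (simp add: Lpn_one f_def)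
  next
    case False
    then have p1: "p > 1" using p by simp
    have pp: "1 / p + 1 / (p / (p - 1)) = 1" using p1 by (simp add: field_simps)
    have gLp: "poly g \<in> Lpset M p" using p by (intro poly_Lp) auto
    note cf = conj_fun[OF p1 pp gLp]
    have "(LINT x|M. \<bar>poly f x\<bar> * gg x) = (LINT x|M. \<bar>poly f x * conj_fun p (poly g) x\<bar>)"
      by (intro Bochner_Integration.integral_cong) (auto simp: abs_mult cf(4) gg_def)
    also have "\<dots> \<le> Lpn M p (poly f) * Lpn M (p / (p - 1)) (conj_fun p (poly g))"
      using p by (intro Hoelder[OF p1 pp] cf poly_Lp) auto
    finally show ?thesis
      unfolding f_def[symmetric] using main cf(3) by (intro Lpn_le_dual[OF p1]) (auto simp: Lpn_nonneg)
  qed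
qed

end

section \<open>Multipliers on polynomials\<close>

text \<open>Subtracting the multiple of \<open>\<psi> (Suc n)\<close> that cancels the coefficient
  of order \<open>Suc n\<close> lowers the degree.\<close>

lemma poly_degree_step:
  fixes \<psi> :: "nat \<Rightarrow> 'a::field poly"
  assumes deg: "\<And>k. degree (\<psi> k) = k" and nz: "\<And>k. \<psi> k \<noteq> 0"
  shows "degree f \<le> n \<Longrightarrow> \<exists>c. f = (\<Sum>k\<le>n. smult (c k) (\<psi> k))"
proof (induction n arbitrary: f)
  case 0
  obtain a where a: "f = [:a:]" using 0 by (auto elim: degree_eq_zeroE)
  obtain b where b: "\<psi> 0 = [:b:]" using deg[of 0] by (auto elim: degree_eq_zeroE)
  have "b \<noteq> 0" using nz[of 0] b by auto
  then have "f = smult (a / b) (\<psi> 0)" using a b by simp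
  then show ?case by (intro exI[of _ "\<lambda>_. a / b"]) simp
next
  case (Suc n)
  define c where "c = coeff f (Suc n) / coeff (\<psi> (Suc n)) (Suc n)"
  have "coeff (\<psi> (Suc n)) (Suc n) \<noteq> 0" using nz[of "Suc n"] deg[of "Suc n"] by (metis leading_coeff_0_iff)
  then have "coeff (f - smult c (\<psi> (Suc n))) (Suc n) = 0" by (simp add: c_def)
  moreover have "degree (f - smult c (\<psi> (Suc n))) \<le> Suc n"
    using Suc.prems deg[of "Suc n"] by (intro degree_diff_le) (auto intro: order_trans[OF degree_smult_le])
  ultimately have "degree (f - smult c (\<psi> (Suc n))) \<le> n"
    by (metis coeff_0 degree_0 le_SucE leading_coeff_0_iff zero_le)
  from Suc.IH[OF this] obtain d where d: "f - smult c (\<psi> (Suc n)) = (\<Sum>k\<le>n. smult (d k) (\<psi> k))" by blast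
  show ?case
    by (rule exI[of _ "d(Suc n := c)"]) (use d in \<open>simp add: algebra_simps\<close>)
qed

lemma poly_fun_simps:
  "poly (f + g) = (\<lambda>x. poly f x + poly g x)" "poly (f - g) = (\<lambda>x. poly f x - poly g x)"
  "poly (smult c f) = (\<lambda>x. c * poly f x)" for f g :: "'a::comm_ring_1 poly"
  by auto

locale jacobi = jacobi_weights +
  fixes \<psi> :: "nat \<Rightarrow> real poly"
  assumes orth: "orthonormal_jacobi_polys \<alpha> \<beta> \<psi>"
begin

abbreviation co :: "(real \<Rightarrow> real) \<Rightarrow> nat \<Rightarrow> real" where "co \<equiv> jacobi_coeff \<alpha> \<beta> \<psi>"

text \<open>The eigenvalue of \<open>Lop\<close>, the square of \<open>jacobi_lambda\<close>. A
  derivative of order \<open>s\<close> therefore carries the exponent \<open>s / 2\<close> on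
  \<open>lam2\<close>.\<close>

definition lam2 :: "nat \<Rightarrow> real" where "lam2 k = real k * (real k + \<alpha> + \<beta> + 1)"

lemma lam2_0 [simp]: "lam2 0 = 0" by (simp add: lam2_def)

text \<open>From \<alpha> \<ge> -1/2 and \<beta> > -1 one gets
  \<open>\<alpha> + \<beta> + 1 > -1/2\<close>, which takes away at most half of \<open>k\<close>
  when \<open>k \<ge> 1\<close>. The eigenvalues thus grow quadratically and stay away from
  \<open>0\<close> for \<open>k \<ge> 1\<close>.\<close>

lemma lam2_lower: "(real k)\<^sup>2 / 2 \<le> lam2 k"
proof (cases k)
  case (Suc n)
  have "real k / 2 \<le> real k + \<alpha> + \<beta> + 1" using beta_gt alpha_ge Suc by simp
  then have "real k * (real k / 2) \<le> lam2 k" unfolding lam2_def by (intro mult_left_mono) auto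
  then show ?thesis by (simp add: power2_eq_square)
qed simp

lemma lam2_nonneg [simp]: "0 \<le> lam2 k"
  using lam2_lower[of k] by (smt (verit) divide_nonneg_nonneg zero_le_power2)

lemma lam2_pos: "k \<ge> 1 \<Longrightarrow> 1 / 2 \<le> lam2 k"
proof -
  assume "k \<ge> 1"
  then have "1 \<le> (real k)\<^sup>2" by (intro one_le_power) simp
  then show ?thesis using lam2_lower[of k] by simp
qed

lemma degree_psi [simp]: "degree (\<psi> k) = k"
  using orth by (simp add: orthonormal_jacobi_polys_def)

lemma psi_orth: "(LINT x|M. poly (\<psi> j) x * poly (\<psi> k) x) = (if j = k then 1 else 0)"
  using orth by (auto simp: orthonormal_jacobi_polys_def power2_eq_square)

lemma psi_nz: "\<psi> k \<noteq> 0"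
  using psi_orth[of k k] by auto

lemma integrable_mult_poly:
  assumes f: "integrable M f" shows "integrable M (\<lambda>x. f x * poly P x)"
proof -
  obtain B where B: "B \<ge> 0" "\<And>x. x \<in> {-1..1} \<Longrightarrow> \<bar>poly P x\<bar> \<le> B" by (rule poly_bounded[of P]) blast
  have [measurable]: "f \<in> borel_measurable M" using f by auto
  show ?thesis
  proof (rule Bochner_Integration.integrable_bound)
    show "integrable M (\<lambda>x. B * f x)" using f by simp
    show "AE x in M. norm (f x * poly P x) \<le> norm (B * f x)"
      using B by (intro AE_I2) (auto simp: abs_mult mult.commute[of B] intro!: mult_left_mono)
  qed measurable
qed

lemma co_def: "co f k = (LINT x|M. f x * poly (\<psi> k) x)"
  by (simp add: jacobi_coeff_def)

lemma co_add: "integrable M f \<Longrightarrow> integrable M g \<Longrightarrow> co (\<lambda>x. f x + g x) k = co f k + co g k"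
  by (simp add: co_def distrib_right integrable_mult_poly)

lemma co_diff: "integrable M f \<Longrightarrow> integrable M g \<Longrightarrow> co (\<lambda>x. f x - g x) k = co f k - co g k"
  by (simp add: co_def left_diff_distrib integrable_mult_poly)

lemma co_cmult: "co (\<lambda>x. c * f x) k = c * co f k"
  by (simp add: co_def mult.assoc)

lemma co_zero: "co (\<lambda>x. 0) k = 0"
  by (simp add: co_def)

lemma co_poly_zero [simp]: "co (poly 0) k = 0"
  by (simp add: co_def)

lemma co_cong: "(\<And>x. x \<in> {-1..1} \<Longrightarrow> f x = g x) \<Longrightarrow> co f k = co g k"
  unfolding co_def by (intro Bochner_Integration.integral_cong) auto

lemma co_sum: "finite I \<Longrightarrow> (\<And>i. i \<in> I \<Longrightarrow> integrable M (f i)) \<Longrightarrow> co (\<lambda>x. \<Sum>i\<in>I. f i x) k = (\<Sum>i\<in>I. co (f i) k)"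
  by (induction I rule: finite_induct) (auto simp: co_zero co_add)

lemma co_sum_psi: "finite I \<Longrightarrow> co (poly (\<Sum>i\<in>I. smult (c i) (\<psi> i))) k = (if k \<in> I then c k else 0)"
proof -
  assume I: "finite I"
  have "co (poly (\<Sum>i\<in>I. smult (c i) (\<psi> i))) k = co (\<lambda>x. \<Sum>i\<in>I. c i * poly (\<psi> i) x) k"
    by (rule arg_cong[where f="\<lambda>h. co h k"], rule ext) (simp add: poly_sum)
  also have "\<dots> = (\<Sum>i\<in>I. co (\<lambda>x. c i * poly (\<psi> i) x) k)"
    by (rule co_sum[OF I]) (auto intro: poly_integrable)
  also have "\<dots> = (\<Sum>i\<in>I. if i = k then c i else 0)"
    by (intro sum.cong) (simp_all only: co_cmult, simp_all add: co_def psi_orth)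
  also have "\<dots> = (if k \<in> I then c k else 0)" using I by simp
  finally show ?thesis .
qed

lemma expansion:
  assumes "degree f \<le> n" shows "f = (\<Sum>k\<le>n. smult (co (poly f) k) (\<psi> k))"
proof -
  obtain c where c: "f = (\<Sum>k\<le>n. smult (c k) (\<psi> k))"
    using poly_degree_step[of \<psi> f n] psi_nz assms by auto
  have "co (poly f) k = c k" if "k \<le> n" for k
    using that by (subst c, subst co_sum_psi) auto
  then have "(\<Sum>k\<le>n. smult (co (poly f) k) (\<psi> k)) = (\<Sum>k\<le>n. smult (c k) (\<psi> k))"
    by (intro sum.cong) auto
  with c show ?thesis by simp
qed

lemma co_high: "degree f < k \<Longrightarrow> co (poly f) k = 0"
  by (subst expansion[OF order_refl], subst co_sum_psi) auto

lemma poly_eqI_co: assumes "\<And>k. co (poly f) k = co (poly g) k" shows "f = g"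
proof -
  define n where "n = max (degree f) (degree g)"
  have "f = (\<Sum>k\<le>n. smult (co (poly f) k) (\<psi> k))" by (rule expansion) (simp add: n_def)
  also have "\<dots> = (\<Sum>k\<le>n. smult (co (poly g) k) (\<psi> k))" by (simp add: assms)
  also have "\<dots> = g" by (rule expansion[symmetric]) (simp add: n_def)
  finally show ?thesis .
qed

lemma coeff_Lop: "coeff (Lop g) n = real n * (real n + \<alpha> + \<beta> + 1) * coeff g n
   - real ((n + 2) * (n + 1)) * coeff g (n + 2) - (\<beta> - \<alpha>) * real (n + 1) * coeff g (n + 1)"
proof (cases n)
  case 0 then show ?thesis by (simp add: Lop_def coeff_pderiv numeral_2_eq_2)
next
  case (Suc m) then show ?thesis
    by (cases m) (simp_all add: Lop_def coeff_pderiv numeral_2_eq_2 algebra_simps)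
qed

lemma degree_Lop: "degree (Lop g) \<le> degree g"
  by (rule degree_le) (auto simp: coeff_Lop coeff_eq_0)

text \<open>The difference \<open>R\<close> of the two sides has degree below \<open>k\<close>,
  because the coefficients of order \<open>k\<close> cancel, and it is orthogonal to every
  \<open>\<psi> j\<close> with \<open>j < k\<close>, because \<open>Lop\<close> is symmetric and
  does not raise degrees. So all its Fourier-Jacobi coefficients vanish.\<close>

lemma Lop_psi: "Lop (\<psi> k) = smult (lam2 k) (\<psi> k)"
proof -
  define R where "R = Lop (\<psi> k) - smult (lam2 k) (\<psi> k)"
  have dR: "coeff R j = 0" if "j \<ge> k" for j
    using that by (cases "j = k") (auto simp: R_def coeff_Lop coeff_eq_0 lam2_def)
  have "co (poly R) j = 0" for j
  proof (cases "j < k")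
    case True
    have ort: "(LINT x|M. poly (\<psi> k) x * poly P x) = 0" if "degree P < k" for P
      using co_high[OF that] by (simp add: co_def mult.commute)
    have "co (poly R) j = (LINT x|M. poly (Lop (\<psi> k)) x * poly (\<psi> j) x) - lam2 k * (LINT x|M. poly (\<psi> k) x * poly (\<psi> j) x)"
      using co_diff[OF poly_integrable[of "Lop (\<psi> k)"] poly_integrable[of "smult (lam2 k) (\<psi> k)"], of j]
      by (simp add: R_def co_def mult.assoc)
    also have "\<dots> = (LINT x|M. poly (\<psi> k) x * poly (Lop (\<psi> j)) x) - 0"
      using ort[of "\<psi> j"] True by (simp add: Lop_symmetric)
    also have "\<dots> = 0" using ort[of "Lop (\<psi> j)"] degree_Lop[of "\<psi> j"] True by simp
    finally show ?thesis .
  next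
    case False
    have "R = 0 \<or> degree R < k" using dR by (metis leading_coeff_0_iff not_le)
    then show ?thesis using False co_high[of R j] by auto
  qed
  then have "R = 0" by (intro poly_eqI_co) simp
  then show ?thesis by (simp add: R_def)
qed

lemma co_Lop: "co (poly (Lop g)) k = lam2 k * co (poly g) k"
  unfolding co_def by (subst Lop_symmetric) (simp add: Lop_psi mult.left_commute[of _ "lam2 k"])

text \<open>A Fourier-Jacobi multiplier. Coefficients beyond the degree of \<open>f\<close> vanish,
  so the finite sum is the full expansion and no convergence is involved.\<close>

definition T :: "(nat \<Rightarrow> real) \<Rightarrow> real poly \<Rightarrow> real poly" where
  "T m f = (\<Sum>k\<le>degree f. smult (m k * co (poly f) k) (\<psi> k))"

lemma co_T [simp]: "co (poly (T m f)) k = m k * co (poly f) k"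
  unfolding T_def by (subst co_sum_psi) (auto simp: co_high)

lemma co_poly_add: "co (poly (f + g)) k = co (poly f) k + co (poly g) k"
  using co_add[OF poly_integrable poly_integrable, of f g] by (simp add: poly_fun_simps)

lemma co_poly_diff: "co (poly (f - g)) k = co (poly f) k - co (poly g) k"
  using co_diff[OF poly_integrable poly_integrable, of f g] by (simp add: poly_fun_simps)

lemma co_poly_smult: "co (poly (smult c f)) k = c * co (poly f) k"
  using co_cmult[of c "poly f"] by (simp add: poly_fun_simps)

lemmas co_poly_simps = co_poly_add co_poly_diff co_poly_smult

lemma T_mult: "T m (T m' f) = T (\<lambda>k. m k * m' k) f"
  by (rule poly_eqI_co) simp

lemma T_add: "T (\<lambda>k. m k + m' k) f = T m f + T m' f"
  by (rule poly_eqI_co) (simp add: co_poly_simps algebra_simps)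

lemma T_cmult: "T (\<lambda>k. c * m k) f = smult c (T m f)"
  by (rule poly_eqI_co) (simp add: co_poly_simps)

lemma T_const: "T (\<lambda>k. c) f = smult c f"
  by (rule poly_eqI_co) (simp add: co_poly_simps)

text \<open>The pairing is linear in finitely many values of the symbol. This lets an integral over
  a parameter of the symbol pass through the operator without vector-valued integration.\<close>

lemma integral_T:
  assumes h: "integrable M h"
  shows "(LINT x|M. poly (T m f) x * h x) = (\<Sum>k\<le>degree f. m k * co (poly f) k * co h k)"
proof -
  have "(LINT x|M. poly (T m f) x * h x) = (LINT x|M. (\<Sum>k\<le>degree f. m k * co (poly f) k * (h x * poly (\<psi> k) x)))"
    by (intro Bochner_Integration.integral_cong) (auto simp: T_def poly_sum sum_distrib_left sum_distrib_right mult_ac)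
  also have "\<dots> = (\<Sum>k\<le>degree f. m k * co (poly f) k * co h k)"
    by (subst Bochner_Integration.integral_sum) (auto simp: co_def intro!: integrable_mult_poly h)
  finally show ?thesis .
qed

section \<open>Multiplier norms and symbols bounded uniformly under dilation\<close>

definition mult :: "real \<Rightarrow> (nat \<Rightarrow> real) \<Rightarrow> real \<Rightarrow> bool" where
  "mult p m C \<longleftrightarrow> (\<forall>f. Lpn M p (poly (T m f)) \<le> C * Lpn M p (poly f))"

lemma multD: "mult p m C \<Longrightarrow> Lpn M p (poly (T m f)) \<le> C * Lpn M p (poly f)"
  by (simp add: mult_def)

text \<open>The polynomial \<open>g\<close> with this symbol solves
  \<open>g + \<mu> L g = f\<close>, so the contraction property applies to it. The scale-independent
  bounds for later symbols are built from this family.\<close>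

lemma mult_resolvent:
  assumes "p \<ge> 1" "\<mu> \<ge> 0" shows "mult p (\<lambda>k. 1 / (1 + \<mu> * lam2 k)) 1"
  unfolding mult_def
proof
  fix f
  define g where "g = T (\<lambda>k. 1 / (1 + \<mu> * lam2 k)) f"
  have "1 + \<mu> * lam2 k \<noteq> 0" for k using assms by (smt (verit) lam2_nonneg mult_nonneg_nonneg)
  then have *: "1 / (1 + \<mu> * lam2 k) * c + \<mu> * (lam2 k * (1 / (1 + \<mu> * lam2 k) * c)) = c" for k c
  proof -
    have "1 / (1 + \<mu> * lam2 k) * c + \<mu> * (lam2 k * (1 / (1 + \<mu> * lam2 k) * c)) = (1 + \<mu> * lam2 k) * (1 / (1 + \<mu> * lam2 k) * c)"
      by (simp only: distrib_right mult_1_left mult.assoc)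
    then show ?thesis using \<open>1 + \<mu> * lam2 k \<noteq> 0\<close> by simp
  qed
  have "g + smult \<mu> (Lop g) = f"
    by (rule poly_eqI_co) (simp only: g_def co_poly_simps co_Lop co_T *)
  then show "Lpn M p (poly (T (\<lambda>k. 1 / (1 + \<mu> * lam2 k)) f)) \<le> 1 * Lpn M p (poly f)"
    using resolvent_contraction[OF assms, of g] by (simp add: g_def)
qed

lemma mult_add:
  assumes "p \<ge> 1" "mult p m C" "mult p m' C'" shows "mult p (\<lambda>k. m k + m' k) (C + C')"
  unfolding mult_def
proof
  fix f
  have "Lpn M p (poly (T (\<lambda>k. m k + m' k) f)) \<le> Lpn M p (poly (T m f)) + Lpn M p (poly (T m' f))"
    using Minkowski(2)[OF assms(1) poly_Lp poly_Lp, of "T m f" "T m' f"] assms(1) by (simp add: T_add poly_fun_simps)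
  also have "\<dots> \<le> (C + C') * Lpn M p (poly f)"
    using multD[OF assms(2), of f] multD[OF assms(3), of f] by (simp add: distrib_right)
  finally show "Lpn M p (poly (T (\<lambda>k. m k + m' k) f)) \<le> (C + C') * Lpn M p (poly f)" .
qed

lemma mult_cmult:
  assumes "p > 0" "mult p m C" shows "mult p (\<lambda>k. c * m k) (\<bar>c\<bar> * C)"
  unfolding mult_def using multD[OF assms(2)] assms(1)
  by (auto simp: T_cmult Lpn_cmult poly_fun_simps mult.assoc intro!: mult_left_mono)

lemma mult_mult:
  assumes "mult p m C" "mult p m' C'" "C \<ge> 0" shows "mult p (\<lambda>k. m k * m' k) (C * C')"
  unfolding mult_def
proof
  fix f
  have "Lpn M p (poly (T m (T m' f))) \<le> C * Lpn M p (poly (T m' f))" by (rule multD[OF assms(1)])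
  also have "\<dots> \<le> C * (C' * Lpn M p (poly f))" by (intro mult_left_mono multD[OF assms(2)] assms)
  finally show "Lpn M p (poly (T (\<lambda>k. m k * m' k) f)) \<le> C * C' * Lpn M p (poly f)"
    by (simp add: T_mult mult.assoc)
qed

lemma mult_const: "p > 0 \<Longrightarrow> mult p (\<lambda>k. c) \<bar>c\<bar>"
  by (simp add: mult_def T_const Lpn_cmult poly_fun_simps)

text \<open>Quantifying over all \<open>\<mu> > 0\<close> makes the class invariant under dilation;
  it is also closed under sums and products. With \<open>\<mu> = t^2\<close> its members give
  operator bounds independent of the scale \<open>t\<close>.\<close>

definition bsym :: "real \<Rightarrow> (real \<Rightarrow> real) \<Rightarrow> bool" where
  "bsym p s \<longleftrightarrow> (\<exists>C\<ge>0. \<forall>\<mu>>0. mult p (\<lambda>k. s (\<mu> * lam2 k)) C)"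

lemma bsymI: "C \<ge> 0 \<Longrightarrow> (\<And>\<mu>. \<mu> > 0 \<Longrightarrow> mult p (\<lambda>k. s (\<mu> * lam2 k)) C) \<Longrightarrow> bsym p s"
  by (auto simp: bsym_def)

lemma bsymE: assumes "bsym p s" obtains C where "C \<ge> 0" "\<And>\<mu>. \<mu> > 0 \<Longrightarrow> mult p (\<lambda>k. s (\<mu> * lam2 k)) C"
  using assms by (auto simp: bsym_def)

lemma bsym_const: "p > 0 \<Longrightarrow> bsym p (\<lambda>x. c)"
  by (rule bsymI[of "\<bar>c\<bar>"]) (auto intro: mult_const)

lemma bsym_y: "p \<ge> 1 \<Longrightarrow> bsym p (\<lambda>x. 1 / (1 + x))"
  by (rule bsymI[of 1]) (auto intro: mult_resolvent)

lemma bsym_add: "p \<ge> 1 \<Longrightarrow> bsym p s \<Longrightarrow> bsym p s' \<Longrightarrow> bsym p (\<lambda>x. s x + s' x)"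
  by (elim bsymE, rule bsymI[rotated], rule mult_add) auto

lemma bsym_mult: "bsym p s \<Longrightarrow> bsym p s' \<Longrightarrow> bsym p (\<lambda>x. s x * s' x)"
  by (elim bsymE, rule bsymI[rotated], rule mult_mult) auto

lemma bsym_diff: "p \<ge> 1 \<Longrightarrow> bsym p s \<Longrightarrow> bsym p s' \<Longrightarrow> bsym p (\<lambda>x. s x - s' x)"
  using bsym_add[of p s "\<lambda>x. (-1) * s' x"] bsym_mult[OF bsym_const[of p "-1"], of s'] by simp

lemma bsym_power: "p \<ge> 1 \<Longrightarrow> bsym p s \<Longrightarrow> bsym p (\<lambda>x. s x ^ n)"
  by (induction n) (auto intro: bsym_const bsym_mult)

lemma bsym_sum:
  assumes "p \<ge> 1" "finite I" "\<And>i. i \<in> I \<Longrightarrow> bsym p (s i)" shows "bsym p (\<lambda>x. \<Sum>i\<in>I. s i x)"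
  using assms(2,3) by (induction I rule: finite_induct) (use assms(1) in \<open>auto intro: bsym_const bsym_add\<close>)

lemma bsym_scale: assumes "c > 0" "bsym p s" shows "bsym p (\<lambda>x. s (c * x))"
proof -
  obtain C where C: "C \<ge> 0" "\<And>\<mu>. \<mu> > 0 \<Longrightarrow> mult p (\<lambda>k. s (\<mu> * lam2 k)) C" using assms by (auto elim: bsymE)
  show ?thesis by (rule bsymI[OF C(1)]) (use C(2)[of "c * _"] assms(1) in \<open>auto simp: mult.assoc\<close>)
qed

lemma bsym_cong: "(\<And>x. x \<ge> 0 \<Longrightarrow> s x = s' x) \<Longrightarrow> bsym p s \<Longrightarrow> bsym p s'"
  by (auto simp: bsym_def)

end

section \<open>Fractional powers\<close>

lemma integrable_powr_split:
  fixes b :: real assumes b: "0 < b" "b < 1"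
  shows "integrable lborel (\<lambda>w::real. indicator {0..1} w * w powr (b - 1) + indicator {1..} w * w powr (b - 2))"
proof (intro Bochner_Integration.integrable_add)
  have "(\<lambda>w::real. w powr (b - 1)) absolutely_integrable_on {0..1}"
    using integrable_on_powr_from_0[of "b - 1" 1] b by (intro nonnegative_absolutely_integrable_1) auto
  then have "integrable lebesgue (\<lambda>w::real. indicator {0..1} w * w powr (b - 1))"
    by (simp add: set_integrable_def)
  then show "integrable lborel (\<lambda>w::real. indicator {0..1} w * w powr (b - 1))"
    by (subst (asm) integrable_completion) auto
  have "(\<lambda>w::real. w powr (b - 2)) integrable_on {1..}"
    using has_integral_powr_to_inf[of "b - 2" 1] b by (auto simp: integrable_on_def)
  then have "(\<lambda>w::real. w powr (b - 2)) absolutely_integrable_on {1..}"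
    by (intro nonnegative_absolutely_integrable_1) auto
  then have "integrable lebesgue (\<lambda>w::real. indicator {1..} w * w powr (b - 2))"
    by (simp add: set_integrable_def)
  then show "integrable lborel (\<lambda>w::real. indicator {1..} w * w powr (b - 2))"
    by (subst (asm) integrable_completion) auto
qed

text \<open>The integrand \<open>w powr (b - 1) * x / (x + w)\<close> of Balakrishnan's formula for
  \<open>x powr b\<close>, times \<open>1 / (1 + x)\<close>. The extra factor supplies a bound by
  \<open>1 / w\<close>, without which the integral over large \<open>w\<close> would not converge
  uniformly in \<open>x\<close>.\<close>

definition pw_kernel :: "real \<Rightarrow> real \<Rightarrow> real \<Rightarrow> real" where
  "pw_kernel b x w = indicator {0<..} w * (w powr (b - 1) * (x / (x + w) * (1 / (1 + x))))"

text \<open>An integrable majorant of \<open>w powr (b - 1) * min 1 (1 / w)\<close>. This is the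
  size of the kernel as a function and, up to a factor 2, as a multiplier.\<close>

definition pw_major :: "real \<Rightarrow> real \<Rightarrow> real" where
  "pw_major b w = indicator {0..1} w * w powr (b - 1) + indicator {1..} w * w powr (b - 2)"

lemma pw_major_ge:
  assumes "w > 0" shows "w powr (b - 1) * min 1 (1 / w) \<le> pw_major b w"
proof -
  have "w powr (b - 2) = w powr (b - 1) * (1 / w)"
    using assms powr_diff[of w "b - 1" 1] by simp
  then show ?thesis using assms by (auto simp: pw_major_def indicator_def min_def)
qed

lemma pw_kernel_integrable:
  assumes b: "0 < b" "b < 1" and x: "x \<ge> 0"
  shows "integrable lborel (pw_kernel b x)"
proof (rule Bochner_Integration.integrable_bound)
  show "integrable lborel (pw_major b)" unfolding pw_major_def by (rule integrable_powr_split[OF b])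
  show "AE w in lborel. norm (pw_kernel b x w) \<le> norm (pw_major b w)"
  proof (intro AE_I2)
    fix w :: real
    show "norm (pw_kernel b x w) \<le> norm (pw_major b w)"
    proof (cases "w > 0")
      case True
      have 1: "x / (x + w) \<le> 1" "1 / (1 + x) \<le> 1" using x True by auto
      have "x / (x + w) * (1 / (1 + x)) \<le> 1 * 1" using x True 1 by (intro mult_mono) auto
      moreover have "x / (x + w) * (1 / (1 + x)) \<le> 1 / w"
      proof -
        have "x / (1 + x) \<le> 1" "1 / (x + w) \<le> 1 / w" using x True by (auto simp: frac_le)
        then have "(x / (1 + x)) * (1 / (x + w)) \<le> 1 * (1 / w)" using x True by (intro mult_mono) auto
        then show ?thesis by (simp add: mult.commute)
      qed
      ultimately have "x / (x + w) * (1 / (1 + x)) \<le> min 1 (1 / w)" by simp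
      then have "w powr (b - 1) * (x / (x + w) * (1 / (1 + x))) \<le> w powr (b - 1) * min 1 (1 / w)"
        by (rule mult_left_mono) simp
      then have "pw_kernel b x w \<le> w powr (b - 1) * min 1 (1 / w)"
        using True unfolding pw_kernel_def by simp
      moreover have "0 \<le> pw_kernel b x w" using x True by (simp add: pw_kernel_def)
      ultimately show ?thesis using pw_major_ge[OF True, of b] by simp
    qed (simp add: pw_kernel_def)
  qed
qed (simp add: pw_kernel_def[abs_def])

text \<open>A beta integral, equal to \<open>pi / sin (pi * b)\<close> for
  \<open>0 < b < 1\<close>.\<close>

definition pw_const :: "real \<Rightarrow> real" where
  "pw_const b = (LINT w|lborel. indicator {0<..} w * (w powr (b - 1) * (1 / (1 + w))))"

text \<open>The substitution of \<open>x * w\<close> for \<open>w\<close> extracts the power of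
  \<open>x\<close>; at \<open>x = 0\<close> both sides vanish, the right one by the value of
  \<open>0 powr b\<close>.\<close>

lemma pw_kernel_integral:
  assumes b: "0 < b" "b < 1" and x: "x \<ge> 0"
  shows "(LINT w|lborel. pw_kernel b x w) = pw_const b * (x powr b / (1 + x))"
proof (cases "x = 0")
  case False
  then have x0: "x > 0" using x by simp
  have "(LINT w|lborel. pw_kernel b x w) = \<bar>x\<bar> *\<^sub>R (LINT w|lborel. pw_kernel b x (0 + x * w))"
    using x0 by (intro lborel_integral_real_affine) auto
  also have "\<dots> = x * (LINT w|lborel. x powr (b - 1) / (1 + x) * (indicator {0<..} w * (w powr (b - 1) * (1 / (1 + w)))))"
  proof -
    have "pw_kernel b x (0 + x * w) = x powr (b - 1) / (1 + x) * (indicator {0<..} w * (w powr (b - 1) * (1 / (1 + w))))" for w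
    proof (cases "w > 0")
      case True
      have "x / (x + x * w) = 1 / (1 + w)"
        using x0 True by (metis distrib_left mult.right_neutral mult_divide_mult_cancel_left less_numeral_extra(3))
      then show ?thesis using True x0 by (simp add: pw_kernel_def powr_mult indicator_def)
    qed (use x0 in \<open>auto simp: pw_kernel_def indicator_def zero_less_mult_iff\<close>)
    then show ?thesis using x0 by simp
  qed
  also have "\<dots> = (x * x powr (b - 1)) / (1 + x) * pw_const b"
    by (simp only: integral_mult_right_zero pw_const_def) simp
  also have "x * x powr (b - 1) = x powr b" using x0 powr_mult_base[of x "b - 1"] by simp
  finally show ?thesis by (simp add: mult.commute)
qed (use b in \<open>simp add: pw_kernel_def\<close>)

lemma pw_const_pos:
  assumes b: "0 < b" "b < 1" shows "pw_const b > 0"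
proof -
  have "integrable lborel (\<lambda>w. 2 * pw_kernel b 1 w)"
    by (intro integrable_mult_right pw_kernel_integrable[OF b]) simp
  moreover have "2 * pw_kernel b 1 w = (2 * (1 / (1 + 1))) * (indicator {0<..} w * (w powr (b - 1) * (1 / (1 + w))))" for w
    by (simp only: pw_kernel_def mult_ac)
  ultimately have i: "integrable lborel (\<lambda>w::real. indicator {0<..} w * (w powr (b - 1) * (1 / (1 + w))))" by simp
  \<comment> \<open>On \<open>[1, 2]\<close> the integrand is at least
    \<open>1/2 * 1/3\<close>.\<close>
  have q: "(LINT w|lborel. indicator {1..2::real} w * (1/6::real)) = 1 / 6"
    by (simp add: content_real)
  have "(LINT w|lborel. indicator {1..2::real} w * (1/6::real)) \<le> pw_const b" unfolding pw_const_def
  proof (rule integral_mono[OF _ i])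
    fix w :: real
    show "indicator {1..2} w * (1/6) \<le> indicator {0<..} w * (w powr (b - 1) * (1 / (1 + w)))"
    proof (cases "1 \<le> w \<and> w \<le> 2")
      case True
      have "w powr (-1) \<le> w powr (b - 1)" using True b by (intro powr_mono) auto
      moreover have "w powr (-1) = 1 / w" using True by (simp add: powr_minus divide_inverse)
      moreover have "1 / 2 \<le> 1 / w" "1 / 3 \<le> 1 / (1 + w)" using True by (auto intro!: divide_left_mono)
      ultimately have "(1/2) * (1/3) \<le> w powr (b - 1) * (1 / (1 + w))" by (intro mult_mono) auto
      then show ?thesis using True by simp
    qed (auto simp: indicator_def)
  qed (intro integrable_mult_left integrable_real_indicator, auto)
  then show ?thesis unfolding q by linarith
qed

context jacobi
begin

text \<open>For \<open>b < 1\<close> the symbol is an average over \<open>w\<close> of products of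
  two resolvent symbols, and the multiplier norms of these products are integrable in
  \<open>w\<close>. Testing with the dual function \<open>H\<close> turns the average of operators
  into a scalar integral of a finite sum, to which Hoelder is applied for each
  \<open>w\<close>.\<close>

lemma bsym_powr:
  assumes p: "1 < p" and b: "0 < b" "b \<le> 1"
  shows "bsym p (\<lambda>x. x powr b / (1 + x))"
proof (cases "b = 1")
  case True
  have "bsym p (\<lambda>x. 1 - 1 / (1 + x))" using p by (intro bsym_diff bsym_const bsym_y) auto
  then show ?thesis by (rule bsym_cong[rotated]) (auto simp: True field_simps)
next
  case False
  then have b1: "b < 1" using b by simp
  define I where "I = (LINT w|lborel. pw_major b w)"
  have imaj: "integrable lborel (pw_major b)" unfolding pw_major_def by (rule integrable_powr_split[OF b(1) b1])
  have maj0: "pw_major b w \<ge> 0" for w by (simp add: pw_major_def)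
  then have I0: "I \<ge> 0" by (simp add: I_def)
  have c0: "pw_const b > 0" by (rule pw_const_pos[OF b(1) b1])
  define p' where "p' = p / (p - 1)"
  have pp: "1 / p + 1 / p' = 1" using p by (simp add: p'_def field_simps)
  show ?thesis
  proof (rule bsymI[of "2 * I / pw_const b"])
    show "0 \<le> 2 * I / pw_const b" using I0 c0 by simp
    fix \<mu> :: real assume mu: "\<mu> > 0"
    define X where "X k = \<mu> * lam2 k" for k
    have X0: "X k \<ge> 0" for k using mu by (simp add: X_def)
    define r where "r w k = X k / (X k + w) * (1 / (1 + X k))" for w k
    \<comment> \<open>Two factorizations of the same symbol, each a product of a resolvent and of
      \<open>1\<close> minus another resolvent. The roles of the parameters \<open>1\<close> and
      \<open>1 / w\<close> are exchanged: one gives norm 2, the other carries the additional factor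
      \<open>1 / w\<close>.\<close>
    have rm: "mult p (r w) (2 * min 1 (1 / w))" if w: "w > 0" for w
    proof -
      have y: "mult p (\<lambda>k. 1 / (1 + X k)) 1" and yw: "mult p (\<lambda>k. 1 / (1 + X k / w)) 1"
        using mult_resolvent[of p \<mu>] mult_resolvent[of p "\<mu> / w"] p mu w by (auto simp: X_def)
      have one: "mult p (\<lambda>k. 1) 1" using mult_const[of p 1] p by simp
      have d: "mult p (\<lambda>k. 1 + (-1) * s k) 2" if "mult p s 1" for s
        using mult_add[OF _ one mult_cmult[OF _ that, of "-1"]] p by simp
      have nz: "1 + X k \<noteq> 0" "X k + w \<noteq> 0" "1 + X k / w \<noteq> 0" for k
        using X0[of k] w by (smt (verit) divide_nonneg_pos)+
      have r1: "r w k = (1 + (-1) * (1 / (1 + X k / w))) * (1 / (1 + X k))" for k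
      proof -
        have "1 + (-1) * (1 / (1 + X k / w)) = X k / (X k + w)" using w nz[of k] by (simp add: field_simps)
        then show ?thesis by (simp add: r_def)
      qed
      have r2: "r w k = (1 / w) * ((1 + (-1) * (1 / (1 + X k))) * (1 / (1 + X k / w)))" for k
      proof -
        have "1 + (-1) * (1 / (1 + X k)) = X k / (1 + X k)" using nz[of k] by (simp add: field_simps)
        moreover have "1 / (1 + X k / w) = w / (X k + w)" using w nz[of k] by (simp add: field_simps)
        ultimately show ?thesis using w by (simp add: r_def)
      qed
      have "mult p (r w) (2 * 1)"
        using mult_mult[OF d[OF yw] y] by (simp add: r1[abs_def])
      moreover have "mult p (r w) (\<bar>1 / w\<bar> * (2 * 1))"
        unfolding r2[abs_def] using p by (intro mult_cmult mult_mult d y yw) auto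
      ultimately show ?thesis using w by (auto simp: min_def)
    qed
    show "mult p (\<lambda>k. (\<mu> * lam2 k) powr b / (1 + \<mu> * lam2 k)) (2 * I / pw_const b)"
      unfolding mult_def
    proof
      fix f
      define m where "m k = X k powr b / (1 + X k)" for k
      define G where "G = poly (T m f)"
      define H where "H = conj_fun p G"
      have G: "G \<in> Lpset M p" using p by (auto simp: G_def intro: poly_Lp)
      note cf = conj_fun[OF p pp G, folded H_def]
      have p'1: "1 \<le> p'" using p by (simp add: p'_def field_simps)
      have Hi: "integrable M H" using Lpset_imp_L1(1)[OF finite_measure_M p'1 cf(1)] .
      define D where "D = degree f"
      have "pw_const b * (LINT x|M. \<bar>G x\<bar> powr p) = pw_const b * (LINT x|M. G x * H x)"
        by (simp add: cf(2))
      also have "\<dots> = (\<Sum>k\<le>D. (pw_const b * m k) * (co (poly f) k * co H k))"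
        unfolding G_def by (subst integral_T[OF Hi]) (simp add: D_def sum_distrib_left mult_ac)
      also have "\<dots> = (\<Sum>k\<le>D. (LINT w|lborel. pw_kernel b (X k) w) * (co (poly f) k * co H k))"
        by (simp add: pw_kernel_integral[OF b(1) b1 X0] m_def)
      also have "\<dots> = (LINT w|lborel. (\<Sum>k\<le>D. pw_kernel b (X k) w * (co (poly f) k * co H k)))"
        using pw_kernel_integrable[OF b(1) b1 X0] by (subst Bochner_Integration.integral_sum) auto
      also have "\<dots> \<le> (LINT w|lborel. pw_major b w * (2 * Lpn M p (poly f) * Lpn M p' H))"
      proof (rule integral_mono)
        show "integrable lborel (\<lambda>w. \<Sum>k\<le>D. pw_kernel b (X k) w * (co (poly f) k * co H k))"
          using pw_kernel_integrable[OF b(1) b1 X0] by auto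
        show "integrable lborel (\<lambda>w. pw_major b w * (2 * Lpn M p (poly f) * Lpn M p' H))"
          using imaj by simp
        fix w :: real
        show "(\<Sum>k\<le>D. pw_kernel b (X k) w * (co (poly f) k * co H k)) \<le> pw_major b w * (2 * Lpn M p (poly f) * Lpn M p' H)"
        proof (cases "w > 0")
          case True
          have "(\<Sum>k\<le>D. pw_kernel b (X k) w * (co (poly f) k * co H k)) = w powr (b - 1) * (\<Sum>k\<le>D. r w k * co (poly f) k * co H k)"
            using True by (simp add: pw_kernel_def r_def sum_distrib_left mult_ac)
          also have "\<dots> = w powr (b - 1) * (LINT x|M. poly (T (r w) f) x * H x)"
            by (subst integral_T[OF Hi]) (simp add: D_def)
          also have "\<dots> \<le> w powr (b - 1) * (LINT x|M. \<bar>poly (T (r w) f) x * H x\<bar>)"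
            by (intro mult_left_mono) (auto intro: order_trans[OF abs_ge_self integral_abs_bound])
          also have "\<dots> \<le> w powr (b - 1) * (Lpn M p (poly (T (r w) f)) * Lpn M p' H)"
            using p by (intro mult_left_mono Hoelder(2)[OF p pp] poly_Lp cf) auto
          also have "\<dots> \<le> w powr (b - 1) * ((2 * min 1 (1 / w)) * Lpn M p (poly f) * Lpn M p' H)"
            by (intro mult_left_mono mult_right_mono multD[OF rm[OF True]]) (auto simp: Lpn_nonneg)
          also have "\<dots> = (w powr (b - 1) * min 1 (1 / w)) * (2 * Lpn M p (poly f) * Lpn M p' H)"
            by (simp add: mult_ac)
          also have "\<dots> \<le> pw_major b w * (2 * Lpn M p (poly f) * Lpn M p' H)"
            by (intro mult_right_mono pw_major_ge True) (auto simp: Lpn_nonneg)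
          finally show ?thesis .
        qed (auto simp: pw_kernel_def maj0 Lpn_nonneg)
      qed
      also have "\<dots> = 2 * I * Lpn M p (poly f) * Lpn M p G powr (p - 1)"
        by (simp add: I_def cf(3))
      finally have "(LINT x|M. \<bar>G x\<bar> powr p) \<le> (2 * I / pw_const b * Lpn M p (poly f)) * Lpn M p G powr (p - 1)"
        using c0 by (simp add: field_simps)
      then have "Lpn M p G \<le> 2 * I / pw_const b * Lpn M p (poly f)"
        using I0 c0 by (intro Lpn_le_dual[OF p]) (auto simp: Lpn_nonneg)
      then show "Lpn M p (poly (T (\<lambda>k. (\<mu> * lam2 k) powr b / (1 + \<mu> * lam2 k)) f)) \<le> 2 * I / pw_const b * Lpn M p (poly f)"
        by (simp add: G_def m_def[abs_def] X_def)
    qed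
  qed
qed

text \<open>With \<open>y = 1 / (1 + x)\<close> one has \<open>1 - y = x y\<close>, so every power of \<open>x\<close> is paid for by a factor
  \<open>1 - y\<close> or \<open>y\<close> and only a fractional power in \<open>(0, 1]\<close> remains.\<close>

lemma bsym_powr_pos:
  assumes p: "1 < p" and a: "0 < a" "a \<le> real m"
  shows "bsym p (\<lambda>x. x powr a * (1 / (1 + x)) ^ m)"
proof -
  \<comment> \<open>The largest integer strictly below \<open>a\<close>, so that the remaining
    exponent \<open>b\<close> lies in \<open>(0, 1]\<close>; the value \<open>0\<close> is not
    covered by \<open>bsym_powr\<close>.\<close>
  define n where "n = nat (\<lceil>a\<rceil> - 1)"
  define b where "b = a - real n"
  have n: "real n = real_of_int \<lceil>a\<rceil> - 1" using a by (simp add: n_def)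
  have b: "0 < b" "b \<le> 1" using n unfolding b_def by linarith+
  have "\<lceil>a\<rceil> \<le> int m" using a by (simp add: ceiling_le_iff)
  then have nm: "n + 1 \<le> m" using a by (simp add: n_def) 
  have "bsym p (\<lambda>x. (1 - 1 / (1 + x)) ^ n * ((x powr b / (1 + x)) * (1 / (1 + x)) ^ (m - n - 1)))"
    using p b by (intro bsym_mult bsym_power bsym_diff bsym_const bsym_y bsym_powr) auto
  then show ?thesis
  proof (rule bsym_cong[rotated])
    fix x :: real assume x: "x \<ge> 0"
    define y where "y = 1 / (1 + x)"
    have "1 - y = x * y" using x by (simp add: y_def field_simps)
    have xy: "x powr b / (1 + x) = x powr b * y" by (simp add: y_def)
    have "(1 - y) ^ n * ((x powr b / (1 + x)) * y ^ (m - n - 1)) = (x ^ n * x powr b) * y ^ (n + 1 + (m - n - 1))"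
      by (simp only: \<open>1 - y = x * y\<close> xy power_mult_distrib power_add power_one_right mult_ac)
    also have "n + 1 + (m - n - 1) = m" using nm by simp
    also have "x ^ n * x powr b = x powr a"
      using x b a by (cases "x = 0") (auto simp: powr_realpow[symmetric] powr_add[symmetric] b_def)
    finally show "(1 - 1 / (1 + x)) ^ n * ((x powr b / (1 + x)) * (1 / (1 + x)) ^ (m - n - 1)) = x powr a * (1 / (1 + x)) ^ m"
      by (simp add: y_def)
  qed
qed

text \<open>With \<open>y = 1 / (1 + x)\<close> and \<open>n\<close> the integer part of
  \<open>a\<close>, the \<open>n + 1\<close> factors \<open>1 - y = x y\<close> turn
  \<open>x powr (- a)\<close> into \<open>x powr (n + 1 - a)\<close>, whose exponent lies in
  \<open>(0, 1]\<close>, times powers of \<open>y\<close>. Strictness of \<open>a < m\<close>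
  ensures that \<open>n + 1\<close> such factors are present.\<close>

lemma bsym_powr_neg:
  assumes p: "1 < p" and a: "0 \<le> a" "a < real m"
  shows "bsym p (\<lambda>x. x powr (- a) * (1 - 1 / (1 + x)) ^ m)"
proof -
  define n where "n = nat \<lfloor>a\<rfloor>"
  define b where "b = 1 + real n - a"
  have n: "real n = real_of_int \<lfloor>a\<rfloor>" using a by (simp add: n_def)
  have b: "0 < b" "b \<le> 1" using n unfolding b_def by linarith+
  have nm: "n + 1 \<le> m" using a n by linarith
  have "bsym p (\<lambda>x. (1 / (1 + x)) ^ n * ((x powr b / (1 + x)) * (1 - 1 / (1 + x)) ^ (m - n - 1)))"
    using p b by (intro bsym_mult bsym_power bsym_diff bsym_const bsym_y bsym_powr) auto
  then show ?thesis
  proof (rule bsym_cong[rotated])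
    fix x :: real assume x: "x \<ge> 0"
    define y where "y = 1 / (1 + x)"
    have y: "1 - y = x * y" using x by (simp add: y_def field_simps)
    have "(1 - y) ^ m = (1 - y) ^ (n + 1) * (1 - y) ^ (m - n - 1)" using nm by (subst power_add[symmetric]) simp
    moreover have "x powr (- a) * (1 - y) ^ (n + 1) = y ^ n * (x powr b / (1 + x))"
    proof (cases "x = 0")
      case False
      have "x powr (- a) * x ^ (n + 1) = x powr b"
        using x False by (simp only: powr_realpow[symmetric] powr_add[symmetric] b_def) (simp add: powr_add[symmetric] powr_realpow[symmetric] algebra_simps)
      then have "x powr (- a) * (1 - y) ^ (n + 1) = x powr b * y ^ (n + 1)"
        by (simp only: y power_mult_distrib mult.assoc[symmetric])
      then show ?thesis by (simp add: y_def)
    qed (use b in \<open>simp add: y\<close>)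
    ultimately have "x powr (- a) * (1 - y) ^ m = y ^ n * (x powr b / (1 + x)) * (1 - y) ^ (m - n - 1)"
      by (simp only: mult.assoc[symmetric])
    then show "(1 / (1 + x)) ^ n * ((x powr b / (1 + x)) * (1 - 1 / (1 + x)) ^ (m - n - 1)) = x powr (- a) * (1 - 1 / (1 + x)) ^ m"
      by (simp add: y_def mult.assoc)
  qed
qed

end

section \<open>Bernstein and Nikolskii inequalities\<close>

text \<open>The reversed polynomial, \<open>z^d Q(1/z)\<close>, has the same modulus as
  \<open>Q\<close> at conjugate points of the unit circle up to inversion, so the maximum principle
  bounds it in the disc; inversion carries the bound to the exterior.\<close>

lemma poly_growth:
  fixes Q :: "complex poly"
  assumes d: "degree Q \<le> d" and B: "\<And>z. cmod z = 1 \<Longrightarrow> cmod (poly Q z) \<le> B" and z: "1 \<le> cmod z"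
  shows "cmod (poly Q z) \<le> B * cmod z ^ d"
proof -
  define R where "R = (\<Sum>i\<le>d. monom (coeff Q i) (d - i))"
  have Q: "poly Q u = (\<Sum>i\<le>d. coeff Q i * u ^ i)" for u
    using d by (subst poly_altdef, intro sum.mono_neutral_left) (auto simp: coeff_eq_0 not_le)
  have R: "poly Q u = u ^ d * poly R (1 / u)" if "u \<noteq> 0" for u
    unfolding Q R_def poly_sum poly_monom sum_distrib_left
    by (intro sum.cong) (use that in \<open>auto simp: power_divide power_diff field_simps\<close>)
  have "cmod (poly R (1 / z)) \<le> B"
  proof (rule maximum_modulus_frontier[of "poly R" "cball 0 1"])
    fix u :: complex assume "u \<in> frontier (cball 0 1)"
    then have u: "cmod u = 1" by (simp add: frontier_cball)
    then have "cmod (poly Q (1 / u)) \<le> B" by (intro B) (simp add: norm_divide)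
    moreover have "poly Q (1 / u) = (1 / u) ^ d * poly R u"
    proof -
      have "u \<noteq> 0" using u by auto
      then show ?thesis using R[of "1 / u"] by simp
    qed
    ultimately show "cmod (poly R u) \<le> B" using u by (simp add: norm_mult norm_divide norm_power)
  qed (use z in \<open>auto intro!: holomorphic_intros continuous_intros simp: norm_divide divide_le_eq_1\<close>)
  then have "cmod z ^ d * cmod (poly R (1 / z)) \<le> cmod z ^ d * B" by (intro mult_left_mono) auto
  moreover have "z \<noteq> 0" using z by auto
  ultimately show ?thesis by (simp add: R norm_mult norm_power mult.commute)
qed

text \<open>Cauchy's estimate on a circle of radius \<open>1 / d\<close> about \<open>z\<close>. On
  it \<open>\<bar>u\<bar>^d\<close> is at most \<open>(1 + 1/d)^d \<le> exp 1 \<le> 3\<close>, which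
  is the constant.\<close>

lemma bernstein_complex:
  fixes Q :: "complex poly"
  assumes d: "degree Q \<le> d" "d \<ge> 1" and B: "\<And>z. cmod z = 1 \<Longrightarrow> cmod (poly Q z) \<le> B" and z: "cmod z = 1"
  shows "cmod (poly (pderiv Q) z) \<le> 3 * real d * B"
proof -
  have B0: "B \<ge> 0" using B[OF z] norm_ge_zero order_trans by blast
  have inside: "cmod (poly Q u) \<le> B" if "cmod u \<le> 1" for u
    by (rule maximum_modulus_frontier[of "poly Q" "cball 0 1"])
       (use that B in \<open>auto intro!: holomorphic_intros continuous_intros simp: frontier_cball\<close>)
  have e: "(1 + 1 / real d) ^ d \<le> 3"
  proof -
    have "(1 + 1 / real d) ^ d \<le> exp 1" using exp_ge_one_plus_x_over_n_power_n[of d 1] d by simp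
    also have "\<dots> \<le> 3" by (rule exp_le)
    finally show ?thesis .
  qed
  have "cmod ((deriv ^^ 1) (poly Q) z) \<le> fact 1 * (3 * B) / (1 / real d) ^ 1"
  proof (rule Cauchy_inequality)
    fix u assume u: "cmod (z - u) = 1 / real d"
    show "cmod (poly Q u) \<le> 3 * B"
    proof (cases "cmod u \<le> 1")
      case True then show ?thesis using inside[of u] B0 by simp
    next
      case False
      have "cmod u \<le> 1 + 1 / real d" using u z norm_triangle_ineq4[of z "z - u"] by simp
      then have "cmod u ^ d \<le> (1 + 1 / real d) ^ d" by (intro power_mono) auto
      then have "cmod u ^ d \<le> 3" using e by linarith
      then have "B * cmod u ^ d \<le> B * 3" using B0 by (intro mult_left_mono)
      then show ?thesis using poly_growth[OF d(1) B, of u] False by linarith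
    qed
  qed (use d in \<open>auto intro!: holomorphic_intros continuous_intros\<close>)
  moreover have "deriv (poly Q) z = poly (pderiv Q) z" by (intro DERIV_imp_deriv poly_DERIV)
  ultimately show ?thesis by (simp add: mult_ac)
qed

text \<open>\<open>P (cos t)\<close> is a trigonometric polynomial of degree \<open>n\<close>.
  Multiplied by \<open>exp (i n t)\<close> it becomes an algebraic polynomial \<open>Q\<close> of
  degree at most \<open>2 n\<close> in \<open>exp (i t)\<close>, with the same bound on the unit
  circle.\<close>

lemma bernstein_cos_lipschitz:
  fixes P :: "real poly"
  assumes n: "degree P \<le> n" "n \<ge> 1" and B: "\<And>x. x \<in> {-1..1} \<Longrightarrow> \<bar>poly P x\<bar> \<le> B"
  shows "\<bar>poly P (cos s) - poly P (cos t)\<bar> \<le> 7 * real n * B * \<bar>s - t\<bar>"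
proof -
  \<comment> \<open>This is \<open>z^n P((z + 1/z) / 2)\<close>, with the powers of \<open>z\<close>
    distributed so that no negative ones remain.\<close>
  define Q :: "complex poly" where
    "Q = (\<Sum>i\<le>n. smult (of_real (coeff P i)) (monom 1 (n - i) * [:1/2, 0, 1/2:] ^ i))"
  have dQ: "degree Q \<le> 2 * n"
    unfolding Q_def
  proof (intro degree_sum_le)
    fix i assume i: "i \<in> {..n}"
    have "degree ([:1/2, 0, 1/2:] ^ i :: complex poly) \<le> 2 * i"
      using degree_power_le[of "[:1/2, 0, 1/2:] :: complex poly" i] by (simp add: numeral_2_eq_2)
    then have "degree (monom 1 (n - i) * [:1/2, 0, 1/2:] ^ i :: complex poly) \<le> (n - i) + 2 * i"
      by (intro order_trans[OF degree_mult_le] add_mono) (auto simp: degree_monom_le)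
    then show "degree (smult (of_real (coeff P i)) (monom 1 (n - i) * [:1/2, 0, 1/2:] ^ i :: complex poly)) \<le> 2 * n"
      using i by (intro order_trans[OF degree_smult_le]) auto
  qed simp
  have Qcis: "poly Q (cis t) = cis (real n * t) * of_real (poly P (cos t))" for t
  proof -
    have c: "poly [:1/2, 0, 1/2:] (cis t) = cis t * of_real (cos t)"
    proof -
      have "cis t * (cis t + cis (- t)) = cis t * of_real (2 * cos t)" by (simp add: complex_eq_iff)
      then have "cis t ^ 2 + 1 = 2 * (cis t * of_real (cos t))"
        by (simp add: distrib_left cis_mult power2_eq_square)
      then show ?thesis by (simp add: power2_eq_square field_simps)
    qed
    have P: "poly P u = (\<Sum>i\<le>n. coeff P i * u ^ i)" for u
      using n by (subst poly_altdef, intro sum.mono_neutral_left) (auto simp: coeff_eq_0 not_le)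
    have "poly Q (cis t) = (\<Sum>i\<le>n. of_real (coeff P i) * (cis t ^ (n - i) * (cis t ^ i * of_real (cos t) ^ i)))"
      unfolding Q_def poly_sum poly_smult poly_mult poly_power poly_monom c by (simp add: power_mult_distrib)
    also have "\<dots> = (\<Sum>i\<le>n. cis t ^ n * (of_real (coeff P i) * of_real (cos t) ^ i))"
    proof (intro sum.cong refl)
      fix i assume "i \<in> {..n}"
      then have "cis t ^ (n - i) * cis t ^ i = cis t ^ n" by (simp add: power_add[symmetric])
      then show "of_real (coeff P i) * (cis t ^ (n - i) * (cis t ^ i * of_real (cos t) ^ i)) = cis t ^ n * (of_real (coeff P i) * of_real (cos t) ^ i)"
        by (metis (no_types, opaque_lifting) mult.assoc mult.left_commute)
    qed
    also have "\<dots> = cis (real n * t) * of_real (poly P (cos t))"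
      by (simp add: P sum_distrib_left Complex.DeMoivre)
    finally show ?thesis .
  qed
  have QB: "cmod (poly Q z) \<le> B" if "cmod z = 1" for z
  proof -
    have "z \<noteq> 0" using that by auto
    then have "cis (Arg z) = z" using that cis_Arg[of z] by (simp add: sgn_eq)
    then obtain t where t: "z = cis t" by metis
    show ?thesis unfolding t Qcis by (auto simp: norm_mult intro!: B)
  qed
  define H where "H u = exp (- (\<i> * of_nat n * u)) * poly Q (exp (\<i> * u))" for u
  have Hr: "H (of_real t) = of_real (poly P (cos t))" for t
  proof -
    have "exp (\<i> * of_real t) = cis t" by (simp add: cis_conv_exp)
    moreover have "exp (- (\<i> * of_nat n * of_real t)) = cis (- (real n * t))" by (simp add: cis_conv_exp mult_ac)
    ultimately show ?thesis by (simp add: H_def Qcis mult.assoc[symmetric] cis_mult)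
  qed
  define H' where "H' u = - (\<i> * of_nat n) * exp (- (\<i> * of_nat n * u)) * poly Q (exp (\<i> * u))
     + exp (- (\<i> * of_nat n * u)) * (poly (pderiv Q) (exp (\<i> * u)) * (exp (\<i> * u) * \<i>))" for u
  have HD: "(H has_field_derivative H' u) (at u within S)" for u S
    unfolding H_def H'_def by (auto intro!: derivative_eq_intros poly_DERIV[THEN DERIV_chain2] simp: algebra_simps)
  have "cmod (H (of_real s) - H (of_real t)) \<le> (7 * real n * B) * cmod (of_real s - of_real t)"
  proof (rule field_differentiable_bound[of "closed_segment (of_real s) (of_real t)" H H'])
    fix u :: complex assume "u \<in> closed_segment (of_real s) (of_real t)"
    then obtain v where u: "u = of_real v" by (auto simp: closed_segment_of_real)
    have m1: "cmod (exp (\<i> * u)) = 1" "cmod (exp (- (\<i> * of_nat n * u))) = 1" by (auto simp: u)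
    have "cmod (H' u) \<le> real n * cmod (poly Q (exp (\<i> * u))) + cmod (poly (pderiv Q) (exp (\<i> * u)))"
      unfolding H'_def by (rule order_trans[OF norm_triangle_ineq]) (simp add: norm_mult m1 u)
    \<comment> \<open>The first term comes from differentiating the exponential factor, the second
      from Bernstein for the degree \<open>2 n\<close>; together \<open>1 + 6 = 7\<close>.\<close>
    also have "\<dots> \<le> real n * B + 3 * real (2 * n) * B"
      using n by (intro add_mono mult_left_mono QB bernstein_complex[OF dQ _ QB] m1) auto
    finally show "cmod (H' u) \<le> 7 * real n * B" by (simp add: mult_ac)
  qed (auto intro: HD)
  then show ?thesis unfolding Hr of_real_diff[symmetric] norm_of_real by simp
qed

lemma two_power_powr: "(2 ^ k) powr a = (2 powr a) ^ k" for a :: real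
proof -
  have "(2 ^ k) powr a = (2 powr real k) powr a" by (simp add: powr_realpow)
  also have "\<dots> = (2 powr a) powr real k" by (simp add: powr_powr mult.commute)
  also have "\<dots> = (2 powr a) ^ k" by (simp add: powr_realpow)
  finally show ?thesis .
qed

lemma sum_atMost_split:
  fixes g :: "nat \<Rightarrow> 'a::comm_monoid_add"
  assumes "a \<le> b" shows "sum g {..b} = sum g {..a} + sum g {a<..b}"
proof -
  have "{..b} = {..a} \<union> {a<..b}" using assms by auto
  then show ?thesis by (simp add: sum.union_disjoint ivl_disj_int)
qed

lemma sin_ge_half: 
  assumes "0 \<le> x" "x \<le> 1" shows "x / 2 \<le> sin (x::real)"
proof -
  have "sin 0 - 0 / 2 \<le> sin x - x / 2"
  proof (rule DERIV_nonneg_imp_nondecreasing[OF assms(1)])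
    fix t assume t: "0 \<le> t" "t \<le> x"
    have "\<bar>sin (t/2)\<bar> \<le> \<bar>t/2\<bar>" by (rule abs_sin_x_le_abs_x)
    then have "(sin (t/2))\<^sup>2 \<le> (1/2)\<^sup>2" using t assms by (subst abs_le_square_iff[symmetric]) auto
    then have "1 / 2 \<le> cos t" using cos_double_sin[of "t/2"] by (simp add: power2_eq_square)
    then show "\<exists>y. ((\<lambda>x. sin x - x / 2) has_real_derivative y) (at t) \<and> 0 \<le> y"
      by (intro exI[of _ "cos t - 1 / 2"]) (auto intro!: derivative_eq_intros)
  qed
  then show ?thesis by simp
qed

section \<open>Nikolskii inequality for the Jacobi weight\<close>

context jacobi_weights
begin

text \<open>The weight is \<open>(1 - x^2) powr (\<alpha> + 1/2)\<close> times
  \<open>(1 + x) powr (\<beta> - \<alpha>)\<close> times \<open>1 / sqrt (1 - x^2)\<close>. By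
  \<alpha> \<ge> -1/2 the first factor increases with \<open>1 - x^2\<close>; by \<beta> \<le>
  \<alpha> the second is smallest at \<open>x = 1\<close>. The third is kept because it integrates
  to arc length.\<close>

lemma w_lower:
  assumes "-1 < x" "x < 1" "0 < e" "e\<^sup>2 \<le> 1 - x\<^sup>2"
  shows "2 powr (\<beta> - \<alpha>) * e powr (2 * \<alpha> + 1) * inverse (sqrt (1 - x\<^sup>2)) \<le> w x"
proof -
  have f: "1 - x\<^sup>2 = (1 - x) * (1 + x)" by (simp add: power2_eq_square algebra_simps)
  have pos: "1 - x > 0" "1 + x > 0" "1 - x\<^sup>2 > 0" using assms f by auto
  have "w x = (1 - x) powr \<alpha> * ((1 + x) powr \<alpha> * (1 + x) powr (\<beta> - \<alpha>))"
    using pos by (simp add: jacobi_weight_def powr_add[symmetric])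
  also have "\<dots> = (1 - x\<^sup>2) powr (\<alpha> + 1/2 + (-1/2)) * (1 + x) powr (\<beta> - \<alpha>)"
    using pos by (simp add: f powr_mult)
  also have "\<dots> = (1 - x\<^sup>2) powr (\<alpha> + 1/2) * (1 - x\<^sup>2) powr (-1/2) * (1 + x) powr (\<beta> - \<alpha>)"
    by (simp only: powr_add)
  also have "(1 - x\<^sup>2) powr (-1/2) = inverse (sqrt (1 - x\<^sup>2))"
    using pos by (simp add: powr_minus powr_half_sqrt)
  finally have w: "w x = (1 - x\<^sup>2) powr (\<alpha> + 1/2) * inverse (sqrt (1 - x\<^sup>2)) * (1 + x) powr (\<beta> - \<alpha>)" .
  have "e powr (2 * \<alpha> + 1) = (e\<^sup>2) powr (\<alpha> + 1/2)"
  proof -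
    have "e\<^sup>2 = e powr 2" using assms by (simp add: powr_numeral)
    then show ?thesis by (simp add: powr_powr algebra_simps)
  qed
  also have "\<dots> \<le> (1 - x\<^sup>2) powr (\<alpha> + 1/2)" using assms alpha_ge by (intro powr_mono2) auto
  finally have a: "e powr (2 * \<alpha> + 1) \<le> (1 - x\<^sup>2) powr (\<alpha> + 1/2)" .
  have b: "2 powr (\<beta> - \<alpha>) \<le> (1 + x) powr (\<beta> - \<alpha>)" using assms beta_le by (intro powr_mono2') auto
  have "e powr (2 * \<alpha> + 1) * inverse (sqrt (1 - x\<^sup>2)) * 2 powr (\<beta> - \<alpha>) \<le> w x"
    unfolding w using pos by (intro mult_mono a b) auto
  then show ?thesis by (simp add: mult_ac)
qed

text \<open>Near a maximum point \<open>cos t0\<close> of \<open>\<bar>P\<bar>\<close> the Bernstein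
  bound keeps \<open>\<bar>P\<bar>\<close> above half of its maximum on an arc of length comparable
  to \<open>1/n\<close>. The weighted mass of a suitable part of this arc is at least a constant
  times \<open>n powr (- (2 * \<alpha> + 2))\<close>.\<close>

lemma nikolskii_two:
  assumes n: "degree P \<le> n" "n \<ge> 1" and x: "x \<in> {-1..1}"
  shows "(poly P x)\<^sup>2 \<le> (2 * 2 powr (\<alpha> - \<beta>) * 56 powr (2 * \<alpha> + 2)) * real n powr (2 * \<alpha> + 2) * (LINT x|M. (poly P x)\<^sup>2)"
proof -
  define N where "N = 2 * \<alpha> + 2"
  obtain x0 where x0: "x0 \<in> {-1..1}" "\<And>x. x \<in> {-1..1} \<Longrightarrow> \<bar>poly P x\<bar> \<le> \<bar>poly P x0\<bar>"
  proof -
    have "\<exists>x\<in>{-1..1}. \<forall>y\<in>{-1..1}. \<bar>poly P y\<bar> \<le> \<bar>poly P x\<bar>"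
      by (rule continuous_attains_sup) (auto intro!: continuous_intros)
    then show thesis using that by blast
  qed
  define B where "B = \<bar>poly P x0\<bar>"
  define t0 where "t0 = arccos x0"
  \<comment> \<open>Chosen so that the Lipschitz constant \<open>7 n B\<close> times \<delta> equals
    \<open>B / 2\<close>. Later \<delta> is divided by 4, whence the \<open>56 = 4 * 14\<close> of
    the statement.\<close>
  define \<delta> where "\<delta> = 1 / (14 * real n)"
  have \<delta>: "\<delta> > 0" "\<delta> \<le> 1/14" using n by (auto simp: \<delta>_def field_simps)
  have t0: "0 \<le> t0" "t0 \<le> pi" "cos t0 = x0" using x0 by (auto simp: t0_def arccos_lbound arccos_ubound)
  have near: "B / 2 \<le> \<bar>poly P (cos t)\<bar>" if "\<bar>t - t0\<bar> \<le> \<delta>" for t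
  proof -
    have "\<bar>poly P (cos t) - poly P (cos t0)\<bar> \<le> 7 * real n * B * \<bar>t - t0\<bar>"
      using n x0 by (intro bernstein_cos_lipschitz) (auto simp: B_def)
    also have "\<dots> \<le> 7 * real n * B * \<delta>" using that by (intro mult_left_mono) (auto simp: B_def)
    also have "\<dots> = B / 2" using n by (simp add: \<delta>_def)
    finally have "\<bar>poly P (cos t) - poly P x0\<bar> \<le> \<bar>poly P x0\<bar> / 2" by (simp only: B_def t0)
    then show ?thesis unfolding B_def by linarith
  qed
  \<comment> \<open>An arc of length \<open>\<delta> / 2\<close> within distance \<delta> of
    \<open>t0\<close>, moved towards the middle of \<open>[0, pi]\<close>. It stays
    \<open>\<delta> / 2\<close> away from both ends, where the sine vanishes.\<close>
  define a where "a = (if t0 \<le> pi / 2 then t0 + \<delta> / 2 else t0 - \<delta>)"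
  define b where "b = a + \<delta> / 2"
  have pi3: "pi > 3" using pi_gt3 .
  have ab: "\<delta> / 2 \<le> a" "a < b" "b \<le> pi - \<delta> / 2" using \<delta> t0 pi3 by (auto simp: a_def b_def)
  have abn: "\<bar>t - t0\<bar> \<le> \<delta>" if "t \<in> {a..b}" for t using that \<delta> by (auto simp: a_def b_def split: if_splits)
  have sinl: "\<delta> / 4 \<le> sin t" if t: "t \<in> {a..b}" for t
  proof -
    have "sin (\<delta> / 2) \<le> sin t"
    proof (cases "t \<le> pi / 2")
      case True then show ?thesis using t ab \<delta> pi3 by (intro sin_monotone_2pi_le) auto
    next
      case False
      have "sin (\<delta> / 2) \<le> sin (pi - t)" using t ab \<delta> pi3 False by (intro sin_monotone_2pi_le) auto
      then show ?thesis by simp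
    qed
    moreover have "\<delta> / 2 / 2 \<le> sin (\<delta> / 2)" using \<delta> by (intro sin_ge_half) auto
    ultimately show ?thesis by simp
  qed
  define k where "k = (B / 2)\<^sup>2 * (2 powr (\<beta> - \<alpha>) * (\<delta> / 4) powr (2 * \<alpha> + 1))"
  have cab: "cos b \<le> cos a" using ab \<delta> by (intro cos_monotone_0_pi_le) auto
  have J: "-1 < x \<and> x < 1 \<and> arccos x \<in> {a..b} \<and> cos (arccos x) = x" if "x \<in> {cos b..cos a}" for x
  proof -
    have "cos a < 1" using ab \<delta> cos_monotone_0_pi[of 0 a] by simp
    moreover have "-1 < cos b" using ab \<delta> cos_monotone_0_pi[of b pi] by simp
    ultimately have x1: "-1 < x" "x < 1" using that by auto
    have rng: "0 \<le> a" "a \<le> pi" "0 \<le> b" "b \<le> pi" using ab \<delta> by linarith+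
    have "arccos x \<le> arccos (cos b)" using that x1 by (intro arccos_le_arccos) auto
    moreover have "arccos (cos a) \<le> arccos x" using that x1 by (intro arccos_le_arccos) auto
    ultimately show ?thesis using x1 by (simp add: arccos_cos rng)
  qed
  have low: "k * inverse (sqrt (1 - x\<^sup>2)) \<le> w x * (poly P x)\<^sup>2" if xJ: "x \<in> {cos b..cos a}" for x
  proof -
    note Jx = J[OF xJ]
    have s2: "1 - x\<^sup>2 = (sin (arccos x))\<^sup>2" using Jx by (metis sin_squared_eq)
    have d2: "(\<delta> / 4)\<^sup>2 \<le> 1 - x\<^sup>2" unfolding s2 using sinl Jx \<delta> by (intro power_mono) auto
    have "2 powr (\<beta> - \<alpha>) * (\<delta> / 4) powr (2 * \<alpha> + 1) * inverse (sqrt (1 - x\<^sup>2)) \<le> w x"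
      using Jx d2 \<delta> by (intro w_lower) auto
    moreover have "(B / 2)\<^sup>2 \<le> (poly P x)\<^sup>2"
      using near[OF abn, of "arccos x"] Jx by (subst abs_le_square_iff[symmetric]) (auto simp: B_def)
    moreover have "0 \<le> w x" using Jx by (intro w_nonneg) auto
    moreover have "x\<^sup>2 \<le> 1" using d2 zero_le_power2[of "\<delta> / 4"] by linarith
    ultimately have "(B / 2)\<^sup>2 * (2 powr (\<beta> - \<alpha>) * (\<delta> / 4) powr (2 * \<alpha> + 1) * inverse (sqrt (1 - x\<^sup>2))) \<le> (poly P x)\<^sup>2 * w x"
      by (intro mult_mono) auto
    then show ?thesis by (simp add: k_def mult_ac)
  qed
  \<comment> \<open>The factor kept from the weight is the derivative of \<open>- arccos\<close>, so
    integrating it over the image of the arc returns the length of the arc.\<close>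
  have i1: "((\<lambda>x. inverse (sqrt (1 - x\<^sup>2))) has_integral (- arccos (cos a) - (- arccos (cos b)))) {cos b..cos a}"
  proof (rule fundamental_theorem_of_calculus[OF cab])
    fix x assume "x \<in> {cos b..cos a}"
    then have x: "-1 < x" "x < 1" using J by blast+
    have "((\<lambda>x. - arccos x) has_real_derivative - inverse (- sqrt (1 - x\<^sup>2))) (at x)"
      by (rule DERIV_minus[OF DERIV_arccos[OF x]])
    then have "((\<lambda>x. - arccos x) has_vector_derivative - inverse (- sqrt (1 - x\<^sup>2))) (at x)"
      by (simp only: has_real_derivative_iff_has_vector_derivative)
    then show "((\<lambda>x. - arccos x) has_vector_derivative inverse (sqrt (1 - x\<^sup>2))) (at x within {cos b..cos a})"
      by (simp only: inverse_minus_eq minus_minus has_vector_derivative_at_within)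
  qed
  have "- arccos (cos a) - (- arccos (cos b)) = \<delta> / 2"
  proof -
    have "0 \<le> a" "a \<le> pi" "0 \<le> b" "b \<le> pi" using ab \<delta> by linarith+
    then have "arccos (cos a) = a" "arccos (cos b) = b" by (simp_all add: arccos_cos)
    then show ?thesis by (simp add: b_def)
  qed
  with i1 have i2: "((\<lambda>x. k * inverse (sqrt (1 - x\<^sup>2))) has_integral k * (\<delta> / 2)) {cos b..cos a}"
    using has_integral_mult_right[OF i1, of k] by (simp only:)
  define I where "I = (LINT x|M. (poly P x)\<^sup>2)"
  have "integrable M (\<lambda>x. (poly P x)\<^sup>2)" by (intro continuous_integrable continuous_intros)
  then have "integrable (lebesgue_on {-1..1}) (\<lambda>x. w x * (poly P x)\<^sup>2)"
    by (subst (asm) integrable_M) auto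
  then have "((\<lambda>x. w x * (poly P x)\<^sup>2) has_integral (LINT x|lebesgue_on {-1..1}. w x * (poly P x)\<^sup>2)) {-1..1}"
    by (intro has_integral_integral_lebesgue_on) auto
  moreover have "(LINT x|lebesgue_on {-1..1}. w x * (poly P x)\<^sup>2) = I"
    unfolding I_def by (subst integral_M) auto
  ultimately have i3: "((\<lambda>x. w x * (poly P x)\<^sup>2) has_integral I) {-1..1}" by simp
  have sub: "{cos b..cos a} \<subseteq> {-1..1}" by auto
  have i4: "(\<lambda>x. w x * (poly P x)\<^sup>2) integrable_on {cos b..cos a}"
    using i3 sub by (metis has_integral_integrable integrable_on_subinterval)
  have "k * (\<delta> / 2) \<le> integral {cos b..cos a} (\<lambda>x. w x * (poly P x)\<^sup>2)"
    by (rule has_integral_le[OF i2 integrable_integral[OF i4] low])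
  also have "\<dots> \<le> integral {-1..1} (\<lambda>x. w x * (poly P x)\<^sup>2)"
    using i3 w_nonneg by (intro integral_subset_le[OF sub i4]) (auto simp: has_integral_integrable)
  also have "\<dots> = I" using i3 by (rule integral_unique)
  finally have main: "k * (\<delta> / 2) \<le> I" .
  have "k * (\<delta> / 2) = B\<^sup>2 * (2 powr (\<beta> - \<alpha>) / 2 * (\<delta> / 4) powr N)"
  proof -
    have "(\<delta> / 4) powr N = (\<delta> / 4) powr (2 * \<alpha> + 1) * (\<delta> / 4)"
    proof -
      have "N = (2 * \<alpha> + 1) + 1" by (simp add: N_def)
      then show ?thesis using \<delta> by (simp only: powr_add) simp
    qed
    then show ?thesis unfolding k_def by (simp only:) (simp add: power2_eq_square)
  qed
  also have "(\<delta> / 4) powr N = 1 / (56 powr N * real n powr N)"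
  proof -
    have "\<delta> / 4 = 1 / (56 * real n)" by (simp add: \<delta>_def)
    then show ?thesis by (simp only: powr_divide powr_mult powr_one_eq_one)
  qed
  finally have "B\<^sup>2 * (2 powr (\<beta> - \<alpha>) / 2 * (1 / (56 powr N * real n powr N))) \<le> I" using main by simp
  then have le: "B\<^sup>2 * (2 powr (\<beta> - \<alpha>) / 2 * (1 / (56 powr N * real n powr N))) * (2 * 2 powr (\<alpha> - \<beta>) * (56 powr N * real n powr N))
     \<le> I * (2 * 2 powr (\<alpha> - \<beta>) * (56 powr N * real n powr N))"
    by (intro mult_right_mono) auto
  have one: "2 powr (\<beta> - \<alpha>) / 2 * (1 / X) * (2 * 2 powr (\<alpha> - \<beta>) * X) = 1" if "X \<noteq> 0" for X :: real
  proof -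
    have "2 powr (\<beta> - \<alpha>) / 2 * (1 / X) * (2 * 2 powr (\<alpha> - \<beta>) * X) = 2 powr (\<beta> - \<alpha>) * 2 powr (\<alpha> - \<beta>)"
      using that by simp
    also have "\<dots> = 1" by (simp only: powr_add[symmetric]) simp
    finally show ?thesis .
  qed
  have "56 powr N * real n powr N \<noteq> 0" using n by simp
  from one[OF this] le have "B\<^sup>2 \<le> I * (2 * 2 powr (\<alpha> - \<beta>) * (56 powr N * real n powr N))"
    by (simp only: mult.assoc[of "B\<^sup>2"] mult_1_right)
  then have "B\<^sup>2 \<le> (2 * 2 powr (\<alpha> - \<beta>) * 56 powr N) * real n powr N * I" by (simp only: mult_ac)
  moreover have "(poly P x)\<^sup>2 \<le> B\<^sup>2" using x0(2)[OF x] by (subst abs_le_square_iff[symmetric]) (simp add: B_def)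
  ultimately show ?thesis unfolding N_def I_def by linarith
qed

end

section \<open>The Christoffel function and kernels of resolvent powers\<close>

context jacobi
begin

text \<open>Apply the Nikolskii inequality to the reproducing kernel \<open>P\<close> at
  \<open>x\<close>: its value at \<open>x\<close> and its squared \<open>L_2\<close> norm both equal
  the sum \<open>K\<close>, so \<open>K^2 \<le> C n powr N * K\<close>.\<close>

lemma christoffel:
  assumes n: "n \<ge> 1" and x: "x \<in> {-1..1}"
  shows "(\<Sum>k\<le>n. (poly (\<psi> k) x)\<^sup>2) \<le> (2 * 2 powr (\<alpha> - \<beta>) * 56 powr (2 * \<alpha> + 2)) * real n powr (2 * \<alpha> + 2)"
proof -
  define K where "K = (\<Sum>k\<le>n. (poly (\<psi> k) x)\<^sup>2)"
  define P where "P = (\<Sum>k\<le>n. smult (poly (\<psi> k) x) (\<psi> k))"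
  have Px: "poly P x = K" by (simp add: P_def K_def poly_sum power2_eq_square)
  have dP: "degree P \<le> n" unfolding P_def by (intro degree_sum_le) (auto intro: order_trans[OF degree_smult_le])
  have coP: "co (poly P) k = (if k \<le> n then poly (\<psi> k) x else 0)" for k
    unfolding P_def by (subst co_sum_psi) auto
  have "(LINT x|M. (poly P x)\<^sup>2) = (LINT x|M. poly (T (\<lambda>_. 1) P) x * poly P x)"
    by (simp add: T_const power2_eq_square)
  also have "\<dots> = (\<Sum>k\<le>degree P. (co (poly P) k)\<^sup>2)"
    by (subst integral_T[OF poly_integrable]) (simp add: power2_eq_square)
  also have "\<dots> = (\<Sum>k\<le>n. (co (poly P) k)\<^sup>2)"
    using dP by (intro sum.mono_neutral_left) (auto simp: co_high)
  also have "\<dots> = K" by (simp add: coP K_def)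
  finally have "K\<^sup>2 \<le> (2 * 2 powr (\<alpha> - \<beta>) * 56 powr (2 * \<alpha> + 2)) * real n powr (2 * \<alpha> + 2) * K"
    using nikolskii_two[OF dP n x] by (simp add: Px)
  moreover have "K \<ge> 0" by (simp add: K_def sum_nonneg)
  ultimately show ?thesis unfolding K_def[symmetric]
    by (cases "K = 0") (auto simp: power2_eq_square mult_le_cancel_right)
qed

text \<open>Up to \<open>k\<close> about \<open>\<mu> powr (-1/2)\<close> the resolvent factor is
  bounded by \<open>1\<close> and \<open>christoffel\<close> suffices. On the \<open>i\<close>-th
  dyadic block above, the factor is of size \<open>4^(- i m)\<close> while the Christoffel sum grows
  like \<open>2^(i N)\<close>; the ratio \<rho> is below \<open>1\<close> because
  \<open>m > \<alpha> + 1\<close>.\<close>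

lemma kernel_bound:
  assumes m: "\<alpha> + 1 < real m"
  obtains C where "C > 0" "\<And>\<mu> x n. 0 < \<mu> \<Longrightarrow> \<mu> \<le> 1 \<Longrightarrow> x \<in> {-1..1} \<Longrightarrow>
    (\<Sum>k\<le>n. (1 / (1 + \<mu> * lam2 k)) ^ m * (poly (\<psi> k) x)\<^sup>2) \<le> C * \<mu> powr (- (\<alpha> + 1))"
proof -
  define N where "N = 2 * \<alpha> + 2"
  have N: "N > 0" using alpha_gt by (simp add: N_def)
  define A where "A = 2 * 2 powr (\<alpha> - \<beta>) * 56 powr N"
  have A: "A > 0" by (simp add: A_def)
  define \<rho> where "\<rho> = 2 powr (N - 2 * real m)"
  have \<rho>: "0 < \<rho>" "\<rho> < 1" using m powr_less_mono[of "N - 2 * real m" 0 2] by (auto simp: \<rho>_def N_def)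
  define D where "D = 1 + 2 ^ m * 2 powr N / (1 - \<rho>)"
  have D: "D > 0" using \<rho> by (simp add: D_def add_pos_nonneg)
  have main: "(\<Sum>k\<le>n. (1 / (1 + \<mu> * lam2 k)) ^ m * (poly (\<psi> k) x)\<^sup>2) \<le> A * D * 2 powr N * \<mu> powr (- (\<alpha> + 1))"
    if mu: "0 < \<mu>" "\<mu> \<le> 1" and x: "x \<in> {-1..1}" for \<mu> x n
  proof -
    \<comment> \<open>The frequency at which \<open>\<mu> * k^2\<close> reaches \<open>1\<close>;
      since \<open>\<mu> \<le> 1\<close> it is at least \<open>1\<close>, so rounding up to
      \<open>K\<close> costs at most a factor 2.\<close>
    define R where "R = \<mu> powr (- 1/2)"
    have R1: "R \<ge> 1" using mu powr_mono'[of "-1/2" 0 \<mu>] by (simp add: R_def)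
    define K where "K = nat \<lceil>R\<rceil>"
    have K: "R \<le> real K" "real K \<le> 2 * R" "K \<ge> 1" using R1 unfolding K_def by linarith+
    have muR: "\<mu> * R\<^sup>2 = 1"
    proof -
      have "R\<^sup>2 = R powr 2" using R1 by (simp add: powr_numeral)
      also have "\<dots> = \<mu> powr (-1)" by (simp add: R_def powr_powr)
      finally show ?thesis using mu by (simp add: powr_minus)
    qed
    define a where "a k = (1 / (1 + \<mu> * lam2 k)) ^ m" for k
    have a01: "0 \<le> a k" "a k \<le> 1" for k
    proof -
      have "0 \<le> \<mu> * lam2 k" using mu by simp
      then have "0 \<le> 1 / (1 + \<mu> * lam2 k)" "1 / (1 + \<mu> * lam2 k) \<le> 1" by (auto simp: divide_le_eq)
      then show "0 \<le> a k" "a k \<le> 1" unfolding a_def by (auto intro: power_le_one)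
    qed
    \<comment> \<open>The factor \<open>2 ^ m\<close> is the price of
      \<open>lam2 k \<ge> k^2 / 2\<close>.\<close>
    have ab: "a k \<le> 2 ^ m * (1 / 4 ^ i) ^ m" if "2 ^ i * K \<le> k" for i k
    proof -
      have "4 ^ i * R\<^sup>2 \<le> (real k)\<^sup>2"
      proof -
        have "2 ^ i * R \<le> 2 ^ i * real K" using K by simp
        also have "2 ^ i * real K = real (2 ^ i * K)" by simp
        also have "\<dots> \<le> real k" using that by (simp only: of_nat_le_iff)
        finally have "(2 ^ i * R)\<^sup>2 \<le> (real k)\<^sup>2" using R1 by (intro power_mono) auto
        moreover have "(2 ^ i)\<^sup>2 = (4 :: real) ^ i" by (simp add: power2_eq_square power_mult_distrib[symmetric])
        ultimately show ?thesis by (simp only: power_mult_distrib)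
      qed
      then have "\<mu> * (4 ^ i * R\<^sup>2) \<le> \<mu> * (real k)\<^sup>2" using mu by (intro mult_left_mono) auto
      moreover have "\<mu> * (4 ^ i * R\<^sup>2) = 4 ^ i * (\<mu> * R\<^sup>2)" by (simp only: mult_ac)
      ultimately have "4 ^ i \<le> \<mu> * (real k)\<^sup>2" by (simp only: muR mult_1_right)
      also have "\<dots> \<le> \<mu> * (2 * lam2 k)" using lam2_lower[of k] mu by (intro mult_left_mono) auto
      finally have "4 ^ i / 2 \<le> 1 + \<mu> * lam2 k" by simp
      then have "1 / (1 + \<mu> * lam2 k) \<le> 1 / (4 ^ i / 2)" by (intro frac_le) auto
      then have "(1 / (1 + \<mu> * lam2 k)) ^ m \<le> (2 * (1 / 4 ^ i)) ^ m" using mu by (intro power_mono) auto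
      then show ?thesis by (simp add: a_def power_mult_distrib power_divide)
    qed
    define S where "S n = (\<Sum>k\<le>n. a k * (poly (\<psi> k) x)\<^sup>2)" for n
    have step: "S (2 ^ i * K) \<le> A * real K powr N * (1 + 2 ^ m * 2 powr N * (\<Sum>j<i. \<rho> ^ j))" for i
    proof (induction i)
      case 0
      have "S (2 ^ 0 * K) \<le> (\<Sum>k\<le>K. 1 * (poly (\<psi> k) x)\<^sup>2)"
      proof -
        have "2 ^ 0 * K = K" by simp
        then show ?thesis unfolding S_def by (simp only:) (intro sum_mono mult_right_mono a01, simp)
      qed
      also have "\<dots> \<le> A * real K powr N" using christoffel[OF K(3) x] by (simp add: A_def N_def)
      finally show ?case by simp
    next
      case (Suc i)
      have le2: "2 ^ i * K \<le> 2 ^ Suc i * K" by (intro mult_right_mono power_increasing) auto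
      have c: "(\<Sum>k\<le>2 ^ Suc i * K. (poly (\<psi> k) x)\<^sup>2) \<le> A * real (2 ^ Suc i * K) powr N"
        unfolding A_def N_def
      proof (rule christoffel[OF _ x])
        show "1 \<le> 2 ^ Suc i * K" using K(3) by (metis Suc_le_eq One_nat_def mult_pos_pos zero_less_numeral zero_less_power)
      qed
      have "S (2 ^ Suc i * K) = S (2 ^ i * K) + (\<Sum>k\<in>{2 ^ i * K<..2 ^ Suc i * K}. a k * (poly (\<psi> k) x)\<^sup>2)"
        unfolding S_def by (rule sum_atMost_split[OF le2])
      also have "(\<Sum>k\<in>{2 ^ i * K<..2 ^ Suc i * K}. a k * (poly (\<psi> k) x)\<^sup>2)
          \<le> (\<Sum>k\<in>{2 ^ i * K<..2 ^ Suc i * K}. 2 ^ m * (1 / 4 ^ i) ^ m * (poly (\<psi> k) x)\<^sup>2)"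
        by (intro sum_mono mult_right_mono ab) auto
      also have "\<dots> = 2 ^ m * (1 / 4 ^ i) ^ m * (\<Sum>k\<in>{2 ^ i * K<..2 ^ Suc i * K}. (poly (\<psi> k) x)\<^sup>2)"
        by (simp add: sum_distrib_left)
      also have "\<dots> \<le> 2 ^ m * (1 / 4 ^ i) ^ m * (\<Sum>k\<le>2 ^ Suc i * K. (poly (\<psi> k) x)\<^sup>2)"
        by (intro mult_left_mono sum_mono2) auto
      also have "\<dots> \<le> 2 ^ m * (1 / 4 ^ i) ^ m * (A * real (2 ^ Suc i * K) powr N)"
        by (rule mult_left_mono[OF c]) simp
      also have "\<dots> = A * real K powr N * (2 ^ m * 2 powr N * \<rho> ^ i)"
      proof -
        have "2 powr (2 * real m) = (2 powr 2) powr real m" by (simp only: powr_powr)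
        also have "\<dots> = (4::real) ^ m" by (simp add: powr_realpow powr_numeral)
        finally have "\<rho> = 2 powr N * (1 / 4 ^ m)" by (simp add: \<rho>_def powr_diff)
        then have "\<rho> ^ i = (2 powr N) ^ i * (1 / 4 ^ m) ^ i" by (simp only: power_mult_distrib)
        also have "(1 / 4 ^ m :: real) ^ i = (1 / 4 ^ i) ^ m"
          by (simp add: power_divide power_mult[symmetric] mult.commute)
        finally have \<rho>i: "\<rho> ^ i = (2 powr N) ^ i * (1 / 4 ^ i) ^ m" .
        have "real (2 ^ Suc i * K) = 2 ^ Suc i * real K" by simp
        then have "real (2 ^ Suc i * K) powr N = (2 ^ Suc i) powr N * real K powr N" by (simp only: powr_mult)
        also have "(2 ^ Suc i) powr N = (2 powr N) ^ Suc i" by (rule two_power_powr)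
        finally have "real (2 ^ Suc i * K) powr N = (2 powr N * (2 powr N) ^ i) * real K powr N" by (simp only: power_Suc)
        then show ?thesis unfolding \<rho>i by (simp only: mult_ac)
      qed
      finally have "S (2 ^ Suc i * K) \<le> S (2 ^ i * K) + A * real K powr N * (2 ^ m * 2 powr N * \<rho> ^ i)" by simp
      moreover have "A * real K powr N * (1 + 2 ^ m * 2 powr N * (\<Sum>j<Suc i. \<rho> ^ j))
        = A * real K powr N * (1 + 2 ^ m * 2 powr N * (\<Sum>j<i. \<rho> ^ j)) + A * real K powr N * (2 ^ m * 2 powr N * \<rho> ^ i)"
        by (simp only: sum.lessThan_Suc distrib_left add.assoc)
      ultimately show ?case using Suc.IH by linarith
    qed
    have geo: "(\<Sum>j<i. \<rho> ^ j) \<le> 1 / (1 - \<rho>)" for i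
    proof -
      have "(\<Sum>j<i. \<rho> ^ j) = (1 - \<rho> ^ i) / (1 - \<rho>)" using \<rho> by (subst sum_gp_strict) auto
      also have "\<dots> \<le> 1 / (1 - \<rho>)" using \<rho> by (intro divide_right_mono) auto
      finally show ?thesis .
    qed
    have "n \<le> 2 ^ n * K"
    proof -
      have "n < 2 ^ n" by (rule less_exp)
      also have "2 ^ n \<le> 2 ^ n * K" using K(3) by simp
      finally show ?thesis by simp
    qed
    then have "S n \<le> S (2 ^ n * K)" unfolding S_def using a01 by (intro sum_mono2) auto
    also have "\<dots> \<le> A * real K powr N * (1 + 2 ^ m * 2 powr N * (\<Sum>j<n. \<rho> ^ j))" by (rule step)
    also have "\<dots> \<le> A * real K powr N * (1 + 2 ^ m * 2 powr N * (1 / (1 - \<rho>)))"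
      using A by (intro mult_left_mono add_left_mono geo) auto
    also have "\<dots> = A * D * real K powr N" by (simp add: D_def)
    also have "\<dots> \<le> A * D * (2 * R) powr N" using A D K N R1 by (intro mult_left_mono powr_mono2) auto
    also have "(2 * R) powr N = 2 powr N * R powr N" by (simp add: powr_mult)
    also have "R powr N = \<mu> powr (- (\<alpha> + 1))" proof -
      have "- 1 / 2 * N = - (\<alpha> + 1)" by (simp add: N_def field_simps)
      then show ?thesis by (simp only: R_def powr_powr)
    qed
    finally show ?thesis by (simp add: S_def a_def mult.assoc)
  qed
  show ?thesis by (rule that[of "A * D * 2 powr N"]) (use A D main in auto)
qed

end

section \<open>Multiplier series\<close>

context jacobi_weights
begin

abbreviation L1 :: "(real \<Rightarrow> real) \<Rightarrow> real" where "L1 f \<equiv> (LINT x|M. \<bar>f x\<bar>)"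

text \<open>Tested on the set where \<open>G\<close> exceeds \<open>c\<close>. With the two-sided
  version below, a bound on pairings with indicators becomes an \<open>L_infinity\<close>
  bound.\<close>

lemma AE_le_of_integrals:
  assumes G: "integrable M G" and le: "\<And>A. A \<in> sets M \<Longrightarrow> (LINT x|M. G x * indicator A x) \<le> c * measure M A"
  shows "AE x in M. G x \<le> c"
proof -
  define A where "A = {x \<in> space M. G x > c}"
  have [measurable]: "G \<in> borel_measurable M" using G by auto
  have A[measurable]: "A \<in> sets M" unfolding A_def by measurable
  have i: "integrable M (\<lambda>x. G x * indicator A x)"
    using integrable_mult_indicator[OF A G] by (simp add: mult.commute)
  have i2: "integrable M (\<lambda>x. c * indicator A x)" by (intro integrable_mult_right integrable_real_indicator A) (simp add: less_top[symmetric])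
  have As: "A \<inter> {-1..1} = A" by (auto simp: A_def)
  have "(LINT x|M. (G x * indicator A x - c * indicator A x)) = (LINT x|M. G x * indicator A x) - c * measure M A"
    using i i2 by (subst Bochner_Integration.integral_diff) (simp_all add: As)
  also have "\<dots> \<le> 0" using le[OF A] by simp
  finally have "(LINT x|M. (G x * indicator A x - c * indicator A x)) \<le> 0" .
  moreover have nn: "AE x in M. 0 \<le> G x * indicator A x - c * indicator A x"
    by (intro AE_I2) (auto simp: A_def indicator_def)
  moreover have "0 \<le> (LINT x|M. (G x * indicator A x - c * indicator A x))"
    by (rule integral_nonneg_AE[OF nn])
  ultimately have "(LINT x|M. (G x * indicator A x - c * indicator A x)) = 0" by simp
  then have "AE x in M. G x * indicator A x - c * indicator A x = 0"
    using integral_nonneg_eq_0_iff_AE[OF Bochner_Integration.integrable_diff[OF i i2] nn] by simp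
  then show ?thesis using AE_space
    by eventually_elim (auto simp: A_def indicator_def split: if_splits)
qed

lemma AE_abs_le_of_integrals:
  assumes G: "integrable M G" and le: "\<And>A. A \<in> sets M \<Longrightarrow> \<bar>LINT x|M. G x * indicator A x\<bar> \<le> c * measure M A"
  shows "AE x in M. \<bar>G x\<bar> \<le> c"
proof -
  have "AE x in M. G x \<le> c"
    by (rule AE_le_of_integrals[OF G]) (use le in \<open>auto simp: abs_le_iff\<close>)
  moreover have "AE x in M. - G x \<le> c"
    by (rule AE_le_of_integrals) (use le G in \<open>auto simp: abs_le_iff\<close>)
  ultimately show ?thesis by eventually_elim auto
qed

end

context jacobi
begin

text \<open>By the Cauchy-Schwarz inequality this bounds the kernel \<open>\<Sum>k. m k * \<psi>\<^sub>k(x) * \<psi>\<^sub>k(y)\<close> absolutely.\<close>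

definition dominated :: "(nat \<Rightarrow> real) \<Rightarrow> real \<Rightarrow> bool" where
  "dominated m \<kappa> \<longleftrightarrow> 0 \<le> \<kappa> \<and> (\<forall>x\<in>{-1..1}. \<forall>n. (\<Sum>k\<le>n. \<bar>m k\<bar> * (poly (\<psi> k) x)\<^sup>2) \<le> \<kappa>)"

lemma dom_two:
  assumes d: "dominated m \<kappa>" and x: "x \<in> {-1..1}" and y: "y \<in> {-1..1}"
  shows "(\<Sum>k\<le>n. \<bar>m k\<bar> * (\<bar>poly (\<psi> k) x\<bar> * \<bar>poly (\<psi> k) y\<bar>)) \<le> \<kappa>"
proof -
  have "(\<Sum>k\<le>n. \<bar>m k\<bar> * (\<bar>poly (\<psi> k) x\<bar> * \<bar>poly (\<psi> k) y\<bar>))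
     \<le> (\<Sum>k\<le>n. \<bar>m k\<bar> * (((poly (\<psi> k) x)\<^sup>2 + (poly (\<psi> k) y)\<^sup>2) / 2))"
  proof (intro sum_mono mult_left_mono)
    fix k
    have "0 \<le> (\<bar>poly (\<psi> k) x\<bar> - \<bar>poly (\<psi> k) y\<bar>)\<^sup>2" by simp
    then show "\<bar>poly (\<psi> k) x\<bar> * \<bar>poly (\<psi> k) y\<bar> \<le> ((poly (\<psi> k) x)\<^sup>2 + (poly (\<psi> k) y)\<^sup>2) / 2"
      by (simp add: power2_diff)
  qed simp
  also have "\<dots> = ((\<Sum>k\<le>n. \<bar>m k\<bar> * (poly (\<psi> k) x)\<^sup>2) + (\<Sum>k\<le>n. \<bar>m k\<bar> * (poly (\<psi> k) y)\<^sup>2)) / 2"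
    by (simp add: sum.distrib[symmetric] sum_divide_distrib distrib_left)
  also have "\<dots> \<le> (\<kappa> + \<kappa>) / 2"
    using d x y unfolding dominated_def by (intro divide_right_mono add_mono) auto
  finally show ?thesis by simp
qed

lemma abs_co_le: assumes f: "integrable M f" shows "\<bar>co f k\<bar> \<le> (LINT x|M. \<bar>f x\<bar> * \<bar>poly (\<psi> k) x\<bar>)"
proof -
  have "\<bar>co f k\<bar> \<le> (LINT x|M. \<bar>f x * poly (\<psi> k) x\<bar>)" unfolding co_def by (rule integral_abs_bound)
  then show ?thesis by (simp add: abs_mult)
qed

lemma integrable_abs_psi: "integrable M f \<Longrightarrow> integrable M (\<lambda>x. \<bar>f x\<bar> * \<bar>poly (\<psi> k) x\<bar>)"
  using integrable_abs[OF integrable_mult_poly[of f "\<psi> k"]] by (simp add: abs_mult)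

lemma dom_point:
  assumes d: "dominated m \<kappa>" and f: "integrable M f" and x: "x \<in> {-1..1}"
  shows "(\<Sum>k\<le>n. \<bar>m k\<bar> * (\<bar>poly (\<psi> k) x\<bar> * (LINT y|M. \<bar>f y\<bar> * \<bar>poly (\<psi> k) y\<bar>))) \<le> \<kappa> * L1 f"
proof -
  have "(\<Sum>k\<le>n. \<bar>m k\<bar> * (\<bar>poly (\<psi> k) x\<bar> * (LINT y|M. \<bar>f y\<bar> * \<bar>poly (\<psi> k) y\<bar>)))
    = (\<Sum>k\<le>n. (LINT y|M. (\<bar>m k\<bar> * \<bar>poly (\<psi> k) x\<bar>) * (\<bar>f y\<bar> * \<bar>poly (\<psi> k) y\<bar>)))"
    by (simp add: mult.assoc)
  also have "\<dots> = (LINT y|M. (\<Sum>k\<le>n. (\<bar>m k\<bar> * \<bar>poly (\<psi> k) x\<bar>) * (\<bar>f y\<bar> * \<bar>poly (\<psi> k) y\<bar>)))"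
    by (subst Bochner_Integration.integral_sum) (auto intro: integrable_abs_psi[OF f])
  also have "\<dots> \<le> (LINT y|M. \<kappa> * \<bar>f y\<bar>)"
  proof (rule integral_mono)
    show "integrable M (\<lambda>y. \<Sum>k\<le>n. (\<bar>m k\<bar> * \<bar>poly (\<psi> k) x\<bar>) * (\<bar>f y\<bar> * \<bar>poly (\<psi> k) y\<bar>))"
      by (intro Bochner_Integration.integrable_sum integrable_mult_right integrable_abs_psi f)
    show "integrable M (\<lambda>y. \<kappa> * \<bar>f y\<bar>)" using f by simp
    fix y assume "y \<in> space M"
    then have "(\<Sum>k\<le>n. \<bar>m k\<bar> * (\<bar>poly (\<psi> k) x\<bar> * \<bar>poly (\<psi> k) y\<bar>)) * \<bar>f y\<bar> \<le> \<kappa> * \<bar>f y\<bar>"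
      by (intro mult_right_mono dom_two[OF d x]) auto
    then show "(\<Sum>k\<le>n. (\<bar>m k\<bar> * \<bar>poly (\<psi> k) x\<bar>) * (\<bar>f y\<bar> * \<bar>poly (\<psi> k) y\<bar>)) \<le> \<kappa> * \<bar>f y\<bar>"
      by (simp add: sum_distrib_left sum_distrib_right mult_ac)
  qed
  also have "\<dots> = \<kappa> * L1 f" by simp
  finally show ?thesis .
qed

lemma dom_point_co:
  assumes d: "dominated m \<kappa>" and f: "integrable M f" and x: "x \<in> {-1..1}"
  shows "(\<Sum>k\<le>n. \<bar>m k * co f k * poly (\<psi> k) x\<bar>) \<le> \<kappa> * L1 f"
proof -
  have "(\<Sum>k\<le>n. \<bar>m k * co f k * poly (\<psi> k) x\<bar>) \<le> (\<Sum>k\<le>n. \<bar>m k\<bar> * (\<bar>poly (\<psi> k) x\<bar> * (LINT y|M. \<bar>f y\<bar> * \<bar>poly (\<psi> k) y\<bar>)))"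
  proof (intro sum_mono)
    fix k
    have "\<bar>m k\<bar> * (\<bar>poly (\<psi> k) x\<bar> * \<bar>co f k\<bar>) \<le> \<bar>m k\<bar> * (\<bar>poly (\<psi> k) x\<bar> * (LINT y|M. \<bar>f y\<bar> * \<bar>poly (\<psi> k) y\<bar>))"
      by (intro mult_left_mono abs_co_le f) auto
    then show "\<bar>m k * co f k * poly (\<psi> k) x\<bar> \<le> \<bar>m k\<bar> * (\<bar>poly (\<psi> k) x\<bar> * (LINT y|M. \<bar>f y\<bar> * \<bar>poly (\<psi> k) y\<bar>))"
      by (simp add: abs_mult mult_ac)
  qed
  also have "\<dots> \<le> \<kappa> * L1 f" by (rule dom_point[OF assms])
  finally show ?thesis .
qed

lemma dom_bilinear:
  assumes d: "dominated m \<kappa>" and f: "integrable M f" and h: "integrable M h"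
  shows "(\<Sum>k\<le>n. \<bar>m k * co f k * co h k\<bar>) \<le> \<kappa> * L1 f * L1 h"
proof -
  define c where "c k = (LINT y|M. \<bar>f y\<bar> * \<bar>poly (\<psi> k) y\<bar>)" for k
  have "(\<Sum>k\<le>n. \<bar>m k * co f k * co h k\<bar>) \<le> (\<Sum>k\<le>n. (\<bar>m k\<bar> * c k) * (LINT x|M. \<bar>h x\<bar> * \<bar>poly (\<psi> k) x\<bar>))"
  proof (intro sum_mono)
    fix k
    have "(\<bar>m k\<bar> * \<bar>co f k\<bar>) * \<bar>co h k\<bar> \<le> (\<bar>m k\<bar> * c k) * (LINT x|M. \<bar>h x\<bar> * \<bar>poly (\<psi> k) x\<bar>)"
      unfolding c_def by (intro mult_mono' mult_left_mono abs_co_le f h) auto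
    then show "\<bar>m k * co f k * co h k\<bar> \<le> (\<bar>m k\<bar> * c k) * (LINT x|M. \<bar>h x\<bar> * \<bar>poly (\<psi> k) x\<bar>)"
      by (simp add: abs_mult)
  qed
  also have "\<dots> = (LINT x|M. (\<Sum>k\<le>n. (\<bar>m k\<bar> * c k) * (\<bar>h x\<bar> * \<bar>poly (\<psi> k) x\<bar>)))"
    by (subst Bochner_Integration.integral_sum) (auto intro: integrable_abs_psi[OF h])
  also have "\<dots> \<le> (LINT x|M. \<kappa> * L1 f * \<bar>h x\<bar>)"
  proof (rule integral_mono)
    show "integrable M (\<lambda>x. \<Sum>k\<le>n. (\<bar>m k\<bar> * c k) * (\<bar>h x\<bar> * \<bar>poly (\<psi> k) x\<bar>))"
      by (intro Bochner_Integration.integrable_sum integrable_mult_right integrable_abs_psi h)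
    show "integrable M (\<lambda>x. \<kappa> * L1 f * \<bar>h x\<bar>)" using h by simp
    fix x assume "x \<in> space M"
    then have "(\<Sum>k\<le>n. \<bar>m k\<bar> * (\<bar>poly (\<psi> k) x\<bar> * c k)) * \<bar>h x\<bar> \<le> \<kappa> * L1 f * \<bar>h x\<bar>"
      unfolding c_def by (intro mult_right_mono dom_point[OF d f]) auto
    moreover have "(\<Sum>k\<le>n. (\<bar>m k\<bar> * c k) * (\<bar>h x\<bar> * \<bar>poly (\<psi> k) x\<bar>)) = (\<Sum>k\<le>n. \<bar>m k\<bar> * (\<bar>poly (\<psi> k) x\<bar> * c k)) * \<bar>h x\<bar>"
      by (simp only: sum_distrib_left sum_distrib_right mult_ac)
    ultimately show "(\<Sum>k\<le>n. (\<bar>m k\<bar> * c k) * (\<bar>h x\<bar> * \<bar>poly (\<psi> k) x\<bar>)) \<le> \<kappa> * L1 f * \<bar>h x\<bar>" by simp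
  qed
  also have "\<dots> = \<kappa> * L1 f * L1 h" by simp
  finally show ?thesis .
qed

lemma abs_summable_of_bounded:
  fixes a :: "nat \<Rightarrow> real" assumes "\<And>n. (\<Sum>k\<le>n. \<bar>a k\<bar>) \<le> c"
  shows "summable (\<lambda>k. \<bar>a k\<bar>)" "summable a" "\<bar>suminf a\<bar> \<le> c"
proof -
  show s: "summable (\<lambda>k. \<bar>a k\<bar>)" by (rule bounded_imp_summable) (use assms in auto)
  then show "summable a" by (rule summable_rabs_cancel)
  have "\<bar>suminf a\<bar> \<le> (\<Sum>k. \<bar>a k\<bar>)" by (rule summable_rabs[OF s])
  also have "\<dots> \<le> c"
  proof (rule suminf_le_const[OF s])
    fix n show "(\<Sum>k<n. \<bar>a k\<bar>) \<le> c"
      using assms[of n] sum_mono2[of "{..n}" "{..<n}" "\<lambda>k. \<bar>a k\<bar>"] by (simp add: subset_iff)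
  qed
  finally show "\<bar>suminf a\<bar> \<le> c" .
qed

text \<open>The extension of \<open>T\<close> from polynomials to integrable functions. For a
  dominated symbol the series converges absolutely at every point of \<open>[-1, 1]\<close>, so
  actual functions and not merely classes are obtained.\<close>

definition Ser :: "(nat \<Rightarrow> real) \<Rightarrow> (real \<Rightarrow> real) \<Rightarrow> real \<Rightarrow> real" where
  "Ser m f x = (\<Sum>k. m k * co f k * poly (\<psi> k) x)"

text \<open>For dominated \<open>m\<close> this is the pairing of \<open>Ser m f\<close> with
  \<open>h\<close>. It is defined through coefficients so that, for bounded \<open>f\<close> and
  \<open>h\<close>, it also makes sense for symbols that are bounded but not dominated, such as
  negative powers of the eigenvalues.\<close>

definition Bil :: "(nat \<Rightarrow> real) \<Rightarrow> (real \<Rightarrow> real) \<Rightarrow> (real \<Rightarrow> real) \<Rightarrow> real" where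
  "Bil m f h = (\<Sum>k. m k * co f k * co h k)"

lemmas Ser_summable = abs_summable_of_bounded(2)[OF dom_point_co]
lemmas Bil_summable = abs_summable_of_bounded(2)[OF dom_bilinear]

lemma Ser_bound: "dominated m \<kappa> \<Longrightarrow> integrable M f \<Longrightarrow> x \<in> {-1..1} \<Longrightarrow> \<bar>Ser m f x\<bar> \<le> \<kappa> * L1 f"
  unfolding Ser_def by (rule abs_summable_of_bounded(3)[OF dom_point_co])

lemma Bil_bound: "dominated m \<kappa> \<Longrightarrow> integrable M f \<Longrightarrow> integrable M h \<Longrightarrow> \<bar>Bil m f h\<bar> \<le> \<kappa> * L1 f * L1 h"
  unfolding Bil_def by (rule abs_summable_of_bounded(3)[OF dom_bilinear])

lemma Bil_commute: "Bil m f h = Bil m h f"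
  by (simp add: Bil_def mult_ac)

lemma Bil_add_left:
  assumes "dominated m \<kappa>" "integrable M f" "integrable M g" "integrable M h"
  shows "Bil m (\<lambda>x. f x + g x) h = Bil m f h + Bil m g h"
proof -
  have "(\<lambda>k. m k * co (\<lambda>x. f x + g x) k * co h k) = (\<lambda>k. m k * co f k * co h k + m k * co g k * co h k)"
    by (simp add: co_add assms algebra_simps)
  then show ?thesis using suminf_add[OF Bil_summable[OF assms(1,2,4)] Bil_summable[OF assms(1,3,4)]]
    by (simp add: Bil_def)
qed

lemma Bil_diff_left:
  assumes "dominated m \<kappa>" "integrable M f" "integrable M g" "integrable M h"
  shows "Bil m (\<lambda>x. f x - g x) h = Bil m f h - Bil m g h"
proof -
  have "(\<lambda>k. m k * co (\<lambda>x. f x - g x) k * co h k) = (\<lambda>k. m k * co f k * co h k - m k * co g k * co h k)"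
    by (simp add: co_diff assms algebra_simps)
  then show ?thesis using suminf_diff[OF Bil_summable[OF assms(1,2,4)] Bil_summable[OF assms(1,3,4)]]
    by (simp add: Bil_def)
qed

lemma Ser_diff:
  assumes "dominated m \<kappa>" "integrable M f" "integrable M g" "x \<in> {-1..1}"
  shows "Ser m (\<lambda>x. f x - g x) x = Ser m f x - Ser m g x"
proof -
  have "(\<lambda>k. m k * co (\<lambda>x. f x - g x) k * poly (\<psi> k) x) = (\<lambda>k. m k * co f k * poly (\<psi> k) x - m k * co g k * poly (\<psi> k) x)"
    by (simp add: co_diff assms algebra_simps)
  then show ?thesis using suminf_diff[OF Ser_summable[OF assms(1,2,4)] Ser_summable[OF assms(1,3,4)]]
    by (simp add: Ser_def)
qed

lemma Ser_measurable: "Ser m f \<in> borel_measurable M"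
  unfolding Ser_def[abs_def] by measurable

lemma Ser_poly: "Ser m (poly f) x = poly (T m f) x"
proof -
  have "Ser m (poly f) x = (\<Sum>k\<le>degree f. m k * co (poly f) k * poly (\<psi> k) x)"
    unfolding Ser_def by (rule suminf_finite) (auto simp: co_high)
  then show ?thesis by (simp add: T_def poly_sum)
qed

lemma Bil_poly: "integrable M h \<Longrightarrow> Bil m (poly f) h = (LINT x|M. poly (T m f) x * h x)"
  unfolding Bil_def by (subst suminf_finite[of "{..degree f}"]) (auto simp: co_high integral_T)

lemma Ser_Lp: assumes "dominated m \<kappa>" "integrable M f" "p > 0" shows "Ser m f \<in> Lpset M p"
  by (rule Lpset_bounded[OF finite_measure_M Ser_measurable, where B="\<kappa> * L1 f"]) (use assms Ser_bound in auto)

text \<open>The partial sums are bounded by \<open>\<kappa> * L1 f\<close> at every point, so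
  dominated convergence lets the integral pass inside the series.\<close>

lemma integral_Ser:
  assumes d: "dominated m \<kappa>" and f: "integrable M f" and h: "integrable M h"
  shows "(LINT x|M. Ser m f x * h x) = Bil m f h"
proof -
  have [measurable]: "h \<in> borel_measurable M" using h by auto
  define S where "S n x = (\<Sum>k<n. m k * co f k * poly (\<psi> k) x)" for n x
  have Sm[measurable]: "S n \<in> borel_measurable M" for n unfolding S_def by measurable
  have "(\<lambda>n. LINT x|M. S n x * h x) \<longlonglongrightarrow> (LINT x|M. Ser m f x * h x)"
  proof (rule integral_dominated_convergence[where w="\<lambda>x. \<kappa> * L1 f * \<bar>h x\<bar>"])
    show "(\<lambda>x. Ser m f x * h x) \<in> borel_measurable M" using Ser_measurable by measurable
    show "integrable M (\<lambda>x. \<kappa> * L1 f * \<bar>h x\<bar>)" using h by simp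
    show "AE x in M. (\<lambda>n. S n x * h x) \<longlonglongrightarrow> Ser m f x * h x"
      unfolding S_def Ser_def
      by (intro AE_I2 tendsto_mult tendsto_const summable_LIMSEQ Ser_summable[OF d f]) auto
    show "AE x in M. norm (S n x * h x) \<le> \<kappa> * L1 f * \<bar>h x\<bar>" for n
    proof (intro AE_I2)
      fix x assume x: "x \<in> space M"
      have "\<bar>S n x\<bar> \<le> (\<Sum>k<n. \<bar>m k * co f k * poly (\<psi> k) x\<bar>)" unfolding S_def by (rule sum_abs)
      also have "\<dots> \<le> (\<Sum>k\<le>n. \<bar>m k * co f k * poly (\<psi> k) x\<bar>)" by (intro sum_mono2) auto
      also have "\<dots> \<le> \<kappa> * L1 f" using x by (intro dom_point_co[OF d f]) auto
      finally show "norm (S n x * h x) \<le> \<kappa> * L1 f * \<bar>h x\<bar>" by (simp add: abs_mult mult_right_mono)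
    qed
  qed measurable
  moreover have "(LINT x|M. S n x * h x) = (\<Sum>k<n. m k * co f k * co h k)" for n
  proof -
    have "(LINT x|M. S n x * h x) = (LINT x|M. (\<Sum>k<n. m k * co f k * (h x * poly (\<psi> k) x)))"
      by (intro Bochner_Integration.integral_cong refl) (simp only: S_def sum_distrib_left sum_distrib_right mult_ac)
    also have "\<dots> = (\<Sum>k<n. m k * co f k * co h k)"
      by (subst Bochner_Integration.integral_sum) (auto simp: co_def intro!: integrable_mult_poly h)
    finally show ?thesis .
  qed
  ultimately have "(\<lambda>n. \<Sum>k<n. m k * co f k * co h k) \<longlonglongrightarrow> (LINT x|M. Ser m f x * h x)" by simp
  moreover have "(\<lambda>n. \<Sum>k<n. m k * co f k * co h k) \<longlonglongrightarrow> Bil m f h"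
    unfolding Bil_def by (intro summable_LIMSEQ Bil_summable[OF d f h])
  ultimately show ?thesis by (rule LIMSEQ_unique)
qed

lemma co_Ser:
  assumes "dominated m \<kappa>" "integrable M f" shows "co (Ser m f) k = m k * co f k"
proof -
  have "co (Ser m f) k = Bil m f (poly (\<psi> k))"
    unfolding co_def[of "Ser m f"] by (rule integral_Ser[OF assms poly_integrable])
  also have "\<dots> = (\<Sum>j\<in>{k}. m j * co f j * co (poly (\<psi> k)) j)"
    unfolding Bil_def by (rule suminf_finite) (auto simp: co_def psi_orth)
  finally show ?thesis by (simp add: co_def[of "poly _"] psi_orth)
qed

text \<open>Approximate \<open>conj_fun p G\<close> by polynomials \<open>P n\<close>; in the
  pairing of \<open>G\<close> with \<open>P n\<close> the symbol moves from \<open>f\<close> to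
  \<open>P n\<close>, where the multiplier bound in the conjugate exponent is available. Only the
  coefficients of \<open>G\<close> enter, so this serves series and differences such as
  \<open>f - Ser m f\<close> equally well.\<close>

lemma mult_dual:
  assumes p: "1 < p" "1 / p + 1 / p' = 1" and G: "G \<in> Lpset M p" and f: "f \<in> Lpset M p"
    and co: "\<And>k. co G k = m k * co f k" and m: "mult p' m C" and C: "C \<ge> 0"
  shows "Lpn M p G \<le> C * Lpn M p f"
proof -
  note cf = conj_fun[OF p G]
  have p'1: "1 \<le> p'" using p by (simp add: conj_exponent[OF p])
  have Gi: "integrable M G" and fi: "integrable M f"
    using p(1) by (auto intro: Lpset_imp_L1(1)[OF finite_measure_M _ G] Lpset_imp_L1(1)[OF finite_measure_M _ f])
  obtain P where P: "(\<lambda>n. Lpn M p' (\<lambda>x. conj_fun p G x - poly (P n) x)) \<longlonglongrightarrow> 0"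
    by (rule poly_dense_seq[OF p'1 cf(1)])
  define e where "e n = Lpn M p' (\<lambda>x. conj_fun p G x - poly (P n) x)" for n
  define g where "g = Lpn M p G"
  have PLp: "poly (P n) \<in> Lpset M p'" for n using p'1 by (intro poly_Lp) auto
  have dLp: "(\<lambda>x. conj_fun p G x - poly (P n) x) \<in> Lpset M p'" for n
    by (rule Minkowski_diff(1)[OF p'1 cf(1) PLp])
  have bound: "g powr p \<le> g * e n + C * Lpn M p f * (g powr (p - 1) + e n)" for n
  proof -
    have PL: "Lpn M p' (poly (P n)) \<le> g powr (p - 1) + e n"
      using Minkowski_diff(2)[OF p'1 cf(1) dLp, of n] cf(3) by (simp add: g_def e_def)
    have "(LINT x|M. G x * poly (P n) x) = (LINT x|M. poly (T (\<lambda>_. 1) (P n)) x * G x)"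
      by (simp add: T_const mult.commute)
    also have "\<dots> = (\<Sum>k\<le>degree (P n). m k * co (poly (P n)) k * co f k)"
      by (subst integral_T[OF Gi]) (simp add: co mult_ac)
    also have "\<dots> = (LINT x|M. poly (T m (P n)) x * f x)" by (rule integral_T[OF fi, symmetric])
    also have "\<dots> \<le> (LINT x|M. \<bar>f x * poly (T m (P n)) x\<bar>)"
      by (simp add: mult.commute order_trans[OF abs_ge_self integral_abs_bound])
    also have "\<dots> \<le> Lpn M p f * Lpn M p' (poly (T m (P n)))"
      using p'1 by (intro Hoelder(2)[OF p f] poly_Lp) auto
    also have "\<dots> \<le> Lpn M p f * (C * Lpn M p' (poly (P n)))"
      by (intro mult_left_mono multD[OF m]) (simp add: Lpn_nonneg)
    also have "\<dots> \<le> Lpn M p f * (C * (g powr (p - 1) + e n))"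
      by (intro mult_left_mono PL C) (simp add: Lpn_nonneg)
    finally have 1: "(LINT x|M. G x * poly (P n) x) \<le> C * Lpn M p f * (g powr (p - 1) + e n)" by (simp add: mult_ac)
    have "(LINT x|M. G x * (conj_fun p G x - poly (P n) x)) \<le> (LINT x|M. \<bar>G x * (conj_fun p G x - poly (P n) x)\<bar>)"
      by (rule order_trans[OF abs_ge_self integral_abs_bound])
    also have "\<dots> \<le> g * e n" unfolding g_def e_def by (rule Hoelder(2)[OF p G dLp])
    finally have 2: "(LINT x|M. G x * (conj_fun p G x - poly (P n) x)) \<le> g * e n" .
    have "g powr p = (LINT x|M. G x * conj_fun p G x)"
      unfolding g_def using p by (simp add: Lpn_powr cf(2))
    also have "\<dots> = (LINT x|M. G x * (conj_fun p G x - poly (P n) x) + G x * poly (P n) x)"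
      by (simp add: algebra_simps)
    also have "\<dots> = (LINT x|M. G x * (conj_fun p G x - poly (P n) x)) + (LINT x|M. G x * poly (P n) x)"
      by (intro Bochner_Integration.integral_add Hoelder(1)[OF p G] dLp PLp)
    finally show ?thesis using 1 2 by linarith
  qed
  have "(\<lambda>n. g * e n + C * Lpn M p f * (g powr (p - 1) + e n)) \<longlonglongrightarrow> g * 0 + C * Lpn M p f * (g powr (p - 1) + 0)"
    using P unfolding e_def by (intro tendsto_intros)
  then have "g powr p \<le> C * Lpn M p f * g powr (p - 1)"
    using bound by (intro LIMSEQ_le_const[where X="\<lambda>n. g * e n + C * Lpn M p f * (g powr (p - 1) + e n)"]) auto
  then show ?thesis
    using p C by (intro Lpn_le_dual[OF p(1)]) (auto simp: Lpn_powr Lpn_nonneg g_def)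
qed

text \<open>Density of polynomials in \<open>L_1\<close> carries the bound from \<open>T\<close> to
  \<open>Bil\<close>. The constant \<kappa> multiplies only the approximation error and disappears
  in the limit.\<close>

lemma Bil_L1_Linf:
  assumes d: "dominated m \<kappa>" and m: "mult 1 m C" and f: "integrable M f"
    and h: "h \<in> borel_measurable M" "\<And>x. x \<in> {-1..1} \<Longrightarrow> \<bar>h x\<bar> \<le> b" and C: "C \<ge> 0"
  shows "\<bar>Bil m f h\<bar> \<le> C * L1 f * b"
proof -
  have hi: "integrable M h" by (rule bounded_integrable[OF h])
  have b: "b \<ge> 0" using h(2)[of 0] by simp
  obtain P where P: "(\<lambda>n. Lpn M 1 (\<lambda>x. f x - poly (P n) x)) \<longlonglongrightarrow> 0"
    by (rule poly_dense_seq[of 1 f]) (use f in \<open>auto simp: Lpset_one\<close>)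
  define e where "e n = L1 (\<lambda>x. f x - poly (P n) x)" for n
  have e: "e \<longlonglongrightarrow> 0" using P by (simp add: e_def[abs_def] Lpn_one)
  have bound: "\<bar>Bil m f h\<bar> \<le> \<kappa> * e n * L1 h + C * (L1 f + e n) * b" for n
  proof -
    have "L1 (poly (P n)) \<le> L1 f + e n"
    proof -
      have "L1 (poly (P n)) \<le> (LINT x|M. \<bar>f x\<bar> + \<bar>f x - poly (P n) x\<bar>)"
        by (intro integral_mono Bochner_Integration.integrable_add integrable_abs Bochner_Integration.integrable_diff f poly_integrable) auto
      also have "\<dots> = L1 f + e n" unfolding e_def
        by (intro Bochner_Integration.integral_add integrable_abs Bochner_Integration.integrable_diff f poly_integrable)
      finally show ?thesis .
    qed
    then have PL: "Lpn M 1 (poly (P n)) \<le> L1 f + e n" by (simp add: Lpn_one)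
    have "Bil m f h = Bil m (\<lambda>x. f x - poly (P n) x) h + Bil m (poly (P n)) h"
      by (simp add: Bil_diff_left[OF d f poly_integrable hi])
    moreover have "\<bar>Bil m (\<lambda>x. f x - poly (P n) x) h\<bar> \<le> \<kappa> * e n * L1 h"
      unfolding e_def by (rule Bil_bound[OF d _ hi]) (auto intro!: f poly_integrable)
    moreover have "\<bar>Bil m (poly (P n)) h\<bar> \<le> C * (L1 f + e n) * b"
    proof -
      have "\<bar>Bil m (poly (P n)) h\<bar> \<le> (LINT x|M. \<bar>poly (T m (P n)) x * h x\<bar>)"
        unfolding Bil_poly[OF hi] by (rule integral_abs_bound)
      also have "\<dots> \<le> (LINT x|M. \<bar>poly (T m (P n)) x\<bar> * b)"
      proof (rule integral_mono)
        show "integrable M (\<lambda>x. \<bar>poly (T m (P n)) x * h x\<bar>)"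
          using integrable_mult_poly[OF hi, of "T m (P n)"] by (simp add: mult.commute)
        show "integrable M (\<lambda>x. \<bar>poly (T m (P n)) x\<bar> * b)" using poly_integrable by simp
        show "\<bar>poly (T m (P n)) x * h x\<bar> \<le> \<bar>poly (T m (P n)) x\<bar> * b" if "x \<in> space M" for x
          using h(2)[of x] that by (auto simp: abs_mult intro!: mult_left_mono)
      qed
      also have "\<dots> = Lpn M 1 (poly (T m (P n))) * b" by (simp add: Lpn_one)
      also have "\<dots> \<le> C * Lpn M 1 (poly (P n)) * b" by (intro mult_right_mono multD[OF m] b)
      also have "\<dots> \<le> C * (L1 f + e n) * b" by (intro mult_right_mono mult_left_mono PL C b)
      finally show ?thesis .
    qed
    ultimately show ?thesis by linarith
  qed
  have "(\<lambda>n. \<kappa> * e n * L1 h + C * (L1 f + e n) * b) \<longlonglongrightarrow> \<kappa> * 0 * L1 h + C * (L1 f + 0) * b"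
    by (intro tendsto_intros e)
  then show ?thesis
    using bound by (intro LIMSEQ_le_const[where X="\<lambda>n. \<kappa> * e n * L1 h + C * (L1 f + e n) * b"]) auto
qed

end

section \<open>Hardy-Littlewood-Sobolev inequality\<close>

text \<open>All exponents are at most \<open>0\<close>. Counting down from the largest integer
  \<open>i0\<close> with \<open>\<theta> i0 \<le> c\<close>, the terms are dominated by a geometric
  series with ratio \<open>2 powr (- \<theta>)\<close>, whatever the finite set
  \<open>I\<close>.\<close>

lemma geometric_int_sum:
  fixes \<theta> c :: real
  assumes \<theta>: "\<theta> > 0" and I: "finite I" and le: "\<And>i::int. i \<in> I \<Longrightarrow> \<theta> * real_of_int i \<le> c"
  shows "(\<Sum>i\<in>I. 2 powr (\<theta> * real_of_int i - c)) \<le> 1 / (1 - 2 powr (- \<theta>))"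
proof -
  define i0 where "i0 = \<lfloor>c / \<theta>\<rfloor>"
  define \<rho> :: real where "\<rho> = 2 powr (- \<theta>)"
  have \<rho>: "0 < \<rho>" "\<rho> < 1" using \<theta> powr_less_mono[of "- \<theta>" 0 2] by (auto simp: \<rho>_def)
  have ii: "i \<le> i0" if "i \<in> I" for i
    using le[OF that] \<theta> by (simp add: i0_def le_floor_iff field_simps)
  have i0: "\<theta> * real_of_int i0 \<le> c"
    using mult_left_mono[OF of_int_floor_le[of "c / \<theta>"], of \<theta>] \<theta> by (simp add: i0_def)
  have "(\<Sum>i\<in>I. 2 powr (\<theta> * real_of_int i - c)) \<le> (\<Sum>i\<in>I. \<rho> ^ nat (i0 - i))"
  proof (rule sum_mono)
    fix i assume i: "i \<in> I"
    have "\<rho> ^ nat (i0 - i) = \<rho> powr real (nat (i0 - i))" using \<rho> by (simp add: powr_realpow)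
    also have "\<dots> = 2 powr (- \<theta> * real (nat (i0 - i)))" by (simp add: \<rho>_def powr_powr)
    also have "real (nat (i0 - i)) = real_of_int i0 - real_of_int i" using ii[OF i] by simp
    finally have e: "\<rho> ^ nat (i0 - i) = 2 powr (- \<theta> * (real_of_int i0 - real_of_int i))" .
    show "2 powr (\<theta> * real_of_int i - c) \<le> \<rho> ^ nat (i0 - i)"
      unfolding e using i0 by (intro powr_mono) (auto simp: algebra_simps)
  qed
  also have "\<dots> = (\<Sum>n\<in>(\<lambda>i. nat (i0 - i)) ` I. \<rho> ^ n)"
  proof (subst sum.reindex)
    show "inj_on (\<lambda>i. nat (i0 - i)) I"
      by (rule inj_onI) (use ii in \<open>simp add: eq_nat_nat_iff\<close>)
  qed simp
  also have "\<dots> \<le> (\<Sum>n. \<rho> ^ n)"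
    using \<rho> I by (intro sum_le_suminf summable_geometric) auto
  also have "\<dots> = 1 / (1 - \<rho>)" using \<rho> by (subst suminf_geometric) auto
  finally show ?thesis by (simp add: \<rho>_def)
qed

text \<open>If \<open>a \<le> b\<close>, write \<open>a\<close> as
  \<open>a powr s * a powr (1 - s)\<close> and enlarge the second factor to
  \<open>b powr (1 - s)\<close>; otherwise equality holds.\<close>

lemma min_max_powr_le:
  fixes a b s :: real
  assumes "a \<ge> 0" "b \<ge> 0" "0 < s" "s < 1"
  shows "min a b * max a b powr s \<le> a powr s * b"
proof (cases "a \<le> b")
  case True
  have "a = a powr s * a powr (1 - s)" using assms by (simp add: powr_add[symmetric])
  then have "a * b powr s = a powr s * (a powr (1 - s) * b powr s)" by (simp add: mult.assoc)
  also have "\<dots> \<le> a powr s * (b powr (1 - s) * b powr s)"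
    using assms True by (intro mult_left_mono mult_right_mono powr_mono2) auto
  also have "b powr (1 - s) * b powr s = b" using assms by (simp add: powr_add[symmetric])
  finally show ?thesis using True by (simp add: min_def max_def)
qed (simp add: min_def max_def mult.commute)

text \<open>The two bounds \<open>a\<^sup>s b\<close> and \<open>a b\<^sup>s\<close> for a pair of dyadic levels decay geometrically
  on either side of the diagonal \<open>i p = j q'\<close>.\<close>

lemma dyadic_level_sum:
  fixes p q q' s :: real and a b :: "int \<Rightarrow> real"
  assumes p: "1 < p" "p < q" and q': "1 / q + 1 / q' = 1" and s: "s = 1 / p - 1 / q"
    and I: "finite I" and ab: "\<And>i. a i \<ge> 0" "\<And>i. b i \<ge> 0"
    and A: "(\<Sum>i\<in>I. 2 powr (real_of_int i * p) * a i) \<le> 1"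
    and B: "(\<Sum>j\<in>I. 2 powr (real_of_int j * q') * b j) \<le> 1"
  shows "(\<Sum>i\<in>I. \<Sum>j\<in>I. 2 powr real_of_int i * 2 powr real_of_int j * (min (a i) (b j) * max (a i) (b j) powr s))
     \<le> 1 / (1 - 2 powr (- (p / q))) + 1 / (1 - 2 powr (- (q' * (1 - 1 / p))))"
proof -
  have q1: "1 < q" using p by simp
  have q'e: "q' = q / (q - 1)" using conj_exponent[OF q1 q'] .
  have q'1: "q' > 1" using q1 by (simp add: q'e)
  have q'q: "1 - q' = - (q' / q)" using q1 by (simp add: q'e field_simps)
  have s01: "0 < s" "s < 1"
  proof -
    have "1 / q < 1 / p" using p by (intro divide_strict_left_mono) auto
    moreover have "1 / p < 1" "0 < 1 / q" using p by auto
    ultimately show "0 < s" "s < 1" unfolding s by linarith+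
  qed
  define x y where "x i = 2 powr (real_of_int i * p) * a i" and "y j = 2 powr (real_of_int j * q') * b j" for i j
  have xy0: "x i \<ge> 0" "y i \<ge> 0" for i using ab by (auto simp: x_def y_def)
  have x1: "x i \<le> 1" if "i \<in> I" for i
    using member_le_sum[OF that, of x] xy0 I A unfolding x_def by force
  have y1: "y i \<le> 1" if "i \<in> I" for i
    using member_le_sum[OF that, of y] xy0 I B unfolding y_def by force
  have ax: "a i = 2 powr (- (real_of_int i * p)) * x i" and bY: "b i = 2 powr (- (real_of_int i * q')) * y i" for i
    by (simp_all add: x_def y_def powr_minus)
  define t where "t i j = 2 powr real_of_int i * 2 powr real_of_int j * (min (a i) (b j) * max (a i) (b j) powr s)" for i j
  \<comment> \<open>The factor with exponent \<open>s\<close> is estimated by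
    \<open>x i \<le> 1\<close> only, while \<open>y j\<close> is kept in full: it is summed last and
    its sum is at most \<open>1\<close>. In \<open>T2\<close> the roles are exchanged.\<close>
  have T1: "t i j \<le> y j * 2 powr (p / q * real_of_int i - real_of_int j * q' / q)" if i: "i \<in> I" for i j
  proof -
    have "t i j \<le> 2 powr real_of_int i * 2 powr real_of_int j * (a i powr s * b j)"
      unfolding t_def using ab s01 by (intro mult_left_mono min_max_powr_le) auto
    also have "\<dots> \<le> 2 powr real_of_int i * 2 powr real_of_int j * ((2 powr (- (real_of_int i * p)) * 1) powr s * b j)"
    proof (intro mult_left_mono mult_right_mono)
      show "a i powr s \<le> (2 powr (- (real_of_int i * p)) * 1) powr s"
        using x1[OF i] xy0 s01 ab(1)[of i] by (subst ax, intro powr_mono2 mult_left_mono) auto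
    qed (use ab in auto)
    also have "2 powr real_of_int i * 2 powr real_of_int j * ((2 powr (- (real_of_int i * p)) * 1) powr s * b j)
       = y j * (2 powr real_of_int i * 2 powr real_of_int j * (2 powr (- (real_of_int i * p) * s) * 2 powr (- (real_of_int j * q'))))"
      by (subst bY) (simp add: powr_powr mult_ac)
    also have "2 powr real_of_int i * 2 powr real_of_int j * (2 powr (- (real_of_int i * p) * s) * 2 powr (- (real_of_int j * q')))
       = 2 powr (real_of_int i + real_of_int j + (- (real_of_int i * p) * s + - (real_of_int j * q')))"
      by (simp only: powr_add)
    also have "real_of_int i + real_of_int j + (- (real_of_int i * p) * s + - (real_of_int j * q'))
       = real_of_int i * (1 - p * s) + real_of_int j * (1 - q')" by (simp add: algebra_simps)
    also have "1 - p * s = p / q" using p by (simp add: s field_simps)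
    finally show ?thesis using ab by (simp add: q'q mult.commute mult_left_mono)
  qed
  have T2: "t i j \<le> x i * 2 powr (q' * (1 - 1 / p) * real_of_int j - real_of_int i * p * (1 - 1 / p))" if j: "j \<in> I" for i j
  proof -
    have "t i j \<le> 2 powr real_of_int i * 2 powr real_of_int j * (b j powr s * a i)"
      unfolding t_def min.commute[of "a i"] max.commute[of "a i"]
      using ab s01 by (intro mult_left_mono min_max_powr_le) auto
    also have "\<dots> \<le> 2 powr real_of_int i * 2 powr real_of_int j * ((2 powr (- (real_of_int j * q')) * 1) powr s * a i)"
    proof (intro mult_left_mono mult_right_mono)
      show "b j powr s \<le> (2 powr (- (real_of_int j * q')) * 1) powr s"
        using y1[OF j] xy0 s01 ab(2)[of j] by (subst bY, intro powr_mono2 mult_left_mono) auto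
    qed (use ab in auto)
    also have "2 powr real_of_int i * 2 powr real_of_int j * ((2 powr (- (real_of_int j * q')) * 1) powr s * a i)
       = x i * (2 powr real_of_int i * 2 powr real_of_int j * (2 powr (- (real_of_int j * q') * s) * 2 powr (- (real_of_int i * p))))"
      by (subst ax) (simp add: powr_powr mult_ac)
    also have "2 powr real_of_int i * 2 powr real_of_int j * (2 powr (- (real_of_int j * q') * s) * 2 powr (- (real_of_int i * p)))
       = 2 powr (real_of_int i + real_of_int j + (- (real_of_int j * q') * s + - (real_of_int i * p)))"
      by (simp only: powr_add)
    also have "real_of_int i + real_of_int j + (- (real_of_int j * q') * s + - (real_of_int i * p))
       = real_of_int j * (1 - q' * s) + real_of_int i * (1 - p)" by (simp add: algebra_simps)
    also have "1 - q' * s = q' * (1 - 1 / p)"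
    proof -
      have "1 - q' * s = (1 + q' / q) - q' / p" by (simp add: s algebra_simps)
      also have "1 + q' / q = q'" using q'q by simp
      finally show ?thesis by (simp add: algebra_simps)
    qed
    also have "1 - p = - (p * (1 - 1 / p))" using p by (simp add: field_simps)
    finally show ?thesis using ab by (simp add: mult_ac mult_left_mono)
  qed
  have pp: "1 - 1 / p > 0" using p by simp
  define P where "P i j \<longleftrightarrow> real_of_int i * p \<le> real_of_int j * q'" for i j
  define K1 K2 where "K1 = 1 / (1 - 2 powr (- (p / q)))" and "K2 = 1 / (1 - 2 powr (- (q' * (1 - 1 / p))))"
  have K: "0 \<le> K1" "0 \<le> K2"
    using p q'1 pp powr_less_mono[of "- (p/q)" 0 2] powr_less_mono[of "- (q' * (1 - 1/p))" 0 2]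
    by (auto simp: K1_def K2_def)
  have S1: "(\<Sum>i\<in>{i\<in>I. P i j}. y j * 2 powr (p / q * real_of_int i - real_of_int j * q' / q)) \<le> y j * K1" for j
  proof -
    have "(\<Sum>i\<in>{i\<in>I. P i j}. 2 powr (p / q * real_of_int i - real_of_int j * q' / q)) \<le> K1"
      unfolding K1_def
    proof (rule geometric_int_sum)
      fix i assume "i \<in> {i \<in> I. P i j}"
      then have "real_of_int i * p / q \<le> real_of_int j * q' / q" using q1 by (intro divide_right_mono) (auto simp: P_def)
      then show "p / q * real_of_int i \<le> real_of_int j * q' / q" by (simp add: mult.commute)
    qed (use p I in auto)
    then have "y j * (\<Sum>i\<in>{i\<in>I. P i j}. 2 powr (p / q * real_of_int i - real_of_int j * q' / q)) \<le> y j * K1"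
      using xy0 by (intro mult_left_mono)
    then show ?thesis by (simp add: sum_distrib_left)
  qed
  have S2: "(\<Sum>j\<in>{j\<in>I. \<not> P i j}. x i * 2 powr (q' * (1 - 1 / p) * real_of_int j - real_of_int i * p * (1 - 1 / p))) \<le> x i * K2" for i
  proof -
    have "(\<Sum>j\<in>{j\<in>I. \<not> P i j}. 2 powr (q' * (1 - 1 / p) * real_of_int j - real_of_int i * p * (1 - 1 / p))) \<le> K2"
      unfolding K2_def
    proof (rule geometric_int_sum)
      fix j assume "j \<in> {j \<in> I. \<not> P i j}"
      then have "(real_of_int j * q') * (1 - 1 / p) \<le> (real_of_int i * p) * (1 - 1 / p)"
        using pp by (intro mult_right_mono) (auto simp: P_def)
      then show "q' * (1 - 1 / p) * real_of_int j \<le> real_of_int i * p * (1 - 1 / p)" by (simp only: mult_ac)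
    qed (use pp q'1 I in auto)
    then have "x i * (\<Sum>j\<in>{j\<in>I. \<not> P i j}. 2 powr (q' * (1 - 1 / p) * real_of_int j - real_of_int i * p * (1 - 1 / p))) \<le> x i * K2"
      using xy0 by (intro mult_left_mono)
    then show ?thesis by (simp add: sum_distrib_left)
  qed
  have "(\<Sum>i\<in>I. \<Sum>j\<in>I. t i j) = (\<Sum>i\<in>I. (\<Sum>j\<in>I. if P i j then t i j else 0) + (\<Sum>j\<in>I. if \<not> P i j then t i j else 0))"
    by (rule sum.cong[OF refl], subst sum.distrib[symmetric], rule sum.cong[OF refl]) simp
  also have "\<dots> = (\<Sum>j\<in>I. \<Sum>i\<in>I. if P i j then t i j else 0) + (\<Sum>i\<in>I. \<Sum>j\<in>I. if \<not> P i j then t i j else 0)"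
    by (subst sum.distrib, subst sum.swap) (rule refl)
  also have "(\<Sum>j\<in>I. \<Sum>i\<in>I. if P i j then t i j else 0) = (\<Sum>j\<in>I. \<Sum>i\<in>{i\<in>I. P i j}. t i j)"
    by (rule sum.cong[OF refl], rule sum.inter_filter[OF I, symmetric])
  also have "(\<Sum>i\<in>I. \<Sum>j\<in>I. if \<not> P i j then t i j else 0) = (\<Sum>i\<in>I. \<Sum>j\<in>{j\<in>I. \<not> P i j}. t i j)"
    by (rule sum.cong[OF refl], rule sum.inter_filter[OF I, symmetric])
  also have "(\<Sum>j\<in>I. \<Sum>i\<in>{i\<in>I. P i j}. t i j) + (\<Sum>i\<in>I. \<Sum>j\<in>{j\<in>I. \<not> P i j}. t i j) \<le> (\<Sum>j\<in>I. y j * K1) + (\<Sum>i\<in>I. x i * K2)"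
  proof (intro add_mono sum_mono)
    fix j
    show "(\<Sum>i\<in>{i\<in>I. P i j}. t i j) \<le> y j * K1"
      by (rule order_trans[OF _ S1], rule sum_mono, rule T1) simp
  next
    fix i
    show "(\<Sum>j\<in>{j\<in>I. \<not> P i j}. t i j) \<le> x i * K2"
      by (rule order_trans[OF _ S2], rule sum_mono, rule T2) simp
  qed
  also have "\<dots> \<le> 1 * K1 + 1 * K2"
    unfolding sum_distrib_right[symmetric] using A B K by (intro add_mono mult_right_mono) (auto simp: x_def y_def)
  finally show ?thesis by (simp add: t_def K1_def K2_def)
qed

section \<open>Negative powers as integrals of resolvent powers\<close>

lemma lint_powr_0:
  fixes e \<tau> :: real assumes "e > 0" "\<tau> \<ge> 0"
  shows "integrable lborel (\<lambda>\<mu>. indicator {0..\<tau>} \<mu> * \<mu> powr (e - 1))"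
    "(LINT \<mu>|lborel. indicator {0..\<tau>} \<mu> * \<mu> powr (e - 1)) = \<tau> powr e / e"
proof -
  have hi: "((\<lambda>\<mu>. \<mu> powr (e - 1)) has_integral \<tau> powr e / e) {0..\<tau>}"
    using has_integral_powr_from_0[of "e - 1" \<tau>] assms by simp
  then have ai: "(\<lambda>\<mu>::real. \<mu> powr (e - 1)) absolutely_integrable_on {0..\<tau>}"
    by (intro nonnegative_absolutely_integrable_1) (auto simp: integrable_on_def)
  then have "integrable lebesgue (\<lambda>\<mu>::real. indicator {0..\<tau>} \<mu> * \<mu> powr (e - 1))"
    by (simp add: set_integrable_def)
  then show "integrable lborel (\<lambda>\<mu>. indicator {0..\<tau>} \<mu> * \<mu> powr (e - 1))"
    by (subst (asm) integrable_completion) auto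
  have "(LINT \<mu>|lborel. indicator {0..\<tau>} \<mu> * \<mu> powr (e - 1)) = (LINT \<mu>|lebesgue. indicator {0..\<tau>} \<mu> * \<mu> powr (e - 1))"
    by (subst integral_completion) auto
  also have "\<dots> = integral {0..\<tau>} (\<lambda>\<mu>. \<mu> powr (e - 1))"
    using set_lebesgue_integral_eq_integral(2)[OF ai] by (simp add: set_lebesgue_integral_def)
  also have "\<dots> = \<tau> powr e / e" using hi by (rule integral_unique)
  finally show "(LINT \<mu>|lborel. indicator {0..\<tau>} \<mu> * \<mu> powr (e - 1)) = \<tau> powr e / e" .
qed

lemma lint_powr_inf:
  fixes e \<tau> :: real assumes "e > 0" "\<tau> > 0"
  shows "integrable lborel (\<lambda>\<mu>. indicator {\<tau>..} \<mu> * \<mu> powr (- e - 1))"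
    "(LINT \<mu>|lborel. indicator {\<tau>..} \<mu> * \<mu> powr (- e - 1)) = \<tau> powr (- e) / e"
proof -
  have hi: "((\<lambda>\<mu>. \<mu> powr (- e - 1)) has_integral \<tau> powr (- e) / e) {\<tau>..}"
    using has_integral_powr_to_inf[of "- e - 1" \<tau>] assms by simp
  then have ai: "(\<lambda>\<mu>::real. \<mu> powr (- e - 1)) absolutely_integrable_on {\<tau>..}"
    by (intro nonnegative_absolutely_integrable_1) (auto simp: integrable_on_def)
  then have "integrable lebesgue (\<lambda>\<mu>::real. indicator {\<tau>..} \<mu> * \<mu> powr (- e - 1))"
    by (simp add: set_integrable_def)
  then show "integrable lborel (\<lambda>\<mu>. indicator {\<tau>..} \<mu> * \<mu> powr (- e - 1))"
    by (subst (asm) integrable_completion) auto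
  have "(LINT \<mu>|lborel. indicator {\<tau>..} \<mu> * \<mu> powr (- e - 1)) = (LINT \<mu>|lebesgue. indicator {\<tau>..} \<mu> * \<mu> powr (- e - 1))"
    by (subst integral_completion) auto
  also have "\<dots> = integral {\<tau>..} (\<lambda>\<mu>. \<mu> powr (- e - 1))"
    using set_lebesgue_integral_eq_integral(2)[OF ai] by (simp add: set_lebesgue_integral_def)
  also have "\<dots> = \<tau> powr (- e) / e" using hi by (rule integral_unique)
  finally show "(LINT \<mu>|lborel. indicator {\<tau>..} \<mu> * \<mu> powr (- e - 1)) = \<tau> powr (- e) / e" .
qed

text \<open>The integrand in the representation of \<open>u powr (- e)\<close> as a constant times
  the integral over \<open>\<mu> > 0\<close> of
  \<open>\<mu> powr (e - 1) * (1 + \<mu> u)^(- m)\<close>, convergent for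
  \<open>0 < e < m\<close>.\<close>

definition rk :: "real \<Rightarrow> nat \<Rightarrow> real \<Rightarrow> real \<Rightarrow> real" where
  "rk e m u \<mu> = \<mu> powr (e - 1) * (1 / (1 + \<mu> * u)) ^ m"

lemma rk_measurable [measurable]: "rk e m u \<in> borel_measurable borel"
  unfolding rk_def[abs_def] by measurable

lemma rk_nonneg: "0 \<le> u \<Longrightarrow> 0 \<le> \<mu> \<Longrightarrow> 0 \<le> rk e m u \<mu>"
  by (simp add: rk_def)

lemma rk_le_1: assumes "0 \<le> u" "0 \<le> \<mu>" shows "rk e m u \<mu> \<le> \<mu> powr (e - 1)"
proof -
  have "0 \<le> \<mu> * u" using assms by simp
  then have "(1 / (1 + \<mu> * u)) ^ m \<le> 1" by (intro power_le_one) auto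
  then show ?thesis unfolding rk_def using mult_left_mono[of _ 1 "\<mu> powr (e - 1)"] by simp
qed

lemma rk_le_2: assumes "0 < u" "0 < \<mu>" shows "rk e m u \<mu> \<le> (1 / u) ^ m * \<mu> powr (- (real m - e) - 1)"
proof -
  have "(1 / (1 + \<mu> * u)) ^ m \<le> (1 / (\<mu> * u)) ^ m"
    using assms by (intro power_mono frac_le) auto
  then have "rk e m u \<mu> \<le> \<mu> powr (e - 1) * (1 / (\<mu> * u)) ^ m" unfolding rk_def by (intro mult_left_mono) auto
  also have "(1 / (\<mu> * u)) ^ m = (1 / u) ^ m * \<mu> powr (- real m)"
    using assms by (simp add: power_divide power_mult_distrib powr_minus powr_realpow divide_inverse power_inverse)
  also have "\<mu> powr (e - 1) * ((1 / u) ^ m * \<mu> powr (- real m)) = (1 / u) ^ m * (\<mu> powr (e - 1) * \<mu> powr (- real m))"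
    by (simp only: mult_ac)
  also have "\<mu> powr (e - 1) * \<mu> powr (- real m) = \<mu> powr ((e - 1) + (- real m))" by (simp only: powr_add)
  also have "(e - 1) + (- real m) = - (real m - e) - 1" by simp
  finally show ?thesis .
qed

lemma rk_integrable_0:
  assumes "0 < e" "0 \<le> u" shows "integrable lborel (\<lambda>\<mu>. indicator {0<..1} \<mu> * rk e m u \<mu>)"
proof (rule Bochner_Integration.integrable_bound[OF lint_powr_0(1)[OF assms(1) zero_le_one]])
  show "AE \<mu> in lborel. norm (indicator {0<..1} \<mu> * rk e m u \<mu>) \<le> norm (indicator {0..1} \<mu> * \<mu> powr (e - 1))"
    using assms by (intro AE_I2) (auto simp: indicator_def rk_le_1 rk_nonneg)
qed measurable

lemma rk_integrable_inf:
  assumes "e < real m" "0 < u" shows "integrable lborel (\<lambda>\<mu>. indicator {1<..} \<mu> * rk e m u \<mu>)"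
    "(LINT \<mu>|lborel. indicator {1<..} \<mu> * rk e m u \<mu>) \<le> (1 / u) ^ m / (real m - e)"
proof -
  have b: "indicator {1<..} \<mu> * rk e m u \<mu> \<le> (1 / u) ^ m * (indicator {1..} \<mu> * \<mu> powr (- (real m - e) - 1))" for \<mu>
    using rk_le_2[OF assms(2), of \<mu> e m] assms by (auto simp: indicator_def)
  have i: "integrable lborel (\<lambda>\<mu>. (1 / u) ^ m * (indicator {1..} \<mu> * \<mu> powr (- (real m - e) - 1)))"
    using assms by (intro integrable_mult_right lint_powr_inf) auto
  show i1: "integrable lborel (\<lambda>\<mu>. indicator {1<..} \<mu> * rk e m u \<mu>)"
  proof (rule Bochner_Integration.integrable_bound[OF i])
    show "AE \<mu> in lborel. norm (indicator {1<..} \<mu> * rk e m u \<mu>) \<le> norm ((1 / u) ^ m * (indicator {1..} \<mu> * \<mu> powr (- (real m - e) - 1)))"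
    proof (intro AE_I2)
      fix \<mu> :: real
      have "0 \<le> indicator {1<..} \<mu> * rk e m u \<mu>" using assms by (auto simp: indicator_def intro: rk_nonneg)
      then show "norm (indicator {1<..} \<mu> * rk e m u \<mu>) \<le> norm ((1 / u) ^ m * (indicator {1..} \<mu> * \<mu> powr (- (real m - e) - 1)))"
        using b[of \<mu>] by simp
    qed
  qed measurable
  have "(LINT \<mu>|lborel. indicator {1<..} \<mu> * rk e m u \<mu>) \<le> (LINT \<mu>|lborel. (1 / u) ^ m * (indicator {1..} \<mu> * \<mu> powr (- (real m - e) - 1)))"
    by (rule integral_mono[OF i1 i b])
  also have "\<dots> = (1 / u) ^ m * (1 powr (- (real m - e)) / (real m - e))"
    using lint_powr_inf(2)[of "real m - e" 1] assms by (simp only: integral_mult_right_zero diff_gt_0_iff_gt zero_less_one)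
  finally show "(LINT \<mu>|lborel. indicator {1<..} \<mu> * rk e m u \<mu>) \<le> (1 / u) ^ m / (real m - e)" by simp
qed

text \<open>For \<open>0 < e < m\<close> this is the beta function at
  \<open>(e, m - e)\<close>.\<close>

definition rc :: "real \<Rightarrow> nat \<Rightarrow> real" where
  "rc e m = (LINT \<mu>|lborel. indicator {0<..} \<mu> * rk e m 1 \<mu>)"

text \<open>Scaling \<mu> by \<open>1 / u\<close>. The integral is split at \<open>\<mu> = 1\<close>
  because the kernel bounds are available for \<open>\<mu> \<le> 1\<close> only.\<close>

lemma rk_integral:
  assumes e: "0 < e" "e < real m" and u: "0 < u"
  shows "(LINT \<mu>|lborel. indicator {0<..1} \<mu> * rk e m u \<mu>) + (LINT \<mu>|lborel. indicator {1<..} \<mu> * rk e m u \<mu>) = rc e m * u powr (- e)"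
proof -
  have "(LINT \<mu>|lborel. indicator {0<..1} \<mu> * rk e m u \<mu>) + (LINT \<mu>|lborel. indicator {1<..} \<mu> * rk e m u \<mu>)
     = (LINT \<mu>|lborel. indicator {0<..1} \<mu> * rk e m u \<mu> + indicator {1<..} \<mu> * rk e m u \<mu>)"
    using rk_integrable_0[OF e(1), of u m] rk_integrable_inf(1)[OF e(2) u] u by simp
  also have "\<dots> = (LINT \<mu>|lborel. indicator {0<..} \<mu> * rk e m u \<mu>)"
    by (intro Bochner_Integration.integral_cong) (auto simp: indicator_def)
  also have "\<dots> = \<bar>1 / u\<bar> *\<^sub>R (LINT \<mu>|lborel. indicator {0<..} (0 + 1 / u * \<mu>) * rk e m u (0 + 1 / u * \<mu>))"
    using u by (intro lborel_integral_real_affine) auto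
  also have "\<dots> = (1 / u) * (LINT \<mu>|lborel. (1 / u) powr (e - 1) * (indicator {0<..} \<mu> * rk e m 1 \<mu>))"
  proof -
    have "indicator {0<..} (0 + 1 / u * \<mu>) * rk e m u (0 + 1 / u * \<mu>) = (1 / u) powr (e - 1) * (indicator {0<..} \<mu> * rk e m 1 \<mu>)" for \<mu>
      using u by (cases "\<mu> > 0") (auto simp: rk_def powr_mult indicator_def zero_less_divide_iff powr_divide)
    then show ?thesis using u by simp
  qed
  also have "\<dots> = (1 / u) * (1 / u) powr (e - 1) * rc e m" by (simp add: rc_def)
  also have "(1 / u) * (1 / u) powr (e - 1) = (1 / u) powr e" using powr_mult_base[of "1 / u" "e - 1"] u by simp
  also have "(1 / u) powr e = u powr (- e)" using u by (simp add: powr_divide powr_minus_divide)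
  finally show ?thesis by (simp add: mult.commute)
qed

lemma rc_pos: assumes e: "0 < e" "e < real m" shows "rc e m > 0"
proof -
  have i: "integrable lborel (\<lambda>\<mu>. indicator {0<..1} \<mu> * rk e m 1 \<mu> + indicator {1<..} \<mu> * rk e m 1 \<mu>)"
    using rk_integrable_0[OF e(1), of 1 m] rk_integrable_inf(1)[OF e(2), of 1] by simp
  have i2: "integrable lborel (\<lambda>\<mu>. indicator {0<..} \<mu> * rk e m 1 \<mu>)"
    using i by (rule Bochner_Integration.integrable_cong[THEN iffD1, rotated 2]) (auto simp: indicator_def)
  define l where "l = min 1 (2 powr (e - 1)) * (1 / 3) ^ m"
  have "(LINT \<mu>|lborel. indicator {1..2::real} \<mu> * l) \<le> rc e m"
    unfolding rc_def
  proof (rule integral_mono[OF _ i2])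
    fix \<mu> :: real
    show "indicator {1..2} \<mu> * l \<le> indicator {0<..} \<mu> * rk e m 1 \<mu>"
    proof (cases "\<mu> \<in> {1..2}")
      case True
      have "min 1 (2 powr (e - 1)) \<le> \<mu> powr (e - 1)"
      proof (cases "e \<ge> 1")
        case True then show ?thesis using \<open>\<mu> \<in> {1..2}\<close> by (auto simp: min_le_iff_disj ge_one_powr_ge_zero)
      next
        case False then have "2 powr (e - 1) \<le> \<mu> powr (e - 1)" using \<open>\<mu> \<in> {1..2}\<close> by (intro powr_mono2') auto
        then show ?thesis by (simp add: min_le_iff_disj)
      qed
      moreover have "(1 / 3) ^ m \<le> (1 / (1 + \<mu> * 1)) ^ m" using True by (intro power_mono frac_le) auto
      ultimately have "l \<le> rk e m 1 \<mu>" unfolding l_def rk_def by (intro mult_mono) auto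
      then show ?thesis using True by (simp add: indicator_def)
    next
      case False then show ?thesis by (auto simp: indicator_def intro: rk_nonneg)
    qed
  qed (intro integrable_mult_left integrable_real_indicator, auto)
  moreover have "(LINT \<mu>|lborel. indicator {1..2::real} \<mu> * l) = l" by (simp add: content_real)
  moreover have "l > 0" by (simp add: l_def)
  ultimately show ?thesis by simp
qed

context jacobi
begin

text \<open>The least integer above \<open>\<alpha> + 1\<close>: that power of the resolvent has a
  bounded kernel by \<open>kernel_bound\<close>.\<close>

definition mm :: nat where "mm = nat \<lfloor>\<alpha> + 1\<rfloor> + 1"

lemma mm_gt: "\<alpha> + 1 < real mm"
  using alpha_gt by (simp add: mm_def) linarith

lemma kernel_dom:
  obtains \<kappa> where "\<kappa> > 0" "\<And>\<mu>. 0 < \<mu> \<Longrightarrow> \<mu> \<le> 1 \<Longrightarrow> dominated (\<lambda>k. (1 / (1 + \<mu> * lam2 k)) ^ mm) (\<kappa> * \<mu> powr (- (\<alpha> + 1)))"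
proof (rule kernel_bound[OF mm_gt])
  fix C assume C: "C > 0" "\<And>\<mu> x n. 0 < \<mu> \<Longrightarrow> \<mu> \<le> 1 \<Longrightarrow> x \<in> {-1..1} \<Longrightarrow>
    (\<Sum>k\<le>n. (1 / (1 + \<mu> * lam2 k)) ^ mm * (poly (\<psi> k) x)\<^sup>2) \<le> C * \<mu> powr (- (\<alpha> + 1))"
  show thesis
  proof (rule that[OF C(1)])
    fix \<mu> :: real assume mu: "0 < \<mu>" "\<mu> \<le> 1"
    have "\<bar>(1 / (1 + \<mu> * lam2 k)) ^ mm\<bar> = (1 / (1 + \<mu> * lam2 k)) ^ mm" for k
      using mu by (intro abs_of_nonneg zero_le_power) simp
    then show "dominated (\<lambda>k. (1 / (1 + \<mu> * lam2 k)) ^ mm) (C * \<mu> powr (- (\<alpha> + 1)))"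
      using C mu by (simp add: dominated_def)
  qed
qed

lemma dom_weaken: assumes "dominated m \<kappa>" "c \<ge> 0" "\<And>k. \<bar>m' k\<bar> \<le> c * \<bar>m k\<bar>" shows "dominated m' (c * \<kappa>)"
  unfolding dominated_def
proof (intro conjI ballI allI)
  show "0 \<le> c * \<kappa>" using assms by (simp add: dominated_def)
  fix x :: real and n assume x: "x \<in> {-1..1}"
  have "(\<Sum>k\<le>n. \<bar>m' k\<bar> * (poly (\<psi> k) x)\<^sup>2) \<le> (\<Sum>k\<le>n. c * \<bar>m k\<bar> * (poly (\<psi> k) x)\<^sup>2)"
    by (intro sum_mono mult_right_mono assms) auto
  also have "\<dots> = c * (\<Sum>k\<le>n. \<bar>m k\<bar> * (poly (\<psi> k) x)\<^sup>2)" by (simp add: sum_distrib_left mult.assoc)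
  also have "\<dots> \<le> c * \<kappa>" using assms x by (intro mult_left_mono) (auto simp: dominated_def)
  finally show "(\<Sum>k\<le>n. \<bar>m' k\<bar> * (poly (\<psi> k) x)\<^sup>2) \<le> c * \<kappa>" .
qed

text \<open>Comparison with the resolvent power at the fixed parameter \<open>\<mu> = 1\<close>.
  This is a qualitative condition, used for convergence; its constant may depend on
  \<open>t\<close>.\<close>

definition rapid :: "(nat \<Rightarrow> real) \<Rightarrow> bool" where
  "rapid m \<longleftrightarrow> (\<exists>C\<ge>0. \<forall>k. \<bar>m k\<bar> \<le> C * (1 / (1 + lam2 k)) ^ mm)"

lemma rapid_dom: assumes "rapid m" obtains \<kappa> where "dominated m \<kappa>"
proof -
  obtain C where C: "C \<ge> 0" "\<And>k. \<bar>m k\<bar> \<le> C * (1 / (1 + lam2 k)) ^ mm" using assms by (auto simp: rapid_def)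
  obtain \<kappa> where "dominated (\<lambda>k. (1 / (1 + 1 * lam2 k)) ^ mm) \<kappa>"
    by (rule kernel_dom) (metis zero_less_one order_refl)
  then have "dominated m (C * \<kappa>)"
    by (rule dom_weaken[OF _ C(1)]) (use C(2) in simp)
  then show ?thesis by (rule that)
qed

section \<open>Bounded functions and convergence of the bilinear form\<close>

definition bdd :: "(real \<Rightarrow> real) \<Rightarrow> bool" where
  "bdd f \<longleftrightarrow> f \<in> borel_measurable M \<and> (\<exists>B. \<forall>x\<in>{-1..1}. \<bar>f x\<bar> \<le> B)"

lemma bdd_integrable: "bdd f \<Longrightarrow> integrable M f"
  unfolding bdd_def by (auto intro: bounded_integrable)

lemma bdd_Lp: "bdd f \<Longrightarrow> p > 0 \<Longrightarrow> f \<in> Lpset M p"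
  unfolding bdd_def by (elim conjE exE) (rule Lpset_bounded[OF finite_measure_M], auto)

lemma bdd_add: assumes "bdd f" "bdd g" shows "bdd (\<lambda>x. f x + g x)"
proof -
  obtain A B where "\<forall>x\<in>{-1..1}. \<bar>f x\<bar> \<le> A" "\<forall>x\<in>{-1..1}. \<bar>g x\<bar> \<le> B" using assms by (auto simp: bdd_def)
  then have "\<forall>x\<in>{-1..1}. \<bar>f x + g x\<bar> \<le> A + B"
    by (intro ballI order_trans[OF abs_triangle_ineq] add_mono) auto
  then show ?thesis using assms by (auto simp: bdd_def)
qed

lemma bdd_mult: assumes "bdd f" "bdd g" shows "bdd (\<lambda>x. f x * g x)"
proof -
  obtain A B where "\<forall>x\<in>{-1..1}. \<bar>f x\<bar> \<le> A" "\<forall>x\<in>{-1..1}. \<bar>g x\<bar> \<le> B" using assms by (auto simp: bdd_def)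
  then have "\<forall>x\<in>{-1..1}. \<bar>f x\<bar> * \<bar>g x\<bar> \<le> A * B"
    by (intro ballI mult_mono') auto
  then show ?thesis using assms unfolding bdd_def abs_mult by (intro conjI borel_measurable_times exI[of _ "A * B"]) auto
qed

lemma bdd_const: "bdd (\<lambda>x. c)" by (auto simp: bdd_def)

lemma bdd_indicator: "A \<in> sets M \<Longrightarrow> bdd (indicator A)"
  by (auto simp: bdd_def indicator_def intro!: exI[of _ 1])

lemma bdd_le: "bdd g \<Longrightarrow> f \<in> borel_measurable M \<Longrightarrow> (\<And>x. x \<in> {-1..1} \<Longrightarrow> \<bar>f x\<bar> \<le> \<bar>g x\<bar>) \<Longrightarrow> bdd f"
  unfolding bdd_def by (meson order_trans)

lemma bdd_sum: "finite I \<Longrightarrow> (\<And>i. i \<in> I \<Longrightarrow> bdd (f i)) \<Longrightarrow> bdd (\<lambda>x. \<Sum>i\<in>I. f i x)"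
  by (induction I rule: finite_induct) (auto intro: bdd_const bdd_add)

lemma bessel: assumes f: "bdd f" shows "(\<Sum>k\<le>n. (co f k)\<^sup>2) \<le> (LINT x|M. (f x)\<^sup>2)"
proof -
  define P where "P = (\<Sum>k\<le>n. smult (co f k) (\<psi> k))"
  have coP: "co (poly P) k = (if k \<le> n then co f k else 0)" for k unfolding P_def by (subst co_sum_psi) auto
  have dP: "degree P \<le> n" unfolding P_def by (intro degree_sum_le) (auto intro: order_trans[OF degree_smult_le])
  have ip: "(LINT x|M. poly P x * h x) = (\<Sum>k\<le>n. co f k * co h k)" if "integrable M h" for h
  proof -
    have "(LINT x|M. poly P x * h x) = (LINT x|M. poly (T (\<lambda>_. 1) P) x * h x)" by (simp add: T_const)
    also have "\<dots> = (\<Sum>k\<le>degree P. co (poly P) k * co h k)" by (subst integral_T[OF that]) simp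
    also have "\<dots> = (\<Sum>k\<le>n. co (poly P) k * co h k)"
      using dP by (intro sum.mono_neutral_left) (auto simp: co_high)
    finally show ?thesis by (simp add: coP)
  qed
  have fi: "integrable M f" by (rule bdd_integrable[OF f])
  have f2: "integrable M (\<lambda>x. (f x)\<^sup>2)" using bdd_integrable[OF bdd_mult[OF f f]] by (simp add: power2_eq_square)
  have Pf: "integrable M (\<lambda>x. poly P x * f x)" using integrable_mult_poly[OF fi, of P] by (simp add: mult.commute)
  have PP: "integrable M (\<lambda>x. poly P x * poly P x)" by (intro continuous_integrable continuous_intros)
  have "0 \<le> (LINT x|M. (f x - poly P x)\<^sup>2)" by simp
  also have "\<dots> = (LINT x|M. (f x)\<^sup>2 - 2 * (poly P x * f x) + poly P x * poly P x)"
    by (intro Bochner_Integration.integral_cong) (auto simp: power2_eq_square algebra_simps)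
  also have "\<dots> = (LINT x|M. (f x)\<^sup>2) - 2 * (LINT x|M. poly P x * f x) + (LINT x|M. poly P x * poly P x)"
    using f2 Pf PP by simp
  also have "(LINT x|M. poly P x * f x) = (\<Sum>k\<le>n. (co f k)\<^sup>2)" using ip[OF fi] by (simp add: power2_eq_square)
  also have "(LINT x|M. poly P x * poly P x) = (\<Sum>k\<le>n. (co f k)\<^sup>2)"
    using ip[OF poly_integrable, of P] by (simp add: power2_eq_square coP)
  finally show ?thesis by simp
qed

text \<open>Bessel's inequality for both functions. It makes \<open>Bil m f h\<close> converge for
  every bounded symbol \<open>m\<close>, with no decay required of it.\<close>

lemma bdd_co_summable:
  assumes "bdd f" "bdd h" shows "summable (\<lambda>k. \<bar>co f k * co h k\<bar>)"
proof -
  have "(\<Sum>k\<le>n. \<bar>co f k * co h k\<bar>) \<le> (LINT x|M. (f x)\<^sup>2) + (LINT x|M. (h x)\<^sup>2)" for n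
  proof -
    have "(\<Sum>k\<le>n. \<bar>co f k * co h k\<bar>) \<le> (\<Sum>k\<le>n. (co f k)\<^sup>2 + (co h k)\<^sup>2)"
    proof (rule sum_mono)
      fix k
      have "2 * \<bar>co f k\<bar> * \<bar>co h k\<bar> \<le> (co f k)\<^sup>2 + (co h k)\<^sup>2"
        using sum_squares_bound[of "\<bar>co f k\<bar>" "\<bar>co h k\<bar>"] by simp
      moreover have "0 \<le> \<bar>co f k\<bar> * \<bar>co h k\<bar>" by simp
      ultimately show "\<bar>co f k * co h k\<bar> \<le> (co f k)\<^sup>2 + (co h k)\<^sup>2" by (simp only: abs_mult)
    qed
    also have "\<dots> \<le> (LINT x|M. (f x)\<^sup>2) + (LINT x|M. (h x)\<^sup>2)"
      unfolding sum.distrib by (intro add_mono bessel assms)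
    finally show ?thesis .
  qed
  then show ?thesis by (rule abs_summable_of_bounded(1))
qed

lemma bdd_Bil_summable:
  assumes f: "bdd f" "bdd h" and m: "\<And>k. \<bar>m k\<bar> \<le> c"
  shows "summable (\<lambda>k. m k * co f k * co h k)"
proof (rule summable_comparison_test')
  show "summable (\<lambda>k. c * \<bar>co f k * co h k\<bar>)" by (intro summable_mult bdd_co_summable f)
  show "norm (m k * co f k * co h k) \<le> c * \<bar>co f k * co h k\<bar>" for k
    using mult_right_mono[OF m, of "\<bar>co f k * co h k\<bar>" k] by (simp add: abs_mult mult.assoc)
qed

lemma bdd_Bil_add:
  assumes "bdd f" "bdd g" "bdd h" and m: "\<And>k. \<bar>m k\<bar> \<le> c"
  shows "Bil m (\<lambda>x. f x + g x) h = Bil m f h + Bil m g h"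
proof -
  have "(\<lambda>k. m k * co (\<lambda>x. f x + g x) k * co h k) = (\<lambda>k. m k * co f k * co h k + m k * co g k * co h k)"
    by (simp add: co_add bdd_integrable assms algebra_simps)
  then show ?thesis
    using suminf_add[OF bdd_Bil_summable[OF assms(1,3) m] bdd_Bil_summable[OF assms(2,3) m]]
    by (simp add: Bil_def)
qed

lemma bdd_Bil_sum:
  assumes "finite I" "\<And>i. i \<in> I \<Longrightarrow> bdd (f i)" "bdd h" and m: "\<And>k. \<bar>m k\<bar> \<le> c"
  shows "Bil m (\<lambda>x. \<Sum>i\<in>I. f i x) h = (\<Sum>i\<in>I. Bil m (f i) h)"
  using assms(1,2)
proof (induction I rule: finite_induct)
  case empty show ?case by (simp add: Bil_def co_zero)
next
  case (insert i I)
  then show ?case using bdd_Bil_add[OF _ bdd_sum assms(3) m, of "f i" I f] by simp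
qed

lemma L1_level:
  assumes "f \<in> borel_measurable M" "A \<in> sets M" "\<And>x. x \<in> {-1..1} \<Longrightarrow> \<bar>f x\<bar> \<le> u * indicator A x"
  shows "L1 f \<le> u * measure M A"
proof -
  have As: "A \<inter> {-1..1} = A" using sets.sets_into_space[OF assms(2)] by auto
  have "L1 f \<le> (LINT x|M. u * indicator A x)"
  proof (rule integral_mono)
    show i: "integrable M (\<lambda>x. u * indicator A x)"
      by (intro integrable_mult_right bdd_integrable bdd_indicator assms)
    show "integrable M (\<lambda>x. \<bar>f x\<bar>)"
      by (rule Bochner_Integration.integrable_bound[OF i]) (use assms in \<open>auto intro!: AE_I2 order_trans[OF assms(3) abs_ge_self]\<close>)
  qed (use assms in auto)
  then show ?thesis by (simp add: As)
qed

text \<open>The symbol of the power \<open>- e\<close> of the Jacobi operator on functions of mean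
  zero; constants are sent to \<open>0\<close>.\<close>

definition ml :: "real \<Rightarrow> nat \<Rightarrow> real" where
  "ml e k = (if k = 0 then 0 else lam2 k powr (- e))"

text \<open>The part over \<open>\<mu> \<le> 1\<close> of the integral representing \<open>ml e k\<close>; the remaining part has a bounded kernel.\<close>

definition mJ :: "real \<Rightarrow> nat \<Rightarrow> real" where
  "mJ e k = (LINT \<mu>|lborel. indicator {0<..1} \<mu> * rk e mm (lam2 k) \<mu>)"

lemma mJ_bounds: assumes "0 < e" shows "0 \<le> mJ e k" "mJ e k \<le> 1 / e"
proof -
  show "0 \<le> mJ e k" unfolding mJ_def
    by (intro Bochner_Integration.integral_nonneg) (auto simp: indicator_def intro: rk_nonneg)
  have "mJ e k \<le> (LINT \<mu>|lborel. indicator {0..1} \<mu> * \<mu> powr (e - 1))"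
    unfolding mJ_def using assms
    by (intro integral_mono rk_integrable_0 lint_powr_0) (auto simp: indicator_def rk_le_1)
  then show "mJ e k \<le> 1 / e" using lint_powr_0(2)[OF assms, of 1] by simp
qed

lemma ml_bounded: assumes "0 < e" shows "\<bar>ml e k\<bar> \<le> 2 powr e"
proof (cases "k = 0")
  case False
  then have l: "1 / 2 \<le> lam2 k" by (intro lam2_pos) simp
  have "lam2 k powr (- e) \<le> (1 / 2) powr (- e)" using l assms by (intro powr_mono2') auto
  also have "\<dots> = 2 powr e" by (simp add: powr_minus_divide powr_divide)
  finally show ?thesis using False by (simp add: ml_def)
qed (simp add: ml_def)

text \<open>For \<open>k \<ge> 1\<close> the difference is the integral over
  \<open>\<mu> > 1\<close>, which is of size \<open>lam2 k\<close> to the power \<open>- mm\<close>.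
  The symbol is therefore rapid and has a bounded kernel.\<close>

lemma ml_decomp:
  assumes e: "0 < e" "e < real mm"
  obtains \<kappa> where "dominated (\<lambda>k. rc e mm * ml e k - mJ e k) \<kappa>" "\<And>k. \<bar>rc e mm * ml e k - mJ e k\<bar> \<le> \<kappa>"
proof -
  \<comment> \<open>The summand \<open>1 / e\<close> serves \<open>k = 0\<close>, where
    \<open>ml\<close> vanishes and the difference is \<open>- mJ\<close>. The power of 3 comes from
    \<open>1 / lam2 k \<le> 3 / (1 + lam2 k)\<close>, valid because
    \<open>lam2 k \<ge> 1/2\<close>.\<close>
  define D where "D = 1 / e + 3 ^ mm / (real mm - e)"
  have D0: "D \<ge> 0" using e by (simp add: D_def)
  have b: "\<bar>rc e mm * ml e k - mJ e k\<bar> \<le> D * (1 / (1 + lam2 k)) ^ mm" for k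
  proof (cases "k = 0")
    case True
    have "\<bar>rc e mm * ml e k - mJ e k\<bar> \<le> 1 / e" using mJ_bounds[OF e(1), of k] True by (simp add: ml_def)
    also have "\<dots> \<le> D" using e by (simp add: D_def)
    finally show ?thesis using True by simp
  next
    case False
    then have l: "1 / 2 \<le> lam2 k" by (intro lam2_pos) simp
    then have l0: "0 < lam2 k" by simp
    have "rc e mm * ml e k - mJ e k = (LINT \<mu>|lborel. indicator {1<..} \<mu> * rk e mm (lam2 k) \<mu>)"
      using rk_integral[OF e l0] False by (simp add: ml_def mJ_def)
    moreover have "0 \<le> (LINT \<mu>|lborel. indicator {1<..} \<mu> * rk e mm (lam2 k) \<mu>)"
      by (intro Bochner_Integration.integral_nonneg) (auto simp: indicator_def intro: rk_nonneg)
    ultimately have "\<bar>rc e mm * ml e k - mJ e k\<bar> \<le> (1 / lam2 k) ^ mm / (real mm - e)"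
      using rk_integrable_inf(2)[OF e(2) l0] by simp
    also have "\<dots> \<le> (3 * (1 / (1 + lam2 k))) ^ mm / (real mm - e)"
    proof (intro divide_right_mono power_mono)
      show "1 / lam2 k \<le> 3 * (1 / (1 + lam2 k))" using l by (simp add: field_simps)
    qed (use l e in auto)
    also have "\<dots> = 3 ^ mm / (real mm - e) * (1 / (1 + lam2 k)) ^ mm" by (simp add: power_mult_distrib power_divide)
    also have "\<dots> \<le> D * (1 / (1 + lam2 k)) ^ mm" using e l by (intro mult_right_mono) (auto simp: D_def)
    finally show ?thesis .
  qed
  then have "rapid (\<lambda>k. rc e mm * ml e k - mJ e k)" using D0 by (auto simp: rapid_def)
  then obtain \<kappa> where \<kappa>: "dominated (\<lambda>k. rc e mm * ml e k - mJ e k) \<kappa>" by (rule rapid_dom)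
  have "\<bar>rc e mm * ml e k - mJ e k\<bar> \<le> D" for k
  proof -
    have "0 \<le> 1 / (1 + lam2 k)" "1 / (1 + lam2 k) \<le> 1" using lam2_nonneg[of k] by (auto simp: divide_le_eq)
    then have "(1 / (1 + lam2 k)) ^ mm \<le> 1" by (intro power_le_one)
    then show ?thesis using b[of k] D0 mult_left_mono[of "(1 / (1 + lam2 k)) ^ mm" 1 D] by linarith
  qed
  moreover have "dominated (\<lambda>k. rc e mm * ml e k - mJ e k) (max \<kappa> D)"
    using \<kappa> unfolding dominated_def by (intro conjI ballI allI) (simp_all add: le_max_iff_disj)
  ultimately show ?thesis by (intro that[of "max \<kappa> D"]) (simp_all add: le_max_iff_disj)
qed

text \<open>Let \<open>b \<le> a\<close> be the measures of the two sets. For each \<mu> \<le> 1 the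
  pairing with the resolvent power is at most \<open>u v b\<close> by contractivity and at most a
  constant times \<open>u v a b \<mu> powr (- (\<alpha> + 1))\<close> by the kernel bound.
  Integrating the better of the two against \<open>\<mu> powr (e - 1)\<close> gives
  \<open>b * a powr s\<close>; both pieces converge since
  \<open>0 < e < \<alpha> + 1\<close>.\<close>

lemma level_estimate:
  assumes s: "0 < s" "s < 1" and e: "e = (\<alpha> + 1) * s"
  obtains C where "C \<ge> 0"
    "\<And>F H A B u v. F \<in> borel_measurable M \<Longrightarrow> H \<in> borel_measurable M \<Longrightarrow> A \<in> sets M \<Longrightarrow> B \<in> sets M \<Longrightarrow>
       0 \<le> u \<Longrightarrow> 0 \<le> v \<Longrightarrow>
       (\<And>x. x \<in> {-1..1} \<Longrightarrow> \<bar>F x\<bar> \<le> u * indicator A x) \<Longrightarrow> (\<And>x. x \<in> {-1..1} \<Longrightarrow> \<bar>H x\<bar> \<le> v * indicator B x) \<Longrightarrow>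
       \<bar>Bil (ml e) F H\<bar> \<le> u * v * C * (min (measure M A) (measure M B) * max (measure M A) (measure M B) powr s)"
proof -
  define d where "d = \<alpha> + 1"
  have d: "d > 0" using alpha_gt by (simp add: d_def)
  have ed: "e = d * s" by (simp add: e d_def)
  have e0: "0 < e" "e < d" using d s by (simp_all add: e d_def[symmetric])
  have em: "e < real mm" using e0 mm_gt by (simp add: d_def)
  define c where "c = rc e mm"
  have c: "c > 0" unfolding c_def by (rule rc_pos[OF e0(1) em])
  obtain \<kappa> where \<kappa>: "\<kappa> > 0" "\<And>\<mu>. 0 < \<mu> \<Longrightarrow> \<mu> \<le> 1 \<Longrightarrow> dominated (\<lambda>k. (1 / (1 + \<mu> * lam2 k)) ^ mm) (\<kappa> * \<mu> powr (- d))"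
    unfolding d_def by (rule kernel_dom) blast
  obtain \<rho> where \<rho>: "dominated (\<lambda>k. c * ml e k - mJ e k) \<rho>" "\<And>k. \<bar>c * ml e k - mJ e k\<bar> \<le> \<rho>"
    unfolding c_def by (rule ml_decomp[OF e0(1) em]) blast
  have \<rho>0: "\<rho> \<ge> 0" using \<rho>(1) by (simp add: dominated_def)
  define m where "m = measure M (space M)"
  define K where "K = 1 / e + \<kappa> / (d - e)"
  have K0: "K \<ge> 0" using e0 \<kappa> by (simp add: K_def)
  define C where "C = (K + \<rho> * m powr (1 - s)) / c"
  have C0: "C \<ge> 0" using K0 \<rho>0 c by (simp add: C_def)
  have mono: "\<bar>Bil (ml e) F H\<bar> \<le> u * v * C * (measure M B * measure M A powr s)"
    if F[measurable]: "F \<in> borel_measurable M" and H[measurable]: "H \<in> borel_measurable M" and A: "A \<in> sets M" and B: "B \<in> sets M"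
      and uv: "0 \<le> u" "0 \<le> v" and Fu: "\<And>x. x \<in> {-1..1} \<Longrightarrow> \<bar>F x\<bar> \<le> u * indicator A x"
      and Hv: "\<And>x. x \<in> {-1..1} \<Longrightarrow> \<bar>H x\<bar> \<le> v * indicator B x"
      and le: "measure M B \<le> measure M A"
    for F H A B u v
  proof -
    define a b where "a = measure M A" and "b = measure M B"
    have ab: "0 \<le> b" "b \<le> a" using le by (simp_all add: a_def b_def)
    have am: "a \<le> m" unfolding a_def m_def by (rule bounded_measure)
    have Fu': "\<bar>F x\<bar> \<le> u" and Hv': "\<bar>H x\<bar> \<le> v" if "x \<in> {-1..1}" for x
      using Fu[OF that] Hv[OF that] uv by (auto simp: indicator_def of_bool_def split: if_splits)
    have bF: "bdd F" unfolding bdd_def using Fu' F by (intro conjI exI[of _ u]) auto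
    have bH: "bdd H" unfolding bdd_def using Hv' H by (intro conjI exI[of _ v]) auto
    have Fi: "integrable M F" and Hi: "integrable M H" by (auto intro: bdd_integrable bF bH)
    have L1F: "L1 F \<le> u * a" unfolding a_def by (rule L1_level[OF F A Fu])
    have L1H: "L1 H \<le> v * b" unfolding b_def by (rule L1_level[OF H B Hv])
    define \<Phi> where "\<Phi> \<mu> k = (1 / (1 + \<mu> * lam2 k)) ^ mm" for \<mu> k
    define Q where "Q \<mu> = Bil (\<Phi> \<mu>) F H" for \<mu>
    \<comment> \<open>The \<open>L_1\<close> contraction is applied to \<open>H\<close>, which lives
      on the smaller set, and \<open>F\<close> is estimated by its height.\<close>
    have Q1: "\<bar>Q \<mu>\<bar> \<le> u * v * b" if mu: "0 < \<mu>" "\<mu> \<le> 1" for \<mu>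
    proof -
      have m1: "mult 1 (\<lambda>k. 1 / (1 + \<mu> * lam2 k)) 1" using mu by (intro mult_resolvent) auto
      have "mult 1 (\<Phi> \<mu>) 1"
      proof -
        have "mult 1 (\<lambda>k. (1 / (1 + \<mu> * lam2 k)) ^ n) 1" for n
        proof (induction n)
          case 0 show ?case using mult_const[of 1 1] by simp
        next
          case (Suc n) show ?case using mult_mult[OF m1 Suc.IH] by simp
        qed
        then show ?thesis by (simp add: \<Phi>_def[abs_def])
      qed
      then have "\<bar>Bil (\<Phi> \<mu>) H F\<bar> \<le> 1 * L1 H * u"
        using \<kappa>(2)[OF mu] Fu' by (intro Bil_L1_Linf[OF _ _ Hi F]) (auto simp: \<Phi>_def[abs_def])
      also have "\<dots> \<le> (v * b) * u" using L1H uv by (simp add: mult_right_mono)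
      finally show ?thesis unfolding Q_def Bil_commute[of _ F H] by (simp add: mult_ac)
    qed
    have Q2: "\<bar>Q \<mu>\<bar> \<le> u * v * b * (\<kappa> * a * \<mu> powr (- d))" if mu: "0 < \<mu>" "\<mu> \<le> 1" for \<mu>
    proof -
      have "\<bar>Q \<mu>\<bar> \<le> \<kappa> * \<mu> powr (- d) * L1 F * L1 H"
        unfolding Q_def \<Phi>_def[abs_def] by (rule Bil_bound[OF \<kappa>(2)[OF mu] Fi Hi])
      also have "\<dots> \<le> \<kappa> * \<mu> powr (- d) * (u * a) * (v * b)"
        using \<kappa>(1) uv ab by (intro mult_mono mult_left_mono L1F L1H mult_nonneg_nonneg) auto
      finally show ?thesis by (simp add: mult_ac)
    qed
    define W where "W = (\<Sum>k. \<bar>co F k * co H k\<bar>)"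
    have sW: "summable (\<lambda>k. \<bar>co F k * co H k\<bar>)" by (rule bdd_co_summable[OF bF bH])
    have \<Phi>01: "0 \<le> \<Phi> \<mu> k" "\<Phi> \<mu> k \<le> 1" if "0 < \<mu>" for \<mu> k
    proof -
      have "0 \<le> \<mu> * lam2 k" using that by simp
      then show "0 \<le> \<Phi> \<mu> k" "\<Phi> \<mu> k \<le> 1" unfolding \<Phi>_def by (auto intro!: power_le_one)
    qed
    \<comment> \<open>Partial sums serve to exchange the integral over \<mu> with the infinite
      series. Their limit gives measurability of the integrand, and the majorant uses the finite sum
      \<open>W\<close> from Bessel's inequality.\<close>
    define S where "S n \<mu> = indicator {0<..1} \<mu> * (\<mu> powr (e - 1) * (\<Sum>k<n. \<Phi> \<mu> k * co F k * co H k))" for n \<mu>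
    define S' where "S' \<mu> = indicator {0<..1} \<mu> * (\<mu> powr (e - 1) * Q \<mu>)" for \<mu>
    have Sm[measurable]: "S n \<in> borel_measurable lborel" for n unfolding S_def \<Phi>_def by measurable
    have lim: "(\<lambda>n. S n \<mu>) \<longlonglongrightarrow> S' \<mu>" for \<mu>
    proof (cases "0 < \<mu> \<and> \<mu> \<le> 1")
      case True
      have "(\<lambda>n. \<Sum>k<n. \<Phi> \<mu> k * co F k * co H k) \<longlonglongrightarrow> Q \<mu>"
        unfolding Q_def Bil_def
        by (intro summable_LIMSEQ bdd_Bil_summable[OF bF bH, of _ 1]) (use \<Phi>01 True in auto)
      then show ?thesis unfolding S_def S'_def by (intro tendsto_intros)
    qed (auto simp: S_def S'_def indicator_def)
    have S'm[measurable]: "S' \<in> borel_measurable lborel"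
      by (rule borel_measurable_LIMSEQ_real[OF lim]) measurable
    have iW: "integrable lborel (\<lambda>\<mu>. W * (indicator {0..1} \<mu> * \<mu> powr (e - 1)))"
      by (intro integrable_mult_right lint_powr_0 e0) simp
    have Sdom: "norm (S n \<mu>) \<le> W * (indicator {0..1} \<mu> * \<mu> powr (e - 1))" for n \<mu>
    proof (cases "0 < \<mu> \<and> \<mu> \<le> 1")
      case True
      have "\<bar>\<Sum>k<n. \<Phi> \<mu> k * co F k * co H k\<bar> \<le> (\<Sum>k<n. \<bar>\<Phi> \<mu> k * co F k * co H k\<bar>)" by (rule sum_abs)
      also have "\<dots> \<le> (\<Sum>k<n. \<bar>co F k * co H k\<bar>)"
      proof (rule sum_mono)
        fix k
        show "\<bar>\<Phi> \<mu> k * co F k * co H k\<bar> \<le> \<bar>co F k * co H k\<bar>"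
          using mult_right_mono[of "\<Phi> \<mu> k" 1 "\<bar>co F k * co H k\<bar>"] \<Phi>01[of \<mu> k] True
          by (simp add: abs_mult mult.assoc)
      qed
      also have "\<dots> \<le> W" unfolding W_def by (rule sum_le_suminf[OF sW]) auto
      finally have "\<mu> powr (e - 1) * \<bar>\<Sum>k<n. \<Phi> \<mu> k * co F k * co H k\<bar> \<le> \<mu> powr (e - 1) * W" by (rule mult_left_mono) simp
      then show ?thesis using True by (simp add: S_def abs_mult mult.commute)
    next
      case False
      have "W \<ge> 0" unfolding W_def by (rule suminf_nonneg[OF sW]) simp
      then show ?thesis using False by (simp add: S_def indicator_def)
    qed
    have l1: "(\<lambda>n. LINT \<mu>|lborel. S n \<mu>) \<longlonglongrightarrow> (LINT \<mu>|lborel. S' \<mu>)"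
      by (rule integral_dominated_convergence[OF S'm Sm iW]) (use lim Sdom in auto)
    have Sint: "(LINT \<mu>|lborel. S n \<mu>) = (\<Sum>k<n. mJ e k * co F k * co H k)" for n
    proof -
      have "(LINT \<mu>|lborel. S n \<mu>) = (LINT \<mu>|lborel. (\<Sum>k<n. (indicator {0<..1} \<mu> * rk e mm (lam2 k) \<mu>) * (co F k * co H k)))"
        unfolding S_def rk_def \<Phi>_def
        by (intro Bochner_Integration.integral_cong refl) (simp only: sum_distrib_left mult_ac)
      also have "\<dots> = (\<Sum>k<n. mJ e k * co F k * co H k)"
      proof (subst Bochner_Integration.integral_sum)
        show "integrable lborel (\<lambda>\<mu>. (indicator {0<..1} \<mu> * rk e mm (lam2 k) \<mu>) * (co F k * co H k))" for k
          by (intro integrable_mult_left rk_integrable_0 e0) simp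
        show "(\<Sum>k<n. LINT \<mu>|lborel. (indicator {0<..1} \<mu> * rk e mm (lam2 k) \<mu>) * (co F k * co H k)) = (\<Sum>k<n. mJ e k * co F k * co H k)"
          by (simp only: integral_mult_left_zero mJ_def mult.assoc[of "integral\<^sup>L lborel _"])
      qed
      finally show ?thesis .
    qed
    have mJb: "\<bar>mJ e k\<bar> \<le> 1 / e" for k using mJ_bounds[OF e0(1), of k] by simp
    have "(\<lambda>n. \<Sum>k<n. mJ e k * co F k * co H k) \<longlonglongrightarrow> Bil (mJ e) F H"
      unfolding Bil_def by (intro summable_LIMSEQ bdd_Bil_summable[OF bF bH mJb])
    then have BJ: "Bil (mJ e) F H = (LINT \<mu>|lborel. S' \<mu>)"
      using l1 unfolding Sint by (rule LIMSEQ_unique)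
    have BJle: "\<bar>Bil (mJ e) F H\<bar> \<le> u * v * b * (K * a powr s)"
    proof (cases "a = 0")
      case True
      then have b0: "b = 0" using ab by simp
      have "S' \<mu> = 0" for \<mu>
        using Q1[of \<mu>] b0 by (auto simp: S'_def indicator_def)
      then show ?thesis using b0 by (simp add: BJ)
    next
      case False
      then have a0: "a > 0" using ab by simp
      \<comment> \<open>The crossing point of the two bounds up to \<kappa>, since
        \<open>a * \<tau> powr (- d) = 1\<close>.\<close>
      define \<tau> where "\<tau> = a powr (1 / d)"
      have \<tau>: "\<tau> > 0" using a0 by (simp add: \<tau>_def)
      define g where "g \<mu> = (u * v * b) * (indicator {0..\<tau>} \<mu> * \<mu> powr (e - 1) + \<kappa> * a * (indicator {\<tau>..} \<mu> * \<mu> powr (- (d - e) - 1)))" for \<mu>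
      have gi: "integrable lborel g" unfolding g_def
        using e0 \<tau> by (intro integrable_mult_right Bochner_Integration.integrable_add lint_powr_0 lint_powr_inf) auto
      have uvb: "0 \<le> u * v * b" using uv ab by simp
      have dominated: "\<bar>S' \<mu>\<bar> \<le> g \<mu>" for \<mu>
      proof (cases "0 < \<mu> \<and> \<mu> \<le> 1")
        case True
        then have SQ: "\<bar>S' \<mu>\<bar> = \<mu> powr (e - 1) * \<bar>Q \<mu>\<bar>" by (simp add: S'_def abs_mult)
        have n1: "0 \<le> \<kappa> * a * (indicator {\<tau>..} \<mu> * \<mu> powr (- (d - e) - 1))" using \<kappa> a0 by simp
        have n2: "0 \<le> indicator {0..\<tau>} \<mu> * \<mu> powr (e - 1)" by simp
        show ?thesis
        proof (cases "\<mu> \<le> \<tau>")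
          case le: True
          have "\<mu> powr (e - 1) * \<bar>Q \<mu>\<bar> \<le> \<mu> powr (e - 1) * (u * v * b)"
            using Q1 True by (intro mult_left_mono) auto
          also have "\<dots> = (u * v * b) * (indicator {0..\<tau>} \<mu> * \<mu> powr (e - 1))" using le True by simp
          also have "\<dots> \<le> g \<mu>" unfolding g_def using n1 uvb by (intro mult_left_mono) auto
          finally show ?thesis by (simp add: SQ)
        next
          case gt: False
          have "\<mu> powr (e - 1) * \<bar>Q \<mu>\<bar> \<le> \<mu> powr (e - 1) * (u * v * b * (\<kappa> * a * \<mu> powr (- d)))"
            using Q2 True by (intro mult_left_mono) auto
          also have "\<dots> = (u * v * b) * (\<kappa> * a * (\<mu> powr (e - 1) * \<mu> powr (- d)))" by (simp only: mult_ac)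
          also have "\<mu> powr (e - 1) * \<mu> powr (- d) = \<mu> powr (- (d - e) - 1)" by (simp add: powr_add[symmetric] algebra_simps)
          also have "(u * v * b) * (\<kappa> * a * \<mu> powr (- (d - e) - 1)) = (u * v * b) * (\<kappa> * a * (indicator {\<tau>..} \<mu> * \<mu> powr (- (d - e) - 1)))"
            using gt by simp
          also have "\<dots> \<le> g \<mu>" unfolding g_def using n2 uvb by (intro mult_left_mono) auto
          finally show ?thesis by (simp add: SQ)
        qed
      next
        case False
        have "0 \<le> g \<mu>" unfolding g_def using \<kappa>(1) a0 by (intro mult_nonneg_nonneg[OF uvb] add_nonneg_nonneg) auto
        moreover have "S' \<mu> = 0" using False by (auto simp: S'_def indicator_def)
        ultimately show ?thesis by simp
      qed
      have S'i: "integrable lborel S'"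
        by (rule Bochner_Integration.integrable_bound[OF gi S'm]) (use dominated in \<open>auto intro!: AE_I2 order_trans[OF dominated abs_ge_self]\<close>)
      have "\<bar>Bil (mJ e) F H\<bar> \<le> (LINT \<mu>|lborel. \<bar>S' \<mu>\<bar>)" unfolding BJ by (rule integral_abs_bound)
      also have "\<dots> \<le> (LINT \<mu>|lborel. g \<mu>)" using S'i gi dominated by (intro integral_mono) auto
      also have "\<dots> = (u * v * b) * (\<tau> powr e / e + \<kappa> * a * (\<tau> powr (- (d - e)) / (d - e)))"
      proof -
        have i1: "integrable lborel (\<lambda>\<mu>. indicator {0..\<tau>} \<mu> * \<mu> powr (e - 1))"
          and i2: "integrable lborel (\<lambda>\<mu>. \<kappa> * a * (indicator {\<tau>..} \<mu> * \<mu> powr (- (d - e) - 1)))"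
          using e0 \<tau> by (intro integrable_mult_right lint_powr_0 lint_powr_inf; simp)+
        have de: "d - e > 0" using e0 by simp
        show ?thesis unfolding g_def integral_mult_right_zero Bochner_Integration.integral_add[OF i1 i2]
          lint_powr_0(2)[OF e0(1) less_imp_le[OF \<tau>]] lint_powr_inf(2)[OF de \<tau>] ..
      qed
      also have "\<tau> powr e = a powr s" using d by (simp add: \<tau>_def powr_powr ed)
      also have "\<kappa> * a * (\<tau> powr (- (d - e)) / (d - e)) = \<kappa> / (d - e) * a powr s"
      proof -
        have "1 / d * (- (d - e)) = s - 1" using d by (simp add: ed field_simps)
        then have "\<tau> powr (- (d - e)) = a powr (s - 1)" by (simp only: \<tau>_def powr_powr)
        moreover have "a * a powr (s - 1) = a powr s" using a0 powr_mult_base[of a "s - 1"] by simp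
        ultimately have "a * \<tau> powr (- (d - e)) = a powr s" by simp
        then have "\<kappa> * (a * \<tau> powr (- (d - e))) / (d - e) = \<kappa> / (d - e) * a powr s" by simp
        then show ?thesis by (simp only: times_divide_eq_right mult.assoc)
      qed
      also have "a powr s / e + \<kappa> / (d - e) * a powr s = K * a powr s" by (simp add: K_def distrib_right)
      finally show ?thesis .
    qed
    \<comment> \<open>Here the bounded kernel gives the factor \<open>a * b\<close>; one trades
      \<open>a\<close> for \<open>a powr s\<close> because \<open>a\<close> is at most the finite
      total mass \<open>m\<close>.\<close>
    have BR: "\<bar>Bil (\<lambda>k. c * ml e k - mJ e k) F H\<bar> \<le> u * v * b * (\<rho> * m powr (1 - s) * a powr s)"
    proof -
      have "a = a powr (1 - s) * a powr s" using ab by (simp add: powr_add[symmetric])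
      also have "\<dots> \<le> m powr (1 - s) * a powr s" using am ab s by (intro mult_right_mono powr_mono2) auto
      finally have am': "a \<le> m powr (1 - s) * a powr s" .
      have "\<bar>Bil (\<lambda>k. c * ml e k - mJ e k) F H\<bar> \<le> \<rho> * L1 F * L1 H" by (rule Bil_bound[OF \<rho>(1) Fi Hi])
      also have "\<dots> \<le> \<rho> * (u * a) * (v * b)"
        using \<rho>0 uv ab by (intro mult_mono mult_left_mono L1F L1H mult_nonneg_nonneg) auto
      also have "\<dots> = (u * v * b * \<rho>) * a" by (simp only: mult_ac)
      also have "\<dots> \<le> (u * v * b * \<rho>) * (m powr (1 - s) * a powr s)"
        using \<rho>0 uv ab by (intro mult_left_mono am') auto
      finally show ?thesis by (simp only: mult.assoc)
    qed
    have "c * Bil (ml e) F H = Bil (mJ e) F H + Bil (\<lambda>k. c * ml e k - mJ e k) F H"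
    proof -
      have "Bil (mJ e) F H + Bil (\<lambda>k. c * ml e k - mJ e k) F H = (\<Sum>k. mJ e k * co F k * co H k + (c * ml e k - mJ e k) * co F k * co H k)"
        unfolding Bil_def by (intro suminf_add bdd_Bil_summable[OF bF bH mJb] bdd_Bil_summable[OF bF bH \<rho>(2)])
      also have "\<dots> = (\<Sum>k. c * (ml e k * co F k * co H k))" by (simp add: algebra_simps)
      also have "\<dots> = c * Bil (ml e) F H" unfolding Bil_def
        by (intro suminf_mult bdd_Bil_summable[OF bF bH ml_bounded[OF e0(1)]])
      finally show ?thesis by simp
    qed
    then have "c * \<bar>Bil (ml e) F H\<bar> \<le> \<bar>Bil (mJ e) F H\<bar> + \<bar>Bil (\<lambda>k. c * ml e k - mJ e k) F H\<bar>"
      using c abs_triangle_ineq[of "Bil (mJ e) F H"] by (metis abs_mult abs_of_pos)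
    also have "\<dots> \<le> u * v * b * (K * a powr s) + u * v * b * (\<rho> * m powr (1 - s) * a powr s)"
      by (intro add_mono BJle BR)
    also have "\<dots> = c * (u * v * C * (b * a powr s))" using c by (simp add: C_def field_simps)
    finally show ?thesis using c by (simp add: a_def b_def)
  qed
  show ?thesis
  proof (rule that[OF C0])
    fix F H :: "real \<Rightarrow> real" and A B and u v :: real
    assume a: "F \<in> borel_measurable M" "H \<in> borel_measurable M" "A \<in> sets M" "B \<in> sets M" "0 \<le> u" "0 \<le> v"
      "\<And>x. x \<in> {-1..1} \<Longrightarrow> \<bar>F x\<bar> \<le> u * indicator A x" "\<And>x. x \<in> {-1..1} \<Longrightarrow> \<bar>H x\<bar> \<le> v * indicator B x"
    show "\<bar>Bil (ml e) F H\<bar> \<le> u * v * C * (min (measure M A) (measure M B) * max (measure M A) (measure M B) powr s)"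
    proof (cases "measure M B \<le> measure M A")
      case True then show ?thesis using mono[OF a True] True by (simp only: min_absorb2 max_absorb1)
    next
      case False
      then have le: "measure M A \<le> measure M B" by simp
      show ?thesis using mono[OF a(2,1,4,3,6,5,8,7) le] le
        by (simp add: min_def max_def Bil_commute[of _ H F] mult_ac)
    qed
  qed
qed

end

section \<open>Decomposition into dyadic level sets\<close>

lemma dyadic_floor:
  fixes y :: real assumes "y > 0"
  shows "2 powr real_of_int i \<le> y \<and> y < 2 powr (real_of_int i + 1) \<longleftrightarrow> i = \<lfloor>log 2 y\<rfloor>"
proof -
  have "2 powr real_of_int i \<le> y \<longleftrightarrow> real_of_int i \<le> log 2 y" using assms by (simp add: le_log_iff)
  moreover have "y < 2 powr (real_of_int i + 1) \<longleftrightarrow> log 2 y < real_of_int i + 1" using assms by (simp add: log_less_iff)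
  moreover have "i = \<lfloor>log 2 y\<rfloor> \<longleftrightarrow> \<lfloor>log 2 y\<rfloor> = i" by (rule eq_commute)
  ultimately show ?thesis by (simp only: floor_eq_iff)
qed

context jacobi
begin

definition lev :: "(real \<Rightarrow> real) \<Rightarrow> int \<Rightarrow> real set" where
  "lev F i = {x \<in> space M. 2 powr real_of_int i \<le> \<bar>F x\<bar> \<and> \<bar>F x\<bar> < 2 powr (real_of_int i + 1)}"

lemma lev_sets:
  assumes [measurable]: "F \<in> borel_measurable M" shows "lev F i \<in> sets M"
  unfolding lev_def by measurable

lemma lev_iff: "x \<in> {-1..1} \<Longrightarrow> F x \<noteq> 0 \<Longrightarrow> x \<in> lev F i \<longleftrightarrow> i = \<lfloor>log 2 \<bar>F x\<bar>\<rfloor>"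
  using dyadic_floor[of "\<bar>F x\<bar>" i] by (simp add: lev_def)

lemma lev_zero: "F x = 0 \<Longrightarrow> x \<notin> lev F i"
  by (simp add: lev_def not_le)

lemma lev_sum:
  assumes "x \<in> {-1..1}" "finite I"
  shows "(\<Sum>i\<in>I. c i * indicator (lev F i) x) = (if F x \<noteq> 0 \<and> \<lfloor>log 2 \<bar>F x\<bar>\<rfloor> \<in> I then c \<lfloor>log 2 \<bar>F x\<bar>\<rfloor> else (0::real))"
proof (cases "F x = 0")
  case True then show ?thesis by (simp add: lev_zero)
next
  case False
  then have "(\<Sum>i\<in>I. c i * indicator (lev F i) x) = (\<Sum>i\<in>I. if i = \<lfloor>log 2 \<bar>F x\<bar>\<rfloor> then c i else 0)"
    using assms by (intro sum.cong) (auto simp: indicator_def lev_iff)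
  then show ?thesis using assms False by simp
qed

lemma lev_measure_sum:
  assumes F: "F \<in> Lpset M p" and p: "p > 0" and I: "finite I"
  shows "(\<Sum>i\<in>I. 2 powr (real_of_int i * p) * measure M (lev F i)) \<le> (LINT x|M. \<bar>F x\<bar> powr p)"
proof -
  have Fm: "F \<in> borel_measurable M" using F by (rule LpsetD)
  have "lev F i \<inter> {-1..1} = lev F i" for i by (auto simp: lev_def)
  then have "(\<Sum>i\<in>I. 2 powr (real_of_int i * p) * measure M (lev F i))
     = (\<Sum>i\<in>I. LINT x|M. 2 powr (real_of_int i * p) * indicator (lev F i) x)" by simp
  also have "\<dots> = (LINT x|M. (\<Sum>i\<in>I. 2 powr (real_of_int i * p) * indicator (lev F i) x))"
    by (subst Bochner_Integration.integral_sum) (auto intro!: integrable_mult_right bdd_integrable bdd_indicator lev_sets Fm)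
  also have "\<dots> \<le> (LINT x|M. \<bar>F x\<bar> powr p)"
  proof (rule integral_mono)
    show "integrable M (\<lambda>x. \<Sum>i\<in>I. 2 powr (real_of_int i * p) * indicator (lev F i) x)"
      by (intro Bochner_Integration.integrable_sum integrable_mult_right bdd_integrable bdd_indicator lev_sets Fm)
    show "integrable M (\<lambda>x. \<bar>F x\<bar> powr p)" using F by (rule LpsetD)
    fix x assume "x \<in> space M"
    then have x: "x \<in> {-1..1}" by simp
    have "2 powr (real_of_int \<lfloor>log 2 \<bar>F x\<bar>\<rfloor> * p) \<le> \<bar>F x\<bar> powr p" if "F x \<noteq> 0"
    proof -
      have "2 powr real_of_int \<lfloor>log 2 \<bar>F x\<bar>\<rfloor> \<le> \<bar>F x\<bar>"
        using dyadic_floor[of "\<bar>F x\<bar>" "\<lfloor>log 2 \<bar>F x\<bar>\<rfloor>"] that by simp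
      then have "(2 powr real_of_int \<lfloor>log 2 \<bar>F x\<bar>\<rfloor>) powr p \<le> \<bar>F x\<bar> powr p" using p by (intro powr_mono2) auto
      then show ?thesis by (simp add: powr_powr)
    qed
    then show "(\<Sum>i\<in>I. 2 powr (real_of_int i * p) * indicator (lev F i) x) \<le> \<bar>F x\<bar> powr p"
      unfolding lev_sum[OF x I] by simp
  qed
  finally show ?thesis .
qed

text \<open>A bounded function meets finitely many dyadic levels above any positive height, but
  possibly infinitely many below. The small values are therefore collected in one error
  term.\<close>

definition low :: "(real \<Rightarrow> real) \<Rightarrow> nat \<Rightarrow> real \<Rightarrow> real" where
  "low F n x = (if \<bar>F x\<bar> < 2 powr (- real n) then F x else 0)"

lemma low_decomp:
  assumes x: "x \<in> {-1..1}" and F: "\<bar>F x\<bar> < 2 powr (real n + 1)"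
  shows "low F n x + (\<Sum>i\<in>{- int n..int n}. F x * indicator (lev F i) x) = F x"
proof -
  have "\<lfloor>log 2 \<bar>F x\<bar>\<rfloor> \<in> {- int n..int n} \<longleftrightarrow> \<not> \<bar>F x\<bar> < 2 powr (- real n)" if "F x \<noteq> 0"
  proof -
    have "log 2 \<bar>F x\<bar> < real n + 1" using F that by (simp add: log_less_iff)
    then have "\<lfloor>log 2 \<bar>F x\<bar>\<rfloor> \<le> int n" by (simp add: floor_le_iff)
    moreover have "- int n \<le> \<lfloor>log 2 \<bar>F x\<bar>\<rfloor> \<longleftrightarrow> 2 powr (- real n) \<le> \<bar>F x\<bar>"
      using that by (simp add: le_floor_iff le_log_iff)
    ultimately show ?thesis by auto
  qed
  then show ?thesis unfolding lev_sum[OF x finite_atLeastAtMost_int] low_def by auto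
qed

lemma low_measurable:
  assumes [measurable]: "F \<in> borel_measurable M" shows "low F n \<in> borel_measurable M"
  unfolding low_def[abs_def] by measurable

lemma low_bdd: "bdd F \<Longrightarrow> bdd (low F n)"
  by (rule bdd_le[of F]) (auto simp: bdd_def low_measurable, simp add: low_def)

lemma Bil_cmult_left:
  assumes "bdd F" "bdd H" "\<And>k. \<bar>m k\<bar> \<le> c" shows "Bil m (\<lambda>x. a * F x) H = a * Bil m F H"
proof -
  have "Bil m (\<lambda>x. a * F x) H = (\<Sum>k. a * (m k * co F k * co H k))"
    by (simp add: Bil_def co_cmult mult_ac)
  also have "\<dots> = a * Bil m F H" unfolding Bil_def by (intro suminf_mult bdd_Bil_summable[OF assms])
  finally show ?thesis .
qed

lemma Lpn_zero_imp_co: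
  assumes "f \<in> Lpset M p" "p > 0" "Lpn M p f = 0" shows "co f k = 0" "AE x in M. f x = 0"
proof -
  have "(LINT x|M. \<bar>f x\<bar> powr p) = 0" using Lpn_powr[OF assms(2), of M f] assms by simp
  then have "AE x in M. \<bar>f x\<bar> powr p = 0"
    using integral_nonneg_eq_0_iff_AE[OF LpsetD(2)[OF assms(1)]] by simp
  then show ae: "AE x in M. f x = 0" by eventually_elim simp
  have "co f k = (LINT x|M. 0)" unfolding co_def
    using ae LpsetD(1)[OF assms(1)] by (intro integral_cong_AE) auto
  then show "co f k = 0" by simp
qed

lemma bddE: assumes "bdd f" obtains B where "\<And>x. x \<in> {-1..1} \<Longrightarrow> \<bar>f x\<bar> \<le> B"
  using assms unfolding bdd_def by blast

text \<open>After normalizing both norms to \<open>1\<close>, split \<open>F\<close> and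
  \<open>H\<close> into levels \<open>- n\<close> to \<open>n\<close> and a low part.
  \<open>level_estimate\<close> bounds each pair of levels and \<open>dyadic_level_sum\<close> adds
  the bounds; the terms with a low part vanish as \<open>n\<close> grows. If a norm is zero, all
  coefficients of that function vanish.\<close>

lemma HLS_bilinear:
  fixes p q q' s e :: real
  assumes p: "1 < p" "p < q" and q': "1 / q + 1 / q' = 1" and s: "s = 1 / p - 1 / q" and e: "e = (\<alpha> + 1) * s"
  obtains C where "C \<ge> 0" "\<And>F H. bdd F \<Longrightarrow> bdd H \<Longrightarrow> \<bar>Bil (ml e) F H\<bar> \<le> C * Lpn M p F * Lpn M q' H"
proof -
  have q1: "1 < q" using p by simp
  have q'1: "q' > 1" using q1 by (simp add: conj_exponent[OF q1 q'])
  have s01: "0 < s" "s < 1"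
  proof -
    have "1 / q < 1 / p" using p by (intro divide_strict_left_mono) auto
    moreover have "1 / p < 1" "0 < 1 / q" using p by auto
    ultimately show "0 < s" "s < 1" unfolding s by linarith+
  qed
  have e0: "0 < e" using alpha_gt s01 by (simp add: e)
  obtain C where C: "C \<ge> 0" and lev_est: "\<And>F H A B u v. F \<in> borel_measurable M \<Longrightarrow> H \<in> borel_measurable M \<Longrightarrow> A \<in> sets M \<Longrightarrow> B \<in> sets M \<Longrightarrow>
       0 \<le> u \<Longrightarrow> 0 \<le> v \<Longrightarrow>
       (\<And>x. x \<in> {-1..1} \<Longrightarrow> \<bar>F x\<bar> \<le> u * indicator A x) \<Longrightarrow> (\<And>x. x \<in> {-1..1} \<Longrightarrow> \<bar>H x\<bar> \<le> v * indicator B x) \<Longrightarrow>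
       \<bar>Bil (ml e) F H\<bar> \<le> u * v * C * (min (measure M A) (measure M B) * max (measure M A) (measure M B) powr s)"
    by (rule level_estimate[OF s01 e]) blast
  define K where "K = 1 / (1 - 2 powr (- (p / q))) + 1 / (1 - 2 powr (- (q' * (1 - 1 / p))))"
  have K0: "K \<ge> 0"
    using p q'1 powr_less_mono[of "- (p/q)" 0 2] powr_less_mono[of "- (q' * (1 - 1/p))" 0 2]
    by (auto simp: K_def intro!: add_nonneg_nonneg)
  define m where "m = measure M (space M)"
  have mlb: "\<bar>ml e k\<bar> \<le> 2 powr e" for k by (rule ml_bounded[OF e0])
  have norm: "\<bar>Bil (ml e) F H\<bar> \<le> 4 * C * K"
    if F: "bdd F" and H: "bdd H" and F1: "(LINT x|M. \<bar>F x\<bar> powr p) \<le> 1" and H1: "(LINT x|M. \<bar>H x\<bar> powr q') \<le> 1" for F H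
  proof -
    have Fm: "F \<in> borel_measurable M" and Hm: "H \<in> borel_measurable M" using F H by (auto simp: bdd_def)
    obtain f0 where f0: "\<And>x. x \<in> {-1..1} \<Longrightarrow> \<bar>F x\<bar> \<le> f0" using F by (rule bddE) blast
    obtain h0 where h0: "\<And>x. x \<in> {-1..1} \<Longrightarrow> \<bar>H x\<bar> \<le> h0" using H by (rule bddE) blast
    have fh0: "0 \<le> f0" "0 \<le> h0" using f0[of 0] h0[of 0] by auto
    \<comment> \<open>The total of the two pairings containing a low part, up to the factor
      \<open>2 powr (- real n)\<close>: there \<open>level_estimate\<close> is used with the whole
      interval for both sets. \<open>E\<close> may depend on \<open>F\<close> and \<open>H\<close>
      since it is multiplied by a null sequence.\<close>
    define E where "E = (f0 + h0) * C * (m * m powr s)"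
    have est: "\<bar>Bil (ml e) F H\<bar> \<le> 4 * C * K + 2 powr (- real n) * E"
      if n: "f0 < 2 powr (real n + 1)" "h0 < 2 powr (real n + 1)" for n
    proof -
      define I where "I = {- int n..int n}"
      have I: "finite I" by (simp add: I_def)
      define Fi Hi where "Fi i x = F x * indicator (lev F i) x" and "Hi i x = H x * indicator (lev H i) x" for i x
      have bFi: "bdd (Fi i)" and bHi: "bdd (Hi i)" for i
        unfolding Fi_def Hi_def by (intro bdd_mult F H bdd_indicator lev_sets Fm Hm)+
      have Fs: "F x = low F n x + (\<Sum>i\<in>I. Fi i x)" if x: "x \<in> {-1..1}" for x
      proof -
        have "\<bar>F x\<bar> < 2 powr (real n + 1)" using f0[OF x] n(1) by linarith
        from low_decomp[where F=F, OF x this] show ?thesis unfolding Fi_def I_def by (rule sym)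
      qed
      have Hs: "H x = low H n x + (\<Sum>i\<in>I. Hi i x)" if x: "x \<in> {-1..1}" for x
      proof -
        have "\<bar>H x\<bar> < 2 powr (real n + 1)" using h0[OF x] n(2) by linarith
        from low_decomp[where F=H, OF x this] show ?thesis unfolding Hi_def I_def by (rule sym)
      qed
      have coF: "co F k = co (\<lambda>x. low F n x + (\<Sum>i\<in>I. Fi i x)) k" for k by (rule co_cong[OF Fs])
      have coH: "co H k = co (\<lambda>x. low H n x + (\<Sum>i\<in>I. Hi i x)) k" for k by (rule co_cong[OF Hs])
      have bFs: "bdd (\<lambda>x. \<Sum>i\<in>I. Fi i x)" by (intro bdd_sum I bFi)
      have 1: "Bil (ml e) F H = Bil (ml e) (low F n) H + (\<Sum>i\<in>I. Bil (ml e) (Fi i) H)"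
      proof -
        have "Bil (ml e) F H = Bil (ml e) (\<lambda>x. low F n x + (\<Sum>i\<in>I. Fi i x)) H"
          by (simp only: Bil_def coF)
        also have "\<dots> = Bil (ml e) (low F n) H + Bil (ml e) (\<lambda>x. \<Sum>i\<in>I. Fi i x) H"
          by (rule bdd_Bil_add[OF low_bdd[OF F] bFs H mlb])
        also have "Bil (ml e) (\<lambda>x. \<Sum>i\<in>I. Fi i x) H = (\<Sum>i\<in>I. Bil (ml e) (Fi i) H)"
          by (rule bdd_Bil_sum[OF I bFi H mlb])
        finally show ?thesis .
      qed
      have 2: "Bil (ml e) (Fi i) H = Bil (ml e) (Fi i) (low H n) + (\<Sum>j\<in>I. Bil (ml e) (Fi i) (Hi j))" for i
      proof -
        have "Bil (ml e) (Fi i) H = Bil (ml e) (\<lambda>x. low H n x + (\<Sum>i\<in>I. Hi i x)) (Fi i)"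
          by (subst Bil_commute) (simp only: Bil_def coH)
        also have "\<dots> = Bil (ml e) (low H n) (Fi i) + Bil (ml e) (\<lambda>x. \<Sum>j\<in>I. Hi j x) (Fi i)"
          by (rule bdd_Bil_add[OF low_bdd[OF H] bdd_sum[OF I bHi] bFi mlb])
        also have "Bil (ml e) (\<lambda>x. \<Sum>j\<in>I. Hi j x) (Fi i) = (\<Sum>j\<in>I. Bil (ml e) (Hi j) (Fi i))"
          by (rule bdd_Bil_sum[OF I bHi bFi mlb])
        also have "(\<Sum>j\<in>I. Bil (ml e) (Hi j) (Fi i)) = (\<Sum>j\<in>I. Bil (ml e) (Fi i) (Hi j))"
          by (rule sum.cong[OF refl Bil_commute])
        also have "Bil (ml e) (low H n) (Fi i) = Bil (ml e) (Fi i) (low H n)" by (rule Bil_commute)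
        finally show ?thesis .
      qed
      have 3: "(\<Sum>i\<in>I. Bil (ml e) (Fi i) (low H n)) = Bil (ml e) (\<lambda>x. \<Sum>i\<in>I. Fi i x) (low H n)"
        by (rule bdd_Bil_sum[OF I bFi low_bdd[OF H] mlb, symmetric])
      have total: "Bil (ml e) F H = Bil (ml e) (low F n) H + Bil (ml e) (\<lambda>x. \<Sum>i\<in>I. Fi i x) (low H n)
          + (\<Sum>i\<in>I. \<Sum>j\<in>I. Bil (ml e) (Fi i) (Hi j))"
        unfolding 1 by (simp only: 2 sum.distrib 3 add.assoc)
      have sp: "space M \<in> sets M" by (rule sets.top)
      have e1: "\<bar>Bil (ml e) (low F n) H\<bar> \<le> 2 powr (- real n) * h0 * C * (m * m powr s)"
      proof -
        have "\<bar>Bil (ml e) (low F n) H\<bar> \<le> 2 powr (- real n) * h0 * C * (min m m * max m m powr s)"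
          unfolding m_def
        proof (rule lev_est[OF low_measurable[OF Fm] Hm sp sp _ fh0(2)])
          fix x :: real assume x: "x \<in> {-1..1}"
          have "\<bar>low F n x\<bar> \<le> 2 powr (- real n)" by (simp add: low_def)
          then show "\<bar>low F n x\<bar> \<le> 2 powr (- real n) * indicator (space M) x" using x by simp
          show "\<bar>H x\<bar> \<le> h0 * indicator (space M) x" using h0[OF x] x by simp
        qed simp
        then show ?thesis by simp
      qed
      have e2: "\<bar>Bil (ml e) (\<lambda>x. \<Sum>i\<in>I. Fi i x) (low H n)\<bar> \<le> f0 * 2 powr (- real n) * C * (m * m powr s)"
      proof -
        have "\<bar>\<Sum>i\<in>I. Fi i x\<bar> \<le> f0" if x: "x \<in> {-1..1}" for x
        proof -
          have S: "(\<Sum>i\<in>I. Fi i x) = F x - low F n x" using Fs[OF x] by linarith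
          have "low F n x = F x \<or> low F n x = 0" by (simp add: low_def)
          then show ?thesis unfolding S using f0[OF x] fh0 by (elim disjE) simp_all
        qed
        then have Ff: "\<bar>\<Sum>i\<in>I. Fi i x\<bar> \<le> f0 * indicator (space M) x" if "x \<in> {-1..1}" for x
          using that by simp
        have "\<bar>Bil (ml e) (\<lambda>x. \<Sum>i\<in>I. Fi i x) (low H n)\<bar> \<le> f0 * 2 powr (- real n) * C * (min m m * max m m powr s)"
          unfolding m_def
        proof (rule lev_est[OF _ low_measurable[OF Hm] sp sp fh0(1) _ Ff])
          show "(\<lambda>x. \<Sum>i\<in>I. Fi i x) \<in> borel_measurable M" using bFs by (simp add: bdd_def)
          fix x :: real assume x: "x \<in> {-1..1}"
          have "\<bar>low H n x\<bar> \<le> 2 powr (- real n)" by (simp add: low_def)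
          then show "\<bar>low H n x\<bar> \<le> 2 powr (- real n) * indicator (space M) x" using x by simp
        qed simp_all
        then show ?thesis by simp
      qed
      define t where "t i j = 2 powr real_of_int i * 2 powr real_of_int j * (min (measure M (lev F i)) (measure M (lev H j)) * max (measure M (lev F i)) (measure M (lev H j)) powr s)" for i j
      \<comment> \<open>The factor 4 arises because the levels are bounded by their upper ends
        \<open>2 powr (i + 1)\<close> and \<open>2 powr (j + 1)\<close>.\<close>
      have e3: "\<bar>Bil (ml e) (Fi i) (Hi j)\<bar> \<le> 4 * C * t i j" for i j
      proof -
        have "\<bar>Bil (ml e) (Fi i) (Hi j)\<bar> \<le> 2 powr (real_of_int i + 1) * 2 powr (real_of_int j + 1) * C * (min (measure M (lev F i)) (measure M (lev H j)) * max (measure M (lev F i)) (measure M (lev H j)) powr s)"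
        proof (rule lev_est)
          show "Fi i \<in> borel_measurable M" "Hi j \<in> borel_measurable M" using bFi bHi by (auto simp: bdd_def)
          show "lev F i \<in> sets M" "lev H j \<in> sets M" by (intro lev_sets Fm Hm)+
          show "\<bar>Fi i x\<bar> \<le> 2 powr (real_of_int i + 1) * indicator (lev F i) x" for x
            by (auto simp: Fi_def lev_def indicator_def)
          show "\<bar>Hi j x\<bar> \<le> 2 powr (real_of_int j + 1) * indicator (lev H j) x" for x
            by (auto simp: Hi_def lev_def indicator_def)
        qed auto
        moreover have "2 powr (real_of_int i + 1) * 2 powr (real_of_int j + 1) * C * X = 4 * C * (2 powr real_of_int i * 2 powr real_of_int j * X)" for X
          by (simp add: powr_add)
        ultimately show ?thesis unfolding t_def by (simp only:)
      qed
      have "\<bar>\<Sum>i\<in>I. \<Sum>j\<in>I. Bil (ml e) (Fi i) (Hi j)\<bar> \<le> (\<Sum>i\<in>I. \<Sum>j\<in>I. 4 * C * t i j)"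
        by (rule order_trans[OF sum_abs], rule sum_mono, rule order_trans[OF sum_abs], rule sum_mono, rule e3)
      also have "\<dots> = 4 * C * (\<Sum>i\<in>I. \<Sum>j\<in>I. t i j)" by (simp add: sum_distrib_left)
      also have "\<dots> \<le> 4 * C * K"
      proof (rule mult_left_mono)
        show "(\<Sum>i\<in>I. \<Sum>j\<in>I. t i j) \<le> K" unfolding t_def K_def
        proof (rule dyadic_level_sum[OF p q' s I])
          show "(\<Sum>i\<in>I. 2 powr (real_of_int i * p) * measure M (lev F i)) \<le> 1"
            using lev_measure_sum[OF bdd_Lp[OF F] _ I, of p] F1 p by simp
          show "(\<Sum>j\<in>I. 2 powr (real_of_int j * q') * measure M (lev H j)) \<le> 1"
            using lev_measure_sum[OF bdd_Lp[OF H] _ I, of q'] H1 q'1 by simp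
        qed auto
      qed (use C in simp)
      finally have e4: "\<bar>\<Sum>i\<in>I. \<Sum>j\<in>I. Bil (ml e) (Fi i) (Hi j)\<bar> \<le> 4 * C * K" .
      have "2 powr (- real n) * E = 2 powr (- real n) * h0 * C * (m * m powr s) + f0 * 2 powr (- real n) * C * (m * m powr s)"
        by (simp add: E_def algebra_simps)
      then show ?thesis using total e1 e2 e4 by linarith
    qed
    obtain n0 :: nat where n0: "max f0 h0 < real n0" using reals_Archimedean2 by blast
    have "\<bar>Bil (ml e) F H\<bar> \<le> 4 * C * K + 2 powr (- real n) * E" if "n \<ge> n0" for n
    proof (rule est)
      have "real n < 2 ^ n" by (rule of_nat_less_two_power)
      also have "(2::real) ^ n = 2 powr real n" by (simp add: powr_realpow)
      also have "\<dots> \<le> 2 powr (real n + 1)" by (intro powr_mono) auto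
      finally show "f0 < 2 powr (real n + 1)" "h0 < 2 powr (real n + 1)" using n0 that by auto
    qed
    moreover have "(\<lambda>n. 4 * C * K + 2 powr (- real n) * E) \<longlonglongrightarrow> 4 * C * K + 0 * E"
    proof (intro tendsto_intros)
      have "(\<lambda>n. (1 / 2) ^ n :: real) \<longlonglongrightarrow> 0" by (rule LIMSEQ_realpow_zero) auto
      moreover have "2 powr (- real n) = (1 / 2) ^ n" for n by (simp add: powr_minus powr_realpow power_one_over inverse_eq_divide)
      ultimately show "(\<lambda>n. 2 powr (- real n)) \<longlonglongrightarrow> 0" by simp
    qed
    ultimately show ?thesis by (intro LIMSEQ_le_const[where X="\<lambda>n. 4 * C * K + 2 powr (- real n) * E"]) auto
  qed
  show ?thesis
  proof (rule that[of "4 * C * K"])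
    show "0 \<le> 4 * C * K" using C K0 by simp
    fix F H assume F: "bdd F" and H: "bdd H"
    define a b where "a = Lpn M p F" and "b = Lpn M q' H"
    have ab: "a \<ge> 0" "b \<ge> 0" by (auto simp: a_def b_def Lpn_nonneg)
    show "\<bar>Bil (ml e) F H\<bar> \<le> 4 * C * K * Lpn M p F * Lpn M q' H"
    proof (cases "a = 0 \<or> b = 0")
      case True
      then have "(\<forall>k. co F k = 0) \<or> (\<forall>k. co H k = 0)"
        using Lpn_zero_imp_co(1)[OF bdd_Lp[OF F], of p] Lpn_zero_imp_co(1)[OF bdd_Lp[OF H], of q'] p q'1
        by (auto simp: a_def b_def)
      then have "Bil (ml e) F H = 0" by (auto simp: Bil_def)
      then show ?thesis using C K0 by (simp add: Lpn_nonneg)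
    next
      case False
      then have ab0: "a > 0" "b > 0" using ab by auto
      define F' H' where "F' x = (1 / a) * F x" and "H' x = (1 / b) * H x" for x
      have bF': "bdd F'" and bH': "bdd H'" unfolding F'_def H'_def by (intro bdd_mult bdd_const F H)+
      have "Lpn M p F' = \<bar>1 / a\<bar> * a" unfolding F'_def a_def using p by (intro Lpn_cmult) simp
      then have "Lpn M p F' = 1" using ab0 by simp
      moreover have "Lpn M q' H' = \<bar>1 / b\<bar> * b" unfolding H'_def b_def using q'1 by (intro Lpn_cmult) simp
      then have "Lpn M q' H' = 1" using ab0 by simp
      ultimately have "(LINT x|M. \<bar>F' x\<bar> powr p) \<le> 1" "(LINT x|M. \<bar>H' x\<bar> powr q') \<le> 1"
        using Lpn_powr[of p M F'] Lpn_powr[of q' M H'] p q'1 by auto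
      then have le: "\<bar>Bil (ml e) F' H'\<bar> \<le> 4 * C * K" by (rule norm[OF bF' bH'])
      have "Bil (ml e) F' H' = (1 / a) * Bil (ml e) F H'" unfolding F'_def by (rule Bil_cmult_left[OF F bH' mlb])
      also have "Bil (ml e) F H' = (1 / b) * Bil (ml e) F H"
        unfolding Bil_commute[of _ F] H'_def by (rule Bil_cmult_left[OF H F mlb])
      finally have "\<bar>Bil (ml e) F H\<bar> / (a * b) \<le> 4 * C * K" using le ab0 by (simp add: abs_mult)
      then show ?thesis using ab0 by (simp add: a_def[symmetric] b_def[symmetric] divide_le_eq mult.assoc)
    qed
  qed
qed

lemma Ser_bdd: "dominated m \<kappa> \<Longrightarrow> integrable M f \<Longrightarrow> bdd (Ser m f)"
  unfolding bdd_def using Ser_bound by (intro conjI Ser_measurable exI[of _ "\<kappa> * L1 f"]) auto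

lemma bdd_conj_fun: assumes "bdd G" "q \<ge> 1" shows "bdd (conj_fun q G)"
proof -
  have [measurable]: "G \<in> borel_measurable M" using assms by (simp add: bdd_def)
  obtain g where g: "\<And>x. x \<in> {-1..1} \<Longrightarrow> \<bar>G x\<bar> \<le> g" using assms(1) by (rule bddE) blast
  have "\<bar>conj_fun q G x\<bar> \<le> g powr (q - 1)" if "x \<in> {-1..1}" for x
  proof -
    have "\<bar>conj_fun q G x\<bar> = \<bar>G x\<bar> powr (q - 1)" by (simp add: conj_fun_def abs_mult abs_sgn_eq)
    also have "\<dots> \<le> g powr (q - 1)" using g[OF that] assms by (intro powr_mono2) auto
    finally show ?thesis .
  qed
  moreover have "conj_fun q G \<in> borel_measurable M" unfolding conj_fun_def[abs_def] by measurable
  ultimately show ?thesis unfolding bdd_def by blast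
qed

text \<open>The bilinear estimate tested with the dual function of \<open>Ser m' f\<close>. Both
  symbols are rapid, so all functions involved are bounded, as the bilinear estimate
  demands.\<close>

lemma HLS_Ser:
  fixes p q s e :: real
  assumes p: "1 < p" "p < q" and s: "s = 1 / p - 1 / q" and e: "e = (\<alpha> + 1) * s"
  obtains C where "C \<ge> 0" "\<And>m m' f. rapid m \<Longrightarrow> rapid m' \<Longrightarrow> (\<And>k. m' k = ml e k * m k) \<Longrightarrow> integrable M f \<Longrightarrow>
    Lpn M q (Ser m' f) \<le> C * Lpn M p (Ser m f)"
proof -
  have q1: "1 < q" using p by simp
  define q' where "q' = q / (q - 1)"
  have q': "1 / q + 1 / q' = 1" using q1 by (simp add: q'_def field_simps)
  obtain C where C: "C \<ge> 0" "\<And>F H. bdd F \<Longrightarrow> bdd H \<Longrightarrow> \<bar>Bil (ml e) F H\<bar> \<le> C * Lpn M p F * Lpn M q' H"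
    by (rule HLS_bilinear[OF p q' s e]) blast
  show ?thesis
  proof (rule that[OF C(1)])
    fix m m' and f :: "real \<Rightarrow> real" assume m: "rapid m" "rapid m'" and mm': "\<And>k. m' k = ml e k * m k" and f: "integrable M f"
    obtain \<kappa> where \<kappa>: "dominated m \<kappa>" using m(1) by (rule rapid_dom)
    obtain \<kappa>' where \<kappa>': "dominated m' \<kappa>'" using m(2) by (rule rapid_dom)
    define F G where "F = Ser m f" and "G = Ser m' f"
    have bF: "bdd F" and bG: "bdd G" unfolding F_def G_def by (rule Ser_bdd[OF \<kappa> f], rule Ser_bdd[OF \<kappa>' f])
    have GL: "G \<in> Lpset M q" using q1 by (intro bdd_Lp bG) auto
    note cf = conj_fun[OF q1 q' GL]
    have bH: "bdd (conj_fun q G)" using q1 by (intro bdd_conj_fun bG) auto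
    have "(LINT x|M. \<bar>G x\<bar> powr q) = (LINT x|M. G x * conj_fun q G x)" by (simp add: cf(2))
    also have "\<dots> = Bil m' f (conj_fun q G)"
      unfolding G_def by (rule integral_Ser[OF \<kappa>' f bdd_integrable]) (use bH in \<open>simp add: G_def\<close>)
    also have "\<dots> = Bil (ml e) F (conj_fun q G)"
      unfolding Bil_def F_def by (simp add: co_Ser[OF \<kappa> f] mm' mult.assoc)
    also have "\<dots> \<le> C * Lpn M p F * Lpn M q' (conj_fun q G)"
      using C(2)[OF bF bH] by linarith
    finally have "(LINT x|M. \<bar>G x\<bar> powr q) \<le> (C * Lpn M p F) * Lpn M q G powr (q - 1)" by (simp add: cf(3))
    then have "Lpn M q G \<le> C * Lpn M p F" using C(1) by (intro Lpn_le_dual[OF q1]) (auto simp: Lpn_nonneg)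
    then show "Lpn M q (Ser m' f) \<le> C * Lpn M p (Ser m f)" by (simp add: F_def G_def)
  qed
qed

section \<open>Multipliers from \<open>L\<^sub>p\<close> to \<open>L\<^sub>\<infinity>\<close>\<close>

text \<open>The exponent comes from the bound \<open>\<mu> powr (- (\<alpha> + 1))\<close> for the kernel of a high power of the resolvent,
  truncating \<open>f\<close> at a suitable height.\<close>

definition ssym :: "real \<Rightarrow> (real \<Rightarrow> real) \<Rightarrow> bool" where
  "ssym p s \<longleftrightarrow> (\<exists>C\<ge>0. \<forall>\<mu> f. 0 < \<mu> \<longrightarrow> \<mu> \<le> 1 \<longrightarrow>
     (AE x in M. \<bar>poly (T (\<lambda>k. s (\<mu> * lam2 k)) f) x\<bar> \<le> C * \<mu> powr (- (\<alpha> + 1) / p) * Lpn M p (poly f)))"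

lemma ssymI:
  assumes "C \<ge> 0" "\<And>\<mu> f. 0 < \<mu> \<Longrightarrow> \<mu> \<le> 1 \<Longrightarrow>
     AE x in M. \<bar>poly (T (\<lambda>k. s (\<mu> * lam2 k)) f) x\<bar> \<le> C * \<mu> powr (- (\<alpha> + 1) / p) * Lpn M p (poly f)"
  shows "ssym p s"
  using assms by (auto simp: ssym_def)

lemma ssymE:
  assumes "ssym p s"
  obtains C where "C \<ge> 0" "\<And>\<mu> f. 0 < \<mu> \<Longrightarrow> \<mu> \<le> 1 \<Longrightarrow>
     AE x in M. \<bar>poly (T (\<lambda>k. s (\<mu> * lam2 k)) f) x\<bar> \<le> C * \<mu> powr (- (\<alpha> + 1) / p) * Lpn M p (poly f)"
  using assms by (auto simp: ssym_def)

lemma mult_resolvent_power: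
  assumes "p \<ge> 1" "\<mu> \<ge> 0" shows "mult p (\<lambda>k. (1 / (1 + \<mu> * lam2 k)) ^ n) 1"
proof (induction n)
  case 0 show ?case using mult_const[of p 1] assms by simp
next
  case (Suc n) show ?case using mult_mult[OF mult_resolvent[OF assms] Suc.IH] by simp
qed

text \<open>Pair with the indicator of a set \<open>A\<close> and cut \<open>f\<close> at a height
  \<tau>. The low part is handled by contractivity, the high part by the kernel bound from
  \<open>L_1\<close> to \<open>L_infinity\<close>; both contributions are multiples of the measure
  of \<open>A\<close>.\<close>

lemma ssym_y:
  assumes p: "1 < p" shows "ssym p (\<lambda>x. (1 / (1 + x)) ^ mm)"
proof -
  define d where "d = \<alpha> + 1"
  obtain \<kappa> where \<kappa>: "\<kappa> > 0" "\<And>\<mu>. 0 < \<mu> \<Longrightarrow> \<mu> \<le> 1 \<Longrightarrow> dominated (\<lambda>k. (1 / (1 + \<mu> * lam2 k)) ^ mm) (\<kappa> * \<mu> powr (- d))"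
    unfolding d_def by (rule kernel_dom) blast
  show ?thesis
  proof (rule ssymI[of "1 + \<kappa>"])
    show "0 \<le> 1 + \<kappa>" using \<kappa> by simp
    fix \<mu> :: real and f assume mu: "0 < \<mu>" "\<mu> \<le> 1"
    define m where "m k = (1 / (1 + \<mu> * lam2 k)) ^ mm" for k
    have dm: "dominated m (\<kappa> * \<mu> powr (- d))" unfolding m_def[abs_def] by (rule \<kappa>(2)[OF mu])
    have mm1: "mult 1 m 1" unfolding m_def[abs_def] using mu by (intro mult_resolvent_power) auto
    define N where "N = Lpn M p (poly f)"
    define c where "c = (1 + \<kappa>) * \<mu> powr (- d / p)"
    have "AE x in M. \<bar>poly (T m f) x\<bar> \<le> c * N"
    proof (rule AE_abs_le_of_integrals[OF poly_integrable])
      fix A assume A: "A \<in> sets M"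
      have As: "A \<inter> {-1..1} = A" using sets.sets_into_space[OF A] by auto
      have Hi: "integrable M (indicator A :: real \<Rightarrow> real)" by (rule bdd_integrable[OF bdd_indicator[OF A]])
      have LH: "L1 (indicator A) = measure M A" by (simp add: As)
      define X where "X = \<bar>LINT x|M. poly (T m f) x * indicator A x\<bar>"
      have bound: "X \<le> c * (N + \<epsilon>) * measure M A" if \<epsilon>: "\<epsilon> > 0" for \<epsilon>
      proof -
        define N' where "N' = N + \<epsilon>"
        have N': "N' > 0" "N \<le> N'" using \<epsilon> Lpn_nonneg[of M p "poly f"] by (auto simp: N'_def N_def)
        \<comment> \<open>The height that balances both parts: the high part has \<open>L_1\<close>
          norm at most \<open>\<tau> powr (1 - p) * N' powr p\<close>, and multiplying by
          \<open>\<mu> powr (- d)\<close> returns \<tau>. The enlarged norm \<open>N'\<close> makes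
          \<tau> positive.\<close>
        define \<tau> where "\<tau> = \<mu> powr (- d / p) * N'"
        have \<tau>: "\<tau> > 0" using mu N' by (simp add: \<tau>_def)
        define F1 F2 where "F1 x = (if \<bar>poly f x\<bar> \<le> \<tau> then poly f x else 0)" and "F2 x = (if \<bar>poly f x\<bar> \<le> \<tau> then 0 else poly f x)" for x
        have F12: "poly f = (\<lambda>x. F1 x + F2 x)" by (auto simp: F1_def F2_def)
        have m1: "F1 \<in> borel_measurable M" "F2 \<in> borel_measurable M" unfolding F1_def[abs_def] F2_def[abs_def] by measurable
        have pi: "integrable M (\<lambda>x. \<bar>poly f x\<bar> powr p)" using p by (intro LpsetD poly_Lp) auto
        have i1: "integrable M F1"
          by (rule Bochner_Integration.integrable_bound[OF poly_integrable[of f] m1(1)]) (auto simp: F1_def)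
        have i2: "integrable M F2"
          by (rule Bochner_Integration.integrable_bound[OF poly_integrable[of f] m1(2)]) (auto simp: F2_def)
        have L2: "L1 F2 \<le> \<tau> powr (1 - p) * N' powr p"
        proof -
          have "L1 F2 \<le> (LINT x|M. \<tau> powr (1 - p) * \<bar>poly f x\<bar> powr p)"
          proof (rule integral_mono)
            show "integrable M (\<lambda>x. \<bar>F2 x\<bar>)" using i2 by simp
            show "integrable M (\<lambda>x. \<tau> powr (1 - p) * \<bar>poly f x\<bar> powr p)" using pi by simp
            fix x
            show "\<bar>F2 x\<bar> \<le> \<tau> powr (1 - p) * \<bar>poly f x\<bar> powr p"
            proof (cases "\<bar>poly f x\<bar> \<le> \<tau>")
              case False
              then have y: "\<tau> \<le> \<bar>poly f x\<bar>" "\<bar>poly f x\<bar> > 0" using \<tau> by auto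
              have "\<bar>poly f x\<bar> = \<bar>poly f x\<bar> powr (1 - p) * \<bar>poly f x\<bar> powr p" using y by (simp add: powr_add[symmetric])
              also have "\<dots> \<le> \<tau> powr (1 - p) * \<bar>poly f x\<bar> powr p" using y \<tau> p by (intro mult_right_mono powr_mono2') auto
              finally show ?thesis using False by (simp add: F2_def)
            qed (simp add: F2_def)
          qed
          also have "\<dots> = \<tau> powr (1 - p) * (LINT x|M. \<bar>poly f x\<bar> powr p)" by simp
          also have "(LINT x|M. \<bar>poly f x\<bar> powr p) = N powr p" unfolding N_def using p by (simp add: Lpn_powr)
          also have "\<tau> powr (1 - p) * N powr p \<le> \<tau> powr (1 - p) * N' powr p"
            using N' p Lpn_nonneg[of M p "poly f"] by (intro mult_left_mono powr_mono2) (auto simp: N_def)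
          finally show ?thesis .
        qed
        have "Bil m (poly f) (indicator A) = Bil m F1 (indicator A) + Bil m F2 (indicator A)"
          by (subst F12, rule Bil_add_left[OF dm i1 i2 Hi])
        moreover have "X = \<bar>Bil m (poly f) (indicator A)\<bar>" unfolding X_def by (simp add: Bil_poly[OF Hi])
        ultimately have "X \<le> \<bar>Bil m F1 (indicator A)\<bar> + \<bar>Bil m F2 (indicator A)\<bar>" by linarith
        \<comment> \<open>Contractivity on \<open>L_infinity\<close>, obtained by transposing the
          \<open>L_1\<close> contraction onto the indicator.\<close>
        moreover have "\<bar>Bil m F1 (indicator A)\<bar> \<le> measure M A * \<tau>"
        proof -
          have "\<bar>Bil m (indicator A) F1\<bar> \<le> 1 * L1 (indicator A) * \<tau>"
            by (rule Bil_L1_Linf[OF dm mm1 Hi m1(1)]) (use \<tau> in \<open>auto simp: F1_def\<close>)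
          then show ?thesis by (simp only: LH mult_1_left Bil_commute[of m F1])
        qed
        moreover have "\<bar>Bil m F2 (indicator A)\<bar> \<le> \<kappa> * (\<mu> powr (- d / p) * N') * measure M A"
        proof -
          have "\<bar>Bil m F2 (indicator A)\<bar> \<le> \<kappa> * \<mu> powr (- d) * L1 F2 * measure M A"
            using Bil_bound[OF dm i2 Hi] by (simp only: LH)
          also have "\<dots> \<le> \<kappa> * \<mu> powr (- d) * (\<tau> powr (1 - p) * N' powr p) * measure M A"
            using \<kappa>(1) by (intro mult_right_mono mult_left_mono L2) auto
          also have "\<dots> = \<kappa> * (\<mu> powr (- d) * (\<tau> powr (1 - p) * N' powr p)) * measure M A" by (simp only: mult.assoc)
          also have "\<mu> powr (- d) * (\<tau> powr (1 - p) * N' powr p) = \<mu> powr (- d / p) * N'"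
          proof -
            have "\<tau> powr (1 - p) = \<mu> powr (- d / p * (1 - p)) * N' powr (1 - p)" by (simp only: \<tau>_def powr_mult powr_powr)
            then have "\<mu> powr (- d) * (\<tau> powr (1 - p) * N' powr p) = (\<mu> powr (- d) * \<mu> powr (- d / p * (1 - p))) * (N' powr (1 - p) * N' powr p)"
              by (simp only: mult_ac)
            also have "\<mu> powr (- d) * \<mu> powr (- d / p * (1 - p)) = \<mu> powr (- d + - d / p * (1 - p))" by (simp only: powr_add)
            also have "- d + - d / p * (1 - p) = - d / p" using p by (simp add: field_simps)
            also have "N' powr (1 - p) * N' powr p = N'" using N' by (simp add: powr_add[symmetric])
            finally show ?thesis .
          qed
          finally show ?thesis .
        qed
        ultimately have "X \<le> measure M A * \<tau> + \<kappa> * (\<mu> powr (- d / p) * N') * measure M A" by linarith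
        also have "\<dots> = c * (N + \<epsilon>) * measure M A" by (simp add: \<tau>_def c_def N'_def algebra_simps)
        finally show ?thesis .
      qed
      have "((\<lambda>\<epsilon>. c * (N + \<epsilon>) * measure M A) \<longlongrightarrow> c * (N + 0) * measure M A) (at_right 0)" by (intro tendsto_intros)
      then have "X \<le> c * (N + 0) * measure M A"
        by (rule tendsto_lowerbound) (auto simp: eventually_at_right_field intro!: exI[of _ 1] bound)
      then show "\<bar>LINT x|M. poly (T m f) x * indicator A x\<bar> \<le> c * N * measure M A" by (simp add: X_def)
    qed
    then show "AE x in M. \<bar>poly (T (\<lambda>k. (1 / (1 + \<mu> * lam2 k)) ^ mm) f) x\<bar> \<le> (1 + \<kappa>) * \<mu> powr (- (\<alpha> + 1) / p) * Lpn M p (poly f)"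
      unfolding m_def[abs_def] c_def N_def d_def .
  qed
qed

text \<open>The smoothing factor acts last, on a polynomial whose \<open>L_p\<close> norm the other
  factor controls. One smoothing factor in a product is enough.\<close>

lemma ssym_mult:
  assumes "ssym p s" "bsym p s'" shows "ssym p (\<lambda>x. s x * s' x)"
proof -
  obtain C where C: "C \<ge> 0" "\<And>\<mu> f. 0 < \<mu> \<Longrightarrow> \<mu> \<le> 1 \<Longrightarrow>
     AE x in M. \<bar>poly (T (\<lambda>k. s (\<mu> * lam2 k)) f) x\<bar> \<le> C * \<mu> powr (- (\<alpha> + 1) / p) * Lpn M p (poly f)"
    using assms(1) by (rule ssymE) blast
  obtain D where D: "D \<ge> 0" "\<And>\<mu>. \<mu> > 0 \<Longrightarrow> mult p (\<lambda>k. s' (\<mu> * lam2 k)) D" using assms(2) by (rule bsymE) blast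
  show ?thesis
  proof (rule ssymI[of "C * D"])
    show "0 \<le> C * D" using C D by simp
    fix \<mu> :: real and f assume mu: "0 < \<mu>" "\<mu> \<le> 1"
    have "C * \<mu> powr (- (\<alpha> + 1) / p) * Lpn M p (poly (T (\<lambda>k. s' (\<mu> * lam2 k)) f)) \<le> C * \<mu> powr (- (\<alpha> + 1) / p) * (D * Lpn M p (poly f))"
      using C(1) by (intro mult_left_mono multD[OF D(2)[OF mu(1)]]) auto
    also have "\<dots> = C * D * \<mu> powr (- (\<alpha> + 1) / p) * Lpn M p (poly f)" by (simp only: mult_ac)
    finally have le: "C * \<mu> powr (- (\<alpha> + 1) / p) * Lpn M p (poly (T (\<lambda>k. s' (\<mu> * lam2 k)) f)) \<le> C * D * \<mu> powr (- (\<alpha> + 1) / p) * Lpn M p (poly f)" .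
    show "AE x in M. \<bar>poly (T (\<lambda>k. s (\<mu> * lam2 k) * s' (\<mu> * lam2 k)) f) x\<bar> \<le> C * D * \<mu> powr (- (\<alpha> + 1) / p) * Lpn M p (poly f)"
      using C(2)[OF mu, of "T (\<lambda>k. s' (\<mu> * lam2 k)) f"] unfolding T_mult
      by eventually_elim (rule order_trans[OF _ le])
  qed
qed

lemma ssym_add:
  assumes "ssym p s" "ssym p s'" shows "ssym p (\<lambda>x. s x + s' x)"
proof -
  obtain C where C: "C \<ge> 0" "\<And>\<mu> f. 0 < \<mu> \<Longrightarrow> \<mu> \<le> 1 \<Longrightarrow>
     AE x in M. \<bar>poly (T (\<lambda>k. s (\<mu> * lam2 k)) f) x\<bar> \<le> C * \<mu> powr (- (\<alpha> + 1) / p) * Lpn M p (poly f)"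
    using assms(1) by (rule ssymE) blast
  obtain D where D: "D \<ge> 0" "\<And>\<mu> f. 0 < \<mu> \<Longrightarrow> \<mu> \<le> 1 \<Longrightarrow>
     AE x in M. \<bar>poly (T (\<lambda>k. s' (\<mu> * lam2 k)) f) x\<bar> \<le> D * \<mu> powr (- (\<alpha> + 1) / p) * Lpn M p (poly f)"
    using assms(2) by (rule ssymE) blast
  show ?thesis
  proof (rule ssymI[of "C + D"])
    show "0 \<le> C + D" using C D by simp
    fix \<mu> :: real and f assume mu: "0 < \<mu>" "\<mu> \<le> 1"
    show "AE x in M. \<bar>poly (T (\<lambda>k. s (\<mu> * lam2 k) + s' (\<mu> * lam2 k)) f) x\<bar> \<le> (C + D) * \<mu> powr (- (\<alpha> + 1) / p) * Lpn M p (poly f)"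
      using C(2)[OF mu, of f] D(2)[OF mu, of f] unfolding T_add poly_add
    proof eventually_elim
      case (elim x)
      then show ?case using abs_triangle_ineq[of "poly (T (\<lambda>k. s (\<mu> * lam2 k)) f) x"]
        by (simp only: distrib_right)
    qed
  qed
qed

text \<open>The restriction \<open>c \<le> 1\<close> keeps \<open>c * \<mu>\<close> in the range
  where the bound is known; the case met below is \<open>c = 1/4\<close>.\<close>

lemma ssym_scale:
  assumes c: "0 < c" "c \<le> 1" and p: "p > 0" and "ssym p s" shows "ssym p (\<lambda>x. s (c * x))"
proof -
  obtain C where C: "C \<ge> 0" "\<And>\<mu> f. 0 < \<mu> \<Longrightarrow> \<mu> \<le> 1 \<Longrightarrow>
     AE x in M. \<bar>poly (T (\<lambda>k. s (\<mu> * lam2 k)) f) x\<bar> \<le> C * \<mu> powr (- (\<alpha> + 1) / p) * Lpn M p (poly f)"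
    using assms(4) by (rule ssymE) blast
  show ?thesis
  proof (rule ssymI[of "C * c powr (- (\<alpha> + 1) / p)"])
    show "0 \<le> C * c powr (- (\<alpha> + 1) / p)" using C by simp
    fix \<mu> :: real and f assume mu: "0 < \<mu>" "\<mu> \<le> 1"
    have cm: "0 < c * \<mu>" "c * \<mu> \<le> 1" using c mu by (auto intro: mult_le_one)
    show "AE x in M. \<bar>poly (T (\<lambda>k. s (c * (\<mu> * lam2 k))) f) x\<bar> \<le> C * c powr (- (\<alpha> + 1) / p) * \<mu> powr (- (\<alpha> + 1) / p) * Lpn M p (poly f)"
      using C(2)[OF cm, of f] by (simp only: mult.assoc powr_mult)
  qed
qed

lemma ssym_cong: "(\<And>x. x \<ge> 0 \<Longrightarrow> s x = s' x) \<Longrightarrow> ssym p s \<Longrightarrow> ssym p s'"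
  by (auto simp: ssym_def)

lemma ssym_diff:
  assumes "1 < p" "ssym p s" "ssym p s'" shows "ssym p (\<lambda>x. s x - s' x)"
proof -
  have "ssym p (\<lambda>x. s x + s' x * (-1))"
    using assms by (intro ssym_add ssym_mult bsym_const) auto
  then show ?thesis by (rule ssym_cong[rotated]) simp
qed

text \<open>Polynomials \<open>P n\<close> approximate \<open>f\<close> in \<open>L_p\<close>, and a
  rapid symbol makes \<open>Ser\<close> continuous from \<open>L_1\<close> to uniform convergence.
  The countably many null sets belonging to the \<open>P n\<close> are combined before passing to
  the limit.\<close>

lemma ssym_Ser:
  assumes p: "1 < p" and "ssym p s"
  obtains C where "C \<ge> 0" "\<And>\<mu> f. 0 < \<mu> \<Longrightarrow> \<mu> \<le> 1 \<Longrightarrow> f \<in> Lpset M p \<Longrightarrow> rapid (\<lambda>k. s (\<mu> * lam2 k)) \<Longrightarrow>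
     AE x in M. \<bar>Ser (\<lambda>k. s (\<mu> * lam2 k)) f x\<bar> \<le> C * \<mu> powr (- (\<alpha> + 1) / p) * Lpn M p f"
proof -
  obtain C where C: "C \<ge> 0" "\<And>\<mu> f. 0 < \<mu> \<Longrightarrow> \<mu> \<le> 1 \<Longrightarrow>
     AE x in M. \<bar>poly (T (\<lambda>k. s (\<mu> * lam2 k)) f) x\<bar> \<le> C * \<mu> powr (- (\<alpha> + 1) / p) * Lpn M p (poly f)"
    using assms(2) by (rule ssymE) blast
  show ?thesis
  proof (rule that[OF C(1)])
    fix \<mu> and f :: "real \<Rightarrow> real"
    assume mu: "0 < \<mu>" "\<mu> \<le> 1" and f: "f \<in> Lpset M p" and r: "rapid (\<lambda>k. s (\<mu> * lam2 k))"
    define m where "m k = s (\<mu> * lam2 k)" for k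
    obtain \<kappa> where \<kappa>: "dominated m \<kappa>" unfolding m_def[abs_def] using r by (rule rapid_dom)
    define D where "D = C * \<mu> powr (- (\<alpha> + 1) / p)"
    have D: "D \<ge> 0" using C by (simp add: D_def)
    have p1: "p \<ge> 1" using p by simp
    obtain P where P: "(\<lambda>n. Lpn M p (\<lambda>x. f x - poly (P n) x)) \<longlonglongrightarrow> 0" by (rule poly_dense_seq[OF p1 f])
    define e where "e n = Lpn M p (\<lambda>x. f x - poly (P n) x)" for n
    have PLp: "poly (P n) \<in> Lpset M p" for n using p by (intro poly_Lp) auto
    have fi: "integrable M f" by (rule Lpset_imp_L1(1)[OF finite_measure_M p1 f])
    have dLp: "(\<lambda>x. f x - poly (P n) x) \<in> Lpset M p" for n by (rule Minkowski_diff(1)[OF p1 f PLp])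
    have PN: "Lpn M p (poly (P n)) \<le> Lpn M p f + e n" for n
      using Minkowski_diff(2)[OF p1 f dLp, of n] by (simp add: e_def)
    define c where "c = \<kappa> * (1 + measure M (space M))"
    have c: "c \<ge> 0" using \<kappa> by (simp add: c_def dominated_def)
    have close: "\<bar>Ser m f x - poly (T m (P n)) x\<bar> \<le> c * e n" if x: "x \<in> {-1..1}" for x n
    proof -
      have "Ser m f x - poly (T m (P n)) x = Ser m (\<lambda>x. f x - poly (P n) x) x"
        by (simp only: Ser_diff[OF \<kappa> fi poly_integrable x] Ser_poly)
      also have "\<bar>\<dots>\<bar> \<le> \<kappa> * L1 (\<lambda>x. f x - poly (P n) x)"
        using Lpset_imp_L1(1)[OF finite_measure_M p1 dLp] by (intro Ser_bound[OF \<kappa> _ x])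
      also have "\<dots> \<le> \<kappa> * ((1 + measure M (space M)) * e n)"
        unfolding e_def using \<kappa> by (intro mult_left_mono Lpset_imp_L1(2)[OF finite_measure_M p1 dLp]) (simp add: dominated_def)
      finally show ?thesis by (simp add: c_def mult.assoc)
    qed
    have "AE x in M. \<forall>n. \<bar>poly (T m (P n)) x\<bar> \<le> D * Lpn M p (poly (P n))"
      unfolding AE_all_countable m_def[abs_def] D_def using C(2)[OF mu] by blast
    then have "AE x in M. \<bar>Ser m f x\<bar> \<le> D * Lpn M p f"
      using AE_space
    proof eventually_elim
      case (elim x)
      then have x: "x \<in> {-1..1}" by simp
      have le: "\<bar>Ser m f x\<bar> \<le> c * e n + D * (Lpn M p f + e n)" for n
      proof -
        have "\<bar>poly (T m (P n)) x\<bar> \<le> D * Lpn M p (poly (P n))" using elim by blast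
        also have "\<dots> \<le> D * (Lpn M p f + e n)" by (intro mult_left_mono PN D)
        finally show ?thesis using close[OF x, of n] by linarith
      qed
      have "(\<lambda>n. c * e n + D * (Lpn M p f + e n)) \<longlonglongrightarrow> c * 0 + D * (Lpn M p f + 0)"
        using P unfolding e_def by (intro tendsto_intros)
      then have "\<bar>Ser m f x\<bar> \<le> c * 0 + D * (Lpn M p f + 0)"
        by (rule LIMSEQ_le_const) (use le in blast)
      then show ?case by simp
    qed
    then show "AE x in M. \<bar>Ser (\<lambda>k. s (\<mu> * lam2 k)) f x\<bar> \<le> C * \<mu> powr (- (\<alpha> + 1) / p) * Lpn M p f"
      unfolding m_def[abs_def] D_def .
  qed
qed

end

section \<open>Realization of the \<open>K\<close>-functional\<close>

text \<open>The symbol of \<open>1 - V_t\<close>: it vanishes to order \<open>l\<close> at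
  \<open>0\<close>, whereas \<open>vsym\<close> decays like \<open>x\<close> to the power
  \<open>- m\<close> at infinity. The two parameters pay for negative and positive powers of
  \<open>x\<close> respectively.\<close>

definition usym :: "nat \<Rightarrow> nat \<Rightarrow> real \<Rightarrow> real" where
  "usym m l x = (1 - (1 / (1 + x)) ^ m) ^ l"

definition vsym :: "nat \<Rightarrow> nat \<Rightarrow> real \<Rightarrow> real" where
  "vsym m l x = 1 - usym m l x"

text \<open>With \<open>x = t^2 lam2 k\<close> the factor \<open>1/4\<close> halves
  \<open>t\<close>, so this is the symbol of the difference of \<open>V\<close> at the scales
  \<open>t / 2\<close> and \<open>t\<close>.\<close>

definition dsym :: "nat \<Rightarrow> nat \<Rightarrow> real \<Rightarrow> real" where
  "dsym m l x = vsym m l (1 / 4 * x) - vsym m l x"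

text \<open>The finite geometric sum exhibits \<open>m\<close> resolvent factors; in
  \<open>usym_factor\<close> it exhibits \<open>l\<close> factors \<open>1 - 1 / (1 + x)\<close>.
  The cofactors are polynomials in the resolvent.\<close>

lemma vsym_factor: "vsym m l x = (1 / (1 + x)) ^ m * (\<Sum>i<l. (1 - (1 / (1 + x)) ^ m) ^ i)"
  using one_diff_power_eq[of "1 - (1 / (1 + x)) ^ m" l] by (simp add: vsym_def usym_def)

lemma usym_factor: "usym m l x = (1 - 1 / (1 + x)) ^ l * (\<Sum>i<m. (1 / (1 + x)) ^ i) ^ l"
  using one_diff_power_eq[of "1 / (1 + x)" m] by (simp add: usym_def power_mult_distrib[symmetric])

lemma vsym_bound: assumes "x \<ge> 0" shows "\<bar>vsym m l x\<bar> \<le> real l * (1 / (1 + x)) ^ m"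
proof -
  have z: "0 \<le> (1 / (1 + x)) ^ m" "(1 / (1 + x)) ^ m \<le> 1" using assms by (auto intro!: power_le_one)
  have "\<bar>\<Sum>i<l. (1 - (1 / (1 + x)) ^ m) ^ i\<bar> \<le> (\<Sum>i<l. 1)"
  proof (rule order_trans[OF sum_abs], rule sum_mono)
    fix i
    have "\<bar>1 - (1 / (1 + x)) ^ m\<bar> ^ i \<le> 1" using z by (intro power_le_one) auto
    then show "\<bar>(1 - (1 / (1 + x)) ^ m) ^ i\<bar> \<le> 1" by (simp only: power_abs)
  qed
  then have "(1 / (1 + x)) ^ m * \<bar>\<Sum>i<l. (1 - (1 / (1 + x)) ^ m) ^ i\<bar> \<le> (1 / (1 + x)) ^ m * real l"
    using z by (intro mult_left_mono) auto
  then show ?thesis unfolding vsym_factor abs_mult using z by (simp only: abs_of_nonneg mult.commute[of "real l"])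
qed

context jacobi
begin

lemma bsym_usym: "p \<ge> 1 \<Longrightarrow> bsym p (usym m l)"
  unfolding usym_def[abs_def] by (intro bsym_power bsym_diff bsym_const bsym_y) auto

lemma bsym_vsym: "p \<ge> 1 \<Longrightarrow> bsym p (vsym m l)"
  unfolding vsym_def[abs_def] by (intro bsym_diff bsym_const bsym_usym) auto

lemma bsym_powr_vsym:
  assumes p: "1 < p" and a: "0 < a" "a \<le> real m" shows "bsym p (\<lambda>x. x powr a * vsym m l x)"
proof -
  have "bsym p (\<lambda>x. (x powr a * (1 / (1 + x)) ^ m) * (\<Sum>i<l. (1 - (1 / (1 + x)) ^ m) ^ i))"
    using p a by (intro bsym_mult bsym_powr_pos bsym_sum bsym_power bsym_diff bsym_const bsym_y) auto
  then show ?thesis by (simp only: vsym_factor mult.assoc)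
qed

lemma bsym_powr_usym:
  assumes p: "1 < p" and a: "0 \<le> a" "a < real l" shows "bsym p (\<lambda>x. x powr (- a) * usym m l x)"
proof -
  have "bsym p (\<lambda>x. (x powr (- a) * (1 - 1 / (1 + x)) ^ l) * (\<Sum>i<m. (1 / (1 + x)) ^ i) ^ l)"
    using p a by (intro bsym_mult bsym_powr_neg bsym_sum bsym_power bsym_y) auto
  then show ?thesis by (simp only: usym_factor mult.assoc)
qed

lemma ssym_vsym:
  assumes p: "1 < p" and m: "mm \<le> m" shows "ssym p (vsym m l)"
proof -
  have "ssym p (\<lambda>x. (1 / (1 + x)) ^ mm * ((1 / (1 + x)) ^ (m - mm) * (\<Sum>i<l. (1 - (1 / (1 + x)) ^ m) ^ i)))"
    using p by (intro ssym_mult ssym_y bsym_mult bsym_sum bsym_power bsym_diff bsym_const bsym_y) auto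
  moreover have "(1 / (1 + x)) ^ mm * ((1 / (1 + x)) ^ (m - mm) * S) = (1 / (1 + x)) ^ m * S" for x S :: real
    using m by (simp only: mult.assoc[symmetric] power_add[symmetric] le_add_diff_inverse)
  ultimately show ?thesis by (simp only: vsym_factor[abs_def])
qed

lemma ssym_dsym:
  assumes p: "1 < p" and m: "mm \<le> m" shows "ssym p (dsym m l)"
  unfolding dsym_def[abs_def] using p by (intro ssym_diff ssym_scale ssym_vsym m) auto

text \<open>The negative power needs the zero of \<open>dsym\<close> at the origin, smoothing needs
  its decay, and a single factorization does not show both. Multiplying by
  \<open>1 = vsym + usym\<close> separates them: \<open>vsym\<close> smooths against the bounded
  \<open>x powr (- a) * dsym\<close>, and \<open>dsym\<close> smooths against the bounded
  \<open>x powr (- a) * usym\<close>.\<close>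

lemma ssym_powr_dsym:
  assumes p: "1 < p" and m: "mm \<le> m" and a: "0 \<le> a" "a < real l"
  shows "ssym p (\<lambda>x. x powr (- a) * dsym m l x)"
proof -
  have bu: "bsym p (\<lambda>x. x powr (- a) * usym m l x)" by (rule bsym_powr_usym[OF p a])
  \<comment> \<open>Writing \<open>dsym\<close> as a difference of \<open>usym\<close> at
    \<open>x\<close> and at \<open>x / 4\<close>; the factor \<open>4 powr (- a)\<close> brings the
    power to the rescaled argument.\<close>
  have e: "x powr (- a) * dsym m l x = x powr (- a) * usym m l x - 4 powr (- a) * ((1 / 4 * x) powr (- a) * usym m l (1 / 4 * x))" for x
  proof -
    have "4 powr (- a) * (1 / 4 * x) powr (- a) = (4 * (1 / 4 * x)) powr (- a)" by (simp only: powr_mult)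
    then have "4 powr (- a) * (1 / 4 * x) powr (- a) = x powr (- a)" by simp
    then have "4 powr (- a) * ((1 / 4 * x) powr (- a) * usym m l (1 / 4 * x)) = x powr (- a) * usym m l (1 / 4 * x)"
      by (simp only: mult.assoc[symmetric])
    then show ?thesis by (simp only: dsym_def vsym_def) (simp add: algebra_simps)
  qed
  have "bsym p (\<lambda>x. x powr (- a) * usym m l x - 4 powr (- a) * ((1 / 4 * x) powr (- a) * usym m l (1 / 4 * x)))"
    using p by (intro bsym_diff bu bsym_mult bsym_const bsym_scale[OF _ bu]) auto
  then have bd: "bsym p (\<lambda>x. x powr (- a) * dsym m l x)" by (simp only: e)
  have "ssym p (\<lambda>x. vsym m l x * (x powr (- a) * dsym m l x) + dsym m l x * (x powr (- a) * usym m l x))"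
    by (intro ssym_add ssym_mult ssym_vsym[OF p m] ssym_dsym[OF p m] bd bu)
  moreover have "vsym m l x * (x powr (- a) * dsym m l x) + dsym m l x * (x powr (- a) * usym m l x) = x powr (- a) * dsym m l x" for x
    by (simp add: vsym_def algebra_simps)
  ultimately show ?thesis by simp
qed

text \<open>Of the \<open>mm + n\<close> resolvent powers, \<open>n\<close> compensate the growth of
  \<open>c\<close> and \<open>mm\<close> remain. The powers of \<open>1 / \<mu>\<close> are harmless
  because \<open>rapid\<close> asks for no uniformity.\<close>

lemma rapid_vsym:
  assumes mu: "0 < \<mu>" "\<mu> \<le> 1" and c: "\<And>k. \<bar>c k\<bar> \<le> (1 + lam2 k) ^ n"
  shows "rapid (\<lambda>k. c k * vsym (mm + n) l (\<mu> * lam2 k))"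
  unfolding rapid_def
proof (intro exI[of _ "real l * (1 / \<mu>) ^ (mm + n)"] conjI allI)
  show "0 \<le> real l * (1 / \<mu>) ^ (mm + n)" using mu by simp
  fix k
  have "1 / (1 + \<mu> * lam2 k) \<le> 1 / (\<mu> * (1 + lam2 k))"
    using mu lam2_nonneg[of k] by (intro frac_le) (auto simp: distrib_left add_pos_nonneg)
  then have "(1 / (1 + \<mu> * lam2 k)) ^ (mm + n) \<le> ((1 / \<mu>) * (1 / (1 + lam2 k))) ^ (mm + n)"
    using mu by (intro power_mono) auto
  then have v: "\<bar>vsym (mm + n) l (\<mu> * lam2 k)\<bar> \<le> real l * ((1 / \<mu>) ^ (mm + n) * (1 / (1 + lam2 k)) ^ (mm + n))"
    using vsym_bound[of "\<mu> * lam2 k" "mm + n" l] mu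
    by (simp only: power_mult_distrib) (meson lam2_nonneg less_imp_le mult_left_mono mult_nonneg_nonneg of_nat_0_le_iff order_trans)
  have "\<bar>c k * vsym (mm + n) l (\<mu> * lam2 k)\<bar> \<le> (1 + lam2 k) ^ n * (real l * ((1 / \<mu>) ^ (mm + n) * (1 / (1 + lam2 k)) ^ (mm + n)))"
    unfolding abs_mult by (intro mult_mono' c v) auto
  also have "\<dots> = real l * (1 / \<mu>) ^ (mm + n) * (((1 + lam2 k) ^ n * (1 / (1 + lam2 k)) ^ n) * (1 / (1 + lam2 k)) ^ mm)"
    by (simp only: power_add mult_ac)
  also have "(1 + lam2 k) ^ n * (1 / (1 + lam2 k)) ^ n = 1"
  proof -
    have "1 + lam2 k \<noteq> 0" using lam2_nonneg[of k] by linarith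
    then have "(1 + lam2 k) * (1 / (1 + lam2 k)) = 1" by simp
    then show ?thesis by (simp only: power_mult_distrib[symmetric]) simp
  qed
  finally show "\<bar>c k * vsym (mm + n) l (\<mu> * lam2 k)\<bar> \<le> real l * (1 / \<mu>) ^ (mm + n) * (1 / (1 + lam2 k)) ^ mm" by simp
qed

lemma rapid_vsym1:
  assumes mu: "0 < \<mu>" "\<mu> \<le> 1" shows "rapid (\<lambda>k. vsym (mm + n) l (\<mu> * lam2 k))"
proof -
  have "rapid (\<lambda>k. 1 * vsym (mm + n) l (\<mu> * lam2 k))" by (rule rapid_vsym[OF mu]) simp
  then show ?thesis by simp
qed

lemma lam2_powr_le: assumes "0 \<le> a" "a \<le> real n" shows "\<bar>lam2 k powr a\<bar> \<le> (1 + lam2 k) ^ n"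
proof -
  have "lam2 k powr a \<le> (1 + lam2 k) powr a" using assms by (intro powr_mono2) auto
  also have "\<dots> \<le> (1 + lam2 k) powr real n" using assms by (intro powr_mono) auto
  also have "\<dots> = (1 + lam2 k) ^ n" using lam2_nonneg[of k] by (intro powr_realpow) linarith
  finally show ?thesis by simp
qed

lemma rapid_diff: assumes "rapid m" "rapid m'" shows "rapid (\<lambda>k. m k - m' k)"
proof -
  obtain C D where C: "C \<ge> 0" "\<And>k. \<bar>m k\<bar> \<le> C * (1 / (1 + lam2 k)) ^ mm"
    and D: "D \<ge> 0" "\<And>k. \<bar>m' k\<bar> \<le> D * (1 / (1 + lam2 k)) ^ mm" using assms unfolding rapid_def by blast
  have "\<bar>m k - m' k\<bar> \<le> (C + D) * (1 / (1 + lam2 k)) ^ mm" for k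
    using C(2)[of k] D(2)[of k] abs_triangle_ineq4[of "m k" "m' k"] by (simp only: distrib_right)
  then show ?thesis unfolding rapid_def using C D by (intro exI[of _ "C + D"]) auto
qed

lemma rapid_bounded_mult: assumes "rapid m" "\<And>k. \<bar>c k\<bar> \<le> B" shows "rapid (\<lambda>k. c k * m k)"
proof -
  obtain C where C: "C \<ge> 0" "\<And>k. \<bar>m k\<bar> \<le> C * (1 / (1 + lam2 k)) ^ mm" using assms unfolding rapid_def by blast
  have B: "B \<ge> 0" using assms(2)[of 0] by linarith
  have "\<bar>c k * m k\<bar> \<le> B * (C * (1 / (1 + lam2 k)) ^ mm)" for k
    unfolding abs_mult by (intro mult_mono' assms C) auto
  then show ?thesis unfolding rapid_def using B C by (intro exI[of _ "B * C"]) (auto simp: mult.assoc)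
qed

lemma rapid_dsym:
  assumes mu: "0 < \<mu>" "\<mu> \<le> 1" shows "rapid (\<lambda>k. dsym (mm + n) l (\<mu> * lam2 k))"
proof -
  have "rapid (\<lambda>k. vsym (mm + n) l ((1 / 4 * \<mu>) * lam2 k) - vsym (mm + n) l (\<mu> * lam2 k))"
    using mu by (intro rapid_diff rapid_vsym1) auto
  then show ?thesis by (simp only: dsym_def mult.assoc)
qed

lemma rapid_powr_dsym:
  assumes mu: "0 < \<mu>" "\<mu> \<le> 1" and a: "a \<ge> 0" shows "rapid (\<lambda>k. (\<mu> * lam2 k) powr (- a) * dsym (mm + n) l (\<mu> * lam2 k))"
proof (rule rapid_bounded_mult[OF rapid_dsym[OF mu]])
  fix k
  show "\<bar>(\<mu> * lam2 k) powr (- a)\<bar> \<le> (\<mu> / 2) powr (- a)"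
  proof (cases "k = 0")
    case False
    then have "\<mu> * (1 / 2) \<le> \<mu> * lam2 k" using mu by (intro mult_left_mono lam2_pos) auto
    then show ?thesis using mu a by (auto intro!: powr_mono2')
  qed simp
qed

lemma lam_powr: "jacobi_lambda \<alpha> \<beta> k powr s = lam2 k powr (s / 2)"
proof -
  have "jacobi_lambda \<alpha> \<beta> k = lam2 k powr (1 / 2)"
    using lam2_nonneg[of k] unfolding jacobi_lambda_def lam2_def by (simp add: powr_half_sqrt)
  then show ?thesis by (simp add: powr_powr)
qed

lemma frac_co:
  assumes "is_fractional_derivative \<alpha> \<beta> \<psi> s g h" "s > 0"
  shows "co h k = lam2 k powr (s / 2) * co g k"
  using assms by (cases "k = 0") (auto simp: is_fractional_derivative_def lam_powr)

abbreviation V :: "nat \<Rightarrow> nat \<Rightarrow> real \<Rightarrow> nat \<Rightarrow> real" where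
  "V m l t k \<equiv> vsym m l (t\<^sup>2 * lam2 k)"

lemma sq01: "0 < t \<Longrightarrow> t \<le> 1 \<Longrightarrow> 0 < t\<^sup>2 \<and> t\<^sup>2 \<le> (1::real)"
  by (auto simp: power_le_one)

text \<open>Split \<open>f - V f\<close> into \<open>(f - g) - V (f - g)\<close> and
  \<open>g - V g\<close>. The last has the coefficients of \<open>h\<close> times
  \<open>t powr s\<close> and the symbol \<open>x powr (- s/2) * usym\<close> at
  \<open>x = t^2 lam2 k\<close>. By \<open>mult_dual\<close> the symbols need bounds in the
  conjugate exponent, and the constant is the same for all pairs \<open>g\<close>,
  \<open>h\<close>.\<close>

lemma realization_1:
  assumes p: "1 < p" and s: "0 < s" and l: "s / 2 < real l"
  obtains C where "C \<ge> 0" "\<And>t f g h. 0 < t \<Longrightarrow> t \<le> 1 \<Longrightarrow> f \<in> Lpset M p \<Longrightarrow> g \<in> Lpset M p \<Longrightarrow> h \<in> Lpset M p \<Longrightarrow>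
    is_fractional_derivative \<alpha> \<beta> \<psi> s g h \<Longrightarrow>
    Lpn M p (\<lambda>x. f x - Ser (V (mm + n) l t) f x) \<le> C * (Lpn M p (\<lambda>x. f x - g x) + t powr s * Lpn M p h)"
proof -
  define p' where "p' = p / (p - 1)"
  have pp: "1 / p + 1 / p' = 1" using p by (simp add: p'_def field_simps)
  have p'1: "1 < p'" using p by (simp add: p'_def field_simps)
  have p1: "1 \<le> p" using p by simp
  obtain C1 where C1: "C1 \<ge> 0" "\<And>\<mu>. \<mu> > 0 \<Longrightarrow> mult p' (\<lambda>k. vsym (mm + n) l (\<mu> * lam2 k)) C1"
    using p'1 by (rule_tac bsymE[OF bsym_vsym[of p' "mm + n" l]]) auto
  obtain C2 where C2: "C2 \<ge> 0" "\<And>\<mu>. \<mu> > 0 \<Longrightarrow> mult p' (\<lambda>k. (\<mu> * lam2 k) powr (- (s / 2)) * usym (mm + n) l (\<mu> * lam2 k)) C2"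
    using s l by (rule_tac bsymE[OF bsym_powr_usym[OF p'1, of "s / 2" l "mm + n"]]) auto
  define C where "C = 1 + C1 + C2"
  show ?thesis
  proof (rule that[of C])
    show "C \<ge> 0" using C1 C2 by (simp add: C_def)
    fix t :: real and f g h :: "real \<Rightarrow> real"
    assume t: "0 < t" "t \<le> 1" and f: "f \<in> Lpset M p" and g: "g \<in> Lpset M p" and h: "h \<in> Lpset M p"
      and fr: "is_fractional_derivative \<alpha> \<beta> \<psi> s g h"
    note t2 = conjunct1[OF sq01[OF t]] conjunct2[OF sq01[OF t]]
    define m where "m = V (mm + n) l t"
    obtain \<kappa> where \<kappa>: "dominated m \<kappa>" unfolding m_def by (rule rapid_dom[OF rapid_vsym1[OF t2]])
    note Li = Lpset_imp_L1(1)[OF finite_measure_M p1]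
    have fg: "(\<lambda>x. f x - g x) \<in> Lpset M p" by (rule Minkowski_diff(1)[OF p1 f g])
    have S: "Ser m k \<in> Lpset M p" if "k \<in> Lpset M p" for k using p1 by (intro Ser_Lp[OF \<kappa> Li[OF that]]) auto
    have A: "Lpn M p (Ser m (\<lambda>x. f x - g x)) \<le> C1 * Lpn M p (\<lambda>x. f x - g x)"
      by (rule mult_dual[OF p pp S[OF fg] fg co_Ser[OF \<kappa> Li[OF fg]] _ C1(1)]) (use C1(2)[OF t2(1)] in \<open>simp add: m_def\<close>)
    have B: "Lpn M p (\<lambda>x. g x - Ser m g x) \<le> t powr s * C2 * Lpn M p h"
    proof (rule mult_dual[OF p pp Minkowski_diff(1)[OF p1 g S[OF g]] h])
      show "mult p' (\<lambda>k. t powr s * ((t\<^sup>2 * lam2 k) powr (- (s / 2)) * usym (mm + n) l (t\<^sup>2 * lam2 k))) (t powr s * C2)"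
        using mult_cmult[OF _ C2(2)[OF t2(1)], of "t powr s"] p'1 by simp
      fix k
      have "co (\<lambda>x. g x - Ser m g x) k = usym (mm + n) l (t\<^sup>2 * lam2 k) * co g k"
        unfolding co_diff[OF Li[OF g] Li[OF S[OF g]]] co_Ser[OF \<kappa> Li[OF g]] by (simp add: m_def vsym_def algebra_simps)
      also have "\<dots> = t powr s * ((t\<^sup>2 * lam2 k) powr (- (s / 2)) * usym (mm + n) l (t\<^sup>2 * lam2 k)) * co h k"
      proof (cases "k = 0")
        \<comment> \<open>At \<open>k = 0\<close> the power of the eigenvalue does not cancel;
          instead \<open>usym\<close> vanishes there since \<open>l\<close> is positive.\<close>
        case True
        have "l \<noteq> 0" using l s by (intro notI) simp
        then show ?thesis using True by (simp add: usym_def)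
      next
        case False
        then have l0: "lam2 k > 0" using lam2_pos[of k] by simp
        have "t powr s * (t\<^sup>2 * lam2 k) powr (- (s / 2)) * lam2 k powr (s / 2) = 1"
        proof -
          have "t\<^sup>2 = t powr 2" using t by (simp add: powr_numeral)
          then have "(t\<^sup>2 * lam2 k) powr (- (s / 2)) = t powr (- s) * lam2 k powr (- (s / 2))"
            by (simp add: powr_mult powr_powr)
          then have "t powr s * (t\<^sup>2 * lam2 k) powr (- (s / 2)) * lam2 k powr (s / 2) = (t powr s * t powr (- s)) * (lam2 k powr (- (s / 2)) * lam2 k powr (s / 2))"
            by (simp only: mult_ac)
          also have "\<dots> = 1" using t l0 by (simp add: powr_add[symmetric])
          finally show ?thesis .
        qed
        then have "usym (mm + n) l (t\<^sup>2 * lam2 k) * co g k = (t powr s * (t\<^sup>2 * lam2 k) powr (- (s / 2)) * lam2 k powr (s / 2)) * (usym (mm + n) l (t\<^sup>2 * lam2 k) * co g k)"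
          by simp
        then show ?thesis unfolding frac_co[OF fr s] by (simp only: mult_ac)
      qed
      finally show "co (\<lambda>x. g x - Ser m g x) k = t powr s * ((t\<^sup>2 * lam2 k) powr (- (s / 2)) * usym (mm + n) l (t\<^sup>2 * lam2 k)) * co h k" .
    qed (use C2 in simp)
    have eq: "f x - Ser m f x = ((f x - g x) - Ser m (\<lambda>x. f x - g x) x) + (g x - Ser m g x)" if "x \<in> {-1..1}" for x
      using Ser_diff[OF \<kappa> Li[OF f] Li[OF g] that] by simp
    have "Lpn M p (\<lambda>x. f x - Ser m f x) = Lpn M p (\<lambda>x. ((f x - g x) - Ser m (\<lambda>x. f x - g x) x) + (g x - Ser m g x))"
      by (rule Lpn_cong) (use eq in simp)
    also have "\<dots> \<le> Lpn M p (\<lambda>x. (f x - g x) - Ser m (\<lambda>x. f x - g x) x) + Lpn M p (\<lambda>x. g x - Ser m g x)"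
      by (rule Minkowski(2)[OF p1 Minkowski_diff(1)[OF p1 fg S[OF fg]] Minkowski_diff(1)[OF p1 g S[OF g]]])
    also have "\<dots> \<le> (Lpn M p (\<lambda>x. f x - g x) + Lpn M p (Ser m (\<lambda>x. f x - g x))) + Lpn M p (\<lambda>x. g x - Ser m g x)"
      by (intro add_right_mono Minkowski_diff(2)[OF p1 fg S[OF fg]])
    also have "\<dots> \<le> (Lpn M p (\<lambda>x. f x - g x) + C1 * Lpn M p (\<lambda>x. f x - g x)) + t powr s * C2 * Lpn M p h"
      by (intro add_mono A B order_refl)
    also have "\<dots> \<le> C * (Lpn M p (\<lambda>x. f x - g x) + t powr s * Lpn M p h)"
    proof -
      have "0 \<le> C2 * Lpn M p (\<lambda>x. f x - g x)" "0 \<le> (1 + C1) * (t powr s * Lpn M p h)"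
        using C1 C2 by (auto simp: Lpn_nonneg intro!: mult_nonneg_nonneg)
      then show ?thesis by (simp add: C_def algebra_simps)
    qed
    finally show "Lpn M p (\<lambda>x. f x - Ser (V (mm + n) l t) f x) \<le> C * (Lpn M p (\<lambda>x. f x - g x) + t powr s * Lpn M p h)"
      by (simp only: m_def)
  qed
qed

text \<open>The derivative of \<open>V f\<close> is the derivative of \<open>V (f - g)\<close> plus
  \<open>V h\<close>. The former costs \<open>t powr (- s)\<close> through the symbol
  \<open>x powr (s/2) * vsym\<close>, which is bounded because \<open>s / 2 \<le> n\<close>.\<close>

lemma realization_2:
  assumes p: "1 < p" and s: "0 < s" and n: "s / 2 \<le> real n"
  obtains C where "C \<ge> 0" "\<And>t f g h. 0 < t \<Longrightarrow> t \<le> 1 \<Longrightarrow> f \<in> Lpset M p \<Longrightarrow> g \<in> Lpset M p \<Longrightarrow> h \<in> Lpset M p \<Longrightarrow>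
    is_fractional_derivative \<alpha> \<beta> \<psi> s g h \<Longrightarrow>
    t powr s * Lpn M p (Ser (\<lambda>k. lam2 k powr (s / 2) * V (mm + n) l t k) f) \<le> C * (Lpn M p (\<lambda>x. f x - g x) + t powr s * Lpn M p h)"
proof -
  define p' where "p' = p / (p - 1)"
  have pp: "1 / p + 1 / p' = 1" using p by (simp add: p'_def field_simps)
  have p'1: "1 < p'" using p by (simp add: p'_def field_simps)
  have p1: "1 \<le> p" using p by simp
  obtain C1 where C1: "C1 \<ge> 0" "\<And>\<mu>. \<mu> > 0 \<Longrightarrow> mult p' (\<lambda>k. vsym (mm + n) l (\<mu> * lam2 k)) C1"
    using p'1 by (rule_tac bsymE[OF bsym_vsym[of p' "mm + n" l]]) auto
  obtain C2 where C2: "C2 \<ge> 0" "\<And>\<mu>. \<mu> > 0 \<Longrightarrow> mult p' (\<lambda>k. (\<mu> * lam2 k) powr (s / 2) * vsym (mm + n) l (\<mu> * lam2 k)) C2"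
    using s n by (rule_tac bsymE[OF bsym_powr_vsym[OF p'1, of "s / 2" "mm + n" l]]) auto
  define C where "C = C1 + C2"
  show ?thesis
  proof (rule that[of C])
    show "C \<ge> 0" using C1 C2 by (simp add: C_def)
    fix t :: real and f g h :: "real \<Rightarrow> real"
    assume t: "0 < t" "t \<le> 1" and f: "f \<in> Lpset M p" and g: "g \<in> Lpset M p" and h: "h \<in> Lpset M p"
      and fr: "is_fractional_derivative \<alpha> \<beta> \<psi> s g h"
    note t2 = conjunct1[OF sq01[OF t]] conjunct2[OF sq01[OF t]]
    define m where "m = V (mm + n) l t"
    define m' where "m' k = lam2 k powr (s / 2) * V (mm + n) l t k" for k
    obtain \<kappa> where \<kappa>: "dominated m \<kappa>" unfolding m_def by (rule rapid_dom[OF rapid_vsym1[OF t2]])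
    obtain \<kappa>' where \<kappa>': "dominated m' \<kappa>'"
      unfolding m'_def[abs_def] using s n by (rule_tac rapid_dom[OF rapid_vsym[OF t2 lam2_powr_le[of "s / 2" n], of l]]) auto
    note Li = Lpset_imp_L1(1)[OF finite_measure_M p1]
    have fg: "(\<lambda>x. f x - g x) \<in> Lpset M p" by (rule Minkowski_diff(1)[OF p1 f g])
    have S: "Ser m k \<in> Lpset M p" "Ser m' k \<in> Lpset M p" if "k \<in> Lpset M p" for k
      using p1 by (intro Ser_Lp[OF \<kappa> Li[OF that]] Ser_Lp[OF \<kappa>' Li[OF that]]; simp)+
    have A: "Lpn M p (Ser m h) \<le> C1 * Lpn M p h"
      by (rule mult_dual[OF p pp S(1)[OF h] h co_Ser[OF \<kappa> Li[OF h]] _ C1(1)]) (use C1(2)[OF t2(1)] in \<open>simp add: m_def\<close>)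
    have ts: "t powr s * t powr (- s) = 1" using t by (simp add: powr_add[symmetric])
    have B: "Lpn M p (Ser m' (\<lambda>x. f x - g x)) \<le> t powr (- s) * C2 * Lpn M p (\<lambda>x. f x - g x)"
    proof (rule mult_dual[OF p pp S(2)[OF fg] fg])
      show "mult p' (\<lambda>k. t powr (- s) * ((t\<^sup>2 * lam2 k) powr (s / 2) * vsym (mm + n) l (t\<^sup>2 * lam2 k))) (t powr (- s) * C2)"
        using mult_cmult[OF _ C2(2)[OF t2(1)], of "t powr (- s)"] p'1 by simp
      fix k
      have "t\<^sup>2 = t powr 2" using t by (simp add: powr_numeral)
      then have "(t\<^sup>2 * lam2 k) powr (s / 2) = t powr s * lam2 k powr (s / 2)" by (simp add: powr_mult powr_powr)
      then have "t powr (- s) * ((t\<^sup>2 * lam2 k) powr (s / 2) * vsym (mm + n) l (t\<^sup>2 * lam2 k)) = (t powr s * t powr (- s)) * m' k"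
        by (simp only: m'_def mult_ac)
      then show "co (Ser m' (\<lambda>x. f x - g x)) k = t powr (- s) * ((t\<^sup>2 * lam2 k) powr (s / 2) * vsym (mm + n) l (t\<^sup>2 * lam2 k)) * co (\<lambda>x. f x - g x) k"
        by (simp only: ts mult_1_left co_Ser[OF \<kappa>' Li[OF fg]])
    qed (use C2 in simp)
    have gh: "Ser m' g = Ser m h"
      unfolding Ser_def[abs_def] m'_def m_def frac_co[OF fr s] by (simp only: mult_ac)
    have eq: "Ser m' f x = Ser m' (\<lambda>x. f x - g x) x + Ser m h x" if "x \<in> {-1..1}" for x
      using Ser_diff[OF \<kappa>' Li[OF f] Li[OF g] that] gh by simp
    have "Lpn M p (Ser m' f) = Lpn M p (\<lambda>x. Ser m' (\<lambda>x. f x - g x) x + Ser m h x)"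
      by (rule Lpn_cong) (use eq in simp)
    also have "\<dots> \<le> Lpn M p (Ser m' (\<lambda>x. f x - g x)) + Lpn M p (Ser m h)"
      by (rule Minkowski(2)[OF p1 S(2)[OF fg] S(1)[OF h]])
    also have "\<dots> \<le> t powr (- s) * C2 * Lpn M p (\<lambda>x. f x - g x) + C1 * Lpn M p h" by (intro add_mono A B)
    finally have "t powr s * Lpn M p (Ser m' f) \<le> t powr s * (t powr (- s) * C2 * Lpn M p (\<lambda>x. f x - g x) + C1 * Lpn M p h)"
      by (rule mult_left_mono) simp
    also have "\<dots> = (t powr s * t powr (- s)) * C2 * Lpn M p (\<lambda>x. f x - g x) + C1 * (t powr s * Lpn M p h)"
      by (simp only: distrib_left mult_ac)
    also have "\<dots> \<le> C * (Lpn M p (\<lambda>x. f x - g x) + t powr s * Lpn M p h)"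
    proof -
      have "0 \<le> C1 * Lpn M p (\<lambda>x. f x - g x)" "0 \<le> C2 * (t powr s * Lpn M p h)"
        using C1 C2 by (auto simp: Lpn_nonneg intro!: mult_nonneg_nonneg)
      then show ?thesis unfolding ts by (simp add: C_def algebra_simps)
    qed
    finally show "t powr s * Lpn M p (Ser (\<lambda>k. lam2 k powr (s / 2) * V (mm + n) l t k) f) \<le> C * (Lpn M p (\<lambda>x. f x - g x) + t powr s * Lpn M p h)"
      by (simp only: m'_def[abs_def])
  qed
qed

text \<open>The same splitting of \<open>f\<close> into \<open>f - g\<close> and \<open>g\<close>,
  now with the smoothing symbols \<open>dsym\<close> and \<open>x powr (- s/2) * dsym\<close>. The
  parameter is \<open>t^2\<close>, so the exponent \<open>(\<alpha> + 1) / p\<close>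
  doubles.\<close>

lemma realization_3:
  assumes p: "1 < p" and s: "0 < s" and l: "s / 2 < real l"
  obtains C where "C \<ge> 0" "\<And>t f g h. 0 < t \<Longrightarrow> t \<le> 1 \<Longrightarrow> f \<in> Lpset M p \<Longrightarrow> g \<in> Lpset M p \<Longrightarrow> h \<in> Lpset M p \<Longrightarrow>
    is_fractional_derivative \<alpha> \<beta> \<psi> s g h \<Longrightarrow>
    AE x in M. \<bar>Ser (V (mm + n) l (t / 2)) f x - Ser (V (mm + n) l t) f x\<bar>
      \<le> C * t powr (- (2 * \<alpha> + 2) / p) * (Lpn M p (\<lambda>x. f x - g x) + t powr s * Lpn M p h)"
proof -
  have p1: "1 \<le> p" using p by simp
  obtain C1 where C1: "C1 \<ge> 0" "\<And>\<mu> f. 0 < \<mu> \<Longrightarrow> \<mu> \<le> 1 \<Longrightarrow> f \<in> Lpset M p \<Longrightarrow> rapid (\<lambda>k. dsym (mm + n) l (\<mu> * lam2 k)) \<Longrightarrow>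
     AE x in M. \<bar>Ser (\<lambda>k. dsym (mm + n) l (\<mu> * lam2 k)) f x\<bar> \<le> C1 * \<mu> powr (- (\<alpha> + 1) / p) * Lpn M p f"
    by (rule ssym_Ser[OF p ssym_dsym[OF p, of "mm + n" l]]) auto
  obtain C2 where C2: "C2 \<ge> 0" "\<And>\<mu> f. 0 < \<mu> \<Longrightarrow> \<mu> \<le> 1 \<Longrightarrow> f \<in> Lpset M p \<Longrightarrow> rapid (\<lambda>k. (\<mu> * lam2 k) powr (- (s / 2)) * dsym (mm + n) l (\<mu> * lam2 k)) \<Longrightarrow>
     AE x in M. \<bar>Ser (\<lambda>k. (\<mu> * lam2 k) powr (- (s / 2)) * dsym (mm + n) l (\<mu> * lam2 k)) f x\<bar> \<le> C2 * \<mu> powr (- (\<alpha> + 1) / p) * Lpn M p f"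
    using s l by (rule_tac ssym_Ser[OF p ssym_powr_dsym[OF p, of "mm + n" "s / 2" l]]) auto
  define C where "C = C1 + C2"
  show ?thesis
  proof (rule that[of C])
    show "C \<ge> 0" using C1 C2 by (simp add: C_def)
    fix t :: real and f g h :: "real \<Rightarrow> real"
    assume t: "0 < t" "t \<le> 1" and f: "f \<in> Lpset M p" and g: "g \<in> Lpset M p" and h: "h \<in> Lpset M p"
      and fr: "is_fractional_derivative \<alpha> \<beta> \<psi> s g h"
    note t2 = conjunct1[OF sq01[OF t]] conjunct2[OF sq01[OF t]]
    note Li = Lpset_imp_L1(1)[OF finite_measure_M p1]
    have fg: "(\<lambda>x. f x - g x) \<in> Lpset M p" by (rule Minkowski_diff(1)[OF p1 f g])
    define m where "m k = dsym (mm + n) l (t\<^sup>2 * lam2 k)" for k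
    define m' where "m' k = (t\<^sup>2 * lam2 k) powr (- (s / 2)) * dsym (mm + n) l (t\<^sup>2 * lam2 k)" for k
    have rm: "rapid m" unfolding m_def[abs_def] by (rule rapid_dsym[OF t2])
    have rm': "rapid m'" unfolding m'_def[abs_def] using s by (intro rapid_powr_dsym t2) simp
    obtain \<kappa> where \<kappa>: "dominated m \<kappa>" by (rule rapid_dom[OF rm])
    obtain \<kappa>' where \<kappa>': "dominated m' \<kappa>'" by (rule rapid_dom[OF rm'])
    have th: "0 < t / 2" "t / 2 \<le> 1" using t by auto
    note th2 = conjunct1[OF sq01[OF th]] conjunct2[OF sq01[OF th]]
    obtain \<kappa>1 where \<kappa>1: "dominated (V (mm + n) l (t / 2)) \<kappa>1" by (rule rapid_dom[OF rapid_vsym1[OF th2]])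
    obtain \<kappa>2 where \<kappa>2: "dominated (V (mm + n) l t) \<kappa>2" by (rule rapid_dom[OF rapid_vsym1[OF t2]])
    have split: "Ser (V (mm + n) l (t / 2)) f x - Ser (V (mm + n) l t) f x = Ser m f x" if x: "x \<in> {-1..1}" for x
    proof -
      have "Ser (V (mm + n) l (t / 2)) f x - Ser (V (mm + n) l t) f x
        = (\<Sum>k. V (mm + n) l (t / 2) k * co f k * poly (\<psi> k) x - V (mm + n) l t k * co f k * poly (\<psi> k) x)"
        unfolding Ser_def by (rule suminf_diff[OF Ser_summable[OF \<kappa>1 Li[OF f] x] Ser_summable[OF \<kappa>2 Li[OF f] x]])
      also have "\<dots> = Ser m f x"
        unfolding Ser_def m_def dsym_def by (simp add: power_divide algebra_simps)
      finally show ?thesis .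
    qed
    have gh: "Ser m g x = t powr s * Ser m' h x" if x: "x \<in> {-1..1}" for x
    proof -
      have "m k * co g k = t powr s * (m' k * co h k)" for k
      proof (cases "k = 0")
        case True then show ?thesis by (simp add: m_def m'_def dsym_def)
      next
        case False
        then have l0: "lam2 k > 0" using lam2_pos[of k] by simp
        have "t\<^sup>2 = t powr 2" using t by (simp add: powr_numeral)
        then have "(t\<^sup>2 * lam2 k) powr (- (s / 2)) = t powr (- s) * lam2 k powr (- (s / 2))"
          by (simp add: powr_mult powr_powr)
        then have "t powr s * (m' k * co h k) = (t powr s * t powr (- s)) * (lam2 k powr (- (s / 2)) * lam2 k powr (s / 2)) * (m k * co g k)"
          unfolding frac_co[OF fr s] m'_def m_def by (simp only: mult_ac)
        also have "\<dots> = m k * co g k" using t l0 by (simp add: powr_add[symmetric])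
        finally show ?thesis ..
      qed
      then have "Ser m g x = (\<Sum>k. t powr s * (m' k * co h k * poly (\<psi> k) x))" unfolding Ser_def by (simp add: mult.assoc)
      also have "\<dots> = t powr s * Ser m' h x" unfolding Ser_def by (rule suminf_mult[OF Ser_summable[OF \<kappa>' Li[OF h] x]])
      finally show ?thesis .
    qed
    have e: "(t\<^sup>2) powr (- (\<alpha> + 1) / p) = t powr (- (2 * \<alpha> + 2) / p)"
    proof -
      have "t\<^sup>2 = t powr 2" using t by (simp add: powr_numeral)
      moreover have "2 * (- (\<alpha> + 1) / p) = - (2 * \<alpha> + 2) / p" by (simp add: algebra_simps)
      ultimately show ?thesis by (simp only: powr_powr)
    qed
    show "AE x in M. \<bar>Ser (V (mm + n) l (t / 2)) f x - Ser (V (mm + n) l t) f x\<bar>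
      \<le> C * t powr (- (2 * \<alpha> + 2) / p) * (Lpn M p (\<lambda>x. f x - g x) + t powr s * Lpn M p h)"
      using C1(2)[OF t2 fg rm[unfolded m_def[abs_def]]] C2(2)[OF t2 h rm'[unfolded m'_def[abs_def]]] AE_space
      unfolding e m_def[abs_def, symmetric] m'_def[abs_def, symmetric]
    proof eventually_elim
      case (elim x)
      then have x: "x \<in> {-1..1}" by simp
      define E where "E = t powr (- (2 * \<alpha> + 2) / p)"
      have E0: "E \<ge> 0" by (simp add: E_def)
      have "Ser m f x = Ser m (\<lambda>x. f x - g x) x + t powr s * Ser m' h x"
        using Ser_diff[OF \<kappa> Li[OF f] Li[OF g] x] gh[OF x] by simp
      then have "\<bar>Ser m f x\<bar> \<le> \<bar>Ser m (\<lambda>x. f x - g x) x\<bar> + t powr s * \<bar>Ser m' h x\<bar>"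
        using abs_triangle_ineq[of "Ser m (\<lambda>x. f x - g x) x" "t powr s * Ser m' h x"] by (simp add: abs_mult)
      also have "\<dots> \<le> C1 * E * Lpn M p (\<lambda>x. f x - g x) + t powr s * (C2 * E * Lpn M p h)"
        using elim unfolding E_def by (intro add_mono mult_left_mono) auto
      also have "\<dots> \<le> C * E * (Lpn M p (\<lambda>x. f x - g x) + t powr s * Lpn M p h)"
      proof -
        have "0 \<le> C2 * E * Lpn M p (\<lambda>x. f x - g x)" "0 \<le> C1 * E * (t powr s * Lpn M p h)"
          using C1 C2 E0 by (auto simp: Lpn_nonneg intro!: mult_nonneg_nonneg)
        then show ?thesis by (simp add: C_def algebra_simps)
      qed
      finally show ?case by (simp only: split[OF x] E_def)
    qed
  qed
qed

end

section \<open>Summation of dyadic blocks\<close>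

text \<open>Jensen's inequality for weights of total at most \<open>W\<close>. The induction splits
  off one weight and normalizes the others by what remains of the total, so only convexity at two
  points is used.\<close>

lemma sum_powr_le:
  fixes c :: "'a \<Rightarrow> real"
  assumes q: "q \<ge> 1" and I: "finite I" and w: "\<And>i. i \<in> I \<Longrightarrow> w i \<ge> 0" and c: "\<And>i. i \<in> I \<Longrightarrow> c i \<ge> 0"
    and W: "(\<Sum>i\<in>I. w i) \<le> W" "W > 0"
  shows "(\<Sum>i\<in>I. w i * c i) powr q \<le> W powr (q - 1) * (\<Sum>i\<in>I. w i * c i powr q)"
proof -
  define w0 where "w0 = W - (\<Sum>i\<in>I. w i)"
  have "(\<Sum>i\<in>J. v i * c i) powr q \<le> V powr (q - 1) * (\<Sum>i\<in>J. v i * c i powr q)"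
    if "finite J" "\<And>i. i \<in> J \<Longrightarrow> v i \<ge> 0" "\<And>i. i \<in> J \<Longrightarrow> c i \<ge> 0" "(\<Sum>i\<in>J. v i) \<le> V" "V > 0" for J v V
    using that
  proof (induction J arbitrary: V rule: finite_induct)
    case empty then show ?case by simp
  next
    case (insert j J)
    define A where "A = (\<Sum>i\<in>J. v i * c i)"
    have A0: "A \<ge> 0" unfolding A_def using insert.prems by (intro sum_nonneg) auto
    show ?case
    \<comment> \<open>If one weight exhausts the total, the others are zero; otherwise
      \<open>V - v j\<close> is positive and may be divided by.\<close>
    proof (cases "v j = V")
      case True
      then have "(\<Sum>i\<in>J. v i) \<le> 0" using insert.prems(3) insert.hyps by simp
      then have z: "v i = 0" if "i \<in> J" for i
        using insert.prems(1) insert.hyps(1) that sum_nonneg_eq_0_iff[of J v]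
        by (metis insertCI order_antisym sum_nonneg)
      have "(V * c j) powr q = V powr (q - 1) * (V * c j powr q)"
        using insert.prems(4) powr_mult_base[of V "q - 1"] by (simp add: powr_mult mult.commute)
      then show ?thesis using insert.hyps True z by simp
    next
      case False
      define V' where "V' = V - v j"
      have vj: "0 \<le> v j" "0 \<le> c j" using insert.prems by auto
      have sJ: "0 \<le> (\<Sum>i\<in>J. v i)" using insert.prems by (intro sum_nonneg) auto
      have V': "V' > 0" "(\<Sum>i\<in>J. v i) \<le> V'"
        using False insert.prems(3) insert.hyps sJ by (auto simp: V'_def)
      have IH: "A powr q \<le> V' powr (q - 1) * (\<Sum>i\<in>J. v i * c i powr q)"
        unfolding A_def by (rule insert.IH) (use insert.prems V' in auto)
      define l where "l = v j / V"
      have l: "0 \<le> l" "l \<le> 1" "1 - l = V' / V"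
        using vj insert.prems(4) V' by (auto simp: l_def V'_def divide_le_eq diff_divide_distrib)
      have "v j * c j + A = V * (l * c j + (1 - l) * (A / V'))"
        using insert.prems(4) V' unfolding l(3) by (simp add: l_def distrib_left)
      then have "(v j * c j + A) powr q = V powr q * (l * c j + (1 - l) * (A / V')) powr q" by (simp add: powr_mult)
      also have "\<dots> \<le> V powr q * (l * c j powr q + (1 - l) * (A / V') powr q)"
        using l vj A0 V' by (intro mult_left_mono powr_convex_two q) auto
      also have "\<dots> \<le> V powr q * (l * c j powr q + (1 - l) * ((\<Sum>i\<in>J. v i * c i powr q) / V'))"
      proof (intro mult_left_mono add_left_mono)
        have "(A / V') powr q = A powr q / V' powr q" using V' A0 by (simp add: powr_divide)
        also have "\<dots> \<le> V' powr (q - 1) * (\<Sum>i\<in>J. v i * c i powr q) / V' powr q"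
          by (intro divide_right_mono IH) simp
        also have "V' powr q = V' powr (q - 1) * V'" using V' powr_mult_base[of V' "q - 1"] by (simp add: mult.commute)
        also have "V' powr (q - 1) * (\<Sum>i\<in>J. v i * c i powr q) / (V' powr (q - 1) * V') = (\<Sum>i\<in>J. v i * c i powr q) / V'"
          using V' by simp
        finally show "(A / V') powr q \<le> (\<Sum>i\<in>J. v i * c i powr q) / V'" .
      qed (use l in simp_all)
      also have "V powr q * (l * c j powr q + (1 - l) * ((\<Sum>i\<in>J. v i * c i powr q) / V')) = V powr (q - 1) * (v j * c j powr q + (\<Sum>i\<in>J. v i * c i powr q))"
      proof -
        have "V powr q = V powr (q - 1) * V" using insert.prems(4) powr_mult_base[of V "q - 1"] by (simp add: mult.commute)
        moreover have "V * (l * c j powr q + (1 - l) * ((\<Sum>i\<in>J. v i * c i powr q) / V')) = v j * c j powr q + (\<Sum>i\<in>J. v i * c i powr q)"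
          using insert.prems(4) V' unfolding l(3) by (simp add: l_def distrib_left)
        ultimately show ?thesis by (simp only: mult.assoc)
      qed
      finally show ?thesis using insert.hyps by (simp add: A_def)
    qed
  qed
  from this[OF I w c W] show ?thesis .
qed

lemma powr_mult_le_add:
  fixes a b :: real
  assumes "0 < p" "p < q" "a \<ge> 0" "b \<ge> 0"
  shows "a powr (q - p) * b powr p \<le> a powr q + b powr q"
proof -
  define m where "m = max a b"
  have m: "a \<le> m" "b \<le> m" "m \<ge> 0" using assms by (auto simp: m_def)
  have "a powr (q - p) * b powr p \<le> m powr (q - p) * m powr p"
    using m assms by (intro mult_mono powr_mono2) auto
  also have "\<dots> = m powr q" by (simp add: powr_add[symmetric])
  also have "\<dots> \<le> a powr q + b powr q" by (auto simp: m_def max_def)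
  finally show ?thesis .
qed

text \<open>If \<open>\<tau>\<close> is the first partial sum of \<open>2 c\<close> that dominates \<open>S\<close>, the terms before it
  contribute at most \<open>S / 2\<close>; the remaining ones are measured in \<open>L\<^sub>p\<close>.\<close>

lemma powr_sum_split:
  fixes a c :: "nat \<Rightarrow> real"
  assumes p: "0 < p" "p < q" and a: "\<And>j. j < n \<Longrightarrow> 0 \<le> a j" "\<And>j. j < n \<Longrightarrow> a j \<le> c j"
  shows "(\<Sum>j<n. a j) powr q \<le> 2 powr p * (\<Sum>i<n. (2 * (\<Sum>j\<le>i. c j)) powr (q - p) * (\<Sum>j\<in>{i..<n}. a j) powr p)"
proof (cases "(\<Sum>j<n. a j) = 0")
  case True
  have "0 \<le> 2 powr p * (\<Sum>i<n. (2 * (\<Sum>j\<le>i. c j)) powr (q - p) * (\<Sum>j\<in>{i..<n}. a j) powr p)"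
    by (intro mult_nonneg_nonneg sum_nonneg) auto
  then show ?thesis using True by simp
next
  case False
  define S where "S = (\<Sum>j<n. a j)"
  have S0: "S > 0" using False a sum_nonneg[of "{..<n}" a] by (simp add: S_def)
  then have n: "n > 0" by (cases n) (auto simp: S_def)
  have ex: "\<exists>i. i < n \<and> S \<le> 2 * (\<Sum>j\<le>i. c j)"
  proof (intro exI[of _ "n - 1"] conjI)
    have "S \<le> (\<Sum>j<n. c j)" unfolding S_def using a by (intro sum_mono) auto
    moreover have "{..n - 1} = {..<n}" using n by auto
    ultimately show "S \<le> 2 * (\<Sum>j\<le>n - 1. c j)" using S0 by simp
  qed (use n in simp)
  define i where "i = (LEAST i. i < n \<and> S \<le> 2 * (\<Sum>j\<le>i. c j))"
  have i: "i < n" "S \<le> 2 * (\<Sum>j\<le>i. c j)" using LeastI_ex[OF ex] by (auto simp: i_def)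
  have before: "2 * (\<Sum>j<i. a j) \<le> S"
  proof (cases i)
    case 0 then show ?thesis using S0 by simp
  next
    case (Suc i')
    have "\<not> (i' < n \<and> S \<le> 2 * (\<Sum>j\<le>i'. c j))" using not_less_Least[of i' "\<lambda>i. i < n \<and> S \<le> 2 * (\<Sum>j\<le>i. c j)"] Suc by (simp add: i_def)
    then have "2 * (\<Sum>j\<le>i'. c j) < S" using i(1) Suc by auto
    moreover have "(\<Sum>j<i. a j) \<le> (\<Sum>j\<le>i'. c j)"
      unfolding Suc lessThan_Suc_atMost using i(1) Suc by (intro sum_mono a) auto
    ultimately show ?thesis by simp
  qed
  have "S = (\<Sum>j<i. a j) + (\<Sum>j\<in>{i..<n}. a j)"
    unfolding S_def using i(1) by (simp add: sum.atLeastLessThan_concat[of 0 i n a, symmetric] lessThan_atLeast0)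
  then have tail: "S \<le> 2 * (\<Sum>j\<in>{i..<n}. a j)" using before by simp
  have "S powr q = S powr (q - p) * S powr p" by (simp add: powr_add[symmetric])
  also have "\<dots> \<le> (2 * (\<Sum>j\<le>i. c j)) powr (q - p) * (2 * (\<Sum>j\<in>{i..<n}. a j)) powr p"
    using p S0 i tail by (intro mult_mono powr_mono2) auto
  also have "\<dots> = 2 powr p * ((2 * (\<Sum>j\<le>i. c j)) powr (q - p) * (\<Sum>j\<in>{i..<n}. a j) powr p)"
    by (simp add: powr_mult)
  also have "\<dots> \<le> 2 powr p * (\<Sum>i<n. (2 * (\<Sum>j\<le>i. c j)) powr (q - p) * (\<Sum>j\<in>{i..<n}. a j) powr p)"
    using i(1) by (intro mult_left_mono member_le_sum) auto
  finally show ?thesis by (simp add: S_def)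
qed

lemma geometric_le: assumes "0 < \<rho>" "\<rho> < (1::real)" shows "(\<Sum>j<n. \<rho> ^ j) \<le> 1 / (1 - \<rho>)"
proof -
  have "(\<Sum>j<n. \<rho> ^ j) = (1 - \<rho> ^ n) / (1 - \<rho>)" using assms by (subst sum_gp_strict) auto
  also have "\<dots> \<le> 1 / (1 - \<rho>)" using assms by (intro divide_right_mono) auto
  finally show ?thesis .
qed

text \<open>Jensen with geometric weights for each \<open>i\<close>, then exchange of the two
  summations. The sum of weights over \<open>j\<close> yields the factor
  \<open>W powr (q - 1)\<close>, the one over \<open>i\<close> the last factor
  \<open>W\<close>.\<close>

lemma discrete_hardy_below:
  fixes D :: "nat \<Rightarrow> real"
  assumes q: "q \<ge> 1" and \<rho>: "0 < \<rho>" "\<rho> < 1" and D: "\<And>j. D j \<ge> 0"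
  shows "(\<Sum>i<n. (\<Sum>j\<le>i. \<rho> ^ (i - j) * D j) powr q) \<le> (1 / (1 - \<rho>)) powr q * (\<Sum>j<n. D j powr q)"
proof -
  define W where "W = 1 / (1 - \<rho>)"
  have W: "W > 0" using \<rho> by (simp add: W_def)
  have "(\<Sum>i<n. (\<Sum>j\<le>i. \<rho> ^ (i - j) * D j) powr q) \<le> (\<Sum>i<n. W powr (q - 1) * (\<Sum>j\<le>i. \<rho> ^ (i - j) * D j powr q))"
  proof (rule sum_mono, rule sum_powr_le)
    fix i
    have "(\<Sum>j\<le>i. \<rho> ^ (i - j)) = (\<Sum>j\<le>i. \<rho> ^ j)" using sum.nat_diff_reindex[of "\<lambda>j. \<rho> ^ j" "Suc i"]
      by (simp add: lessThan_Suc_atMost)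
    also have "\<dots> \<le> W" unfolding W_def lessThan_Suc_atMost[symmetric] by (rule geometric_le[OF \<rho>])
    finally show "(\<Sum>j\<le>i. \<rho> ^ (i - j)) \<le> W" .
  qed (use q \<rho> D W in auto)
  also have "\<dots> = W powr (q - 1) * (\<Sum>i<n. \<Sum>j\<le>i. \<rho> ^ (i - j) * D j powr q)" by (simp add: sum_distrib_left)
  also have "(\<Sum>i<n. \<Sum>j\<le>i. \<rho> ^ (i - j) * D j powr q) = (\<Sum>j<n. \<Sum>i\<in>{j..<n}. \<rho> ^ (i - j) * D j powr q)"
    by (subst sum.Sigma, simp, simp, subst sum.Sigma, simp, simp,
        rule sum.reindex_bij_witness[of _ "\<lambda>(j, i). (i, j)" "\<lambda>(i, j). (j, i)"]) auto
  also have "W powr (q - 1) * \<dots> \<le> W powr (q - 1) * (\<Sum>j<n. W * D j powr q)"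
  proof (intro mult_left_mono sum_mono)
    fix j assume "j \<in> {..<n}"
    have "(\<Sum>i\<in>{j..<n}. \<rho> ^ (i - j)) = (\<Sum>i<n - j. \<rho> ^ i)"
      by (rule sum.reindex_bij_witness[of _ "\<lambda>i. i + j" "\<lambda>i. i - j"]) auto
    also have "\<dots> \<le> W" unfolding W_def by (rule geometric_le[OF \<rho>])
    finally show "(\<Sum>i\<in>{j..<n}. \<rho> ^ (i - j) * D j powr q) \<le> W * D j powr q"
      unfolding sum_distrib_right[symmetric] by (rule mult_right_mono) simp
  qed simp
  also have "\<dots> = (W powr (q - 1) * W) * (\<Sum>j<n. D j powr q)" by (simp only: sum_distrib_left mult.assoc)
  also have "W powr (q - 1) * W = W powr q" using W powr_mult_base[of W "q - 1"] by (simp add: mult.commute)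
  finally show ?thesis by (simp add: W_def)
qed

lemma discrete_hardy_above:
  fixes D :: "nat \<Rightarrow> real"
  assumes q: "q \<ge> 1" and \<rho>: "0 < \<rho>" "\<rho> < 1" and D: "\<And>j. D j \<ge> 0"
  shows "(\<Sum>i<n. (\<Sum>j\<in>{i..<n}. \<rho> ^ (j - i) * D j) powr q) \<le> (1 / (1 - \<rho>)) powr q * (\<Sum>j<n. D j powr q)"
proof -
  define W where "W = 1 / (1 - \<rho>)"
  have W: "W > 0" using \<rho> by (simp add: W_def)
  have "(\<Sum>i<n. (\<Sum>j\<in>{i..<n}. \<rho> ^ (j - i) * D j) powr q) \<le> (\<Sum>i<n. W powr (q - 1) * (\<Sum>j\<in>{i..<n}. \<rho> ^ (j - i) * D j powr q))"
  proof (rule sum_mono, rule sum_powr_le)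
    fix i
    have "(\<Sum>j\<in>{i..<n}. \<rho> ^ (j - i)) = (\<Sum>j<n - i. \<rho> ^ j)"
      by (rule sum.reindex_bij_witness[of _ "\<lambda>k. k + i" "\<lambda>k. k - i"]) auto
    also have "\<dots> \<le> W" unfolding W_def by (rule geometric_le[OF \<rho>])
    finally show "(\<Sum>j\<in>{i..<n}. \<rho> ^ (j - i)) \<le> W" .
  qed (use q \<rho> D W in auto)
  also have "\<dots> = W powr (q - 1) * (\<Sum>i<n. \<Sum>j\<in>{i..<n}. \<rho> ^ (j - i) * D j powr q)" by (simp add: sum_distrib_left)
  also have "(\<Sum>i<n. \<Sum>j\<in>{i..<n}. \<rho> ^ (j - i) * D j powr q) = (\<Sum>j<n. \<Sum>i\<le>j. \<rho> ^ (j - i) * D j powr q)"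
    by (subst sum.Sigma, simp, simp, subst sum.Sigma, simp, simp,
        rule sum.reindex_bij_witness[of _ "\<lambda>(j, i). (i, j)" "\<lambda>(i, j). (j, i)"]) auto
  also have "W powr (q - 1) * \<dots> \<le> W powr (q - 1) * (\<Sum>j<n. W * D j powr q)"
  proof (intro mult_left_mono sum_mono)
    fix j assume "j \<in> {..<n}"
    have "(\<Sum>i\<le>j. \<rho> ^ (j - i)) = (\<Sum>i\<le>j. \<rho> ^ i)" using sum.nat_diff_reindex[of "\<lambda>j. \<rho> ^ j" "Suc j"]
      by (simp add: lessThan_Suc_atMost)
    also have "\<dots> \<le> W" unfolding W_def lessThan_Suc_atMost[symmetric] by (rule geometric_le[OF \<rho>])
    finally show "(\<Sum>i\<le>j. \<rho> ^ (j - i) * D j powr q) \<le> W * D j powr q"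
      unfolding sum_distrib_right[symmetric] by (rule mult_right_mono) simp
  qed simp
  also have "\<dots> = (W powr (q - 1) * W) * (\<Sum>j<n. D j powr q)" by (simp only: sum_distrib_left mult.assoc)
  also have "W powr (q - 1) * W = W powr q" using W powr_mult_base[of W "q - 1"] by (simp add: mult.commute)
  finally show ?thesis by (simp add: W_def)
qed

section \<open>Properties of the \<open>K\<close>-functional and \<open>L_q\<close> bounds for sums
  of blocks\<close>

context jacobi
begin

lemma jacobi_Lp_eq: "jacobi_Lp p \<alpha> \<beta> = Lpset M p"
  by (simp add: jacobi_Lp_def Lpset_def)

lemma jacobi_norm_eq: "jacobi_norm p \<alpha> \<beta> f = Lpn M p f"
  by (simp add: jacobi_norm_def Lpn_def)

abbreviation K :: "real \<Rightarrow> real \<Rightarrow> (real \<Rightarrow> real) \<Rightarrow> real \<Rightarrow> real" where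
  "K \<equiv> K_functional \<alpha> \<beta> \<psi>"

definition admissible :: "real \<Rightarrow> real \<Rightarrow> (real \<Rightarrow> real) \<Rightarrow> (real \<Rightarrow> real) \<Rightarrow> bool" where
  "admissible p s g h \<longleftrightarrow> g \<in> Lpset M p \<and> h \<in> Lpset M p \<and> is_fractional_derivative \<alpha> \<beta> \<psi> s g h"

lemma K_eq: "K p s f t = Inf {Lpn M p (\<lambda>x. f x - g x) + t powr s * Lpn M p h | g h. admissible p s g h}"
  by (simp add: K_functional_def admissible_def jacobi_Lp_eq jacobi_norm_eq)

lemma admissible_zero: "admissible p s (\<lambda>_. 0) (\<lambda>_. 0)"
  by (simp add: admissible_def is_fractional_derivative_def jacobi_Lp_eq Lpset_zero co_zero)

lemma K_nonempty: "{Lpn M p (\<lambda>x. f x - g x) + t powr s * Lpn M p h | g h. admissible p s g h} \<noteq> {}"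
  using admissible_zero by blast

lemma K_le: "admissible p s g h \<Longrightarrow> K p s f t \<le> Lpn M p (\<lambda>x. f x - g x) + t powr s * Lpn M p h"
  unfolding K_eq by (rule cInf_lower) (auto intro!: bdd_belowI[of _ 0] add_nonneg_nonneg simp: Lpn_nonneg)

text \<open>How estimates pass to the infimum: the constant must be the same for all admissible
  pairs. The proof divides by \<open>C\<close>, so \<open>C = 0\<close> is settled by the zero
  pair.\<close>

lemma K_greatest:
  assumes C: "C \<ge> 0" and X: "\<And>g h. admissible p s g h \<Longrightarrow> X \<le> C * (Lpn M p (\<lambda>x. f x - g x) + t powr s * Lpn M p h)"
  shows "X \<le> C * K p s f t"
proof (cases "C = 0")
  case True then show ?thesis using X[OF admissible_zero] by simp
next
  case False
  then have C0: "C > 0" using C by simp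
  have "X / C \<le> K p s f t" unfolding K_eq
  proof (rule cInf_greatest[OF K_nonempty])
    fix y assume "y \<in> {Lpn M p (\<lambda>x. f x - g x) + t powr s * Lpn M p h | g h. admissible p s g h}"
    then show "X / C \<le> y" using X C0 by (auto simp: divide_le_eq mult.commute)
  qed
  then show ?thesis using C0 by (simp add: divide_le_eq mult.commute)
qed

lemma K_nonneg: "0 \<le> K p s f t"
  using K_greatest[of 1 p s 0 f t] by (auto simp: Lpn_nonneg intro!: add_nonneg_nonneg)

lemma K_mono: assumes "s > 0" "0 < u" "u \<le> t" shows "K p s f u \<le> K p s f t"
proof -
  have "K p s f u \<le> 1 * K p s f t"
  proof (rule K_greatest)
    fix g h assume a: "admissible p s g h"
    have "u powr s \<le> t powr s" using assms by (intro powr_mono2) auto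
    then have "u powr s * Lpn M p h \<le> t powr s * Lpn M p h" by (intro mult_right_mono) (auto simp: Lpn_nonneg)
    then show "K p s f u \<le> 1 * (Lpn M p (\<lambda>x. f x - g x) + t powr s * Lpn M p h)" using K_le[OF a, of f u] by simp
  qed simp
  then show ?thesis by simp
qed

text \<open>For each pair, enlarging \<open>t\<close> costs at most \<open>(t / u) powr s\<close> in
  the derivative term and nothing in the other. With \<open>K_mono\<close> this makes
  \<open>K\<close> comparable at neighbouring dyadic scales.\<close>

lemma K_scale: assumes "s > 0" "0 < u" "u \<le> t" shows "K p s f t \<le> (t / u) powr s * K p s f u"
proof (rule K_greatest)
  fix g h assume a: "admissible p s g h"
  have 1: "1 \<le> (t / u) powr s" using assms by (intro ge_one_powr_ge_zero) auto
  have "Lpn M p (\<lambda>x. f x - g x) \<le> (t / u) powr s * Lpn M p (\<lambda>x. f x - g x)"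
    using mult_right_mono[OF 1 Lpn_nonneg] by simp
  moreover have "t powr s = (t / u) powr s * u powr s" using assms by (simp add: powr_divide)
  ultimately show "K p s f t \<le> (t / u) powr s * (Lpn M p (\<lambda>x. f x - g x) + u powr s * Lpn M p h)"
    using K_le[OF a, of f t] by (simp add: distrib_left mult.assoc)
qed simp

text \<open>A monotone function is Borel; extending by \<open>0\<close> to \<open>u \<le> 0\<close>
  keeps it monotone on the whole line because \<open>K\<close> is nonnegative.\<close>

lemma K_measurable: assumes "s > 0" shows "(\<lambda>u. if 0 < u then K p s f u else 0) \<in> borel_measurable borel"
  by (rule borel_measurable_mono) (auto simp: mono_def K_nonneg intro: K_mono[OF assms])

text \<open>The exceptional null set depends on the pair and there are uncountably many pairs. A
  minimizing sequence reduces them to countably many.\<close>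

lemma K_AE_bound:
  assumes c: "c \<ge> 0" and X: "\<And>g h. admissible p s g h \<Longrightarrow> AE x in M. X x \<le> c * (Lpn M p (\<lambda>x. f x - g x) + t powr s * Lpn M p h)"
  shows "AE x in M. X x \<le> c * K p s f t"
proof -
  have ex: "\<exists>g h. admissible p s g h \<and> Lpn M p (\<lambda>x. f x - g x) + t powr s * Lpn M p h < K p s f t + 1 / real (Suc n)" for n
  proof -
    let ?A = "{Lpn M p (\<lambda>x. f x - g x) + t powr s * Lpn M p h | g h. admissible p s g h}"
    have "Inf ?A < K p s f t + 1 / real (Suc n)" unfolding K_eq[symmetric] by simp
    then have "\<exists>y\<in>?A. y < K p s f t + 1 / real (Suc n)" by (rule cInf_lessD[OF K_nonempty])
    then show ?thesis by blast
  qed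
  have "AE x in M. X x \<le> c * (K p s f t + 1 / real (Suc n))" for n
  proof -
    obtain g h where gh: "admissible p s g h" "Lpn M p (\<lambda>x. f x - g x) + t powr s * Lpn M p h < K p s f t + 1 / real (Suc n)"
      using ex by blast
    have le: "c * (Lpn M p (\<lambda>x. f x - g x) + t powr s * Lpn M p h) \<le> c * (K p s f t + 1 / real (Suc n))"
      using gh(2) c by (intro mult_left_mono) auto
    from X[OF gh(1)] show ?thesis by eventually_elim (rule order_trans[OF _ le])
  qed
  then have "AE x in M. \<forall>n. X x \<le> c * (K p s f t + 1 / real (Suc n))" unfolding AE_all_countable by blast
  then show ?thesis
  proof eventually_elim
    case (elim x)
    have "(\<lambda>n. c * (K p s f t + inverse (real (Suc n)))) \<longlonglongrightarrow> c * (K p s f t + 0)"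
      by (intro tendsto_intros LIMSEQ_inverse_real_of_nat)
    then have "X x \<le> c * (K p s f t + 0)"
      by (rule LIMSEQ_le_const) (use elim in \<open>auto simp: inverse_eq_divide\<close>)
    then show ?case by simp
  qed
qed

text \<open>\<open>powr_sum_split\<close> is applied at almost every point, with the
  \<open>L_infinity\<close> bounds \<open>c\<close> as majorants. Integration then leaves the tails,
  to which Minkowski in \<open>L_p\<close> applies.\<close>

lemma integral_powr_sum_le:
  fixes d :: "nat \<Rightarrow> real \<Rightarrow> real" and c e :: "nat \<Rightarrow> real"
  assumes p: "1 < p" "p < q"
    and dm: "\<And>j. j < n \<Longrightarrow> d j \<in> Lpset M p" and dc: "\<And>j. j < n \<Longrightarrow> AE x in M. \<bar>d j x\<bar> \<le> c j"
    and de: "\<And>j. j < n \<Longrightarrow> Lpn M p (d j) \<le> e j" and bd: "\<And>j. j < n \<Longrightarrow> bdd (d j)"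
  shows "(LINT x|M. \<bar>\<Sum>j<n. d j x\<bar> powr q) \<le> 2 powr p * (\<Sum>i<n. (2 * (\<Sum>j\<le>i. c j)) powr (q - p) * (\<Sum>j\<in>{i..<n}. e j) powr p)"
proof -
  have p1: "1 \<le> p" using p by simp
  have L: "(\<lambda>x. \<bar>d j x\<bar>) \<in> Lpset M p" if "j < n" for j
    using dm[OF that] by (auto simp: Lpset_def)
  have Ln: "Lpn M p (\<lambda>x. \<bar>d j x\<bar>) = Lpn M p (d j)" for j by (simp add: Lpn_def)
  have tl: "(\<lambda>x. \<Sum>j\<in>{i..<n}. \<bar>d j x\<bar>) \<in> Lpset M p \<and> Lpn M p (\<lambda>x. \<Sum>j\<in>{i..<n}. \<bar>d j x\<bar>) \<le> (\<Sum>j\<in>{i..<n}. Lpn M p (\<lambda>x. \<bar>d j x\<bar>))" for i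
    using L by (intro Minkowski_sum p1) auto
  have ti: "integrable M (\<lambda>x. (\<Sum>j\<in>{i..<n}. \<bar>d j x\<bar>) powr p)" for i
  proof -
    have "integrable M (\<lambda>x. \<bar>\<Sum>j\<in>{i..<n}. \<bar>d j x\<bar>\<bar> powr p)" using tl[of i] by (intro LpsetD) auto
    then show ?thesis by (simp add: sum_nonneg)
  qed
  have te: "(LINT x|M. (\<Sum>j\<in>{i..<n}. \<bar>d j x\<bar>) powr p) \<le> (\<Sum>j\<in>{i..<n}. e j) powr p" for i
  proof -
    have "(LINT x|M. (\<Sum>j\<in>{i..<n}. \<bar>d j x\<bar>) powr p) = (LINT x|M. \<bar>\<Sum>j\<in>{i..<n}. \<bar>d j x\<bar>\<bar> powr p)" by (simp add: sum_nonneg)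
    also have "\<dots> = Lpn M p (\<lambda>x. \<Sum>j\<in>{i..<n}. \<bar>d j x\<bar>) powr p" using p by (simp add: Lpn_powr)
    also have "\<dots> \<le> (\<Sum>j\<in>{i..<n}. e j) powr p"
    proof (rule powr_mono2)
      have "(\<Sum>j\<in>{i..<n}. Lpn M p (\<lambda>x. \<bar>d j x\<bar>)) \<le> (\<Sum>j\<in>{i..<n}. e j)"
        unfolding Ln by (intro sum_mono de) auto
      then show "Lpn M p (\<lambda>x. \<Sum>j\<in>{i..<n}. \<bar>d j x\<bar>) \<le> (\<Sum>j\<in>{i..<n}. e j)" using tl[of i] by linarith
    qed (use p in \<open>auto simp: Lpn_nonneg\<close>)
    finally show ?thesis .
  qed
  have "AE x in M. \<forall>j\<in>{..<n}. \<bar>d j x\<bar> \<le> c j" using dc by (intro AE_finite_allI) auto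
  then have ae: "AE x in M. \<bar>\<Sum>j<n. d j x\<bar> powr q \<le> 2 powr p * (\<Sum>i<n. (2 * (\<Sum>j\<le>i. c j)) powr (q - p) * (\<Sum>j\<in>{i..<n}. \<bar>d j x\<bar>) powr p)"
  proof eventually_elim
    case (elim x)
    have "\<bar>\<Sum>j<n. d j x\<bar> powr q \<le> (\<Sum>j<n. \<bar>d j x\<bar>) powr q" using p by (intro powr_mono2 sum_abs) auto
    also have "\<dots> \<le> 2 powr p * (\<Sum>i<n. (2 * (\<Sum>j\<le>i. c j)) powr (q - p) * (\<Sum>j\<in>{i..<n}. \<bar>d j x\<bar>) powr p)"
      using p elim by (intro powr_sum_split) auto
    finally show ?case .
  qed
  have "(LINT x|M. \<bar>\<Sum>j<n. d j x\<bar> powr q) \<le> (LINT x|M. 2 powr p * (\<Sum>i<n. (2 * (\<Sum>j\<le>i. c j)) powr (q - p) * (\<Sum>j\<in>{i..<n}. \<bar>d j x\<bar>) powr p))"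
  proof (rule integral_mono_AE[OF _ _ ae])
    have "(\<lambda>x. \<Sum>j<n. d j x) \<in> Lpset M q" using p bd by (intro bdd_Lp bdd_sum) auto
    then show "integrable M (\<lambda>x. \<bar>\<Sum>j<n. d j x\<bar> powr q)" by (rule LpsetD)
    show "integrable M (\<lambda>x. 2 powr p * (\<Sum>i<n. (2 * (\<Sum>j\<le>i. c j)) powr (q - p) * (\<Sum>j\<in>{i..<n}. \<bar>d j x\<bar>) powr p))"
      by (intro integrable_mult_right Bochner_Integration.integrable_sum ti)
  qed
  also have "\<dots> = 2 powr p * (\<Sum>i<n. (2 * (\<Sum>j\<le>i. c j)) powr (q - p) * (LINT x|M. (\<Sum>j\<in>{i..<n}. \<bar>d j x\<bar>) powr p))"
    unfolding integral_mult_right_zero by (subst Bochner_Integration.integral_sum) (auto intro: ti)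
  also have "\<dots> \<le> 2 powr p * (\<Sum>i<n. (2 * (\<Sum>j\<le>i. c j)) powr (q - p) * (\<Sum>j\<in>{i..<n}. e j) powr p)"
    by (intro mult_left_mono sum_mono te) auto
  finally show ?thesis .
qed

text \<open>A subsequence of the \<open>L_1\<close>-convergent sequence converges almost everywhere,
  and Fatou's lemma transfers the bound.\<close>

lemma Lp_Fatou:
  fixes F :: "nat \<Rightarrow> real \<Rightarrow> real"
  assumes q: "q > 0" and F: "\<And>n. F n \<in> Lpset M q" and G: "integrable M G" and Fi: "\<And>n. integrable M (F n)"
    and lim: "(\<lambda>n. LINT x|M. \<bar>F n x - G x\<bar>) \<longlonglongrightarrow> 0" and bound: "\<And>n. (LINT x|M. \<bar>F n x\<bar> powr q) \<le> B"
  shows "G \<in> Lpset M q" "(LINT x|M. \<bar>G x\<bar> powr q) \<le> B"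
proof -
  have [measurable]: "G \<in> borel_measurable M" by (rule borel_measurable_integrable[OF G])
  have [measurable]: "F n \<in> borel_measurable M" for n by (rule borel_measurable_integrable[OF Fi])
  obtain r :: "nat \<Rightarrow> nat" where r: "strict_mono r" "AE x in M. (\<lambda>n. F (r n) x - G x) \<longlonglongrightarrow> 0"
    using tendsto_L1_AE_subseq[of M "\<lambda>n x. F n x - G x"] Bochner_Integration.integrable_diff[OF Fi G] lim
    by (auto simp: real_norm_def)
  have B: "B \<ge> 0" by (rule order_trans[OF _ bound[of 0]]) (rule Bochner_Integration.integral_nonneg, simp)
  have "(\<integral>\<^sup>+x. ennreal (\<bar>G x\<bar> powr q) \<partial>M) \<le> (\<integral>\<^sup>+x. liminf (\<lambda>n. ennreal (\<bar>F (r n) x\<bar> powr q)) \<partial>M)"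
  proof (rule nn_integral_mono_AE)
    show "AE x in M. ennreal (\<bar>G x\<bar> powr q) \<le> liminf (\<lambda>n. ennreal (\<bar>F (r n) x\<bar> powr q))"
      using r(2)
    proof eventually_elim
      case (elim x)
      then have "(\<lambda>n. (F (r n) x - G x) + G x) \<longlonglongrightarrow> 0 + G x" by (intro tendsto_intros)
      then have "(\<lambda>n. \<bar>F (r n) x\<bar>) \<longlonglongrightarrow> \<bar>G x\<bar>" by (intro tendsto_rabs) simp
      then have "(\<lambda>n. \<bar>F (r n) x\<bar> powr q) \<longlonglongrightarrow> \<bar>G x\<bar> powr q" using q by (intro tendsto_powr') auto
      then have "(\<lambda>n. ennreal (\<bar>F (r n) x\<bar> powr q)) \<longlonglongrightarrow> ennreal (\<bar>G x\<bar> powr q)" by (intro tendsto_ennrealI)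
      then have "liminf (\<lambda>n. ennreal (\<bar>F (r n) x\<bar> powr q)) = ennreal (\<bar>G x\<bar> powr q)"
        by (intro lim_imp_Liminf) auto
      then show ?case by simp
    qed
  qed
  also have "\<dots> \<le> liminf (\<lambda>n. \<integral>\<^sup>+x. ennreal (\<bar>F (r n) x\<bar> powr q) \<partial>M)"
    by (rule nn_integral_liminf) measurable
  also have "\<dots> \<le> liminf (\<lambda>n. ennreal B)"
  proof (rule Liminf_mono, rule always_eventually, rule allI)
    fix n
    have "(\<integral>\<^sup>+x. ennreal (\<bar>F (r n) x\<bar> powr q) \<partial>M) = ennreal (LINT x|M. \<bar>F (r n) x\<bar> powr q)"
      by (rule nn_integral_eq_integral[OF LpsetD(2)[OF F]]) simp
    also have "\<dots> \<le> ennreal B" by (intro ennreal_leI bound)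
    finally show "(\<integral>\<^sup>+x. ennreal (\<bar>F (r n) x\<bar> powr q) \<partial>M) \<le> ennreal B" .
  qed
  also have "\<dots> = ennreal B" by (simp add: Liminf_const)
  finally have le: "(\<integral>\<^sup>+x. ennreal (\<bar>G x\<bar> powr q) \<partial>M) \<le> ennreal B" .
  have i: "integrable M (\<lambda>x. \<bar>G x\<bar> powr q)"
  proof (rule integrableI_bounded)
    have "(\<integral>\<^sup>+x. ennreal (norm (\<bar>G x\<bar> powr q)) \<partial>M) \<le> ennreal B" using le by simp
    also have "\<dots> < \<infinity>" by simp
    finally show "(\<integral>\<^sup>+x. ennreal (norm (\<bar>G x\<bar> powr q)) \<partial>M) < \<infinity>" .
  qed measurable
  then show "G \<in> Lpset M q" by (intro LpsetI) auto
  have "ennreal (LINT x|M. \<bar>G x\<bar> powr q) \<le> ennreal B"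
    using le nn_integral_eq_integral[OF i] by simp
  then show "(LINT x|M. \<bar>G x\<bar> powr q) \<le> B" using B by (simp add: ennreal_le_iff)
qed

end

section \<open>The main estimate\<close>

text \<open>On \<open>(t/2, t]\<close> the integrand is bounded below by a constant \<open>c\<close>
  comparable to its value at \<open>t\<close>, by the growth condition \<open>scale\<close>; the
  induction halves \<open>t\<close>. The factor \<open>2 powr (s * q)\<close> comes from
  \<open>scale\<close> and the factor 2 from the length \<open>t / 2\<close> of the
  interval.\<close>

lemma dyadic_sum_le:
  fixes \<kappa> :: "real \<Rightarrow> real" and s \<sigma> q t :: real
  defines "\<Phi> \<equiv> \<lambda>u. (u powr (-\<sigma>) * \<kappa> u) powr q / u"
  assumes pos: "q > 0" "s > 0" "\<sigma> > 0"
    and mono: "\<And>u v. 0 < u \<Longrightarrow> u \<le> v \<Longrightarrow> \<kappa> u \<le> \<kappa> v"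
    and scale: "\<And>u v. 0 < u \<Longrightarrow> u \<le> v \<Longrightarrow> \<kappa> v \<le> (v / u) powr s * \<kappa> u"
    and nn: "\<And>u. 0 \<le> \<kappa> u"
    and int: "set_integrable lborel {0<..1} \<Phi>"
    and t: "0 < t" "t \<le> 1"
  shows "(\<Sum>j<n. ((t / 2 ^ j) powr (-\<sigma>) * \<kappa> (t / 2 ^ j)) powr q) \<le> 2 * 2 powr (s * q) * (LINT u:{0<..t}|lborel. \<Phi> u)"
  using t
proof (induction n arbitrary: t)
  case 0
  have "0 \<le> (LINT u:{0<..t}|lborel. \<Phi> u)" unfolding set_lebesgue_integral_def
    by (rule Bochner_Integration.integral_nonneg) (auto simp: indicator_def \<Phi>_def)
  then show ?case by simp
next
  case (Suc n)
  define c where "c = 2 powr (- (s * q)) * ((t powr (-\<sigma>) * \<kappa> t) powr q / t)"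
  have si: "set_integrable lborel A \<Phi>" if "A \<subseteq> {0<..1}" "A \<in> sets lborel" for A
    by (rule set_integrable_subset[OF int]) (use that in auto)
  have U: "{0<..t} = {0<..t/2} \<union> {t/2<..t}" using Suc.prems by auto
  have "(LINT u:{0<..t}|lborel. \<Phi> u) = (LINT u:{0<..t/2}|lborel. \<Phi> u) + (LINT u:{t/2<..t}|lborel. \<Phi> u)"
    unfolding U by (rule set_integral_Un) (use Suc.prems in \<open>auto intro!: si\<close>)
  moreover have "t / 2 * c \<le> (LINT u:{t/2<..t}|lborel. \<Phi> u)"
  proof -
    have "t / 2 * c = (LINT u:{t/2<..t}|lborel. c)" using Suc.prems by (simp add: set_lebesgue_integral_def)
    also have "\<dots> \<le> (LINT u:{t/2<..t}|lborel. \<Phi> u)"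
    proof (rule set_integral_mono)
      show "set_integrable lborel {t/2<..t} (\<lambda>_. c)" using Suc.prems by (simp add: set_integrable_def)
      show "set_integrable lborel {t/2<..t} \<Phi>" using Suc.prems by (intro si) auto
      fix u assume u: "u \<in> {t/2<..t}"
      then have u0: "0 < u" "u \<le> t" "t / u \<le> 2" using Suc.prems by (auto simp: divide_le_eq)
      have "\<kappa> t \<le> (t / u) powr s * \<kappa> u" using scale u0 by simp
      also have "\<dots> \<le> 2 powr s * \<kappa> u" using u0 Suc.prems pos nn by (intro mult_right_mono powr_mono2) auto
      finally have "\<kappa> t \<le> 2 powr s * \<kappa> u" .
      then have k: "2 powr (-s) * \<kappa> t \<le> \<kappa> u" by (simp add: powr_minus field_simps)
      have "c = (2 powr (-s)) powr q * ((t powr (-\<sigma>) * \<kappa> t) powr q / t)" by (simp add: c_def powr_powr)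
      also have "\<dots> = (t powr (-\<sigma>) * (2 powr (-s) * \<kappa> t)) powr q / t" by (simp add: powr_mult)
      also have "\<dots> \<le> (u powr (-\<sigma>) * \<kappa> u) powr q / u"
        using u0 pos k nn by (intro frac_le powr_mono2 mult_mono powr_mono2') auto
      finally show "c \<le> \<Phi> u" by (simp add: \<Phi>_def)
    qed
    finally show ?thesis .
  qed
  ultimately have st: "t / 2 * c + (LINT u:{0<..t/2}|lborel. \<Phi> u) \<le> (LINT u:{0<..t}|lborel. \<Phi> u)" by simp
  have ce: "2 * 2 powr (s * q) * (t / 2 * c) = (t powr (-\<sigma>) * \<kappa> t) powr q"
    using Suc.prems by (simp add: c_def powr_minus)
  have "(\<Sum>j<Suc n. ((t / 2 ^ j) powr (-\<sigma>) * \<kappa> (t / 2 ^ j)) powr q)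
      = (t powr (-\<sigma>) * \<kappa> t) powr q + (\<Sum>j<n. ((t / 2 / 2 ^ j) powr (-\<sigma>) * \<kappa> (t / 2 / 2 ^ j)) powr q)"
    by (subst sum.lessThan_Suc_shift) simp
  also have "\<dots> \<le> (t powr (-\<sigma>) * \<kappa> t) powr q + 2 * 2 powr (s * q) * (LINT u:{0<..t/2}|lborel. \<Phi> u)"
    by (intro add_left_mono Suc.IH) (use Suc.prems in auto)
  also have "\<dots> = 2 * 2 powr (s * q) * (t / 2 * c + (LINT u:{0<..t/2}|lborel. \<Phi> u))"
    unfolding ce[symmetric] by (simp only: distrib_left)
  also have "\<dots> \<le> 2 * 2 powr (s * q) * (LINT u:{0<..t}|lborel. \<Phi> u)" by (intro mult_left_mono st) simp
  finally show ?case .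
qed

lemma powr_dyadic:
  fixes t a :: real
  assumes "t > 0" "i \<le> j" shows "(t / 2 ^ j) powr a = (t / 2 ^ i) powr a * (2 powr (- a)) ^ (j - i)"
proof -
  obtain k where k: "j = i + k" using assms(2) le_Suc_ex by blast
  have "t / 2 ^ j = (t / 2 ^ i) * 2 powr (- real (j - i))"
    unfolding k by (simp add: powr_minus powr_realpow power_add divide_inverse)
  then have "(t / 2 ^ j) powr a = (t / 2 ^ i) powr a * 2 powr (- real (j - i) * a)"
    by (simp only: powr_mult powr_powr)
  also have "2 powr (- real (j - i) * a) = (2 powr (- a)) ^ (j - i)"
    by (simp add: powr_power mult.commute)
  finally show ?thesis .
qed

text \<open>Since \<open>\<sigma> - N / p = - N / q\<close>, the inner sums are
  \<open>(t / 2^i) powr (- N / q)\<close> and \<open>(t / 2^i) powr \<sigma>\<close> times geometric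
  averages \<open>X i\<close>, \<open>Y i\<close> of \<open>D\<close>. Their powers of
  \<open>t\<close> cancel because \<open>\<sigma> * p = (N / q) * (q - p)\<close>; the discrete
  Hardy inequalities finish.\<close>

lemma dyadic_block_sum_le:
  fixes D :: "nat \<Rightarrow> real" and A B N p q t \<sigma> :: real
  assumes p: "1 < p" "p < q" and N: "N > 0" and t: "t > 0" and A: "A \<ge> 0" and B: "B \<ge> 0" and D: "\<And>j. D j \<ge> 0"
    and \<sigma>: "\<sigma> = N * (1 / p - 1 / q)"
  shows "(\<Sum>i<n. (2 * (\<Sum>j\<le>i. A * (t / 2 ^ j) powr (- N / p) * ((t / 2 ^ j) powr \<sigma> * D j))) powr (q - p)
            * (\<Sum>j\<in>{i..<n}. B * ((t / 2 ^ j) powr \<sigma> * D j)) powr p)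
    \<le> (2 * A) powr (q - p) * B powr p * ((1 / (1 - 2 powr (- (N / q)))) powr q + (1 / (1 - 2 powr (- \<sigma>))) powr q) * (\<Sum>j<n. D j powr q)"
proof -
  define \<rho>1 where "\<rho>1 = 2 powr (- (N / q))"
  define \<rho>2 where "\<rho>2 = 2 powr (- \<sigma>)"
  have s0: "\<sigma> > 0" unfolding \<sigma> using p N by (intro mult_pos_pos) (auto simp: field_simps)
  have \<rho>1: "0 < \<rho>1" "\<rho>1 < 1" using p N powr_less_mono[of "- (N / q)" 0 2] by (auto simp: \<rho>1_def)
  have \<rho>2: "0 < \<rho>2" "\<rho>2 < 1" using s0 powr_less_mono[of "- \<sigma>" 0 2] by (auto simp: \<rho>2_def)
  define X where "X i = (\<Sum>j\<le>i. \<rho>1 ^ (i - j) * D j)" for i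
  define Y where "Y i = (\<Sum>j\<in>{i..<n}. \<rho>2 ^ (j - i) * D j)" for i
  have X0: "X i \<ge> 0" for i unfolding X_def using \<rho>1 D by (intro sum_nonneg) auto
  have Y0: "Y i \<ge> 0" for i unfolding Y_def using \<rho>2 D by (intro sum_nonneg) auto
  have ex1: "- N / p + \<sigma> = - (N / q)" unfolding \<sigma> by (simp add: algebra_simps)
  have XE: "2 * (\<Sum>j\<le>i. A * (t / 2 ^ j) powr (- N / p) * ((t / 2 ^ j) powr \<sigma> * D j)) = 2 * A * ((t / 2 ^ i) powr (- (N / q)) * X i)" for i
  proof -
    have "A * (t / 2 ^ j) powr (- N / p) * ((t / 2 ^ j) powr \<sigma> * D j) = A * ((t / 2 ^ i) powr (- (N / q)) * (\<rho>1 ^ (i - j) * D j))"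
      if "j \<le> i" for j
    proof -
      have "(t / 2 ^ i) powr (- (N / q)) * \<rho>1 ^ (i - j) = (t / 2 ^ j) powr (- (N / q)) * ((2 powr (N / q)) ^ (i - j) * \<rho>1 ^ (i - j))"
        using powr_dyadic[OF t that, of "- (N / q)"] by simp
      also have "(2 powr (N / q)) ^ (i - j) * \<rho>1 ^ (i - j) = 1"
        by (simp add: \<rho>1_def power_mult_distrib[symmetric] powr_add[symmetric])
      finally have "(t / 2 ^ i) powr (- (N / q)) * \<rho>1 ^ (i - j) = (t / 2 ^ j) powr (- N / p) * (t / 2 ^ j) powr \<sigma>"
        by (simp only: powr_add[symmetric] ex1 mult_1_right)
      then show ?thesis by (simp only: mult.assoc[symmetric])
    qed
    then have "(\<Sum>j\<le>i. A * (t / 2 ^ j) powr (- N / p) * ((t / 2 ^ j) powr \<sigma> * D j)) = (\<Sum>j\<le>i. A * ((t / 2 ^ i) powr (- (N / q)) * (\<rho>1 ^ (i - j) * D j)))"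
      by (intro sum.cong) auto
    then show ?thesis unfolding X_def by (simp only: sum_distrib_left mult.assoc)
  qed
  have YE: "(\<Sum>j\<in>{i..<n}. B * ((t / 2 ^ j) powr \<sigma> * D j)) = B * ((t / 2 ^ i) powr \<sigma> * Y i)" for i
  proof -
    have "(\<Sum>j\<in>{i..<n}. B * ((t / 2 ^ j) powr \<sigma> * D j)) = (\<Sum>j\<in>{i..<n}. B * ((t / 2 ^ i) powr \<sigma> * (\<rho>2 ^ (j - i) * D j)))"
    proof (rule sum.cong[OF refl])
      fix j assume "j \<in> {i..<n}"
      then have "i \<le> j" by simp
      from powr_dyadic[OF t this, of \<sigma>]
      show "B * ((t / 2 ^ j) powr \<sigma> * D j) = B * ((t / 2 ^ i) powr \<sigma> * (\<rho>2 ^ (j - i) * D j))"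
        by (simp only: \<rho>2_def mult.assoc)
    qed
    then show ?thesis unfolding Y_def by (simp only: sum_distrib_left)
  qed
  have ex2: "- (N / q) * (q - p) + \<sigma> * p = 0" unfolding \<sigma> using p by (simp add: field_simps)
  have term_eq: "(2 * A * ((t / 2 ^ i) powr (- (N / q)) * X i)) powr (q - p) * (B * ((t / 2 ^ i) powr \<sigma> * Y i)) powr p
      = (2 * A) powr (q - p) * B powr p * (X i powr (q - p) * Y i powr p)" for i
  proof -
    have "(2 * A * ((t / 2 ^ i) powr (- (N / q)) * X i)) powr (q - p) * (B * ((t / 2 ^ i) powr \<sigma> * Y i)) powr p
      = ((2 * A) powr (q - p) * ((t / 2 ^ i) powr (- (N / q) * (q - p)) * X i powr (q - p))) * (B powr p * ((t / 2 ^ i) powr (\<sigma> * p) * Y i powr p))"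
      by (simp only: powr_mult powr_powr)
    also have "\<dots> = (2 * A) powr (q - p) * B powr p * (X i powr (q - p) * Y i powr p) * ((t / 2 ^ i) powr (- (N / q) * (q - p)) * (t / 2 ^ i) powr (\<sigma> * p))"
      by (simp only: mult_ac)
    also have "(t / 2 ^ i) powr (- (N / q) * (q - p)) * (t / 2 ^ i) powr (\<sigma> * p) = 1"
      using t by (simp only: powr_add[symmetric] ex2) simp
    finally show ?thesis by simp
  qed
  have q1: "1 \<le> q" using p by simp
  have hb: "(\<Sum>i<n. X i powr q) \<le> (1 / (1 - \<rho>1)) powr q * (\<Sum>j<n. D j powr q)"
    unfolding X_def by (rule discrete_hardy_below[OF q1 \<rho>1 D])
  have ha: "(\<Sum>i<n. Y i powr q) \<le> (1 / (1 - \<rho>2)) powr q * (\<Sum>j<n. D j powr q)"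
    unfolding Y_def by (rule discrete_hardy_above[OF q1 \<rho>2 D])
  have "(\<Sum>i<n. X i powr (q - p) * Y i powr p) \<le> (\<Sum>i<n. X i powr q + Y i powr q)"
    using p X0 Y0 by (intro sum_mono powr_mult_le_add) auto
  also have "\<dots> \<le> ((1 / (1 - \<rho>1)) powr q + (1 / (1 - \<rho>2)) powr q) * (\<Sum>j<n. D j powr q)"
    unfolding sum.distrib distrib_right by (rule add_mono[OF hb ha])
  finally have fin: "(\<Sum>i<n. X i powr (q - p) * Y i powr p) \<le> ((1 / (1 - \<rho>1)) powr q + (1 / (1 - \<rho>2)) powr q) * (\<Sum>j<n. D j powr q)" .
  have c0: "0 \<le> (2 * A) powr (q - p) * B powr p" by simp
  have "(\<Sum>i<n. (2 * (\<Sum>j\<le>i. A * (t / 2 ^ j) powr (- N / p) * ((t / 2 ^ j) powr \<sigma> * D j))) powr (q - p)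
            * (\<Sum>j\<in>{i..<n}. B * ((t / 2 ^ j) powr \<sigma> * D j)) powr p)
      = (2 * A) powr (q - p) * B powr p * (\<Sum>i<n. X i powr (q - p) * Y i powr p)"
    unfolding sum_distrib_left[where r="_ powr (q - p) * _ powr p"] by (intro sum.cong refl) (simp only: XE YE term_eq)
  then show ?thesis
    using mult_left_mono[OF fin c0] by (simp only: \<rho>1_def \<rho>2_def mult.assoc)
qed

context jacobi
begin

text \<open>The block \<open>w (Suc j) - w j\<close> is bounded in \<open>L_infinity\<close> by
  \<open>R3\<close>, and in \<open>L_p\<close> by \<open>R1\<close> at both ends, where
  \<open>dec\<close> replaces the finer scale by the coarser. The resulting \<open>L_q\<close> bound
  for telescoping sums does not depend on \<open>n\<close>, so it survives the limit
  \<open>w n\<close> to \<open>f\<close>, which is taken in \<open>L_1\<close>.\<close>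

lemma blocks_Lq:
  fixes w :: "nat \<Rightarrow> real \<Rightarrow> real" and D :: "nat \<Rightarrow> real" and f :: "real \<Rightarrow> real"
  assumes p: "1 < p" "p < q" and N: "N > 0" and \<sigma>: "\<sigma> = N * (1 / p - 1 / q)" and t: "t > 0"
    and f: "f \<in> Lpset M p" and bw: "\<And>j. bdd (w j)" and C: "C1 \<ge> 0" "C3 \<ge> 0" and D: "\<And>j. D j \<ge> 0"
    and R1: "\<And>j. Lpn M p (\<lambda>x. f x - w j x) \<le> C1 * ((t / 2 ^ j) powr \<sigma> * D j)"
    and R3: "\<And>j. AE x in M. \<bar>w (Suc j) x - w j x\<bar> \<le> C3 * (t / 2 ^ j) powr (- N / p) * ((t / 2 ^ j) powr \<sigma> * D j)"
    and dec: "\<And>j. (t / 2 ^ Suc j) powr \<sigma> * D (Suc j) \<le> (t / 2 ^ j) powr \<sigma> * D j"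
    and W: "\<And>n. (\<Sum>j<n. D j powr q) \<le> W"
  shows "(\<lambda>x. f x - w 0 x) \<in> Lpset M q"
    "(LINT x|M. \<bar>f x - w 0 x\<bar> powr q) \<le> 2 powr p * ((2 * C3) powr (q - p) * (2 * C1) powr p
       * ((1 / (1 - 2 powr (- (N / q)))) powr q + (1 / (1 - 2 powr (- \<sigma>))) powr q) * W)"
proof -
  have p1: "1 \<le> p" and q0: "q > 0" and p0: "p > 0" using p by auto
  have s0: "\<sigma> > 0" unfolding \<sigma> using p N by (intro mult_pos_pos) (auto simp: field_simps)
  define E where "E = (2 * C3) powr (q - p) * (2 * C1) powr p * ((1 / (1 - 2 powr (- (N / q)))) powr q + (1 / (1 - 2 powr (- \<sigma>))) powr q)"
  have E0: "E \<ge> 0" unfolding E_def by (intro mult_nonneg_nonneg add_nonneg_nonneg) auto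
  have fw: "(\<lambda>x. f x - w j x) \<in> Lpset M p" for j by (rule Minkowski_diff(1)[OF p1 f bdd_Lp[OF bw p0]])
  have dd: "bdd (\<lambda>x. w i x - w j x)" for i j
    using bdd_add[OF bw bdd_mult[OF bdd_const[of "-1"] bw]] by simp
  have step: "Lpn M p (\<lambda>x. w (Suc j) x - w j x) \<le> 2 * C1 * ((t / 2 ^ j) powr \<sigma> * D j)" for j
  proof -
    have "Lpn M p (\<lambda>x. w (Suc j) x - w j x) = Lpn M p (\<lambda>x. (f x - w j x) - (f x - w (Suc j) x))" by simp
    also have "\<dots> \<le> Lpn M p (\<lambda>x. f x - w j x) + Lpn M p (\<lambda>x. f x - w (Suc j) x)"
      by (rule Minkowski_diff(2)[OF p1 fw fw])
    also have "\<dots> \<le> C1 * ((t / 2 ^ j) powr \<sigma> * D j) + C1 * ((t / 2 ^ Suc j) powr \<sigma> * D (Suc j))"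
      by (intro add_mono R1)
    also have "\<dots> \<le> C1 * ((t / 2 ^ j) powr \<sigma> * D j) + C1 * ((t / 2 ^ j) powr \<sigma> * D j)"
      by (intro add_left_mono mult_left_mono dec C)
    finally show ?thesis by (simp only: mult_2 distrib_right)
  qed
  have tele: "(\<Sum>j<n. w (Suc j) x - w j x) = w n x - w 0 x" for n x by (rule sum_lessThan_telescope)
  have bound: "(LINT x|M. \<bar>w n x - w 0 x\<bar> powr q) \<le> 2 powr p * (E * W)" for n
  proof -
    have "(LINT x|M. \<bar>w n x - w 0 x\<bar> powr q) = (LINT x|M. \<bar>\<Sum>j<n. w (Suc j) x - w j x\<bar> powr q)" by (simp only: tele)
    also have "\<dots> \<le> 2 powr p * (\<Sum>i<n. (2 * (\<Sum>j\<le>i. C3 * (t / 2 ^ j) powr (- N / p) * ((t / 2 ^ j) powr \<sigma> * D j))) powr (q - p)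
            * (\<Sum>j\<in>{i..<n}. 2 * C1 * ((t / 2 ^ j) powr \<sigma> * D j)) powr p)"
      by (rule integral_powr_sum_le[OF p]) (rule bdd_Lp[OF dd p0] R3 step dd)+
    also have "\<dots> \<le> 2 powr p * (E * (\<Sum>j<n. D j powr q))"
      unfolding E_def using C by (intro mult_left_mono dyadic_block_sum_le[OF p N t _ _ D \<sigma>]) auto
    also have "\<dots> \<le> 2 powr p * (E * W)" by (intro mult_left_mono W E0) simp
    finally show ?thesis .
  qed
  \<comment> \<open>Boundedness of \<open>D\<close> is enough for convergence in \<open>L_1\<close>,
    because the accompanying factor \<open>(t / 2 ^ j) powr \<sigma>\<close> tends to
    \<open>0\<close>.\<close>
  have Db: "D j \<le> W powr (1 / q)" for j
  proof -
    have "D j powr q \<le> (\<Sum>i<Suc j. D i powr q)" by (rule member_le_sum) auto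
    also have "\<dots> \<le> W" by (rule W)
    finally have "(D j powr q) powr (1 / q) \<le> W powr (1 / q)" using q0 by (intro powr_mono2) auto
    then show ?thesis using q0 D[of j] by (simp add: powr_powr)
  qed
  have z: "(\<lambda>j. (t / 2 ^ j) powr \<sigma>) \<longlonglongrightarrow> 0"
  proof -
    have "(\<lambda>j. t * (1 / 2) ^ j) \<longlonglongrightarrow> t * 0" by (intro tendsto_mult tendsto_const LIMSEQ_power_zero) simp
    then have "(\<lambda>j. t / 2 ^ j) \<longlonglongrightarrow> 0" by (simp add: power_divide)
    then have "(\<lambda>j. (t / 2 ^ j) powr \<sigma>) \<longlonglongrightarrow> 0 powr \<sigma>"
      by (rule tendsto_powr') (use s0 t in auto)
    then show ?thesis by simp
  qed
  let ?m = "1 + measure M (space M)"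
  have lim: "(\<lambda>j. LINT x|M. \<bar>(w j x - w 0 x) - (f x - w 0 x)\<bar>) \<longlonglongrightarrow> 0"
  proof (rule real_tendsto_sandwich)
    show "\<forall>\<^sub>F j in sequentially. 0 \<le> (LINT x|M. \<bar>(w j x - w 0 x) - (f x - w 0 x)\<bar>)"
      by (intro always_eventually allI Bochner_Integration.integral_nonneg) simp
    show "\<forall>\<^sub>F j in sequentially. (LINT x|M. \<bar>(w j x - w 0 x) - (f x - w 0 x)\<bar>) \<le> ?m * (C1 * ((t / 2 ^ j) powr \<sigma> * W powr (1 / q)))"
    proof (intro always_eventually allI)
      fix j
      have "(LINT x|M. \<bar>(w j x - w 0 x) - (f x - w 0 x)\<bar>) = (LINT x|M. \<bar>f x - w j x\<bar>)"
        by (rule Bochner_Integration.integral_cong) (auto simp: abs_minus_commute)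
      also have "\<dots> \<le> ?m * Lpn M p (\<lambda>x. f x - w j x)" by (rule Lpset_imp_L1(2)[OF finite_measure_M p1 fw])
      also have "\<dots> \<le> ?m * (C1 * ((t / 2 ^ j) powr \<sigma> * W powr (1 / q)))"
        by (intro mult_left_mono order_trans[OF R1] C Db) (auto simp: add_nonneg_nonneg)
      finally show "(LINT x|M. \<bar>(w j x - w 0 x) - (f x - w 0 x)\<bar>) \<le> ?m * (C1 * ((t / 2 ^ j) powr \<sigma> * W powr (1 / q)))" .
    qed
    have "(\<lambda>j. ?m * (C1 * ((t / 2 ^ j) powr \<sigma> * W powr (1 / q)))) \<longlonglongrightarrow> ?m * (C1 * (0 * W powr (1 / q)))"
      by (intro tendsto_mult tendsto_const z)
    then show "(\<lambda>j. ?m * (C1 * ((t / 2 ^ j) powr \<sigma> * W powr (1 / q)))) \<longlonglongrightarrow> 0" by simp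
  qed simp
  note Li = Lpset_imp_L1(1)[OF finite_measure_M p1]
  note FT = Lp_Fatou[OF q0 bdd_Lp[OF dd q0] Li[OF fw] bdd_integrable[OF dd] lim bound]
  show "(\<lambda>x. f x - w 0 x) \<in> Lpset M q" by (rule FT(1))
  show "(LINT x|M. \<bar>f x - w 0 x\<bar> powr q) \<le> 2 powr p * ((2 * C3) powr (q - p) * (2 * C1) powr p
       * ((1 / (1 - 2 powr (- (N / q)))) powr q + (1 / (1 - 2 powr (- \<sigma>))) powr q) * W)"
    using FT(2) by (simp only: E_def)
qed

text \<open>The infimum for the exponent \<open>q\<close> is tested with a single pair:
  \<open>V_t f\<close> and its derivative of order \<open>r\<close>. The approximation error is
  treated by blocks, the derivative by the Hardy-Littlewood-Sobolev inequality; all constants are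
  fixed before \<open>f\<close> and \<open>t\<close>.\<close>

lemma main_estimate:
  fixes p q r \<sigma> :: real
  assumes p: "1 < p" "p < q" and r: "0 < r" and \<sigma>: "\<sigma> = (2 * \<alpha> + 2) * (1 / p - 1 / q)"
  defines "\<Phi> \<equiv> \<lambda>f u. (u powr (-\<sigma>) * K p (r + \<sigma>) f u) powr q / u"
  obtains C where "\<And>f t. f \<in> Lpset M p \<Longrightarrow> set_integrable lborel {0<..1} (\<Phi> f) \<Longrightarrow> 0 < t \<Longrightarrow> t \<le> 1 \<Longrightarrow>
    f \<in> Lpset M q \<and> K q r f t \<le> C * (LINT u:{0<..t}|lborel. \<Phi> f u) powr (1 / q)"
proof -
  define s where "s = r + \<sigma>"
  define N where "N = 2 * \<alpha> + 2"
  have N0: "N > 0" using alpha_gt by (simp add: N_def)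
  have p1: "1 \<le> p" and q0: "q > 0" and q1: "1 \<le> q" and p0: "p > 0" using p by auto
  have \<sigma>N: "\<sigma> = N * (1 / p - 1 / q)" by (simp add: \<sigma> N_def)
  have s0: "\<sigma> > 0" unfolding \<sigma>N using p N0 by (intro mult_pos_pos) (auto simp: field_simps)
  have s: "s > 0" using s0 r by (simp add: s_def)
  \<comment> \<open>The \<open>n\<close> additional resolvent powers pay for
    \<open>lam2 k powr (s / 2)\<close>; the order of vanishing \<open>l\<close> must exceed
    \<open>s / 2\<close> strictly.\<close>
  define n where "n = nat \<lceil>s / 2\<rceil>"
  define l where "l = n + 1"
  have n: "s / 2 \<le> real n" unfolding n_def by linarith
  have l: "s / 2 < real l" using n by (simp add: l_def)
  obtain C1 where C1: "C1 \<ge> 0" "\<And>t f g h. 0 < t \<Longrightarrow> t \<le> 1 \<Longrightarrow> f \<in> Lpset M p \<Longrightarrow> g \<in> Lpset M p \<Longrightarrow> h \<in> Lpset M p \<Longrightarrow>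
    is_fractional_derivative \<alpha> \<beta> \<psi> s g h \<Longrightarrow>
    Lpn M p (\<lambda>x. f x - Ser (V (mm + n) l t) f x) \<le> C1 * (Lpn M p (\<lambda>x. f x - g x) + t powr s * Lpn M p h)"
    by (rule realization_1[OF p(1) s l, where n=n]) (rule that, assumption, blast)
  obtain C2 where C2: "C2 \<ge> 0" "\<And>t f g h. 0 < t \<Longrightarrow> t \<le> 1 \<Longrightarrow> f \<in> Lpset M p \<Longrightarrow> g \<in> Lpset M p \<Longrightarrow> h \<in> Lpset M p \<Longrightarrow>
    is_fractional_derivative \<alpha> \<beta> \<psi> s g h \<Longrightarrow>
    t powr s * Lpn M p (Ser (\<lambda>k. lam2 k powr (s / 2) * V (mm + n) l t k) f) \<le> C2 * (Lpn M p (\<lambda>x. f x - g x) + t powr s * Lpn M p h)"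
    by (rule realization_2[OF p(1) s n, where l=l]) (rule that, assumption, blast)
  obtain C3 where C3: "C3 \<ge> 0" "\<And>t f g h. 0 < t \<Longrightarrow> t \<le> 1 \<Longrightarrow> f \<in> Lpset M p \<Longrightarrow> g \<in> Lpset M p \<Longrightarrow> h \<in> Lpset M p \<Longrightarrow>
    is_fractional_derivative \<alpha> \<beta> \<psi> s g h \<Longrightarrow>
    AE x in M. \<bar>Ser (V (mm + n) l (t / 2)) f x - Ser (V (mm + n) l t) f x\<bar>
      \<le> C3 * t powr (- (2 * \<alpha> + 2) / p) * (Lpn M p (\<lambda>x. f x - g x) + t powr s * Lpn M p h)"
    by (rule realization_3[OF p(1) s l, where n=n]) (rule that, assumption, blast)
  have he: "\<sigma> / 2 = (\<alpha> + 1) * (1 / p - 1 / q)" by (simp add: \<sigma>)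
  obtain CH where CH: "CH \<ge> 0" "\<And>m m' f. rapid m \<Longrightarrow> rapid m' \<Longrightarrow> (\<And>k. m' k = ml (\<sigma> / 2) k * m k) \<Longrightarrow> integrable M f \<Longrightarrow>
    Lpn M q (Ser m' f) \<le> CH * Lpn M p (Ser m f)"
    by (rule HLS_Ser[OF p refl he]) (rule that, assumption, blast)
  define E where "E = 2 powr p * ((2 * C3) powr (q - p) * (2 * C1) powr p
       * ((1 / (1 - 2 powr (- (N / q)))) powr q + (1 / (1 - 2 powr (- \<sigma>))) powr q))"
  have E0: "E \<ge> 0" unfolding E_def by (intro mult_nonneg_nonneg add_nonneg_nonneg) auto
  define F where "F = 2 * 2 powr (s * q)"
  have F0: "F > 0" by (simp add: F_def)
  show ?thesis
  proof (rule that)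
    fix f :: "real \<Rightarrow> real" and t :: real
    assume f: "f \<in> Lpset M p" and int: "set_integrable lborel {0<..1} (\<Phi> f)" and t: "0 < t" "t \<le> 1"
    have fi: "integrable M f" by (rule Lpset_imp_L1(1)[OF finite_measure_M p1 f])
    define I where "I = (LINT u:{0<..t}|lborel. \<Phi> f u)"
    have I0: "I \<ge> 0" unfolding I_def set_lebesgue_integral_def
      by (rule Bochner_Integration.integral_nonneg) (auto simp: indicator_def \<Phi>_def)
    \<comment> \<open>Normalized so that the \<open>q\<close>-th powers of \<open>D\<close> form the
      sum that the integral dominates.\<close>
    define D where "D j = (t / 2 ^ j) powr (-\<sigma>) * K p s f (t / 2 ^ j)" for j :: nat
    have DK: "(t / 2 ^ j) powr \<sigma> * D j = K p s f (t / 2 ^ j)" for j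
    proof -
      have "(t / 2 ^ j) powr \<sigma> * (t / 2 ^ j) powr (- \<sigma>) = 1"
        using t by (simp add: powr_add[symmetric])
      then show ?thesis unfolding D_def by (simp only: mult.assoc[symmetric] mult_1_left)
    qed
    have D0: "D j \<ge> 0" for j by (simp add: D_def K_nonneg)
    have W: "(\<Sum>j<k. D j powr q) \<le> F * I" for k
      unfolding D_def F_def I_def \<Phi>_def s_def
      by (rule dyadic_sum_le[OF q0 s[unfolded s_def] s0 K_mono[OF s[unfolded s_def]] K_scale[OF s[unfolded s_def]] K_nonneg int[unfolded \<Phi>_def] t])
    have tj: "0 < t / 2 ^ j" "t / 2 ^ j \<le> 1" for j :: nat
    proof -
      show "0 < t / 2 ^ j" using t by simp
      have "t / 2 ^ j \<le> 1 / 1" using t by (intro frac_le) auto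
      then show "t / 2 ^ j \<le> 1" by simp
    qed
    define m where "m \<tau> = V (mm + n) l \<tau>" for \<tau> :: real
    have rm: "rapid (m \<tau>)" if "0 < \<tau>" "\<tau> \<le> 1" for \<tau>
      unfolding m_def using sq01[OF that] by (intro rapid_vsym1) auto
    have bS: "bdd (Ser m' f)" if "rapid m'" for m'
      by (rule rapid_dom[OF that]) (rule Ser_bdd[OF _ fi])
    define w where "w j = Ser (m (t / 2 ^ j)) f" for j :: nat
    have R1: "Lpn M p (\<lambda>x. f x - w j x) \<le> C1 * ((t / 2 ^ j) powr \<sigma> * D j)" for j
      unfolding DK w_def m_def
      by (rule K_greatest[OF C1(1)]) (rule C1(2)[OF tj f], auto simp: admissible_def)
    have R3: "AE x in M. \<bar>w (Suc j) x - w j x\<bar> \<le> C3 * (t / 2 ^ j) powr (- N / p) * ((t / 2 ^ j) powr \<sigma> * D j)" for j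
    proof -
      have e: "t / 2 ^ Suc j = t / 2 ^ j / 2" by simp
      show ?thesis unfolding DK w_def m_def e N_def
        by (rule K_AE_bound) (use C3(1) in simp, rule C3(2)[OF tj f], auto simp: admissible_def)
    qed
    have dec: "(t / 2 ^ Suc j) powr \<sigma> * D (Suc j) \<le> (t / 2 ^ j) powr \<sigma> * D j" for j
      unfolding DK by (rule K_mono[OF s tj(1)]) (use t in \<open>simp add: field_simps\<close>)
    have bw: "bdd (w j)" for j unfolding w_def by (rule bS[OF rm[OF tj]])
    note BL = blocks_Lq[OF p N0 \<sigma>N t(1) f bw C1(1) C3(1) D0 R1 R3 dec W, folded E_def]
    have fq: "f \<in> Lpset M q"
      using Minkowski(1)[OF q1 BL(1) bdd_Lp[OF bw[of 0] q0]] by simp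
    have first: "Lpn M q (\<lambda>x. f x - w 0 x) \<le> (E * F) powr (1 / q) * I powr (1 / q)"
    proof (rule Lpn_leI[OF q0])
      have "(LINT x|M. \<bar>f x - w 0 x\<bar> powr q) \<le> E * (F * I)" using BL(2) by (simp only: E_def mult.assoc)
      also have "\<dots> = ((E * F) powr (1 / q) * I powr (1 / q)) powr q"
        using E0 F0 I0 q0 by (simp add: powr_mult powr_powr)
      finally show "(LINT x|M. \<bar>f x - w 0 x\<bar> powr q) \<le> ((E * F) powr (1 / q) * I powr (1 / q)) powr q" .
    qed simp
    \<comment> \<open>Rapid symbols make \<open>w 0\<close>, \<open>h\<close> and \<open>g\<close>
      bounded, hence elements of \<open>L_q\<close>, so the pair \<open>w 0\<close>,
      \<open>h\<close> is admissible for the exponent \<open>q\<close>.\<close>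
    define h where "h = Ser (\<lambda>k. lam2 k powr (r / 2) * m t k) f"
    define g where "g = Ser (\<lambda>k. lam2 k powr (s / 2) * m t k) f"
    have rr: "rapid (\<lambda>k. lam2 k powr a * m t k)" if "0 \<le> a" "a \<le> real n" for a
      unfolding m_def using sq01[OF t] lam2_powr_le[OF that] by (intro rapid_vsym) auto
    have rh: "rapid (\<lambda>k. lam2 k powr (r / 2) * m t k)" using r s0 n by (intro rr) (auto simp: s_def)
    have rg: "rapid (\<lambda>k. lam2 k powr (s / 2) * m t k)" using s n by (intro rr) auto
    have w0: "w 0 = Ser (m t) f" by (simp add: w_def)
    have "is_fractional_derivative \<alpha> \<beta> \<psi> r (w 0) h"
    proof -
      have ch: "co h k = lam2 k powr (r / 2) * m t k * co f k" for k
        unfolding h_def by (rule rapid_dom[OF rh]) (rule co_Ser[OF _ fi])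
      have cw: "co (w 0) k = m t k * co f k" for k
        unfolding w0 by (rule rapid_dom[OF rm[OF t]]) (rule co_Ser[OF _ fi])
      show ?thesis unfolding is_fractional_derivative_def jacobi_Lp_eq lam_powr ch cw
        using bdd_Lp[OF bw[of 0], of 1] bdd_Lp[OF bS[OF rh], of 1] r by (simp add: h_def)
    qed
    then have adm: "admissible q r (w 0) h"
      unfolding admissible_def h_def using bdd_Lp[OF bw[of 0] q0] bdd_Lp[OF bS[OF rh] q0] by blast
    \<comment> \<open>As \<open>r = s - \<sigma>\<close>, the function \<open>h\<close> arises from
      \<open>g\<close> by the power \<open>- \<sigma> / 2\<close> of the Jacobi operator, and
      \<open>\<sigma> / 2 = (\<alpha> + 1) * (1/p - 1/q)\<close> is the exponent of the
      Hardy-Littlewood-Sobolev inequality.\<close>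
    have "Lpn M q h \<le> CH * Lpn M p g"
      unfolding h_def g_def
    proof (rule CH(2)[OF rg rh _ fi])
      fix k
      show "lam2 k powr (r / 2) * m t k = ml (\<sigma> / 2) k * (lam2 k powr (s / 2) * m t k)"
      proof (cases "k = 0")
        case True then show ?thesis by (simp add: ml_def)
      next
        case False
        have "lam2 k powr (r / 2) = lam2 k powr (- (\<sigma> / 2)) * lam2 k powr (s / 2)"
          unfolding powr_add[symmetric] by (simp add: s_def field_simps)
        then show ?thesis using False by (simp add: ml_def)
      qed
    qed
    then have "t powr r * Lpn M q h \<le> t powr r * (CH * Lpn M p g)" by (intro mult_left_mono) auto
    also have "t powr r * (CH * Lpn M p g) = CH * t powr (- \<sigma>) * (t powr s * Lpn M p g)"
    proof -
      have "t powr (- \<sigma>) * t powr s = t powr r" unfolding powr_add[symmetric] by (simp add: s_def)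
      then show ?thesis by (simp add: mult_ac)
    qed
    also have "\<dots> \<le> CH * t powr (- \<sigma>) * (C2 * K p s f t)"
    proof (intro mult_left_mono)
      show "t powr s * Lpn M p g \<le> C2 * K p s f t" unfolding g_def m_def
        by (rule K_greatest[OF C2(1)]) (rule C2(2)[OF t f], auto simp: admissible_def)
    qed (use CH(1) in simp)
    also have "\<dots> = CH * C2 * D 0" by (simp add: D_def)
    also have "\<dots> \<le> CH * C2 * (F powr (1 / q) * I powr (1 / q))"
    proof (intro mult_left_mono)
      have "D 0 powr q \<le> F * I" using W[of 1] by simp
      then have "(D 0 powr q) powr (1 / q) \<le> (F * I) powr (1 / q)" using q0 by (intro powr_mono2) auto
      then show "D 0 \<le> F powr (1 / q) * I powr (1 / q)" using q0 D0[of 0] by (simp add: powr_powr powr_mult)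
    qed (use CH(1) C2(1) in simp)
    finally have second: "t powr r * Lpn M q h \<le> CH * C2 * (F powr (1 / q) * I powr (1 / q))" .
    have "K q r f t \<le> Lpn M q (\<lambda>x. f x - w 0 x) + t powr r * Lpn M q h" by (rule K_le[OF adm])
    also have "\<dots> \<le> (E * F) powr (1 / q) * I powr (1 / q) + CH * C2 * (F powr (1 / q) * I powr (1 / q))"
      by (rule add_mono[OF first second])
    also have "\<dots> = ((E * F) powr (1 / q) + CH * C2 * F powr (1 / q)) * I powr (1 / q)"
      by (simp only: distrib_right mult.assoc)
    finally show "f \<in> Lpset M q \<and> K q r f t \<le> ((E * F) powr (1 / q) + CH * C2 * F powr (1 / q)) * (LINT u:{0<..t}|lborel. \<Phi> f u) powr (1 / q)"
      using fq by (simp only: I_def)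
  qed
qed

text \<open>A finite integral of a nonnegative function gives integrability once measurability is
  known. The latter follows from monotonicity of \<open>K\<close>, after replacing it by
  \<open>0\<close> for \<open>u \<le> 0\<close>, where the indicator vanishes.\<close>

lemma set_integrable_K:
  assumes s: "s > 0" and fin: "(\<integral>\<^sup>+u\<in>{0<..1}. ennreal ((u powr (-\<sigma>) * K p s f u) powr q / u) \<partial>lborel) < \<infinity>"
  shows "set_integrable lborel {0<..1} (\<lambda>u. (u powr (-\<sigma>) * K p s f u) powr q / u)"
proof -
  define \<kappa> where "\<kappa> u = (if 0 < u then K p s f u else 0)" for u
  have [measurable]: "\<kappa> \<in> borel_measurable borel" unfolding \<kappa>_def by (rule K_measurable[OF s])
  have e: "indicat_real {0<..1} u *\<^sub>R ((u powr (-\<sigma>) * K p s f u) powr q / u) = indicat_real {0<..1} u * ((u powr (-\<sigma>) * \<kappa> u) powr q / u)" for u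
    by (auto simp: indicator_def \<kappa>_def)
  show ?thesis unfolding set_integrable_def
  proof (rule integrableI_bounded)
    show "(\<lambda>u. indicat_real {0<..1} u *\<^sub>R ((u powr (-\<sigma>) * K p s f u) powr q / u)) \<in> borel_measurable lborel"
      unfolding e by measurable
    have "(\<integral>\<^sup>+u. ennreal (norm (indicat_real {0<..1} u *\<^sub>R ((u powr (-\<sigma>) * K p s f u) powr q / u))) \<partial>lborel)
      = (\<integral>\<^sup>+u\<in>{0<..1}. ennreal ((u powr (-\<sigma>) * K p s f u) powr q / u) \<partial>lborel)"
      by (intro nn_integral_cong) (auto simp: indicator_def)
    then show "(\<integral>\<^sup>+u. ennreal (norm (indicat_real {0<..1} u *\<^sub>R ((u powr (-\<sigma>) * K p s f u) powr q / u))) \<partial>lborel) < \<infinity>"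
      using fin by simp
  qed
qed

end

theorem theorem1:
  fixes p q r \<alpha> \<beta> \<sigma> :: real and \<psi> :: "nat \<Rightarrow> real poly"
  assumes "1 < p" and "p < q" and "0 < r"
    and "\<beta> \<le> \<alpha>" and "-1 < \<beta>" and "-1/2 \<le> \<alpha>"
    and "orthonormal_jacobi_polys \<alpha> \<beta> \<psi>"
    and "\<sigma> = (2 * \<alpha> + 2) * (1 / p - 1 / q)"
  shows "\<exists>C. \<forall>f \<in> jacobi_Lp p \<alpha> \<beta>.
    (\<integral>\<^sup>+u\<in>{0<..1}. ennreal ((u powr (-\<sigma>) * K_functional \<alpha> \<beta> \<psi> p (r + \<sigma>) f u) powr q / u)
       \<partial>lborel) < \<infinity> \<longrightarrow>
    f \<in> jacobi_Lp q \<alpha> \<beta> \<and>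
    (\<forall>t. 0 < t \<and> t \<le> 1 \<longrightarrow>
      K_functional \<alpha> \<beta> \<psi> q r f t \<le>
        C * (LINT u:{0<..t}|lborel.
               (u powr (-\<sigma>) * K_functional \<alpha> \<beta> \<psi> p (r + \<sigma>) f u) powr q / u) powr (1 / q))"
proof -
  interpret jacobi \<alpha> \<beta> \<psi> by unfold_locales (use assms in auto)
  have "0 < (2 * \<alpha> + 2) * (1 / p - 1 / q)"
    using assms(1,2) alpha_gt by (intro mult_pos_pos) (auto simp: field_simps)
  then have s: "r + \<sigma> > 0" using assms(3,8) by simp
  obtain C where C: "\<And>f t. f \<in> Lpset M p \<Longrightarrow> set_integrable lborel {0<..1} (\<lambda>u. (u powr (-\<sigma>) * K p (r + \<sigma>) f u) powr q / u) \<Longrightarrow>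
      0 < t \<Longrightarrow> t \<le> 1 \<Longrightarrow>
      f \<in> Lpset M q \<and> K q r f t \<le> C * (LINT u:{0<..t}|lborel. (u powr (-\<sigma>) * K p (r + \<sigma>) f u) powr q / u) powr (1 / q)"
    by (rule main_estimate[OF assms(1,2,3,8)]) (rule that, blast)
  show ?thesis
  proof (intro exI[of _ C] ballI impI conjI allI)
    fix f assume f: "f \<in> jacobi_Lp p \<alpha> \<beta>"
      and fin: "(\<integral>\<^sup>+u\<in>{0<..1}. ennreal ((u powr (-\<sigma>) * K p (r + \<sigma>) f u) powr q / u) \<partial>lborel) < \<infinity>"
    note C' = C[OF f[unfolded jacobi_Lp_eq] set_integrable_K[OF s fin]]
    \<comment> \<open>Membership does not involve \<open>t\<close>; any admissible value such as
      \<open>1\<close> yields it.\<close>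
    show "f \<in> jacobi_Lp q \<alpha> \<beta>" unfolding jacobi_Lp_eq using C'[of 1] by simp
    fix t :: real assume "0 < t \<and> t \<le> 1"
    then show "K q r f t \<le> C * (LINT u:{0<..t}|lborel. (u powr (-\<sigma>) * K p (r + \<sigma>) f u) powr q / u) powr (1 / q)"
      using C'[of t] by blast
  qed
qed

end
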